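(* Let $n\ge2$, $K=\mathrm{SU}(n)$ with maximal torus $T$, let $Q$ be the universal hyperkähler implosion for $\mathrm{SU}(n)$ and $\mathcal Z_Q$ its twistor space. Then the map $$\tilde\sigma\colon\mathcal Z_Q\to\mathcal O(2)\otimes(\mathfrak k_{\mathbb C}\oplus\mathfrak t_{\mathbb C})\oplus\bigoplus_{j=1}^{n-1}\mathcal O(\ell_j)\otimes\wedge^j\mathbb C^n,\qquad \ell_j=j(n-j),$$ into the total space of this vector bundle over $\mathbb P^1$, defined in the context, is generically injective; that is, its restriction to some dense Zariski-open subset of $\mathcal Z_Q$ is injective.
   Context: **The space $Q$.** Let $M=\bigoplus_{i=1}^{n-1}\mathrm{Hom}(\mathbb C^i,\mathbb C^{i+1})\oplus\mathrm{Hom}(\mathbb C^{i+1},\mathbb C^i)$, with elements (quivers) $(\alpha,\beta)=(\alpha_i,\beta_i)_{1\le i\le n-1}$, $\alpha_i\colon\mathbb C^i\to\mathbb C^{i+1}$, $\beta_i\colon\mathbb C^{i+1}\to\mathbb C^i$, and put $\alpha_0=\beta_0=0$. It is a flat hyperkähler space with right quaternion multiplication $(\alpha_i,\beta_i)\mathbf j=(-\beta_i^*,\alpha_i^* )$, where $*$ is the Hermitian adjoint. The group $H=\prod_{k=1}^{n-1}\mathrm{SU}(k)$ acts by $\alpha_i\mapsto g_{i+1}\alpha_ig_i^{-1}$, $\beta_i\mapsto g_i\beta_ig_{i+1}^{-1}$ with $g_n=1$. The hyperkähler moment map equations for $H$ say that there are scalars $\lambda_i^{\mathbb C}\in\mathbb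 C$ and $\lambda_i^{\mathbb R}\in\mathbb R$ ($1\le i\le n-1$) with, for $0\le i\le n-2$, $$\alpha_i\beta_i-\beta_{i+1}\alpha_{i+1}=\lambda^{\mathbb C}_{i+1}I,\qquad \alpha_i\alpha_i^*-\beta_i^*\beta_i+\beta_{i+1}\beta_{i+1}^*-\alpha_{i+1}^*\alpha_{i+1}=\lambda^{\mathbb R}_{i+1}I.$$ The universal hyperkähler implosion $Q$ is the hyperkähler quotient of $M$ by $H$: the set of $H$-orbits of quivers satisfying these equations. Write $\lambda^{\mathbb C}=(\lambda_i^{\mathbb C})_i$, $\lambda^{\mathbb R}=(\lambda_i^{\mathbb R})_i$. **The twistor space.** The twistor space of $M$ is the vector bundle $\mathcal Z_M=\mathcal O(1)\otimes M$ over $\mathbb P^1$ (with $M$ regarded as a complex vector space). The twistor space $\mathcal Z_Q$ is the GIT quotient, relative to $\mathbb P^1$, by $H_{\mathbb C}=\prod_{k=1}^{n-1}\mathrm{SL}(k,\mathbb C)$ of the closed subvariety of $\mathcal Z_M$ of points $(a_i,b_i)_i$ in fibres of $\mathcal Z_M$ such that $a_ib_i-b_{i+1}a_{i+1}$ is a scalar matrix (with values in the fibre of $\mathcal O(2)$) for $0\le i\le n-2$, where $a_0=b_0=0$. As a set, $\mathcal Z_Q=\mathbb P^1\times Q$: the point $([u:v],q)$, with $q$ represented by $(\alpha,\beta)$, corresponds to the class over $[u:v]$ of $(u\alpha+v\beta^*,-v\alpha^*+u\beta)$. The Zariski topology on $\mathcal Z_Q$ is that of this algebraic variety. **The maps.**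 Here $\mathfrak k_{\mathbb C}=\mathfrak{sl}(n,\mathbb C)$, and $\mathfrak t_{\mathbb C}$ is identified with $\mathbb C^{n-1}$. For a complex vector space $V$, elements of $H^0(\mathbb P^1,\mathcal O(m)\otimes V)$ are identified with $V$-valued homogeneous polynomials of degree $m$ in $(u,v)$. Write $(Y)_0=Y-\frac1n\mathrm{tr}(Y)I_n$. Let $\mathcal R=H^0\bigl(\mathbb P^1,\mathcal O(2)\otimes(\mathfrak k_{\mathbb C}\oplus\mathfrak t_{\mathbb C})\oplus\bigoplus_{j=1}^{n-1}\mathcal O(\ell_j)\otimes\wedge^j\mathbb C^n\bigr)$ and let $\sigma\colon Q\to\mathcal R$ send the class of $(\alpha,\beta)$ to the tuple of sections - $(u,v)\mapsto\bigl((u\alpha_{n-1}+v\beta_{n-1}^* )(-v\alpha_{n-1}^*+u\beta_{n-1})\bigr)_0\in\mathfrak k_{\mathbb C}$; - $(u,v)\mapsto u^2\lambda^{\mathbb C}-uv\,\lambda^{\mathbb R}-v^2\overline{\lambda^{\mathbb C}}\in\mathfrak t_{\mathbb C}$; - for $1\le j\le n-1$, $(u,v)\mapsto\wedge^j\bigl((u\alpha_{n-1}+v\beta_{n-1}^* )(u\alpha_{n-2}+v\beta_{n-2}^* )\cdots(u\alpha_j+v\beta_j^* )\bigr)\in\wedge^j\mathbb C^n$, where a linear map $\wedge^j\mathbb C^j\to\wedge^j\mathbb C^n$ is identified with the image of the standard basis element of $\wedge^j\mathbb C^j$. The map $\tilde\sigma$ is the composition of $\mathrm{id}\times\sigma\colon\mathcal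 Z_Q=\mathbb P^1\times Q\to\mathbb P^1\times\mathcal R$ with the evaluation map from $\mathbb P^1\times\mathcal R$ to the total space of the vector bundle $\mathcal O(2)\otimes(\mathfrak k_{\mathbb C}\oplus\mathfrak t_{\mathbb C})\oplus\bigoplus_{j=1}^{n-1}\mathcal O(\ell_j)\otimes\wedge^j\mathbb C^n$. *)

theory Defs
  imports
    "Jordan_Normal_Form.Schur_Decomposition"
    "Jordan_Normal_Form.DL_Submatrix"
    "HOL-Analysis.Abstract_Topology"
begin

section \<open>Quivers and the universal hyperkaehler implosion\<close>

text \<open>
  A quiver \<open>(\<alpha>, \<beta>)\<close> consists of \<open>\<alpha> i : C^i \<rightarrow> C^(i+1)\<close> and \<open>\<beta> i : C^(i+1) \<rightarrow> C^i\<close>. The index \<open>i = 0\<close>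
  is included: a matrix with an empty dimension is unique, so that \<open>\<alpha> 0\<close> and \<open>\<beta> 0\<close> are the zero maps
  and the space of quivers is the direct sum over \<open>1 \<le> i \<le> n - 1\<close>.
\<close>

type_synonym quiver = "(nat \<Rightarrow> complex mat) \<times> (nat \<Rightarrow> complex mat)"

definition quivers :: "nat \<Rightarrow> quiver set" where
  "quivers n = (\<Pi>\<^sub>E i\<in>{..<n}. carrier_mat (Suc i) i) \<times> (\<Pi>\<^sub>E i\<in>{..<n}. carrier_mat i (Suc i))"

definition quiver_scale :: "nat \<Rightarrow> complex \<Rightarrow> quiver \<Rightarrow> quiver" where
  "quiver_scale n t x = (\<lambda>i\<in>{..<n}. t \<cdot>\<^sub>m fst x i, \<lambda>i\<in>{..<n}. t \<cdot>\<^sub>m snd x i)"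

definition SL :: "nat \<Rightarrow> complex mat set" where
  "SL k = {g \<in> carrier_mat k k. det g = 1}"

definition SU :: "nat \<Rightarrow> complex mat set" where
  "SU k = {g \<in> SL k. g * mat_adjoint g = 1\<^sub>m k}"

text \<open>The components at \<open>0\<close> and \<open>n\<close> are trivial; they only serve to make the action uniform.\<close>

definition gauge_group :: "(nat \<Rightarrow> complex mat set) \<Rightarrow> nat \<Rightarrow> (nat \<Rightarrow> complex mat) set" where
  "gauge_group G n = {g \<in> (\<Pi>\<^sub>E k\<in>{..n}. G k). g n = 1\<^sub>m n}"

abbreviation "H_group \<equiv> gauge_group SU"
abbreviation "HC_group \<equiv> gauge_group SL"

definition quiver_act :: "nat \<Rightarrow> (nat \<Rightarrow> complex mat) \<Rightarrow> quiver \<Rightarrow> quiver" where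
  "quiver_act n g x =
    (\<lambda>i\<in>{..<n}. g (Suc i) * fst x i * the (mat_inverse (g i)),
     \<lambda>i\<in>{..<n}. g i * snd x i * the (mat_inverse (g (Suc i))))"

definition muC :: "quiver \<Rightarrow> nat \<Rightarrow> complex mat" where
  "muC x i = fst x i * snd x i - snd x (Suc i) * fst x (Suc i)"

definition muR :: "quiver \<Rightarrow> nat \<Rightarrow> complex mat" where
  "muR x i = fst x i * mat_adjoint (fst x i) - mat_adjoint (snd x i) * snd x i
     + snd x (Suc i) * mat_adjoint (snd x (Suc i)) - mat_adjoint (fst x (Suc i)) * fst x (Suc i)"

definition complex_solutions :: "nat \<Rightarrow> quiver set" where
  "complex_solutions n = {x \<in> quivers n. \<exists>l :: nat \<Rightarrow> complex.
     \<forall>i. Suc i < n \<longrightarrow> muC x i = l (Suc i) \<cdot>\<^sub>m 1\<^sub>m (Suc i)}"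

definition hyperkaehler_solutions :: "nat \<Rightarrow> quiver set" where
  "hyperkaehler_solutions n = {x \<in> complex_solutions n. \<exists>l :: nat \<Rightarrow> real.
     \<forall>i. Suc i < n \<longrightarrow> muR x i = complex_of_real (l (Suc i)) \<cdot>\<^sub>m 1\<^sub>m (Suc i)}"

definition lambdaC :: "quiver \<Rightarrow> nat \<Rightarrow> complex" where
  "lambdaC x i = (THE c. muC x (i - 1) = c \<cdot>\<^sub>m 1\<^sub>m i)"

definition lambdaR :: "quiver \<Rightarrow> nat \<Rightarrow> real" where
  "lambdaR x i = (THE c. muR x (i - 1) = complex_of_real c \<cdot>\<^sub>m 1\<^sub>m i)"

definition implosion :: "nat \<Rightarrow> quiver set set" where
  "implosion n = hyperkaehler_solutions n //
     {(x, y). x \<in> hyperkaehler_solutions n \<and> (\<exists>g\<in>H_group n. y = quiver_act n g x)}"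


section \<open>The projective line and bundles over it\<close>

definition proj_point :: "complex \<times> complex \<Rightarrow> (complex \<times> complex) set" where
  "proj_point uv = {(t * fst uv, t * snd uv) |t. t \<noteq> 0}"

definition proj_line :: "(complex \<times> complex) set set" where
  "proj_line = proj_point ` (- {(0, 0)})"

text \<open>
  The total space of a direct sum of bundles \<open>O(m) \<otimes> V\<close> is the quotient of \<open>(C^2 - 0) \<times> V\<close> by the
  action \<open>t (z, w) = (t z, t^m w)\<close> of \<open>C^*\<close>; the action on the fibre direction is the parameter \<open>s\<close>.
  A homogeneous polynomial \<open>f\<close> of degree \<open>m\<close> is the section \<open>[z] \<mapsto> [z, f z]\<close>.
\<close>

definition bundle_point ::
  "(complex \<Rightarrow> 'v \<Rightarrow> 'v) \<Rightarrow> complex \<times> complex \<Rightarrow> 'v \<Rightarrow> ((complex \<times> complex) \<times> 'v) set" where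
  "bundle_point s uv w = {((t * fst uv, t * snd uv), s t w) |t. t \<noteq> 0}"


section \<open>The twistor space\<close>

text \<open>
  The two standard affine charts of the twistor space \<open>O(1) \<otimes> M\<close> of the space \<open>M\<close> of quivers. In
  both of them, the subvariety given by the complex moment map equation is \<open>C \<times> complex_solutions n\<close>,
  and \<open>HC_group n\<close> acts on the second factor.
\<close>

type_synonym twistor_point = "((complex \<times> complex) \<times> quiver) set"

definition charts :: "nat \<Rightarrow> (complex \<times> quiver \<Rightarrow> twistor_point) set" where
  "charts n = {\<lambda>(w, x). bundle_point (quiver_scale n) (1, w) x,
               \<lambda>(w, x). bundle_point (quiver_scale n) (w, 1) x}"

inductive_set polynomial_functions :: "nat \<Rightarrow> (complex \<times> quiver \<Rightarrow> complex) set" for n where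
  const: "(\<lambda>_. c) \<in> polynomial_functions n"
| base: "fst \<in> polynomial_functions n"
| alpha: "i < n \<Longrightarrow> r < Suc i \<Longrightarrow> s < i \<Longrightarrow>
    (\<lambda>p. fst (snd p) i $$ (r, s)) \<in> polynomial_functions n"
| beta: "i < n \<Longrightarrow> r < i \<Longrightarrow> s < Suc i \<Longrightarrow>
    (\<lambda>p. snd (snd p) i $$ (r, s)) \<in> polynomial_functions n"
| add: "f \<in> polynomial_functions n \<Longrightarrow> h \<in> polynomial_functions n \<Longrightarrow>
    (\<lambda>p. f p + h p) \<in> polynomial_functions n"
| mult: "f \<in> polynomial_functions n \<Longrightarrow> h \<in> polynomial_functions n \<Longrightarrow>
    (\<lambda>p. f p * h p) \<in> polynomial_functions n"

text \<open>Polynomials whose restriction to the closed subvariety \<open>C \<times> complex_solutions n\<close> is invariant.\<close>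

definition invariant_functions :: "nat \<Rightarrow> (complex \<times> quiver \<Rightarrow> complex) set" where
  "invariant_functions n = {f \<in> polynomial_functions n.
     \<forall>w. \<forall>x\<in>complex_solutions n. \<forall>g\<in>HC_group n. f (w, quiver_act n g x) = f (w, x)}"

text \<open>
  Over each chart, the GIT quotient is the (maximal) spectrum of the ring of invariant regular
  functions. Its points are the classes of points that are not separated by invariant functions,
  and the sets on which an invariant function does not vanish are a basis of its Zariski topology.
\<close>

definition git_class :: "nat \<Rightarrow> twistor_point \<Rightarrow> twistor_point set" where
  "git_class n z = {\<phi> p' |\<phi> p p'. \<phi> \<in> charts n \<and> p \<in> UNIV \<times> complex_solutions n \<and>
     p' \<in> UNIV \<times> complex_solutions n \<and> z = \<phi> p \<and> (\<forall>f\<in>invariant_functions n. f p = f p')}"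

definition git_quotient :: "nat \<Rightarrow> twistor_point set topology" where
  "git_quotient n = topology_generated_by
     {git_class n ` \<phi> ` {p \<in> UNIV \<times> complex_solutions n. f p \<noteq> 0} |\<phi> f.
        \<phi> \<in> charts n \<and> f \<in> invariant_functions n}"

definition rotate_quiver :: "nat \<Rightarrow> complex \<times> complex \<Rightarrow> quiver \<Rightarrow> quiver" where
  "rotate_quiver n = (\<lambda>(u, v) (\<alpha>, \<beta>).
    (\<lambda>i\<in>{..<n}. u \<cdot>\<^sub>m \<alpha> i + v \<cdot>\<^sub>m mat_adjoint (\<beta> i),
     \<lambda>i\<in>{..<n}. (- v) \<cdot>\<^sub>m mat_adjoint (\<alpha> i) + u \<cdot>\<^sub>m \<beta> i))"

text \<open>
  The following map identifies \<open>proj_line \<times> implosion n\<close> with the GIT quotient; the twistor space of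
  the implosion is that product, with the topology transported along this identification. Here and
  below, \<open>the_elem\<close> picks the common value that a function takes on all representatives.
\<close>

definition twistor_class :: "nat \<Rightarrow> (complex \<times> complex) set \<times> quiver set \<Rightarrow> twistor_point set" where
  "twistor_class n = (\<lambda>(p, q).
     the_elem ((\<lambda>(uv, x). git_class n (bundle_point (quiver_scale n) uv (rotate_quiver n uv x))) ` (p \<times> q)))"

definition twistor_space :: "nat \<Rightarrow> ((complex \<times> complex) set \<times> quiver set) topology" where
  "twistor_space n = pullback_topology (proj_line \<times> implosion n) (twistor_class n) (git_quotient n)"


section \<open>The maps to sections and to the total space\<close>

definition traceless_part :: "nat \<Rightarrow> complex mat \<Rightarrow> complex mat" where
  "traceless_part n Y = Y - ((\<Sum>i<n. Y $$ (i, i)) / of_nat n) \<cdot>\<^sub>m 1\<^sub>m n"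

text \<open>
  Vectors of the \<open>j\<close>-th exterior power of \<open>C^n\<close> are given by their coordinates with respect to the
  basis vectors \<open>e_I = e_i1 \<and> \<dots> \<and> e_ij\<close> for \<open>I = {i1 < \<dots> < ij} \<subseteq> {0, \<dots>, n - 1}\<close>. The image of
  \<open>e_1 \<and> \<dots> \<and> e_j\<close> under the \<open>j\<close>-th exterior power of an \<open>n \<times> j\<close> matrix, i.e. the wedge product of
  its columns, has the maximal minors of the matrix as coordinates.
\<close>

definition index_sets :: "nat \<Rightarrow> nat \<Rightarrow> nat set set" where
  "index_sets n j = {I. I \<subseteq> {..<n} \<and> card I = j}"

definition wedge_columns :: "nat \<Rightarrow> nat \<Rightarrow> complex mat \<Rightarrow> nat set \<Rightarrow> complex" where
  "wedge_columns n j A = (\<lambda>I\<in>index_sets n j. det (submatrix A I UNIV))"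

text \<open>The composition \<open>a (n - 1) * \<dots> * a (j + 1) * a j\<close>, of dimension \<open>n \<times> j\<close>.\<close>

definition compose_from :: "nat \<Rightarrow> (nat \<Rightarrow> complex mat) \<Rightarrow> nat \<Rightarrow> complex mat" where
  "compose_from n a j = fold (\<lambda>i B. a i * B) [j..<n] (1\<^sub>m j)"

type_synonym fibre = "complex mat \<times> (nat \<Rightarrow> complex) \<times> (nat \<Rightarrow> nat set \<Rightarrow> complex)"

definition sections_of_quiver :: "nat \<Rightarrow> quiver \<Rightarrow> complex \<times> complex \<Rightarrow> fibre" where
  "sections_of_quiver n x = (\<lambda>(u, v). let (a, b) = rotate_quiver n (u, v) x in
     (traceless_part n (a (n - 1) * b (n - 1)),
      \<lambda>i\<in>{1..<n}. u\<^sup>2 * lambdaC x i - u * v * complex_of_real (lambdaR x i) - v\<^sup>2 * cnj (lambdaC x i),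
      \<lambda>j\<in>{1..<n}. wedge_columns n j (compose_from n a j)))"

definition sigma :: "nat \<Rightarrow> quiver set \<Rightarrow> complex \<times> complex \<Rightarrow> fibre" where
  "sigma n q = the_elem (sections_of_quiver n ` q)"

definition fibres :: "nat \<Rightarrow> fibre set" where
  "fibres n = {X \<in> carrier_mat n n. (\<Sum>i<n. X $$ (i, i)) = 0} \<times> (\<Pi>\<^sub>E i\<in>{1..<n}. UNIV) \<times>
     (\<Pi>\<^sub>E j\<in>{1..<n}. \<Pi>\<^sub>E I\<in>index_sets n j. UNIV)"

definition fibre_scale :: "nat \<Rightarrow> complex \<Rightarrow> fibre \<Rightarrow> fibre" where
  "fibre_scale n t = (\<lambda>(X, \<tau>, w).
    (t\<^sup>2 \<cdot>\<^sub>m X, \<lambda>i\<in>{1..<n}. t\<^sup>2 * \<tau> i, \<lambda>j\<in>{1..<n}. \<lambda>I\<in>index_sets n j. t ^ (j * (n - j)) * w j I))"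

definition total_space :: "nat \<Rightarrow> ((complex \<times> complex) \<times> fibre) set set" where
  "total_space n = {bundle_point (fibre_scale n) uv w |uv w. uv \<noteq> (0, 0) \<and> w \<in> fibres n}"

definition evaluation ::
  "nat \<Rightarrow> (complex \<times> complex) set \<times> (complex \<times> complex \<Rightarrow> fibre) \<Rightarrow> ((complex \<times> complex) \<times> fibre) set" where
  "evaluation n = (\<lambda>(p, s). the_elem ((\<lambda>uv. bundle_point (fibre_scale n) uv (s uv)) ` p))"

definition sigma_tilde ::
  "nat \<Rightarrow> (complex \<times> complex) set \<times> quiver set \<Rightarrow> ((complex \<times> complex) \<times> fibre) set" where
  "sigma_tilde n = evaluation n \<circ> map_prod id (sigma n)"

end

theory Submission
  imports Defs
begin

text \<open>
  The open set consists of the classes of points at which all products \<open>b_k a_k\<close> are invertible. At such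
  a point, the maximal minors recover each composition \<open>a_(n-1) \<dots> a_j\<close> up to \<open>SL(j)\<close>, hence all \<open>a_j\<close> up
  to the complexified gauge group. The last product \<open>a b\<close> then determines the last \<open>b\<close>, and the complex
  moment map equation propagates this downwards. Two solutions of the hyperkaehler equations in one
  regular orbit of the complexified group differ by the compact group, because the norm is strictly
  convex along such an orbit. This gives injectivity.

  For density, take a solution of the hyperkaehler equations. After rotation by all but finitely many
  points of the projective line, \<open>a_k\<close> and the adjoint of \<open>b_k\<close> have the same kernel for every \<open>k\<close>, and
  such a quiver is a limit of complex solutions with invertible products \<open>b_k a_k\<close>. By the Kempf--Ness
  argument, the closure of the orbit of each of these contains a solution of the hyperkaehler equations,
  so that it represents a point of the twistor space.
\<close>


section \<open>Matrices\<close>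

text \<open>Density is the harder half. The eigenvalues of \<open>b_k a_k\<close> are minus sums of
  consecutive multipliers, so these products become invertible once the multipliers are moved
  slightly. A solution with moved multipliers is built from the top: the last product is prescribed
  and factored close to the given factors, and each factorisation prescribes the product below it.
  This is obstructed when \<open>a_k\<close> and the adjoint of \<open>b_k\<close> have different
  kernels: if \<open>a = 0\<close> and \<open>b\<close> is nonzero, the row space of a small product
  of full rank is tied to \<open>b\<close>, so the product cannot be chosen freely. The twistor line
  removes the obstruction. Equality of kernels comes from traces of both moment maps over the
  kernels of the compositions \<open>a_k ... a_j\<close>; the argument fails only where a weighted
  sum of complex multipliers vanishes and the real one does not. For each of the finitely many
  dimension vectors this confines the parameter to the roots of a nonzero polynomial of degree at
  most 2. Limits are taken in the classical sense: invariants are continuous, so a sequence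
  converging to a point of a Zariski-open set eventually stays in it.\<close>

lemma mult_mat_index:
  "i < dim_row A \<Longrightarrow> j < dim_col B \<Longrightarrow> dim_col A = dim_row B \<Longrightarrow>
    (A * B) $$ (i, j) = (\<Sum>k<dim_row B. A $$ (i, k) * B $$ (k, j))"
  by (auto simp: scalar_prod_def atLeast0LessThan intro!: sum.cong)

context
  fixes A B C :: "'a :: comm_ring_1 mat"
begin

text \<open>Side conditions are equations between dimensions instead of membership in
  \<open>carrier_mat\<close>, so that the simplifier can decide them without having to guess a
  size.\<close>

lemma mat_assoc:
  "dim_col A = dim_row B \<Longrightarrow> dim_col B = dim_row C \<Longrightarrow> (A * B) * C = A * (B * C)"
  by (rule assoc_mult_mat[of _ "dim_row A" "dim_col A" _ "dim_col B" _ "dim_col C"]) auto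

lemma mat_add_distrib_left:
  "dim_col A = dim_row B \<Longrightarrow> dim_row C = dim_row B \<Longrightarrow> dim_col C = dim_col B \<Longrightarrow>
    A * (B + C) = A * B + A * C"
  by (rule mult_add_distrib_mat[of _ "dim_row A" "dim_col A" _ "dim_col B"]) auto

lemma mat_add_distrib_right:
  "dim_col A = dim_row C \<Longrightarrow> dim_row B = dim_row A \<Longrightarrow> dim_col B = dim_col A \<Longrightarrow>
    (A + B) * C = A * C + B * C"
  by (rule add_mult_distrib_mat[of _ "dim_row A" "dim_col A" _ _ "dim_col C"]) auto

lemma mat_diff_distrib_left:
  "dim_col A = dim_row B \<Longrightarrow> dim_row C = dim_row B \<Longrightarrow> dim_col C = dim_col B \<Longrightarrow>
    A * (B - C) = A * B - A * C"
  by (rule mult_minus_distrib_mat[of _ "dim_row A" "dim_col A" _ "dim_col B"]) auto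

lemma mat_diff_distrib_right:
  "dim_col A = dim_row C \<Longrightarrow> dim_row B = dim_row A \<Longrightarrow> dim_col B = dim_col A \<Longrightarrow>
    (A - B) * C = A * C - B * C"
  by (rule minus_mult_distrib_mat[of _ "dim_row A" "dim_col A" _ _ "dim_col C"]) auto

lemma mat_smult_left: "dim_col A = dim_row B \<Longrightarrow> (k \<cdot>\<^sub>m A) * B = k \<cdot>\<^sub>m (A * B)"
  by (rule mult_smult_assoc_mat[of _ "dim_row A" "dim_col A" _ "dim_col B"]) auto

lemma mat_smult_right: "dim_col A = dim_row B \<Longrightarrow> A * (k \<cdot>\<^sub>m B) = k \<cdot>\<^sub>m (A * B)"
  by (rule mult_smult_distrib[of _ "dim_row A" "dim_col A" _ "dim_col B"]) auto

lemma mat_one_left: "dim_row A = n \<Longrightarrow> 1\<^sub>m n * A = A"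
  by (rule left_mult_one_mat[of _ _ "dim_col A"]) auto

lemma mat_one_right: "dim_col A = n \<Longrightarrow> A * 1\<^sub>m n = A"
  by (rule right_mult_one_mat[of _ "dim_row A"]) auto

lemma mat_smult_add:
  "dim_row A = dim_row B \<Longrightarrow> dim_col A = dim_col B \<Longrightarrow> k \<cdot>\<^sub>m (A + B) = k \<cdot>\<^sub>m A + k \<cdot>\<^sub>m B"
  by (rule eq_matI) (auto simp: algebra_simps)

lemma mat_smult_diff:
  "dim_row A = dim_row B \<Longrightarrow> dim_col A = dim_col B \<Longrightarrow> k \<cdot>\<^sub>m (A - B) = k \<cdot>\<^sub>m A - k \<cdot>\<^sub>m B"
  by (rule eq_matI) (auto simp: algebra_simps)

end

lemmas mat_distrib = mat_smult_add mat_smult_diff mat_add_distrib_left mat_add_distrib_right mat_diff_distrib_left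
  mat_diff_distrib_right mat_smult_left mat_smult_right mat_assoc mat_one_left mat_one_right

lemma mat_inverse_unique:
  fixes A :: "complex mat"
  assumes "A \<in> carrier_mat n n" "B \<in> carrier_mat n n" "C \<in> carrier_mat n n"
    and "A * B = 1\<^sub>m n" "C * A = 1\<^sub>m n"
  shows "B = C"
proof -
  have "B = (C * A) * B"
    unfolding assms(5) using assms(2) by (simp add: mat_one_left)
  also have "\<dots> = C * (A * B)"
    using assms(1-3) by (simp add: mat_assoc)
  also have "\<dots> = C"
    unfolding assms(4) using assms(3) by (simp add: mat_one_right)
  finally show ?thesis .
qed

lemma det_0_imp_row_kernel:
  fixes A :: "complex mat"
  assumes A: "A \<in> carrier_mat n n" and "det A = 0"
  obtains v where "\<exists>i<n. v i \<noteq> 0" "\<And>j. j < n \<Longrightarrow> (\<Sum>i<n. v i * A $$ (i, j)) = 0"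
proof -
  have "det A\<^sup>T = 0" using assms by (simp add: det_transpose)
  then obtain v where v: "v \<in> carrier_vec n" "v \<noteq> 0\<^sub>v n" "A\<^sup>T *\<^sub>v v = 0\<^sub>v n"
    using det_0_iff_vec_prod_zero_field[of "A\<^sup>T" n] A by auto
  have "\<exists>i<n. v $ i \<noteq> 0"
    using v(1,2) by (auto simp: vec_eq_iff)
  moreover have "(\<Sum>i<n. v $ i * A $$ (i, j)) = 0" if "j < n" for j
  proof -
    have "(A\<^sup>T *\<^sub>v v) $ j = 0" using v(3) that by simp
    then show ?thesis
      using A v(1) that by (simp add: scalar_prod_def atLeast0LessThan mult.commute)
  qed
  ultimately show thesis by (rule that)
qed


subsection \<open>Adjoint, trace and norm\<close>

abbreviation adj :: "complex mat \<Rightarrow> complex mat" where "adj \<equiv> mat_adjoint"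

lemma dim_adj [simp]: "dim_row (adj A) = dim_col A" "dim_col (adj A) = dim_row A"
  by (auto simp: mat_adjoint_def)

lemma adj_carrier [simp]: "adj A \<in> carrier_mat m k \<longleftrightarrow> A \<in> carrier_mat k m"
  unfolding carrier_mat_def mem_Collect_eq dim_adj by (rule conj_commute)

lemma index_adj [simp]:
  "i < dim_col A \<Longrightarrow> j < dim_row A \<Longrightarrow> adj A $$ (i, j) = cnj (A $$ (j, i))"
  by (simp add: mat_adjoint_def mat_of_rows_index)

lemma adj_adj [simp]: "adj (adj A) = A"
  by (rule eq_matI) auto

lemma adj_add: "dim_row A = dim_row B \<Longrightarrow> dim_col A = dim_col B \<Longrightarrow> adj (A + B) = adj A + adj B"
  by (rule eq_matI) auto

lemma adj_diff: "dim_row A = dim_row B \<Longrightarrow> dim_col A = dim_col B \<Longrightarrow> adj (A - B) = adj A - adj B"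
  by (rule eq_matI) auto

lemma adj_smult: "adj (c \<cdot>\<^sub>m A) = cnj c \<cdot>\<^sub>m adj A"
  by (rule eq_matI) auto

lemma adj_mult: "dim_col A = dim_row B \<Longrightarrow> adj (A * B) = adj B * adj A"
  by (rule eq_matI) (auto simp: mult_mat_index simp del: index_mult_mat(1) intro!: sum.cong)

lemma adj_one [simp]: "adj (1\<^sub>m n) = 1\<^sub>m n"
  by (rule eq_matI) auto

lemma adj_zero [simp]: "adj (0\<^sub>m m n) = 0\<^sub>m n m"
  by (rule eq_matI) auto

lemmas adj_simps = adj_add adj_diff adj_smult adj_mult

lemma det_adj: assumes "A \<in> carrier_mat n n" shows "det (adj A) = cnj (det A)"
proof -
  interpret comm_ring_hom cnj by standard auto
  have "adj A = map_mat cnj A\<^sup>T" using assms by (intro eq_matI) auto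
  then show ?thesis using assms by (simp add: det_transpose)
qed

definition mtr :: "complex mat \<Rightarrow> complex" where "mtr A = (\<Sum>i<dim_row A. A $$ (i, i))"

definition sqnorm :: "complex mat \<Rightarrow> real" where
  "sqnorm A = (\<Sum>i<dim_row A. \<Sum>j<dim_col A. (cmod (A $$ (i, j)))\<^sup>2)"

lemma mtr_add: "A \<in> carrier_mat n n \<Longrightarrow> B \<in> carrier_mat n n \<Longrightarrow> mtr (A + B) = mtr A + mtr B"
  by (simp add: mtr_def sum.distrib)

lemma mtr_diff: "A \<in> carrier_mat n n \<Longrightarrow> B \<in> carrier_mat n n \<Longrightarrow> mtr (A - B) = mtr A - mtr B"
  by (simp add: mtr_def sum_subtractf)

lemma mtr_smult: "A \<in> carrier_mat n n \<Longrightarrow> mtr (c \<cdot>\<^sub>m A) = c * mtr A"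
  by (simp add: mtr_def sum_distrib_left)

lemma mtr_one [simp]: "mtr (1\<^sub>m n) = of_nat n"
  by (simp add: mtr_def)

lemma mtr_mult:
  assumes "A \<in> carrier_mat m n" "B \<in> carrier_mat n m"
  shows "mtr (A * B) = (\<Sum>i<m. \<Sum>j<n. A $$ (i, j) * B $$ (j, i))"
  using assms by (simp add: mtr_def mult_mat_index del: index_mult_mat(1))

lemma mtr_commute:
  assumes "A \<in> carrier_mat m n" "B \<in> carrier_mat n m"
  shows "mtr (A * B) = mtr (B * A)"
  unfolding mtr_mult[OF assms] mtr_mult[OF assms(2,1)]
  by (subst sum.swap) (simp add: mult.commute)

lemma mtr_mult_adj: "mtr (A * adj A) = complex_of_real (sqnorm A)"
proof -
  have "mtr (A * adj A) = (\<Sum>i<dim_row A. \<Sum>j<dim_col A. A $$ (i, j) * adj A $$ (j, i))"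
    by (rule mtr_mult) auto
  also have "\<dots> = complex_of_real (sqnorm A)"
    by (auto simp: sqnorm_def complex_norm_square simp del: of_real_power intro!: sum.cong)
  finally show ?thesis .
qed

lemma mtr_adj_mult: "mtr (adj A * A) = complex_of_real (sqnorm A)"
  by (subst mtr_commute[of _ "dim_col A" "dim_row A"]) (auto simp: mtr_mult_adj)

lemma sqnorm_nonneg [simp]: "sqnorm A \<ge> 0"
  by (simp add: sqnorm_def sum_nonneg)

lemma sqnorm_entry_le:
  assumes "i < dim_row A" "j < dim_col A"
  shows "(cmod (A $$ (i, j)))\<^sup>2 \<le> sqnorm A"
proof -
  have "(cmod (A $$ (i, j)))\<^sup>2 \<le> (\<Sum>j<dim_col A. (cmod (A $$ (i, j)))\<^sup>2)"
    by (rule member_le_sum) (use assms in auto)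
  also have "\<dots> \<le> sqnorm A"
    unfolding sqnorm_def
    by (rule member_le_sum[of i _ "\<lambda>i. \<Sum>j<dim_col A. (cmod (A $$ (i, j)))\<^sup>2"])
       (use assms in \<open>auto intro: sum_nonneg\<close>)
  finally show ?thesis .
qed

lemma sqnorm_eq_0: "sqnorm A = 0 \<Longrightarrow> A = 0\<^sub>m (dim_row A) (dim_col A)"
proof (rule eq_matI)
  fix i j assume "sqnorm A = 0" "i < dim_row (0\<^sub>m (dim_row A) (dim_col A) :: complex mat)"
    "j < dim_col (0\<^sub>m (dim_row A) (dim_col A) :: complex mat)"
  then show "A $$ (i, j) = 0\<^sub>m (dim_row A) (dim_col A) $$ (i, j)"
    using sqnorm_entry_le[of i A j] by auto
qed auto

lemma sqnorm_adj [simp]: "sqnorm (adj A) = sqnorm A"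
  unfolding sqnorm_def by (subst sum.swap) (auto intro!: sum.cong)

lemma adj_mult_eq_0:
  assumes "adj A * A = 0\<^sub>m (dim_col A) (dim_col A)"
  shows "A = 0\<^sub>m (dim_row A) (dim_col A)"
proof -
  have "mtr (adj A * A) = 0" unfolding assms by (simp add: mtr_def)
  then show ?thesis using sqnorm_eq_0 by (simp add: mtr_adj_mult)
qed


subsection \<open>The spectral theorem\<close>

text \<open>The direct sum of the scalar \<open>c\<close> and \<open>M\<close>; it carries a unitary
  matrix of size n to one of size n + 1 in the induction for the spectral theorem.\<close>

definition bordered :: "complex \<Rightarrow> complex mat \<Rightarrow> complex mat" where
  "bordered c M = mat (Suc (dim_row M)) (Suc (dim_col M))
    (\<lambda>(i, j). if i = 0 then (if j = 0 then c else 0)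
              else if j = 0 then 0 else M $$ (i - 1, j - 1))"

lemma dim_bordered [simp]:
  "dim_row (bordered c M) = Suc (dim_row M)" "dim_col (bordered c M) = Suc (dim_col M)"
  by (auto simp: bordered_def)

lemma bordered_mult:
  assumes "dim_col M = dim_row N"
  shows "bordered c M * bordered d N = bordered (c * d) (M * N)"
proof (rule eq_matI)
  fix i j assume "i < dim_row (bordered (c * d) (M * N))" "j < dim_col (bordered (c * d) (M * N))"
  then have ij: "i < Suc (dim_row M)" "j < Suc (dim_col N)" by auto
  have "(bordered c M * bordered d N) $$ (i, j) =
      (\<Sum>k<Suc (dim_row N). bordered c M $$ (i, k) * bordered d N $$ (k, j))"
    using ij assms by (simp add: mult_mat_index del: index_mult_mat(1))
  also have "\<dots> = bordered (c * d) (M * N) $$ (i, j)"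
    unfolding sum.lessThan_Suc_shift
    using ij assms by (cases i; cases j)
      (auto simp: bordered_def mult_mat_index simp del: index_mult_mat(1))
  finally show "(bordered c M * bordered d N) $$ (i, j) = bordered (c * d) (M * N) $$ (i, j)" .
qed (use assms in auto)

lemma adj_bordered: "adj (bordered c M) = bordered (cnj c) (adj M)"
  by (rule eq_matI) (auto simp: bordered_def)

lemma bordered_one: "bordered 1 (1\<^sub>m n) = 1\<^sub>m (Suc n)"
  by (rule eq_matI) (auto simp: bordered_def)

lemma bordered_diag: "bordered (d 0) (mat_diag n (\<lambda>i. d (Suc i))) = mat_diag (Suc n) d"
  by (rule eq_matI) (auto simp: bordered_def mat_diag_def)

definition unitary :: "nat \<Rightarrow> complex mat \<Rightarrow> bool" where
  "unitary n U \<longleftrightarrow> U \<in> carrier_mat n n \<and> adj U * U = 1\<^sub>m n \<and> U * adj U = 1\<^sub>m n"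

lemma unitaryD:
  assumes "unitary n U"
  shows "U \<in> carrier_mat n n" "dim_row U = n" "dim_col U = n" "adj U * U = 1\<^sub>m n" "U * adj U = 1\<^sub>m n"
  using assms by (auto simp: unitary_def)

lemma unitary_cancel:
  assumes "unitary n U" "dim_row X = n"
  shows "U * (adj U * X) = X" "adj U * (U * X) = X"
  using assms unitaryD[OF assms(1)] by (simp_all add: mat_assoc[symmetric] mat_one_left)

lemma unitary_mult:
  assumes U: "unitary n U" and V: "unitary n V"
  shows "unitary n (U * V)"
  unfolding unitary_def
  using unitaryD[OF U] unitaryD[OF V]
  by (simp add: adj_mult mat_assoc unitary_cancel[OF U] unitary_cancel[OF V])

lemma unitary_adj: "unitary n U \<Longrightarrow> unitary n (adj U)"
  by (auto simp: unitary_def)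

lemma unitaryI: "U \<in> carrier_mat n n \<Longrightarrow> U * adj U = 1\<^sub>m n \<Longrightarrow> unitary n U"
  unfolding unitary_def by (auto intro: mat_mult_left_right_inverse)

text \<open>The Householder reflection exchanging \<open>e_0\<close> and \<open>v\<close>; the sign of \<open>v_0\<close> avoids a division by zero.\<close>

lemma unitary_first_column:
  fixes v :: "nat \<Rightarrow> complex" and r :: real
  assumes "(\<Sum>i<Suc n. (cmod (v i))\<^sup>2) = 1" "v 0 = of_real r" "r \<le> 0"
  obtains U where "unitary (Suc n) U" "\<And>i. i < Suc n \<Longrightarrow> U $$ (i, 0) = v i"
proof -
  define w where "w = mat (Suc n) 1 (\<lambda>(i, j). v i - (if i = 0 then 1 else 0))"
  \<comment> \<open>The reflection along \<open>w = v - e_0\<close> subtracts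
    \<open>2 / |w|^2\<close> times \<open>w * adj w\<close>. As \<open>v\<close> is a unit vector
    with real first entry \<open>r\<close>, \<open>|w|^2 = 2 (1 - r)\<close>, which gives this
    constant.\<close>
  define c :: complex where "c = of_real (1 / (1 - r))"
  define U where "U = 1\<^sub>m (Suc n) - c \<cdot>\<^sub>m (w * adj w)"
  have w [simp]: "dim_row w = Suc n" "dim_col w = 1" by (auto simp: w_def)
  have "sqnorm w = (\<Sum>i<Suc n. (cmod (v i - (if i = 0 then 1 else 0)))\<^sup>2)"
    by (auto simp: sqnorm_def w_def intro!: sum.cong)
  also have "\<dots> = (r - 1)\<^sup>2 + (\<Sum>i<n. (cmod (v (Suc i)))\<^sup>2)"
    unfolding sum.lessThan_Suc_shift using assms(2)
    by (simp add: cmod_def of_real_power[symmetric] flip: of_real_diff)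
  also have "\<dots> = (r - 1)\<^sup>2 + 1 - r\<^sup>2"
    using assms(1,2) unfolding sum.lessThan_Suc_shift by simp
  finally have nw: "sqnorm w = 2 * (1 - r)" by (simp add: power2_eq_square algebra_simps)
  have "(adj w * w) $$ (0, 0) = mtr (adj w * w)" by (simp add: mtr_def)
  then have ww: "adj w * w = of_real (2 * (1 - r)) \<cdot>\<^sub>m 1\<^sub>m 1"
    by (intro eq_matI) (auto simp: mtr_adj_mult nw)
  have c1: "c * (1 - complex_of_real r) = 1"
  proof -
    have "complex_of_real (1 / (1 - r)) * complex_of_real (1 - r) = complex_of_real (1 / (1 - r) * (1 - r))"
      by (rule of_real_mult[symmetric])
    also have "1 / (1 - r) * (1 - r) = 1" using assms(3) by simp
    finally show ?thesis unfolding c_def of_real_diff of_real_1 .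
  qed
  have adjU: "adj U = U"
    by (simp add: U_def adj_simps c_def)
  have "U * U = 1\<^sub>m (Suc n) - c \<cdot>\<^sub>m (w * adj w) - (c \<cdot>\<^sub>m (w * adj w) - c \<cdot>\<^sub>m (c \<cdot>\<^sub>m (w * ((adj w * w) * adj w))))"
    by (simp add: U_def mat_distrib)
  also have "w * ((adj w * w) * adj w) = of_real (2 * (1 - r)) \<cdot>\<^sub>m (w * adj w)"
    unfolding ww by (simp add: mat_distrib)
  also have "1\<^sub>m (Suc n) - c \<cdot>\<^sub>m (w * adj w) - (c \<cdot>\<^sub>m (w * adj w) - c \<cdot>\<^sub>m (c \<cdot>\<^sub>m (of_real (2 * (1 - r)) \<cdot>\<^sub>m (w * adj w)))) = 1\<^sub>m (Suc n)"
  proof (rule eq_matI)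
    fix i j assume "i < dim_row (1\<^sub>m (Suc n) :: complex mat)" "j < dim_col (1\<^sub>m (Suc n) :: complex mat)"
    then have ij: "i < Suc n" "j < Suc n" by auto
    have "c * complex_of_real (2 - 2 * r) = 2 * (c * (1 - complex_of_real r))"
      by (simp add: algebra_simps)
    then have "c * complex_of_real (2 - 2 * r) = 2" by (simp add: c1)
    then show "(1\<^sub>m (Suc n) - c \<cdot>\<^sub>m (w * adj w) - (c \<cdot>\<^sub>m (w * adj w) - c \<cdot>\<^sub>m (c \<cdot>\<^sub>m (of_real (2 * (1 - r)) \<cdot>\<^sub>m (w * adj w))))) $$ (i, j) = 1\<^sub>m (Suc n) $$ (i, j)"
      using ij by (simp del: index_mult_mat(1) of_real_mult of_real_diff)
  qed auto
  finally have "unitary (Suc n) U"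
    by (intro unitaryI carrier_matI) (auto simp: adjU, auto simp: U_def)
  moreover have "U $$ (i, 0) = v i" if "i < Suc n" for i
  proof -
    have "(w * adj w) $$ (i, 0) = (v i - (if i = 0 then 1 else 0)) * (of_real r - 1)"
      using that assms(2) by (simp add: mult_mat_index del: index_mult_mat(1)) (simp add: w_def)
    moreover have "c * (of_real r - 1) = -1" using c1 by (simp add: algebra_simps)
    then have "c * (x * (of_real r - 1)) = - x" for x by (metis mult.left_commute mult_minus1_right)
    ultimately show ?thesis
      using that by (simp add: U_def del: index_mult_mat(1))
  qed
  ultimately show thesis by (rule that)
qed

lemma complex_eigenvector:
  fixes A :: "complex mat"
  assumes A: "A \<in> carrier_mat (Suc n) (Suc n)"
  obtains e v r where "(\<Sum>i<Suc n. (cmod (v i))\<^sup>2) = 1" "v 0 = complex_of_real r" "r \<le> 0"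
    "\<And>i. i < Suc n \<Longrightarrow> (\<Sum>j<Suc n. A $$ (i, j) * v j) = e * v i"
proof -
  obtain as where as: "char_poly A = (\<Prod>a\<leftarrow>as. [:- a, 1:])" "length as = Suc n"
    using char_poly_factorized[OF A] by blast
  then obtain e as' where e: "as = e # as'" by (cases as) auto
  have "poly (char_poly A) e = 0" unfolding as(1) e by simp
  then have "eigenvalue A e" using eigenvalue_root_char_poly[OF A] by simp
  then obtain u where u: "u \<in> carrier_vec (Suc n)" "u \<noteq> 0\<^sub>v (Suc n)" "A *\<^sub>v u = e \<cdot>\<^sub>v u"
    using A by (auto simp: eigenvalue_def eigenvector_def)
  define N where "N = (\<Sum>i<Suc n. (cmod (u $ i))\<^sup>2)"
  obtain i0 where i0: "i0 < Suc n" "u $ i0 \<noteq> 0"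
    using u(1,2) by (auto simp: vec_eq_iff)
  have "(cmod (u $ i0))\<^sup>2 \<le> N"
    unfolding N_def by (rule member_le_sum) (use i0 in auto)
  then have N: "N > 0" using i0(2) by (smt (verit) zero_less_norm_iff zero_less_power)
  \<comment> \<open>A phase that makes the first entry a non-positive real number, as the reflection
    requires; if that entry vanishes, any phase serves.\<close>
  define z :: complex where "z = (if u $ 0 = 0 then 1 else - cnj (u $ 0) / of_real (cmod (u $ 0)))"
  have z: "cmod z = 1" by (auto simp: z_def norm_divide)
  define v where "v i = z / of_real (sqrt N) * u $ i" for i
  have "(\<Sum>i<Suc n. (cmod (v i))\<^sup>2) = (\<Sum>i<Suc n. (cmod (u $ i))\<^sup>2 / N)"
    using N z by (intro sum.cong) (auto simp: v_def norm_mult norm_divide power_divide)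
  also have "\<dots> = 1" using N by (simp add: N_def flip: sum_divide_distrib)
  finally have 1: "(\<Sum>i<Suc n. (cmod (v i))\<^sup>2) = 1" .
  have 2: "v 0 = complex_of_real (- cmod (u $ 0) / sqrt N)"
  proof (cases "u $ 0 = 0")
    case False
    have "cnj (u $ 0) * u $ 0 = of_real (cmod (u $ 0)) * of_real (cmod (u $ 0))"
      using complex_norm_square[of "u $ 0"] by (simp add: power2_eq_square mult.commute)
    then show ?thesis using False by (simp add: v_def z_def field_simps)
  qed (auto simp: v_def)
  have 3: "(\<Sum>j<Suc n. A $$ (i, j) * v j) = e * v i" if "i < Suc n" for i
  proof -
    have "(A *\<^sub>v u) $ i = e * u $ i" using u that by simp
    then have "(\<Sum>j<Suc n. A $$ (i, j) * u $ j) = e * u $ i"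
      using A u(1) that by (simp add: scalar_prod_def atLeast0LessThan del: sum.lessThan_Suc)
    moreover have "(\<Sum>j<Suc n. A $$ (i, j) * v j) = z / of_real (sqrt N) * (\<Sum>j<Suc n. A $$ (i, j) * u $ j)"
      unfolding sum_distrib_left by (intro sum.cong) (auto simp: v_def)
    ultimately show ?thesis by (simp add: v_def)
  qed
  show thesis using that[OF 1 2 _ 3] N by simp
qed

text \<open>Deflation: in a unitary basis that starts with a unit eigenvector the first column is a
  multiple of \<open>e_0\<close>, self-adjointness gives the same for the first row, and the
  remaining block is self-adjoint and smaller.\<close>

theorem spectral_theorem:
  assumes "A \<in> carrier_mat n n" "adj A = A"
  obtains U d where "unitary n U" "A = U * mat_diag n (\<lambda>i. complex_of_real (d i)) * adj U"
  using assms
proof (induction n arbitrary: A thesis)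
  case 0
  have "A = 1\<^sub>m 0 * mat_diag 0 (\<lambda>i. complex_of_real 0) * adj (1\<^sub>m 0)"
    using 0 by (intro eq_matI) auto
  moreover have "unitary 0 (1\<^sub>m 0)" by (simp add: unitary_def)
  ultimately show ?case using 0(1)[of "1\<^sub>m 0" "\<lambda>_. 0"] by blast
next
  case (Suc n)
  note A = Suc.prems(2,3)
  obtain e v r where v: "(\<Sum>i<Suc n. (cmod (v i))\<^sup>2) = 1" "v 0 = complex_of_real r" "r \<le> 0"
    "\<And>i. i < Suc n \<Longrightarrow> (\<Sum>j<Suc n. A $$ (i, j) * v j) = e * v i"
    by (rule complex_eigenvector[OF A(1)], rule that)
  obtain U where U: "unitary (Suc n) U" "\<And>i. i < Suc n \<Longrightarrow> U $$ (i, 0) = v i"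
    by (rule unitary_first_column[OF v(1-3)], rule that)
  note Ud = unitaryD[OF U(1)]
  define B where "B = adj U * (A * U)"
  have B [simp]: "dim_row B = Suc n" "dim_col B = Suc n" using A Ud by (auto simp: B_def)
  have adjB: "adj B = B" using A Ud by (simp add: B_def adj_mult mat_assoc)
  have B0: "B $$ (i, 0) = (if i = 0 then e else 0)" if "i < Suc n" for i
  proof -
    have "(A * U) $$ (k, 0) = e * U $$ (k, 0)" if "k < Suc n" for k
    proof -
      have "(A * U) $$ (k, 0) = (\<Sum>j<Suc n. A $$ (k, j) * U $$ (j, 0))"
        using that A Ud by (simp add: mult_mat_index del: index_mult_mat(1) sum.lessThan_Suc)
      also have "\<dots> = (\<Sum>j<Suc n. A $$ (k, j) * v j)" using U(2) by (intro sum.cong) auto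
      finally show ?thesis using v(4) U(2) that by simp
    qed
    then have "B $$ (i, 0) = (\<Sum>k<Suc n. adj U $$ (i, k) * (e * U $$ (k, 0)))"
      using that A Ud by (simp add: B_def mult_mat_index del: index_mult_mat(1) sum.lessThan_Suc)
    also have "\<dots> = e * (\<Sum>k<Suc n. adj U $$ (i, k) * U $$ (k, 0))"
      unfolding sum_distrib_left by (intro sum.cong) auto
    also have "(\<Sum>k<Suc n. adj U $$ (i, k) * U $$ (k, 0)) = (adj U * U) $$ (i, 0)"
      using that Ud(1-3) by (simp add: mult_mat_index del: index_mult_mat(1) sum.lessThan_Suc)
    finally show ?thesis using Ud that by simp
  qed
  have B0': "B $$ (0, j) = (if j = 0 then cnj e else 0)" if "j < Suc n" for j
  proof -
    have "B $$ (0, j) = adj B $$ (0, j)" using adjB by simp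
    also have "\<dots> = cnj (B $$ (j, 0))" using that by simp
    finally show ?thesis using B0[OF that] by simp
  qed
  have e: "e \<in> \<real>" using B0[of 0] B0'[of 0] by (simp add: Reals_cnj_iff)
  define C where "C = mat n n (\<lambda>(i, j). B $$ (Suc i, Suc j))"
  have BC: "B = bordered e C"
    by (rule eq_matI) (use B0 B0' in \<open>auto simp: bordered_def C_def\<close>, use e in \<open>simp add: Reals_cnj_iff\<close>)
  have "adj C = C"
  proof (rule eq_matI)
    fix i j assume "i < dim_row C" "j < dim_col C"
    then have ij: "i < n" "j < n" by (auto simp: C_def)
    have "B $$ (Suc i, Suc j) = adj B $$ (Suc i, Suc j)" using adjB by simp
    also have "\<dots> = cnj (B $$ (Suc j, Suc i))" using ij by simp
    finally show "adj C $$ (i, j) = C $$ (i, j)" using ij by (simp add: C_def)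
  qed (auto simp: C_def)
  then obtain V d where V: "unitary n V" "C = V * mat_diag n (\<lambda>i. complex_of_real (d i)) * adj V"
    using Suc.IH[of C] by (auto simp: C_def)
  note Vd = unitaryD[OF V(1)]
  define W where "W = U * bordered 1 V"
  define d' where "d' i = (case i of 0 \<Rightarrow> Re e | Suc i \<Rightarrow> d i)" for i
  have uV: "unitary (Suc n) (bordered 1 V)"
    unfolding unitary_def
    using Vd by (auto simp: adj_bordered bordered_mult bordered_one intro: carrier_matI)
  have "A = U * (B * adj U)"
    using A Ud by (simp add: B_def mat_assoc unitary_cancel[OF U(1)] mat_one_right)
  also have "B = bordered 1 V * mat_diag (Suc n) (\<lambda>i. complex_of_real (d' i)) * adj (bordered 1 V)"
  proof -
    have "mat_diag (Suc n) (\<lambda>i. complex_of_real (d' i)) =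
        bordered e (mat_diag n (\<lambda>i. complex_of_real (d i)))"
      using e unfolding bordered_diag[symmetric] by (simp add: d'_def)
    then show ?thesis
      unfolding BC V(2) using Vd by (simp add: adj_bordered bordered_mult mat_diag_def)
  qed
  finally have "A = W * mat_diag (Suc n) (\<lambda>i. complex_of_real (d' i)) * adj W"
    using Ud Vd unfolding W_def by (simp add: mat_assoc adj_mult mat_diag_def)
  moreover have "unitary (Suc n) W" unfolding W_def by (intro unitary_mult U uV)
  ultimately show ?case by (intro Suc.prems(1))
qed


subsection \<open>Limits of matrices\<close>

text \<open>Convergence is entrywise and carries the size with it, since matrices of all sizes share
  one type.\<close>

definition mat_lim :: "nat \<Rightarrow> nat \<Rightarrow> (nat \<Rightarrow> complex mat) \<Rightarrow> complex mat \<Rightarrow> bool" where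
  "mat_lim m k F A \<longleftrightarrow> A \<in> carrier_mat m k \<and> (\<forall>t. F t \<in> carrier_mat m k) \<and>
     (\<forall>i<m. \<forall>j<k. (\<lambda>t. F t $$ (i, j)) \<longlonglongrightarrow> A $$ (i, j))"

lemma mat_limD:
  assumes "mat_lim m k F A"
  shows "A \<in> carrier_mat m k" "F t \<in> carrier_mat m k" "dim_row A = m" "dim_col A = k"
    "dim_row (F t) = m" "dim_col (F t) = k"
    "i < m \<Longrightarrow> j < k \<Longrightarrow> (\<lambda>t. F t $$ (i, j)) \<longlonglongrightarrow> A $$ (i, j)"
  using assms unfolding mat_lim_def by auto

lemma mat_limI:
  assumes "A \<in> carrier_mat m k" "\<And>t. F t \<in> carrier_mat m k"
    "\<And>i j. i < m \<Longrightarrow> j < k \<Longrightarrow> (\<lambda>t. F t $$ (i, j)) \<longlonglongrightarrow> A $$ (i, j)"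
  shows "mat_lim m k F A"
  using assms unfolding mat_lim_def by auto

lemma mat_lim_const: "A \<in> carrier_mat m k \<Longrightarrow> mat_lim m k (\<lambda>_. A) A"
  by (rule mat_limI) auto

lemma mat_lim_unique:
  assumes "mat_lim m k F A" "mat_lim m k F B"
  shows "A = B"
proof (rule eq_matI)
  note A = mat_limD[OF assms(1)] and B = mat_limD[OF assms(2)]
  fix i j assume "i < dim_row B" "j < dim_col B"
  then show "A $$ (i, j) = B $$ (i, j)"
    using LIMSEQ_unique[OF A(7) B(7)] B by simp
qed (use mat_limD[OF assms(1)] mat_limD[OF assms(2)] in auto)

lemma mat_lim_add:
  assumes "mat_lim m k F A" "mat_lim m k G B"
  shows "mat_lim m k (\<lambda>t. F t + G t) (A + B)"
  using mat_limD[OF assms(1)] mat_limD[OF assms(2)]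
  by (intro mat_limI carrier_matI) (auto intro!: tendsto_intros)

lemma mat_lim_diff:
  assumes "mat_lim m k F A" "mat_lim m k G B"
  shows "mat_lim m k (\<lambda>t. F t - G t) (A - B)"
  using mat_limD[OF assms(1)] mat_limD[OF assms(2)]
  by (intro mat_limI carrier_matI) (auto intro!: tendsto_intros)

lemma mat_lim_smult:
  assumes "c \<longlonglongrightarrow> d" "mat_lim m k F A"
  shows "mat_lim m k (\<lambda>t. c t \<cdot>\<^sub>m F t) (d \<cdot>\<^sub>m A)"
  using mat_limD[OF assms(2)] assms(1)
  by (intro mat_limI carrier_matI) (auto intro!: tendsto_intros)

lemma mat_lim_mult:
  assumes "mat_lim m k F A" "mat_lim k l G B"
  shows "mat_lim m l (\<lambda>t. F t * G t) (A * B)"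
proof (rule mat_limI)
  note F = mat_limD[OF assms(1)] and G = mat_limD[OF assms(2)]
  fix i j assume "i < m" "j < l"
  then show "(\<lambda>t. (F t * G t) $$ (i, j)) \<longlonglongrightarrow> (A * B) $$ (i, j)"
    using F G by (auto simp: mult_mat_index simp del: index_mult_mat(1) intro!: tendsto_sum tendsto_mult)
qed (use mat_limD[OF assms(1)] mat_limD[OF assms(2)] in auto)

lemma det_tendsto:
  assumes "mat_lim n n F A"
  shows "(\<lambda>t. det (F t)) \<longlonglongrightarrow> det A"
  unfolding det_def'[OF mat_limD(1)[OF assms]] det_def'[OF mat_limD(2)[OF assms]]
  by (intro tendsto_sum tendsto_mult tendsto_prod tendsto_const mat_limD(7)[OF assms])
     (auto dest: permutes_in_image)

lemma sqnorm_tendsto: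
  assumes "mat_lim m k F A"
  shows "(\<lambda>t. sqnorm (F t)) \<longlonglongrightarrow> sqnorm A"
  unfolding sqnorm_def mat_limD[OF assms]
  by (intro tendsto_sum tendsto_power tendsto_norm mat_limD(7)[OF assms]) auto

text \<open>Cramer's formula: the inverse is rational in the entries, so its continuity reduces to
  that of determinants.\<close>

definition cinv :: "complex mat \<Rightarrow> complex mat" where "cinv A = (1 / det A) \<cdot>\<^sub>m adj_mat A"

lemma cinv:
  assumes "A \<in> carrier_mat n n"
  shows "cinv A \<in> carrier_mat n n" "det A \<noteq> 0 \<Longrightarrow> A * cinv A = 1\<^sub>m n"
    "det A \<noteq> 0 \<Longrightarrow> cinv A * A = 1\<^sub>m n"
proof -
  note adj_mat = adj_mat[OF assms] carrier_matD[OF adj_mat(1)[OF assms]]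
  show "cinv A \<in> carrier_mat n n" unfolding cinv_def using adj_mat by simp
  show "A * cinv A = 1\<^sub>m n" "cinv A * A = 1\<^sub>m n" if "det A \<noteq> 0"
    using assms adj_mat that by (auto simp: cinv_def mat_distrib)
qed

lemma mat_lim_cinv:
  assumes "mat_lim n n F A" "det A \<noteq> 0"
  shows "mat_lim n n (\<lambda>t. cinv (F t)) (cinv A)"
  unfolding cinv_def
proof (intro mat_lim_smult tendsto_divide tendsto_const det_tendsto assms mat_limI)
  note F = mat_limD[OF assms(1)]
  fix i j assume ij: "i < n" "j < n"
  have "mat_lim (n - 1) (n - 1) (\<lambda>t. mat_delete (F t) j i) (mat_delete A j i)"
    by (rule mat_limI) (use F ij in \<open>auto simp: mat_delete_def\<close>)
  then show "(\<lambda>t. adj_mat (F t) $$ (i, j)) \<longlonglongrightarrow> adj_mat A $$ (i, j)"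
    using F ij by (auto simp: adj_mat_def cofactor_def intro!: tendsto_intros det_tendsto)
qed (use mat_limD[OF assms(1)] adj_mat in blast)+


subsection \<open>Characteristic polynomials as functions\<close>

text \<open>Working with values turns a shift by a scalar matrix into a substitution, and lets an
  identity known away from one point be completed by continuity.\<close>

definition charfun :: "complex mat \<Rightarrow> complex \<Rightarrow> complex" where
  "charfun A x = det (x \<cdot>\<^sub>m 1\<^sub>m (dim_row A) - A)"

lemma charfun_char_poly: "A \<in> carrier_mat n n \<Longrightarrow> poly (char_poly A) x = charfun A x"
  unfolding charfun_def char_poly_def
  by (rule poly_det_cong[of _ n]) (auto simp: char_poly_matrix_def)

lemma charfun_continuous: "A \<in> carrier_mat n n \<Longrightarrow> isCont (charfun A) x"
  using isCont_cong[of "charfun A" "poly (char_poly A)"] by (simp add: charfun_char_poly)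

lemma charfun_shift:
  assumes "A \<in> carrier_mat n n"
  shows "charfun (A + c \<cdot>\<^sub>m 1\<^sub>m n) x = charfun A (x - c)"
proof -
  have "x \<cdot>\<^sub>m 1\<^sub>m n - (A + c \<cdot>\<^sub>m 1\<^sub>m n) = (x - c) \<cdot>\<^sub>m 1\<^sub>m n - A"
    by (rule eq_matI) (use assms in \<open>auto simp: algebra_simps\<close>)
  then show ?thesis using assms by (simp add: charfun_def)
qed

lemma charfun_similar:
  assumes "A \<in> carrier_mat n n" "P \<in> carrier_mat n n" "Q \<in> carrier_mat n n" "P * Q = 1\<^sub>m n"
  shows "charfun (P * A * Q) x = charfun A x"
proof -
  have "similar_mat (P * A * Q) A"
    unfolding similar_mat_def
    by (intro exI, rule similar_mat_witI[OF assms(4) mat_mult_left_right_inverse[OF assms(2-4)] refl])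
       (use assms in auto)
  then have "char_poly (P * A * Q) = char_poly A" by (rule char_poly_similar)
  then show ?thesis
    using assms charfun_char_poly[of "P * A * Q" n x] charfun_char_poly[of A n x] by simp
qed

text \<open>Both sides are determinants of Schur complements of the same block matrix.\<close>

lemma det_one_minus_mult_commute:
  fixes A B :: "complex mat"
  assumes "A \<in> carrier_mat m k" "B \<in> carrier_mat k m"
  shows "det (1\<^sub>m m - A * B) = det (1\<^sub>m k - B * A)"
proof -
  define L where "L = four_block_mat (1\<^sub>m m) (0\<^sub>m m k) B (1\<^sub>m k)"
  define M where "M = four_block_mat (1\<^sub>m m) A (0\<^sub>m k m) (1\<^sub>m k - B * A)"
  define L' where "L' = four_block_mat (1\<^sub>m m) A (0\<^sub>m k m) (1\<^sub>m k)"
  define M' where "M' = four_block_mat (1\<^sub>m m - A * B) (0\<^sub>m m k) B (1\<^sub>m k)"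
  note d = carrier_matD[OF assms(1)] carrier_matD[OF assms(2)]
  have 1: "L * M = four_block_mat (1\<^sub>m m) A B (1\<^sub>m k)"
    unfolding L_def M_def
    by (subst mult_four_block_mat[of _ m m _ k _ k _ _ m _ k])
       (use assms d in \<open>auto intro!: cong_four_block_mat eq_matI intro: carrier_matI simp: mat_distrib simp del: index_mult_mat(1)\<close>)
  have 2: "L' * M' = four_block_mat (1\<^sub>m m) A B (1\<^sub>m k)"
    unfolding L'_def M'_def
    by (subst mult_four_block_mat[of _ m m _ k _ k _ _ m _ k])
       (use assms d in \<open>auto intro!: cong_four_block_mat eq_matI intro: carrier_matI simp: mat_distrib simp del: index_mult_mat(1)\<close>)
  have c: "1\<^sub>m k - B * A \<in> carrier_mat k k" "1\<^sub>m m - A * B \<in> carrier_mat m m"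
    using d by (auto intro: carrier_matI)
  have "det L = 1" "det L' = 1" "det M = det (1\<^sub>m k - B * A)" "det M' = det (1\<^sub>m m - A * B)"
    unfolding L_def M_def L'_def M'_def
    using assms c by (simp_all add: det_four_block_mat_upper_right_zero[of _ m _ k]
        det_four_block_mat_lower_left_zero[of _ m _ k])
  moreover have "det (L * M) = det L * det M" "det (L' * M') = det L' * det M'"
    by (rule det_mult[of _ "m + k"]; use assms c in \<open>auto simp: L_def M_def L'_def M'_def\<close>)+
  ultimately show ?thesis using 1 2 by simp
qed

text \<open>For \<open>x \<noteq> 0\<close> this is the preceding determinant identity for
  \<open>A / x\<close> and \<open>B\<close>; the extra factor \<open>x\<close> is the difference
  between the sizes k + 1 and k. The value at 0 follows because both sides are continuous.\<close>

lemma charfun_mult_commute: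
  fixes A B :: "complex mat"
  assumes AB: "A \<in> carrier_mat (Suc k) k" "B \<in> carrier_mat k (Suc k)"
  shows "charfun (A * B) x = x * charfun (B * A) x"
proof -
  have *: "charfun (A * B) x = x * charfun (B * A) x" if "x \<noteq> 0" for x
  proof -
    have "charfun (A * B) x = det (x \<cdot>\<^sub>m (1\<^sub>m (Suc k) - ((1 / x) \<cdot>\<^sub>m A) * B))"
      unfolding charfun_def using that AB
      by (intro arg_cong[of _ _ det] eq_matI) (auto simp: mat_distrib algebra_simps simp del: index_mult_mat(1))
    also have "\<dots> = x ^ Suc k * det (1\<^sub>m (Suc k) - ((1 / x) \<cdot>\<^sub>m A) * B)"
      using AB by (simp add: det_smult)
    also have "det (1\<^sub>m (Suc k) - ((1 / x) \<cdot>\<^sub>m A) * B) = det (1\<^sub>m k - B * ((1 / x) \<cdot>\<^sub>m A))"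
      by (rule det_one_minus_mult_commute) (use AB in auto)
    also have "x ^ Suc k * \<dots> = x * det (x \<cdot>\<^sub>m (1\<^sub>m k - B * ((1 / x) \<cdot>\<^sub>m A)))"
      using AB by (simp add: det_smult)
    also have "\<dots> = x * charfun (B * A) x"
      unfolding charfun_def using that AB
      by (intro arg_cong[of _ _ "\<lambda>M. x * det M"] eq_matI)
         (auto simp: mat_distrib algebra_simps simp del: index_mult_mat(1))
    finally show ?thesis .
  qed
  show ?thesis
  proof (cases "x = 0")
    case True
    have "isCont (charfun (A * B)) 0" "isCont (\<lambda>x. x * charfun (B * A) x) 0"
      by (rule charfun_continuous[of _ "Suc k"], use AB in simp)
        (intro continuous_intros charfun_continuous[of _ k], use AB in simp)
    then have l: "charfun (A * B) \<midarrow>0\<rightarrow> charfun (A * B) 0"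
        "(\<lambda>x. x * charfun (B * A) x) \<midarrow>0\<rightarrow> 0 * charfun (B * A) 0"
      unfolding isCont_def by auto
    have "eventually (\<lambda>x. x * charfun (B * A) x = charfun (A * B) x) (at 0)"
      using * by (auto simp: eventually_at_filter)
    from LIM_unique[OF l(1) Lim_transform_eventually[OF l(2) this]]
    have "charfun (A * B) 0 = 0 * charfun (B * A) 0" .
    then show ?thesis using True by simp
  qed (rule *)
qed

lemma charfun_upper_triangular:
  assumes "A \<in> carrier_mat n n" "upper_triangular A"
  shows "charfun A x = (\<Prod>i<n. x - A $$ (i, i))"
proof -
  have "charfun A x = det (x \<cdot>\<^sub>m 1\<^sub>m n - A)" using assms by (simp add: charfun_def)
  also have "\<dots> = prod_list (diag_mat (x \<cdot>\<^sub>m 1\<^sub>m n - A))"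
    by (rule det_upper_triangular[of _ n]) (use assms in \<open>auto simp: upper_triangular_def intro: carrier_matI\<close>)
  also have "\<dots> = (\<Prod>i<n. x - A $$ (i, i))"
    using assms by (auto simp: prod_list_diag_prod atLeast0LessThan intro!: prod.cong)
  finally show ?thesis .
qed


section \<open>Lifting perturbations of a product\<close>

lemma det_0_imp_column_kernel:
  fixes A :: "complex mat"
  assumes A: "A \<in> carrier_mat n n" and "det A = 0"
  obtains v where "\<exists>i<n. v i \<noteq> 0" "\<And>i. i < n \<Longrightarrow> (\<Sum>j<n. A $$ (i, j) * v j) = 0"
proof -
  have "det A\<^sup>T = 0" using assms by (simp add: det_transpose)
  then obtain v where v: "\<exists>i<n. v i \<noteq> 0" "\<And>j. j < n \<Longrightarrow> (\<Sum>i<n. v i * A\<^sup>T $$ (i, j)) = 0"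
    using det_0_imp_row_kernel[of "A\<^sup>T" n] A by auto
  show thesis
    by (rule that[OF v(1)]) (use v(2) A in \<open>auto simp: mult.commute\<close>)
qed

text \<open>The last hypothesis says that the columns in \<open>I\<close> are independent. A missing
  column is replaced by the conjugate of a left null vector \<open>u\<close> of the matrix with that
  column erased: it is orthogonal to all other columns and pairs with \<open>u\<close> to
  \<open>|u|^2\<close>, so independence persists.\<close>

lemma invertible_with_given_columns:
  fixes A :: "complex mat"
  assumes "A \<in> carrier_mat n n" "I \<subseteq> {..<n}"
    and "\<And>x. (\<And>i. i < n \<Longrightarrow> i \<notin> I \<Longrightarrow> x i = 0) \<Longrightarrow>
      (\<And>r. r < n \<Longrightarrow> (\<Sum>i<n. A $$ (r, i) * x i) = 0) \<Longrightarrow> (\<forall>i<n. x i = 0)"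
  shows "\<exists>P\<in>carrier_mat n n. det P \<noteq> 0 \<and> (\<forall>r<n. \<forall>i\<in>I. P $$ (r, i) = A $$ (r, i))"
  using assms
proof (induction "card ({..<n} - I)" arbitrary: A I)
  case 0
  then have I: "I = {..<n}" by auto
  have "det A \<noteq> 0"
  proof
    assume "det A = 0"
    from det_0_imp_column_kernel[OF 0(2) this] obtain v where
      v: "\<exists>i<n. v i \<noteq> 0" "\<And>i. i < n \<Longrightarrow> (\<Sum>j<n. A $$ (i, j) * v j) = 0" by blast
    have "\<forall>i<n. v i = 0" by (rule 0(4)) (use I v in auto)
    then show False using v(1) by blast
  qed
  then show ?case using 0(2) by auto
next
  case (Suc c)
  then have "{..<n} - I \<noteq> {}" by (metis card.empty nat.distinct(1))
  then obtain k where k: "k < n" "k \<notin> I" by auto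
  define A0 where "A0 = mat n n (\<lambda>(r, i). if i = k then 0 else A $$ (r, i))"
  have A0: "A0 \<in> carrier_mat n n" by (simp add: A0_def)
  have "det A0 = 0"
  proof -
    have "A0 *\<^sub>v unit_vec n k = 0\<^sub>v n"
      using k by (intro eq_vecI) (auto simp: A0_def)
    moreover have "unit_vec n k \<noteq> (0\<^sub>v n :: complex vec)" using k by simp
    ultimately show ?thesis
      unfolding det_0_iff_vec_prod_zero_field[OF A0] by (metis unit_vec_carrier)
  qed
  from det_0_imp_row_kernel[OF A0 this] obtain u where
    u: "\<exists>i<n. u i \<noteq> 0" "\<And>j. j < n \<Longrightarrow> (\<Sum>i<n. u i * A0 $$ (i, j)) = 0" by blast
  define A1 where "A1 = mat n n (\<lambda>(r, i). if i = k then cnj (u r) else A $$ (r, i))"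
  have uu: "(\<Sum>r<n. u r * cnj (u r)) \<noteq> 0"
  proof
    assume "(\<Sum>r<n. u r * cnj (u r)) = 0"
    then have "complex_of_real (\<Sum>r<n. (cmod (u r))\<^sup>2) = 0"
      by (simp add: complex_norm_square del: of_real_power)
    then have "(\<Sum>r<n. (cmod (u r))\<^sup>2) = 0" by (simp only: of_real_eq_0_iff)
    then show False using u(1) by (auto simp: sum_nonneg_eq_0_iff)
  qed
  have "\<exists>P\<in>carrier_mat n n. det P \<noteq> 0 \<and> (\<forall>r<n. \<forall>i\<in>insert k I. P $$ (r, i) = A1 $$ (r, i))"
  proof (rule Suc.hyps(1))
    have "{..<n} - insert k I = ({..<n} - I) - {k}" by auto
    then show "c = card ({..<n} - insert k I)" using k Suc.hyps(2) by simp
    show "A1 \<in> carrier_mat n n" by (simp add: A1_def)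
    show "insert k I \<subseteq> {..<n}" using k Suc.prems by auto
    fix x assume x: "\<And>i. i < n \<Longrightarrow> i \<notin> insert k I \<Longrightarrow> x i = 0"
      "\<And>r. r < n \<Longrightarrow> (\<Sum>i<n. A1 $$ (r, i) * x i) = 0"
    have uA: "(\<Sum>r<n. u r * A1 $$ (r, i)) = 0" if "i < n" "i \<noteq> k" for i
      using u(2)[OF that(1)] that by (simp add: A0_def A1_def)
    have "0 = (\<Sum>r<n. u r * (\<Sum>i<n. A1 $$ (r, i) * x i))" using x(2) by simp
    also have "\<dots> = (\<Sum>i<n. (\<Sum>r<n. u r * A1 $$ (r, i)) * x i)"
      unfolding sum_distrib_left sum_distrib_right by (subst sum.swap) (simp add: mult.assoc)
    also have "\<dots> = (\<Sum>i<n. if i = k then (\<Sum>r<n. u r * A1 $$ (r, k)) * x k else 0)"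
      by (rule sum.cong) (auto simp: uA)
    also have "\<dots> = (\<Sum>r<n. u r * cnj (u r)) * x k"
      using k by (simp add: A1_def)
    finally have xk: "x k = 0" using uu by simp
    show "\<forall>i<n. x i = 0"
    proof (rule Suc.prems(3))
      show "x i = 0" if "i < n" "i \<notin> I" for i using that x(1) xk by auto
      show "(\<Sum>i<n. A $$ (r, i) * x i) = 0" if "r < n" for r
      proof -
        have "(\<Sum>i<n. A $$ (r, i) * x i) = (\<Sum>i<n. A1 $$ (r, i) * x i)"
          using that xk by (intro sum.cong) (auto simp: A1_def)
        then show ?thesis using x(2)[OF that] by simp
      qed
    qed
  qed
  moreover have "A1 $$ (r, i) = A $$ (r, i)" if "r < n" "i \<in> I" for r i
    using that k Suc.prems(2) by (auto simp: A1_def)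
  ultimately show ?case by (metis insertI2)
qed

section \<open>Factoring singular perturbations of a coordinate projection\<close>

definition coord_proj :: "nat \<Rightarrow> nat set \<Rightarrow> complex mat" where
  "coord_proj n I = mat_diag n (\<lambda>i. if i \<in> I then 1 else 0)"

lemma dim_coord_proj [simp]: "dim_row (coord_proj n I) = n" "dim_col (coord_proj n I) = n"
  by (auto simp: coord_proj_def mat_diag_def)

lemma coord_proj_carrier [simp]: "coord_proj n I \<in> carrier_mat n n"
  by (auto intro: carrier_matI)

lemma coord_proj_idem: "coord_proj n I * coord_proj n I = coord_proj n I"
  unfolding coord_proj_def by (simp add: mat_diag_mult_right[of _ n]) (rule eq_matI, auto simp: mat_diag_def)

lemma coord_proj_mult_index:
  "i < n \<Longrightarrow> j < dim_col A \<Longrightarrow> dim_row A = n \<Longrightarrow>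
    (coord_proj n I * A) $$ (i, j) = (if i \<in> I then A $$ (i, j) else 0)"
  unfolding coord_proj_def by (subst mat_diag_mult_left[of _ n "dim_col A"]) auto

lemma mult_coord_proj_index:
  "i < dim_row A \<Longrightarrow> j < n \<Longrightarrow> dim_col A = n \<Longrightarrow>
    (A * coord_proj n I) $$ (i, j) = (if j \<in> I then A $$ (i, j) else 0)"
  unfolding coord_proj_def by (subst mat_diag_mult_right[of _ "dim_row A" n]) auto

lemma adj_coord_proj [simp]: "adj (coord_proj n I) = coord_proj n I"
  by (rule eq_matI) (auto simp: coord_proj_def mat_diag_def)

text \<open>A nonzero left null vector with largest entry at \<open>i0\<close> expresses row \<open>i0\<close> of \<open>N\<close> through the
  other rows with coefficients of absolute value at most \<open>1\<close>; the inner index \<open>i0\<close> is then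
  exchanged with the last index \<open>k\<close>.\<close>

lemma small_factorisation:
  fixes N :: "complex mat"
  assumes N: "N \<in> carrier_mat (Suc k) (Suc k)" and I: "I \<subseteq> {..<k}"
    and NI: "\<And>i j. i < Suc k \<Longrightarrow> j < Suc k \<Longrightarrow> i \<in> I \<Longrightarrow> N $$ (i, j) = 0"
    and u: "\<exists>i<Suc k. u i \<noteq> 0" "\<And>i. i \<in> I \<Longrightarrow> u i = 0"
      "\<And>j. j < Suc k \<Longrightarrow> (\<Sum>i<Suc k. u i * N $$ (i, j)) = 0"
  shows "\<exists>A B. A \<in> carrier_mat (Suc k) (Suc k) \<and> B \<in> carrier_mat (Suc k) (Suc k) \<and> N = A * B \<and>
    (\<forall>i<Suc k. \<forall>j<Suc k. cmod (A $$ (i, j)) \<le> sqrt (sqrt (sqnorm N)) \<and>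
      cmod (B $$ (i, j)) \<le> sqrt (sqrt (sqnorm N)) \<and> (j \<in> insert k I \<longrightarrow> A $$ (i, j) = 0) \<and>
      (i \<in> insert k I \<longrightarrow> B $$ (i, j) = 0))"
proof -
  have "Max ((\<lambda>i. cmod (u i)) ` {..<Suc k}) \<in> (\<lambda>i. cmod (u i)) ` {..<Suc k}"
    by (rule Max_in) auto
  then obtain i0 where i0: "i0 < Suc k" "\<And>i. i < Suc k \<Longrightarrow> cmod (u i) \<le> cmod (u i0)"
    using Max_ge[of "(\<lambda>i. cmod (u i)) ` {..<Suc k}"] by (auto simp del: lessThan_Suc Max_ge)
  have ui0: "u i0 \<noteq> 0" using u(1) i0(2) by force
  then have i0I: "i0 \<notin> I" using u(2) by auto
  \<comment> \<open>The square root of the Frobenius norm of \<open>N\<close>: one factor is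
    multiplied by it and the other divided by it, so that both are of this order and tend to 0
    together with \<open>N\<close>.\<close>
  define q where "q = sqrt (sqrt (sqnorm N))"
  define \<tau> where "\<tau> j = (if j = i0 then k else j)" for j
  define E where "E r l = (if r = l then 1 else if r = i0 then - u l / u i0 else 0)" for r l
  define J where "J = {..<k} - I"
  define A where "A = mat (Suc k) (Suc k) (\<lambda>(r, j). if j \<in> J then of_real q * E r (\<tau> j) else 0)"
  define B where "B = mat (Suc k) (Suc k) (\<lambda>(j, c). if j \<in> J then N $$ (\<tau> j, c) / of_real q else 0)"
  have J: "j \<in> J \<Longrightarrow> j < Suc k" "k \<notin> J" for j by (auto simp: J_def)
  have \<tau>: "bij_betw \<tau> J ({..<Suc k} - I - {i0})"
    unfolding bij_betw_def
  proof
    show "inj_on \<tau> J" by (auto simp: inj_on_def \<tau>_def J_def split: if_splits)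
    show "\<tau> ` J = {..<Suc k} - I - {i0}"
    proof (intro equalityI subsetI)
      fix x assume "x \<in> \<tau> ` J"
      then show "x \<in> {..<Suc k} - I - {i0}" using I i0 by (auto simp: \<tau>_def J_def split: if_splits)
    next
      fix x assume x: "x \<in> {..<Suc k} - I - {i0}"
      show "x \<in> \<tau> ` J"
      proof (cases "x = k")
        case True
        then have "i0 \<in> J" "\<tau> i0 = x" using x i0 i0I by (auto simp: J_def \<tau>_def)
        then show ?thesis by blast
      next
        case False
        then have "x \<in> J" "\<tau> x = x" using x by (auto simp: J_def \<tau>_def)
        then show ?thesis by force
      qed
    qed
  qed
  have Nle: "cmod (N $$ (i, j)) \<le> q * q" if "i < Suc k" "j < Suc k" for i j
  proof -
    have "(cmod (N $$ (i, j)))\<^sup>2 \<le> sqnorm N" by (rule sqnorm_entry_le) (use N that in auto)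
    then have "cmod (N $$ (i, j)) \<le> sqrt (sqnorm N)" by (rule real_le_rsqrt)
    also have "\<dots> = q * q" by (simp add: q_def)
    finally show ?thesis .
  qed
  have q0: "q \<ge> 0" by (simp add: q_def)
  have E1: "cmod (E r l) \<le> 1" if "l < Suc k" for r l
    using i0(2)[OF that] ui0 by (auto simp: E_def norm_divide divide_simps)
  have NAB: "N = A * B"
  proof (rule eq_matI)
    fix r c assume "r < dim_row (A * B)" "c < dim_col (A * B)"
    then have rc: "r < Suc k" "c < Suc k" by (auto simp: A_def B_def)
    \<comment> \<open>For \<open>q = 0\<close> the quotient is 0 by convention, which is the right
      value because \<open>N\<close> then vanishes.\<close>
    have qq: "of_real q * e * (N $$ (\<tau> j, c) / of_real q) = e * N $$ (\<tau> j, c)" if "j \<in> J" for e j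
    proof (cases "q = 0")
      case True
      have "\<tau> j < Suc k" using bij_betwE[OF \<tau>] that by auto
      then have "N $$ (\<tau> j, c) = 0" using Nle[of "\<tau> j" c] rc True by simp
      then show ?thesis by simp
    qed simp
    have "(A * B) $$ (r, c) = (\<Sum>j<Suc k. A $$ (r, j) * B $$ (j, c))"
      using rc by (simp add: A_def B_def mult_mat_index del: index_mult_mat(1) sum.lessThan_Suc)
    also have "\<dots> = (\<Sum>j<Suc k. if j \<in> J then E r (\<tau> j) * N $$ (\<tau> j, c) else 0)"
      using rc qq by (intro sum.cong) (auto simp: A_def B_def)
    also have "\<dots> = (\<Sum>j\<in>J. E r (\<tau> j) * N $$ (\<tau> j, c))"
      using J by (subst sum.inter_restrict[symmetric]) (auto intro!: sum.cong)
    also have "\<dots> = (\<Sum>l\<in>{..<Suc k} - I - {i0}. E r l * N $$ (l, c))"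
      by (rule sum.reindex_bij_betw[OF \<tau>])
    also have "\<dots> = N $$ (r, c)"
    proof (cases "r = i0")
      case True
      have "(\<Sum>i<Suc k. u i * N $$ (i, c)) = (\<Sum>i\<in>{..<Suc k} - I. u i * N $$ (i, c))"
        by (rule sum.mono_neutral_right) (use u(2) in auto)
      also have "\<dots> = u i0 * N $$ (i0, c) + (\<Sum>i\<in>{..<Suc k} - I - {i0}. u i * N $$ (i, c))"
        using i0 i0I by (intro sum.remove) auto
      finally have *: "u i0 * N $$ (i0, c) = - (\<Sum>i\<in>{..<Suc k} - I - {i0}. u i * N $$ (i, c))"
        using u(3)[OF rc(2)] by (simp add: eq_neg_iff_add_eq_0)
      have "(\<Sum>l\<in>{..<Suc k} - I - {i0}. E r l * N $$ (l, c)) =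
          (\<Sum>l\<in>{..<Suc k} - I - {i0}. - (u l * N $$ (l, c)) / u i0)"
        by (rule sum.cong) (auto simp: E_def True)
      also have "\<dots> = N $$ (i0, c)"
        unfolding sum_divide_distrib[symmetric] sum_negf *[symmetric] using ui0 by simp
      finally show ?thesis using True by simp
    next
      case False
      have "(\<Sum>l\<in>{..<Suc k} - I - {i0}. E r l * N $$ (l, c)) =
          (\<Sum>l\<in>{..<Suc k} - I - {i0}. if r = l then N $$ (r, c) else 0)"
        by (rule sum.cong) (auto simp: E_def False)
      also have "\<dots> = N $$ (r, c)" using False rc NI[of r c] by (subst sum.delta') auto
      finally show ?thesis .
    qed
    finally show "N $$ (r, c) = (A * B) $$ (r, c)" by simp
  qed (use N in \<open>auto simp: A_def B_def\<close>)
  have "cmod (A $$ (i, j)) \<le> q \<and> cmod (B $$ (i, j)) \<le> q \<and> (j \<in> insert k I \<longrightarrow> A $$ (i, j) = 0) \<and>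
      (i \<in> insert k I \<longrightarrow> B $$ (i, j) = 0)" if ij: "i < Suc k" "j < Suc k" for i j
  proof (intro conjI impI)
    have t: "\<tau> l < Suc k" if "l \<in> J" for l using bij_betwE[OF \<tau>] that by auto
    show "cmod (A $$ (i, j)) \<le> q"
      using ij q0 E1[OF t, of j i] mult_left_mono[OF E1[OF t, of j i] q0] by (auto simp: A_def norm_mult)
    show "cmod (B $$ (i, j)) \<le> q"
    proof (cases "i \<in> J \<and> q > 0")
      case True
      then show ?thesis using ij Nle[OF t ij(2), of i]
        by (auto simp: B_def norm_divide divide_simps)
    qed (use ij q0 in \<open>auto simp: B_def\<close>)
    show "A $$ (i, j) = 0" if "j \<in> insert k I" using that ij by (auto simp: A_def J_def)
    show "B $$ (i, j) = 0" if "i \<in> insert k I" using that ij by (auto simp: B_def J_def)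
  qed
  then show ?thesis using NAB unfolding q_def
    by (intro exI[of _ A] exI[of _ B]) (auto simp: A_def B_def)
qed


lemma row_kernel_matrix:
  fixes A :: "complex mat"
  assumes A: "A \<in> carrier_mat n n" and "det A = 0"
  obtains y where "y \<in> carrier_mat 1 n" "y \<noteq> 0\<^sub>m 1 n" "y * A = 0\<^sub>m 1 n"
proof -
  obtain v where v: "\<exists>i<n. v i \<noteq> 0" "\<And>j. j < n \<Longrightarrow> (\<Sum>i<n. v i * A $$ (i, j)) = 0"
    using det_0_imp_row_kernel[OF assms] by blast
  define y where "y = mat 1 n (\<lambda>(i, j). v j)"
  have "y \<noteq> 0\<^sub>m 1 n"
  proof
    assume "y = 0\<^sub>m 1 n"
    then have "y $$ (0, i) = 0" if "i < n" for i using that by simp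
    then show False using v(1) by (auto simp: y_def)
  qed
  moreover have "y * A = 0\<^sub>m 1 n"
    by (rule eq_matI) (use A v(2) in \<open>auto simp: y_def mult_mat_index simp del: index_mult_mat(1)\<close>)
  ultimately show thesis by (intro that) (auto simp: y_def)
qed

text \<open>With \<open>M = P Y P + (1 - P)\<close> and \<open>G\<close> its inverse, \<open>Y G P Y\<close> is the part of \<open>Y\<close> of rank \<open>|I|\<close> and
  \<open>N = Y - Y G P Y\<close> is the (singular) Schur complement.\<close>

lemma schur_complement:
  fixes Y :: "complex mat" and I :: "nat set" and n :: nat
  defines "P \<equiv> coord_proj n I"
  defines "M \<equiv> P * Y * P + (1\<^sub>m n - P)"
  defines "G \<equiv> cinv M"
  defines "N \<equiv> Y - Y * (G * (P * Y))"
  assumes Y: "Y \<in> carrier_mat n n" and M: "det M \<noteq> 0"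
  shows "P * G = G * P" "P * N = 0\<^sub>m n n"
    and "det Y = 0 \<Longrightarrow> \<exists>y. y \<in> carrier_mat 1 n \<and> y \<noteq> 0\<^sub>m 1 n \<and> y * P = 0\<^sub>m 1 n \<and> y * N = 0\<^sub>m 1 n"
proof -
  have d [simp]: "dim_row P = n" "dim_col P = n" "dim_row Y = n" "dim_col Y = n"
    "dim_row M = n" "dim_col M = n"
    using Y by (auto simp: P_def M_def)
  have Mc: "M \<in> carrier_mat n n" by (auto intro: carrier_matI)
  note G = cinv[OF Mc, folded G_def]
  have [simp]: "dim_row G = n" "dim_col G = n" using G(1) by auto
  have [simp]: "dim_row N = n" "dim_col N = n" by (auto simp: N_def)
  have PP0: "P * P = P" by (simp add: P_def coord_proj_idem)
  have PP: "P * (P * X) = P * X" if "dim_row X = n" for X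
    using that PP0 by (simp add: mat_assoc[symmetric])
  have MP: "M * P = P * (Y * P)" "P * M = P * (Y * P)"
    by (auto simp: M_def mat_distrib PP PP0 intro!: eq_matI simp del: index_mult_mat(1))
  have GM: "G * (M * X) = X" "M * (G * X) = X" if "dim_row X = n" for X
    using that G(2,3) M by (simp_all add: mat_assoc[symmetric] mat_one_left)
  have GM': "G * M = 1\<^sub>m n" "M * G = 1\<^sub>m n" using G M by auto
  have "P * G = G * (M * (P * G))" by (simp add: GM)
  also have "\<dots> = G * ((P * M) * G)"
    using MP by (simp add: mat_assoc[symmetric])
  also have "\<dots> = G * (P * (M * G))" by (simp add: mat_assoc)
  also have "\<dots> = G * P" using GM' by (simp add: mat_one_right)
  finally show PG: "P * G = G * P" .
  have "P * (Y * (G * P)) = (P * (Y * P)) * G"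
    unfolding PG[symmetric] by (simp add: mat_assoc)
  also have "\<dots> = P * (M * G)" unfolding MP(2)[symmetric] by (simp add: mat_assoc)
  also have "\<dots> = P" using GM' by (simp add: mat_one_right)
  finally have "P * (Y * (G * P)) * Y = P * Y" by simp
  then have "P * (Y * (G * (P * Y))) = P * Y" by (simp add: mat_assoc)
  then show PN: "P * N = 0\<^sub>m n n"
    by (simp add: N_def mat_distrib) (rule eq_matI, auto)
  show "\<exists>y. y \<in> carrier_mat 1 n \<and> y \<noteq> 0\<^sub>m 1 n \<and> y * P = 0\<^sub>m 1 n \<and> y * N = 0\<^sub>m 1 n" if Y0: "det Y = 0"
  proof -
    obtain y where y: "y \<in> carrier_mat 1 n" "y \<noteq> 0\<^sub>m 1 n" "y * Y = 0\<^sub>m 1 n"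
      using row_kernel_matrix[OF Y Y0] by blast
    have [simp]: "dim_row y = 1" "dim_col y = n" using y(1) by auto
    \<comment> \<open>A left null vector of \<open>Y\<close> with its part in \<open>I\<close>
      removed. It is nonzero because \<open>y = y * P\<close> would make \<open>y\<close> a left
      null vector of the invertible \<open>M\<close>.\<close>
    define x where "x = y - y * P"
    have [simp]: "dim_row x = 1" "dim_col x = n" by (auto simp: x_def)
    have "x * P = 0\<^sub>m 1 n"
      by (simp add: x_def mat_distrib PP0) (rule eq_matI, auto)
    moreover have "x * N = 0\<^sub>m 1 n"
    proof -
      have "y * (Y * X) = 0\<^sub>m 1 (dim_col X)" if "dim_row X = n" for X
        using that y(3) by (simp add: mat_assoc[symmetric])
      then have "y * N = 0\<^sub>m 1 n"
        using y(3) by (simp add: N_def mat_distrib)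
      moreover have "y * (P * N) = 0\<^sub>m 1 n" unfolding PN by simp
      ultimately show ?thesis by (simp add: x_def mat_distrib)
    qed
    moreover have "x \<noteq> 0\<^sub>m 1 n"
    proof
      assume x0: "x = 0\<^sub>m 1 n"
      have yP: "y = y * P"
      proof (rule eq_matI)
        fix i j assume "i < dim_row (y * P)" "j < dim_col (y * P)"
        then show "y $$ (i, j) = (y * P) $$ (i, j)"
          using arg_cong[OF x0, of "\<lambda>x. x $$ (i, j)"] by (simp add: x_def del: index_mult_mat(1))
      qed auto
      have "y * M = (y * P) * M" by (rule arg_cong[OF yP])
      also have "\<dots> = y * (P * (Y * P))" using MP by (simp add: mat_assoc)
      also have "\<dots> = (y * P) * (Y * P)" by (simp add: mat_assoc)
      also have "\<dots> = (y * Y) * P" unfolding yP[symmetric] by (simp add: mat_assoc)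
      also have "\<dots> = 0\<^sub>m 1 n" using y(3) by simp
      finally have "y * (M * G) = 0\<^sub>m 1 n" by (simp add: mat_assoc[symmetric])
      then show False using y(2) GM' by (simp add: mat_one_right)
    qed
    ultimately show ?thesis by (intro exI[of _ x]) (auto intro: carrier_matI)
  qed
qed

section \<open>From square to rectangular factors\<close>

text \<open>The inclusion of the first k coordinates; with its adjoint it passes between the square
  factors given by the Schur complement and the rectangular maps of a quiver.\<close>

definition incl_mat :: "nat \<Rightarrow> complex mat" where
  "incl_mat k = mat (Suc k) k (\<lambda>(i, j). if i = j then 1 else 0)"

lemma dim_incl_mat [simp]: "dim_row (incl_mat k) = Suc k" "dim_col (incl_mat k) = k"
  by (auto simp: incl_mat_def)

lemma adj_incl_mult_incl: "adj (incl_mat k) * incl_mat k = 1\<^sub>m k"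
proof (rule eq_matI)
  fix i j assume ij: "i < dim_row (1\<^sub>m k :: complex mat)" "j < dim_col (1\<^sub>m k :: complex mat)"
  have "(adj (incl_mat k) * incl_mat k) $$ (i, j) = (\<Sum>l<Suc k. cnj (incl_mat k $$ (l, i)) * incl_mat k $$ (l, j))"
    using ij by (simp add: mult_mat_index del: index_mult_mat(1) sum.lessThan_Suc)
  also have "\<dots> = (\<Sum>l<Suc k. if l = i then 1\<^sub>m k $$ (i, j) else 0)"
    by (rule sum.cong) (use ij in \<open>auto simp: incl_mat_def\<close>)
  finally show "(adj (incl_mat k) * incl_mat k) $$ (i, j) = 1\<^sub>m k $$ (i, j)"
    using ij by (simp del: sum.lessThan_Suc)
qed auto

lemma incl_mult_index:
  assumes "dim_row A = k" "i < Suc k" "j < dim_col A"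
  shows "(incl_mat k * A) $$ (i, j) = (if i < k then A $$ (i, j) else 0)"
proof -
  have "(incl_mat k * A) $$ (i, j) = (\<Sum>l<k. incl_mat k $$ (i, l) * A $$ (l, j))"
    using assms by (simp add: mult_mat_index del: index_mult_mat(1))
  also have "\<dots> = (\<Sum>l<k. if l = i then A $$ (i, j) else 0)"
    by (rule sum.cong) (use assms in \<open>auto simp: incl_mat_def\<close>)
  finally show ?thesis by simp
qed

lemma adj_incl_mult_index:
  assumes "dim_row A = Suc k" "i < k" "j < dim_col A"
  shows "(adj (incl_mat k) * A) $$ (i, j) = A $$ (i, j)"
proof -
  have "(adj (incl_mat k) * A) $$ (i, j) = (\<Sum>l<Suc k. cnj (incl_mat k $$ (l, i)) * A $$ (l, j))"
    using assms by (simp add: mult_mat_index del: index_mult_mat(1) sum.lessThan_Suc)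
  also have "\<dots> = (\<Sum>l<Suc k. if l = i then A $$ (i, j) else 0)"
    by (rule sum.cong) (use assms in \<open>auto simp: incl_mat_def\<close>)
  finally show ?thesis using assms by (simp del: sum.lessThan_Suc)
qed

lemma incl_adj_incl_mult:
  assumes "dim_row A = Suc k" "\<And>j. j < dim_col A \<Longrightarrow> A $$ (k, j) = 0"
  shows "incl_mat k * (adj (incl_mat k) * A) = A"
  by (rule eq_matI) (use assms in \<open>auto simp: incl_mult_index adj_incl_mult_index less_Suc_eq simp del: index_mult_mat(1)\<close>)

lemma mult_incl_adj_incl:
  assumes "dim_col A = Suc k" "\<And>j. j < dim_row A \<Longrightarrow> A $$ (j, k) = 0"
  shows "A * (incl_mat k * adj (incl_mat k)) = A"
proof -
  have "incl_mat k * (adj (incl_mat k) * adj A) = adj A"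
    by (rule incl_adj_incl_mult) (use assms in auto)
  then have "adj (incl_mat k * (adj (incl_mat k) * adj A)) = adj (adj A)" by simp
  then show ?thesis using assms(1) by (simp add: adj_mult mat_assoc)
qed

text \<open>The normal form of the factorisation problem. \<open>Y G P\<close> and
  \<open>P Y\<close> both tend to \<open>P\<close> and multiply to the part of full rank; the small
  factors of the Schur complement live in columns and rows outside \<open>I\<close>, so the mixed
  products vanish. Keeping index k free as well makes the last column of \<open>A\<close> zero,
  which is what later reduces the inner dimension from k + 1 to k.\<close>

lemma coord_proj_factor_perturbation:
  fixes Y :: "nat \<Rightarrow> complex mat"
  assumes Y: "mat_lim (Suc k) (Suc k) Y (coord_proj (Suc k) I)" and I: "I \<subseteq> {..<k}"
    and det: "eventually (\<lambda>t. det (Y t) = 0) sequentially"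
  shows "\<exists>A B. mat_lim (Suc k) (Suc k) A (coord_proj (Suc k) I) \<and>
    mat_lim (Suc k) (Suc k) B (coord_proj (Suc k) I) \<and> eventually (\<lambda>t. A t * B t = Y t) sequentially \<and>
    (\<forall>t. A t * (incl_mat k * adj (incl_mat k)) = A t)"
proof -
  define n where "n = Suc k"
  define P where "P = coord_proj n I"
  define M where "M t = P * Y t * P + (1\<^sub>m n - P)" for t
  define G where "G t = cinv (M t)" for t
  define N where "N t = Y t - Y t * (G t * (P * Y t))" for t
  note Yd = mat_limD[OF Y, folded n_def]
  have Pc: "P \<in> carrier_mat n n" "dim_row P = n" "dim_col P = n" by (auto simp: P_def)
  have PP: "P * P = P" by (simp add: P_def coord_proj_idem)
  have Pl: "mat_lim n n (\<lambda>_. P) P" and Yl: "mat_lim n n Y P"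
    using mat_lim_const[OF Pc(1)] Y by (auto simp: P_def n_def)
  have "mat_lim n n M (P * P * P + (1\<^sub>m n - P))"
    unfolding M_def by (intro mat_lim_add mat_lim_mult[of n n _ _ n] mat_lim_diff mat_lim_const Pl Yl) auto
  also have "P * P * P + (1\<^sub>m n - P) = 1\<^sub>m n" using Pc by (simp add: PP) (rule eq_matI, auto)
  finally have Ml: "mat_lim n n M (1\<^sub>m n)" .
  have "cinv (1\<^sub>m n) = 1\<^sub>m n"
    by (rule mat_inverse_unique[of "1\<^sub>m n" n]) (use cinv[of "1\<^sub>m n" n] in auto)
  then have Gl: "mat_lim n n G (1\<^sub>m n)"
    unfolding G_def using mat_lim_cinv[OF Ml] by simp
  have "mat_lim n n N (P - P * (1\<^sub>m n * (P * P)))"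
    unfolding N_def by (intro mat_lim_mult[of n n _ _ n] mat_lim_diff Pl Yl Gl)
  then have Nl: "mat_lim n n N (0\<^sub>m n n)" using Pc by (simp add: PP)
  note Nd = mat_limD[OF Nl]
  have "(\<lambda>t. det (M t)) \<longlonglongrightarrow> 1" using det_tendsto[OF Ml] by simp
  then have Mdet: "eventually (\<lambda>t. det (M t) \<noteq> 0) sequentially"
    using tendsto_imp_eventually_ne by fastforce
  define ok where "ok t A B \<longleftrightarrow> A \<in> carrier_mat n n \<and> B \<in> carrier_mat n n \<and> N t = A * B \<and>
    (\<forall>i<n. \<forall>j<n. cmod (A $$ (i, j)) \<le> sqrt (sqrt (sqnorm (N t))) \<and>
      cmod (B $$ (i, j)) \<le> sqrt (sqrt (sqnorm (N t))) \<and> (j \<in> insert k I \<longrightarrow> A $$ (i, j) = 0) \<and>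
      (i \<in> insert k I \<longrightarrow> B $$ (i, j) = 0))" for t A B
  have ex: "\<exists>A B. ok t A B" if t: "det (M t) \<noteq> 0" "det (Y t) = 0" for t
  proof -
    note S = schur_complement[of "Y t" n I, folded P_def, folded M_def, folded G_def, folded N_def, OF Yd(2) t(1)]
    obtain y where y: "y \<in> carrier_mat 1 n" "y \<noteq> 0\<^sub>m 1 n" "y * P = 0\<^sub>m 1 n" "y * N t = 0\<^sub>m 1 n"
      using S(3)[OF t(2)] by blast
    have y0: "\<exists>i<n. y $$ (0, i) \<noteq> 0"
    proof (rule ccontr)
      assume "\<not> ?thesis"
      then have "y = 0\<^sub>m 1 n" using y(1) by (intro eq_matI) auto
      then show False using y(2) by simp
    qed
    have yI: "y $$ (0, i) = 0" if "i \<in> I" for i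
    proof -
      have "i < n" using that I by (auto simp: n_def)
      then show ?thesis
        using arg_cong[OF y(3), of "\<lambda>x. x $$ (0, i)"] y(1) that
        by (simp add: P_def mult_coord_proj_index del: index_mult_mat(1))
    qed
    have yN: "(\<Sum>i<n. y $$ (0, i) * N t $$ (i, j)) = 0" if "j < n" for j
      using arg_cong[OF y(4), of "\<lambda>x. x $$ (0, j)"] y(1) that Nd(5,6)[of t]
      by (simp add: mult_mat_index del: index_mult_mat(1))
    have NI: "N t $$ (i, j) = 0" if "i < n" "j < n" "i \<in> I" for i j
      using arg_cong[OF S(2), of "\<lambda>x. x $$ (i, j)"] that Nd(5,6)[of t]
      by (simp add: P_def coord_proj_mult_index del: index_mult_mat(1))
    show ?thesis
      unfolding ok_def n_def
      by (rule small_factorisation[of "N t" k I "\<lambda>i. y $$ (0, i)"])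
         (use Nd I y0 yI yN NI in \<open>auto simp: n_def simp del: sum.lessThan_Suc\<close>)
  qed
  define AB where "AB t = (SOME p. ok t (fst p) (snd p))" for t
  \<comment> \<open>The value 0 at the indices where no factorisation is available keeps the bound
    by the norm of \<open>N t\<close> valid for every t, so the limits need no side
    condition.\<close>
  define A' where "A' t = (if det (M t) \<noteq> 0 \<and> det (Y t) = 0 then fst (AB t) else 0\<^sub>m n n)" for t
  define B' where "B' t = (if det (M t) \<noteq> 0 \<and> det (Y t) = 0 then snd (AB t) else 0\<^sub>m n n)" for t
  have ok: "ok t (A' t) (B' t)" if "det (M t) \<noteq> 0" "det (Y t) = 0" for t
    using someI_ex[of "\<lambda>p. ok t (fst p) (snd p)"] ex[OF that] that by (auto simp: A'_def B'_def AB_def)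
  have c: "A' t \<in> carrier_mat n n" "B' t \<in> carrier_mat n n" for t
    using ok[of t] by (cases "det (M t) \<noteq> 0 \<and> det (Y t) = 0"; auto simp: ok_def A'_def B'_def)+
  note cd = carrier_matD[OF c(1)] carrier_matD[OF c(2)]
  have bnd: "cmod (A' t $$ (i, j)) \<le> sqrt (sqrt (sqnorm (N t)))"
    "cmod (B' t $$ (i, j)) \<le> sqrt (sqrt (sqnorm (N t)))"
    "j \<in> insert k I \<Longrightarrow> A' t $$ (i, j) = 0" "i \<in> insert k I \<Longrightarrow> B' t $$ (i, j) = 0"
    if "i < n" "j < n" for t i j
    using ok[of t] that by (cases "det (M t) \<noteq> 0 \<and> det (Y t) = 0"; auto simp: ok_def A'_def B'_def)+
  have "(\<lambda>t. sqrt (sqrt (sqnorm (N t)))) \<longlonglongrightarrow> sqrt (sqrt (sqnorm (0\<^sub>m n n)))"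
    by (intro tendsto_real_sqrt sqnorm_tendsto[of n n] Nl)
  then have q: "(\<lambda>t. sqrt (sqrt (sqnorm (N t)))) \<longlonglongrightarrow> 0" by (simp add: sqnorm_def)
  have A'l: "mat_lim n n A' (0\<^sub>m n n)" "mat_lim n n B' (0\<^sub>m n n)"
    by (intro mat_limI c; use bnd in \<open>auto intro!: tendsto_0_le[OF q, of _ 1] always_eventually\<close>)+
  have A'P: "A' t * P = 0\<^sub>m n n" "P * B' t = 0\<^sub>m n n" for t
    by (rule eq_matI; use cd bnd in \<open>auto simp: P_def mult_coord_proj_index coord_proj_mult_index simp del: index_mult_mat(1)\<close>)+
  define A where "A t = Y t * (G t * P) + A' t" for t
  define B where "B t = P * Y t + B' t" for t
  note Gd = mat_limD[OF Gl]
  have "mat_lim n n A (P * (1\<^sub>m n * P) + 0\<^sub>m n n)" "mat_lim n n B (P * P + 0\<^sub>m n n)"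
    unfolding A_def B_def by (intro mat_lim_add mat_lim_mult[of n n _ _ n] Yl Gl Pl A'l)+
  then have "mat_lim n n A P" "mat_lim n n B P" using Pc by (simp_all add: PP mat_one_left)
  moreover have "A t * B t = Y t" if t: "det (M t) \<noteq> 0" "det (Y t) = 0" for t
  proof -
    have "P * (P * X) = P * X" if "dim_row X = n" for X
      using that Pc PP by (simp add: mat_assoc[symmetric])
    moreover have "A' t * (P * X) = 0\<^sub>m n (dim_col X)" if "dim_row X = n" for X
      using that Pc cd A'P(1)[of t] by (simp add: mat_assoc[symmetric])
    ultimately have "A t * B t = Y t * (G t * (P * Y t)) + Y t * (G t * 0\<^sub>m n n) + (0\<^sub>m n n + A' t * B' t)"
      using cd Pc Yd Gd A'P(2)[of t] unfolding A_def B_def by (simp add: mat_distrib)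
    also have "A' t * B' t = N t" using ok[OF t] by (simp add: ok_def)
    also have "Y t * (G t * (P * Y t)) + Y t * (G t * 0\<^sub>m n n) + (0\<^sub>m n n + N t) = Y t"
      using Pc Yd Gd unfolding N_def
      by (intro eq_matI) (auto simp del: index_mult_mat(1))
    finally show ?thesis .
  qed
  then have "eventually (\<lambda>t. A t * B t = Y t) sequentially"
    using eventually_conj[OF Mdet det] by (auto elim: eventually_mono)
  moreover have "A t * (incl_mat k * adj (incl_mat k)) = A t" for t
  proof (rule mult_incl_adj_incl)
    have kI: "k \<notin> I" using I by auto
    have "A t = Y t * G t * P + A' t" using Yd Gd Pc by (simp add: A_def mat_assoc)
    then show "A t $$ (j, k) = 0" if "j < dim_row (A t)" for j
      using that bnd(3)[of j k t] cd Yd Gd Pc kI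
      by (simp add: P_def mult_coord_proj_index n_def del: index_mult_mat(1))
  qed (use cd Yd Gd in \<open>simp add: A_def n_def\<close>)
  ultimately show ?thesis unfolding P_def n_def by blast
qed

lemma mult_adj_incl_index:
  assumes "dim_col A = k" "j < Suc k" "i < dim_row A"
  shows "(A * adj (incl_mat k)) $$ (i, j) = (if j < k then A $$ (i, j) else 0)"
proof -
  have "A * adj (incl_mat k) = adj (incl_mat k * adj A)" using assms by (simp add: adj_mult)
  then show ?thesis using assms by (simp add: incl_mult_index del: index_mult_mat(1))
qed

text \<open>In bases adapted to the common kernel of \<open>a\<close> and \<open>adj b\<close>, the part of \<open>Y t\<close> of the rank of \<open>a b\<close>
  has factors close to \<open>a\<close> and \<open>b\<close>. The remaining Schur complement is singular and tends to \<open>0\<close>, hence has small factors.\<close>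

lemma product_perturbation:
  fixes a b :: "complex mat" and Y :: "nat \<Rightarrow> complex mat"
  assumes a: "a \<in> carrier_mat (Suc k) k" and b: "b \<in> carrier_mat k (Suc k)"
    and ker: "\<And>v. v \<in> carrier_mat k 1 \<Longrightarrow> a * v = 0\<^sub>m (Suc k) 1 \<longleftrightarrow> adj b * v = 0\<^sub>m (Suc k) 1"
    and Y: "mat_lim (Suc k) (Suc k) Y (a * b)" "eventually (\<lambda>t. det (Y t) = 0) sequentially"
  shows "\<exists>A B. mat_lim (Suc k) k A a \<and> mat_lim k (Suc k) B b \<and>
    eventually (\<lambda>t. A t * B t = Y t) sequentially"
proof -
  define n where "n = Suc k"
  have [simp]: "dim_row a = n" "dim_col a = k" "dim_row b = k" "dim_col b = n" using a b by (auto simp: n_def)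
  have "adj a * a \<in> carrier_mat k k" "adj (adj a * a) = adj a * a" by (auto simp: adj_mult intro: carrier_matI)
  from spectral_theorem[OF this] obtain R d where R: "unitary k R"
    "adj a * a = R * mat_diag k (\<lambda>i. complex_of_real (d i)) * adj R" by blast
  note Rd = unitaryD[OF R(1)]
  note [simp] = Rd(2,3)
  define E where "E = incl_mat k"
  have [simp]: "dim_row E = n" "dim_col E = k" by (auto simp: E_def n_def)
  have EE: "adj E * E = 1\<^sub>m k" by (simp add: E_def adj_incl_mult_incl)
  \<comment> \<open>The zero eigenvalues of \<open>adj a * a\<close> mark the kernel of
    \<open>a\<close>. By assumption this is also the kernel of \<open>adj b\<close>, so one index
    set and one basis \<open>R\<close> serve both factors.\<close>
  define I where "I = {i. i < k \<and> d i \<noteq> 0}"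
  define P where "P = coord_proj n I"
  have [simp]: "dim_row P = n" "dim_col P = n" by (auto simp: P_def)
  have PP: "P * P = P" by (simp add: P_def coord_proj_idem)
  have D: "adj (a * R) * (a * R) = mat_diag k (\<lambda>i. complex_of_real (d i))"
  proof -
    have "adj (a * R) * (a * R) = adj R * ((adj a * a) * R)" by (simp add: adj_mult mat_assoc)
    also have "\<dots> = adj R * (R * (mat_diag k (\<lambda>i. complex_of_real (d i)) * (adj R * R)))"
      unfolding R(2) by (simp add: mat_assoc mat_diag_def)
    finally show ?thesis unfolding Rd(4)
      by (simp add: unitary_cancel[OF R(1)] mat_one_right mat_diag_def)
  qed
  define e where "e i = mat k 1 (\<lambda>(r, c). if r = i then (1::complex) else 0)" for i
  have [simp]: "dim_row (e i) = k" "dim_col (e i) = 1" for i by (auto simp: e_def)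
  have Xe: "(X * e i) $$ (r, 0) = X $$ (r, i)" if "dim_col X = k" "r < dim_row X" "i < k" for X r i
  proof -
    have "(X * e i) $$ (r, 0) = (\<Sum>l<k. if l = i then X $$ (r, i) else 0)"
      unfolding mult_mat_index[OF that(2) _ that(1)[folded \<open>dim_row (e i) = k\<close>], of 0, simplified]
      by (intro sum.cong) (use that in \<open>auto simp: e_def\<close>)
    then show ?thesis using that by simp
  qed
  have inj: "\<forall>i<k. x i = 0"
    if C: "C = a \<or> C = adj b" and x: "\<And>i. i < k \<Longrightarrow> i \<notin> I \<Longrightarrow> x i = 0"
      and Cx: "C * (R * mat k 1 (\<lambda>(i, j). x i)) = 0\<^sub>m n 1" for C and x :: "nat \<Rightarrow> complex"
  proof (intro allI impI)
    define X where "X = mat k 1 (\<lambda>(i, j). x i)"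
    have [simp]: "dim_row X = k" "dim_col X = 1" by (auto simp: X_def)
    have "R * X \<in> carrier_mat k 1" by (intro carrier_matI) auto
    then have "a * (R * X) = 0\<^sub>m n 1"
      using C Cx ker[of "R * X"] unfolding X_def[symmetric] n_def by auto
    then have DX: "mat_diag k (\<lambda>i. complex_of_real (d i)) * X = 0\<^sub>m k 1"
      unfolding D[symmetric] by (simp add: mat_assoc)
    have "mat_diag k (\<lambda>i. complex_of_real (d i)) * X = mat k 1 (\<lambda>(i, j). complex_of_real (d i) * X $$ (i, j))"
      by (rule mat_diag_mult_left) (auto simp: X_def)
    then have "complex_of_real (d i) * x i = 0" if "i < k" for i
      using arg_cong[OF DX, of "\<lambda>M. M $$ (i, 0)"] that by (simp add: X_def del: index_mult_mat(1))
    then show "x i = 0" if "i < k" for i using that x[of i] by (auto simp: I_def)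
  qed
  have off: "C * (R * e i) = 0\<^sub>m n 1" if C: "C = a \<or> C = adj b" and i: "i < k" "i \<notin> I" for C i
  proof -
    have "adj (a * R * e i) * (a * R * e i) = adj (e i) * (mat_diag k (\<lambda>i. complex_of_real (d i)) * e i)"
      unfolding D[symmetric] by (simp add: adj_mult mat_assoc)
    also have "mat_diag k (\<lambda>i. complex_of_real (d i)) * e i = 0\<^sub>m k 1"
      by (subst mat_diag_mult_left[of _ k 1]) (use i in \<open>auto simp: e_def I_def intro!: eq_matI\<close>)
    finally have "a * R * e i = 0\<^sub>m n 1"
      using adj_mult_eq_0[of "a * R * e i"] by simp
    then have "a * (R * e i) = 0\<^sub>m n 1" by (simp add: mat_assoc)
    moreover have "R * e i \<in> carrier_mat k 1" by (intro carrier_matI) auto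
    ultimately show ?thesis using C ker[of "R * e i"] unfolding n_def by auto
  qed
  \<comment> \<open>In the basis \<open>R\<close> the columns of \<open>C\<close> outside
    \<open>I\<close> vanish and those in \<open>I\<close> are independent, so they extend to an
    invertible matrix. For \<open>a\<close> and \<open>adj b\<close> this yields \<open>S\<close>
    and \<open>T\<close> with \<open>a * b = S * P * T\<close>.\<close>
  have fill: "\<exists>S\<in>carrier_mat n n. det S \<noteq> 0 \<and> S * P = C * R * adj E" if C: "C = a \<or> C = adj b" for C
  proof -
    have [simp]: "dim_row C = n" "dim_col C = k" using C by auto
    define Z where "Z = C * R * adj E"
    have Zi: "Z $$ (r, i) = (if i < k then (C * R) $$ (r, i) else 0)" if "r < n" "i < n" for r i
      unfolding Z_def E_def using that by (subst mult_adj_incl_index) (auto simp: n_def)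
    have Zoff: "Z $$ (r, i) = 0" if "r < n" "i < n" "i \<notin> I" for r i
    proof (cases "i < k")
      case True
      have "(C * R) $$ (r, i) = (C * R * e i) $$ (r, 0)"
        by (rule Xe[symmetric]) (use that True in auto)
      also have "\<dots> = 0" using off[OF C True that(3)] that by (simp add: mat_assoc del: index_mult_mat(1))
      finally show ?thesis using Zi that by simp
    qed (use that Zi in simp)
    have "\<exists>S\<in>carrier_mat n n. det S \<noteq> 0 \<and> (\<forall>r<n. \<forall>i\<in>I. S $$ (r, i) = Z $$ (r, i))"
    proof (rule invertible_with_given_columns)
      show "Z \<in> carrier_mat n n" by (auto simp: Z_def intro: carrier_matI)
      show "I \<subseteq> {..<n}" by (auto simp: I_def n_def)
      fix x :: "nat \<Rightarrow> complex" assume x: "\<And>i. i < n \<Longrightarrow> i \<notin> I \<Longrightarrow> x i = 0"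
        "\<And>r. r < n \<Longrightarrow> (\<Sum>i<n. Z $$ (r, i) * x i) = 0"
      have "C * R * mat k 1 (\<lambda>(i, j). x i) = 0\<^sub>m n 1"
      proof (rule eq_matI)
        fix r c assume "r < dim_row (0\<^sub>m n 1 :: complex mat)" "c < dim_col (0\<^sub>m n 1 :: complex mat)"
        then have rc: "r < n" "c = 0" by auto
        have "(C * R * mat k 1 (\<lambda>(i, j). x i)) $$ (r, c) = (\<Sum>i<k. (C * R) $$ (r, i) * x i)"
          using rc by (simp add: mult_mat_index del: index_mult_mat(1))
        also have "\<dots> = (\<Sum>i<n. Z $$ (r, i) * x i)"
          unfolding n_def using rc Zi by (simp add: n_def del: index_mult_mat(1))
        finally show "(C * R * mat k 1 (\<lambda>(i, j). x i)) $$ (r, c) = 0\<^sub>m n 1 $$ (r, c)"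
          using x(2) rc by simp
      qed auto
      then have "\<forall>i<k. x i = 0" using x(1) by (intro inj[OF C]) (auto simp: mat_assoc n_def)
      then show "\<forall>i<n. x i = 0" using x(1) by (auto simp: n_def less_Suc_eq I_def)
    qed
    then obtain S where S: "S \<in> carrier_mat n n" "det S \<noteq> 0" "\<forall>r<n. \<forall>i\<in>I. S $$ (r, i) = Z $$ (r, i)"
      by blast
    have "S * P = Z"
    proof (rule eq_matI)
      fix i j assume "i < dim_row Z" "j < dim_col Z"
      then have "i < n" "j < n" by (auto simp: Z_def)
      then show "(S * P) $$ (i, j) = Z $$ (i, j)"
        using S Zoff by (simp add: P_def mult_coord_proj_index del: index_mult_mat(1))
    qed (use S in \<open>auto simp: Z_def\<close>)
    then show ?thesis using S by (auto simp: Z_def)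
  qed
  obtain S where S: "S \<in> carrier_mat n n" "det S \<noteq> 0" "S * P = a * R * adj E" using fill by blast
  obtain T' where T': "T' \<in> carrier_mat n n" "det T' \<noteq> 0" "T' * P = adj b * R * adj E" using fill by blast
  define T where "T = adj T'"
  have T: "T \<in> carrier_mat n n" "det T \<noteq> 0" using T' det_adj[OF T'(1)] by (auto simp: T_def)
  have [simp]: "dim_row S = n" "dim_col S = n" "dim_row T = n" "dim_col T = n" using S T by auto
  have TP: "P * T = E * (adj R * b)"
  proof -
    have "P * T = adj (T' * P)" using T'(1) by (simp add: T_def adj_mult P_def)
    then show ?thesis unfolding T'(3) by (simp add: adj_mult mat_assoc)
  qed
  note iS = cinv[OF S(1)] and iT = cinv[OF T(1)]
  have [simp]: "dim_row (cinv S) = n" "dim_col (cinv S) = n" "dim_row (cinv T) = n" "dim_col (cinv T) = n"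
    using iS(1) iT(1) by auto
  have iSS: "cinv S * (S * X) = X" "S * (cinv S * X) = X" if "dim_row X = n" for X
    using that iS(2,3)[OF S(2)] by (simp_all add: mat_assoc[symmetric] mat_one_left)
  have iTT: "T * cinv T = 1\<^sub>m n" "cinv T * T = 1\<^sub>m n" using iT(2,3)[OF T(2)] .
  have EX: "adj E * (E * X) = X" if "dim_row X = k" for X
    using that EE by (simp add: mat_assoc[symmetric] mat_one_left)
  have "a * b = (a * R * adj E) * (E * (adj R * b))"
    by (simp add: mat_assoc EX unitary_cancel[OF R(1)])
  also have "\<dots> = S * (P * T)" unfolding S(3)[symmetric] TP[symmetric] using PP
    by (simp add: mat_assoc) (simp add: mat_assoc[symmetric])
  finally have "cinv S * (a * b) * cinv T = P"
    using iTT by (simp add: mat_assoc iSS mat_one_right)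
  moreover define Y' where "Y' t = cinv S * Y t * cinv T" for t
  note Yd = mat_limD[OF Y(1), folded n_def]
  have "mat_lim n n Y' (cinv S * (a * b) * cinv T)"
    unfolding Y'_def using Y(1) iS(1) iT(1) by (intro mat_lim_mult[of n n _ _ n] mat_lim_const) (auto simp: n_def)
  ultimately have Y'l: "mat_lim n n Y' P" by simp
  have "det (Y' t) = 0" if "det (Y t) = 0" for t
    unfolding Y'_def using that Yd iS(1) iT(1) by (simp add: det_mult[of _ n])
  then have "eventually (\<lambda>t. det (Y' t) = 0) sequentially" using Y(2) by (auto elim: eventually_mono)
  from coord_proj_factor_perturbation[of k Y' I, folded n_def, folded P_def E_def, OF Y'l _ this]
  obtain A B where AB: "mat_lim n n A P" "mat_lim n n B P" "eventually (\<lambda>t. A t * B t = Y' t) sequentially"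
    "\<And>t. A t * (E * adj E) = A t" by (auto simp: I_def)
  note Ad = mat_limD[OF AB(1)] and Bd = mat_limD[OF AB(2)]
  have "mat_lim n k (\<lambda>t. S * A t * (E * adj R)) (S * P * (E * adj R))"
    by (intro mat_lim_mult[of n n _ _ k] mat_lim_mult[of n n _ _ n] mat_lim_const AB S) (auto intro: carrier_matI)
  also have "S * P * (E * adj R) = a"
    unfolding S(3) using Rd(5) by (simp add: mat_assoc EX mat_one_right)
  finally have 1: "mat_lim n k (\<lambda>t. S * A t * (E * adj R)) a" .
  have "mat_lim k n (\<lambda>t. R * (adj E * (B t * T))) (R * (adj E * (P * T)))"
    by (intro mat_lim_mult[of k k _ _ n] mat_lim_mult[of k n _ _ n] mat_lim_mult[of n n _ _ n] mat_lim_const AB T)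
       (auto intro: carrier_matI)
  also have "R * (adj E * (P * T)) = b"
    unfolding TP by (simp add: EX unitary_cancel[OF R(1)])
  finally have 2: "mat_lim k n (\<lambda>t. R * (adj E * (B t * T))) b" .
  \<comment> \<open>\<open>A t\<close> absorbs \<open>E * adj E\<close>, so passing through the
    smaller inner dimension loses nothing.\<close>
  have "S * A t * (E * adj R) * (R * (adj E * (B t * T))) = Y t" if "A t * B t = Y' t" for t
  proof -
    have "S * A t * (E * adj R) * (R * (adj E * (B t * T))) = S * (A t * (E * adj E) * (B t * T))"
      using Ad Bd by (simp add: mat_assoc unitary_cancel[OF R(1)])
    also have "\<dots> = S * ((A t * B t) * T)" unfolding AB(4) using Ad Bd by (simp add: mat_assoc)
    also have "\<dots> = Y t"
      unfolding that Y'_def using Yd iTT by (simp add: mat_assoc iSS mat_one_right)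
    finally show ?thesis .
  qed
  then have "eventually (\<lambda>t. S * A t * (E * adj R) * (R * (adj E * (B t * T))) = Y t) sequentially"
    using AB(3) by (auto elim: eventually_mono)
  then show ?thesis using 1 2 unfolding n_def[symmetric] by blast
qed


section \<open>Quivers\<close>

lemma quiversD:
  assumes "x \<in> quivers n" "i < n"
  shows "fst x i \<in> carrier_mat (Suc i) i" "snd x i \<in> carrier_mat i (Suc i)"
    "dim_row (fst x i) = Suc i" "dim_col (fst x i) = i"
    "dim_row (snd x i) = i" "dim_col (snd x i) = Suc i"
proof -
  show "fst x i \<in> carrier_mat (Suc i) i" "snd x i \<in> carrier_mat i (Suc i)"
    using assms by (auto simp: quivers_def mem_Times_iff)
  then show "dim_row (fst x i) = Suc i" "dim_col (fst x i) = i"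
    "dim_row (snd x i) = i" "dim_col (snd x i) = Suc i" by auto
qed

lemma quivers_eqI:
  assumes "x \<in> quivers n" "y \<in> quivers n"
    "\<And>i. i < n \<Longrightarrow> fst x i = fst y i" "\<And>i. i < n \<Longrightarrow> snd x i = snd y i"
  shows "x = y"
proof (rule prod_eqI)
  show "fst x = fst y"
    by (rule PiE_ext[of _ "{..<n}" "\<lambda>i. carrier_mat (Suc i) i"])
       (use assms in \<open>auto simp: quivers_def mem_Times_iff\<close>)
  show "snd x = snd y"
    by (rule PiE_ext[of _ "{..<n}" "\<lambda>i. carrier_mat i (Suc i)"])
       (use assms in \<open>auto simp: quivers_def mem_Times_iff\<close>)
qed

lemma quiversI:
  assumes "\<And>i. i < n \<Longrightarrow> a i \<in> carrier_mat (Suc i) i" "\<And>i. i < n \<Longrightarrow> b i \<in> carrier_mat i (Suc i)"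
  shows "(\<lambda>i\<in>{..<n}. a i, \<lambda>i\<in>{..<n}. b i) \<in> quivers n"
  using assms by (auto simp: quivers_def)

lemma quiver_scale_quivers: "x \<in> quivers n \<Longrightarrow> quiver_scale n t x \<in> quivers n"
  unfolding quiver_scale_def by (intro quiversI) (auto dest: quiversD)

lemma quiver_scale_sel [simp]:
  "i < n \<Longrightarrow> fst (quiver_scale n t x) i = t \<cdot>\<^sub>m fst x i"
  "i < n \<Longrightarrow> snd (quiver_scale n t x) i = t \<cdot>\<^sub>m snd x i"
  by (auto simp: quiver_scale_def)

lemma mat_smult_smult: "s \<cdot>\<^sub>m (t \<cdot>\<^sub>m (A :: complex mat)) = (s * t) \<cdot>\<^sub>m A"
  by (rule eq_matI) auto

lemma mat_one_smult: "1 \<cdot>\<^sub>m (A :: complex mat) = A"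
  by (rule eq_matI) auto

lemma quiver_scale_scale:
  "x \<in> quivers n \<Longrightarrow> quiver_scale n s (quiver_scale n t x) = quiver_scale n (s * t) x"
  by (rule quivers_eqI[of _ n]) (simp_all add: quiver_scale_quivers mat_smult_smult)

lemma quiver_scale_one:
  assumes "x \<in> quivers n"
  shows "quiver_scale n 1 x = x"
  by (rule quivers_eqI[OF quiver_scale_quivers[OF assms] assms]) (simp_all add: mat_one_smult)


subsection \<open>The gauge groups\<close>

text \<open>The inverse chosen in \<open>quiver_act\<close> is replaced by Cramer's formula, for
  which the algebraic rules and the continuity are proved.\<close>

lemma the_mat_inverse:
  assumes "g \<in> carrier_mat k k" "det g \<noteq> 0"
  shows "the (mat_inverse g) = cinv g"
proof (cases "mat_inverse g")
  case None
  then have "g \<notin> Units (ring_mat TYPE(complex) k ())"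
    by (rule mat_inverse(1)[OF assms(1)])
  then show ?thesis using det_non_zero_imp_unit[OF assms, of "()"] by blast
next
  case (Some B)
  have "B = cinv g"
    by (rule mat_inverse_unique[OF assms(1)])
       (use mat_inverse(2)[OF assms(1) Some] cinv[OF assms(1)] assms in simp_all)
  then show ?thesis using Some by simp
qed

lemma SL_D:
  assumes "g \<in> SL k"
  shows "g \<in> carrier_mat k k" "det g = 1" "det g \<noteq> 0" "dim_row g = k" "dim_col g = k"
    "the (mat_inverse g) = cinv g" "cinv g \<in> carrier_mat k k"
    "dim_row (cinv g) = k" "dim_col (cinv g) = k" "g * cinv g = 1\<^sub>m k" "cinv g * g = 1\<^sub>m k"
proof -
  show g: "g \<in> carrier_mat k k" "det g = 1" using assms by (auto simp: SL_def)
  show 0: "det g \<noteq> 0" unfolding g(2) by simp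
  show "dim_row g = k" "dim_col g = k" using g(1) by auto
  show "the (mat_inverse g) = cinv g" by (rule the_mat_inverse[OF g(1) 0])
  show "cinv g \<in> carrier_mat k k" "g * cinv g = 1\<^sub>m k" "cinv g * g = 1\<^sub>m k"
    using cinv(1)[OF g(1)] cinv(2,3)[OF g(1) 0] by auto
  then show "dim_row (cinv g) = k" "dim_col (cinv g) = k" by auto
qed

lemma SL_cancel:
  assumes "g \<in> SL k" "dim_row X = k"
  shows "g * (cinv g * X) = X" "cinv g * (g * X) = X"
  by (simp_all add: mat_assoc[symmetric] SL_D[OF assms(1)] assms(2) mat_one_left)

lemma SL_mult: "g \<in> SL k \<Longrightarrow> h \<in> SL k \<Longrightarrow> g * h \<in> SL k"
  using det_mult[of g k h] mult_carrier_mat[of g k k h k] by (simp add: SL_def)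

lemma SL_cinv:
  assumes "g \<in> SL k"
  shows "cinv g \<in> SL k"
proof -
  have "det (g * cinv g) = det g * det (cinv g)" by (rule det_mult) (rule SL_D[OF assms])+
  then show ?thesis using SL_D(2,7,10)[OF assms] by (simp add: SL_def)
qed

lemma SL_one: "1\<^sub>m k \<in> SL k" by (simp add: SL_def)

lemma cinv_eqI: "g \<in> SL k \<Longrightarrow> h \<in> carrier_mat k k \<Longrightarrow> h * g = 1\<^sub>m k \<Longrightarrow> cinv g = h"
  by (rule mat_inverse_unique[OF SL_D(1,7) _ SL_D(10)])

lemma cinv_cinv:
  assumes "g \<in> SL k"
  shows "cinv (cinv g) = g"
  by (rule cinv_eqI[OF SL_cinv[OF assms] SL_D(1,10)[OF assms]])

lemma cinv_mult:
  assumes g: "g \<in> SL k" and h: "h \<in> SL k"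
  shows "cinv (g * h) = cinv h * cinv g"
proof (rule cinv_eqI[OF SL_mult[OF g h]])
  note d = SL_D(4,5,8,9)[OF g] SL_D(4,5,8,9)[OF h]
  show "cinv h * cinv g \<in> carrier_mat k k" by (intro carrier_matI) (simp_all add: d)
  show "cinv h * cinv g * (g * h) = 1\<^sub>m k"
    by (simp add: d mat_assoc SL_cancel[OF g] SL_D(11)[OF h])
qed

lemma cinv_one: "cinv (1\<^sub>m k) = 1\<^sub>m k"
  by (rule cinv_eqI[OF SL_one]) auto

lemma SU_SL: "g \<in> SU k \<Longrightarrow> g \<in> SL k" by (simp add: SU_def)

lemma SU_unitary: "g \<in> SU k \<Longrightarrow> unitary k g"
  by (rule unitaryI) (auto simp: SU_def SL_def)

lemma SU_cinv: "g \<in> SU k \<Longrightarrow> cinv g = adj g"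
  using SU_unitary[of g k] by (intro cinv_eqI[OF SU_SL]) (auto simp: unitary_def)

lemma gauge_groupD:
  assumes "g \<in> gauge_group G n"
  shows "k \<le> n \<Longrightarrow> g k \<in> G k" "g n = 1\<^sub>m n"
  using assms by (auto simp: gauge_group_def)

lemma gauge_groupI:
  "(\<And>k. k \<le> n \<Longrightarrow> g k \<in> G k) \<Longrightarrow> g n = 1\<^sub>m n \<Longrightarrow> (\<lambda>k\<in>{..n}. g k) \<in> gauge_group G n"
  by (auto simp: gauge_group_def)

lemma H_HC: "g \<in> H_group n \<Longrightarrow> g \<in> HC_group n"
  by (auto simp: gauge_group_def SU_SL PiE_iff)

lemma gauge_mat_inverse: "g \<in> HC_group n \<Longrightarrow> k \<le> n \<Longrightarrow> the (mat_inverse (g k)) = cinv (g k)"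
  using SL_D(6) gauge_groupD(1) by blast

lemma quiver_act_sel:
  assumes "g \<in> HC_group n" "i < n"
  shows "fst (quiver_act n g x) i = g (Suc i) * fst x i * cinv (g i)"
    "snd (quiver_act n g x) i = g i * snd x i * cinv (g (Suc i))"
  using assms by (simp_all add: quiver_act_def gauge_mat_inverse)

lemma gauge_dims:
  assumes "g \<in> HC_group n" "k \<le> n"
  shows "g k \<in> carrier_mat k k" "dim_row (g k) = k" "dim_col (g k) = k"
    "dim_row (cinv (g k)) = k" "dim_col (cinv (g k)) = k"
  using SL_D[OF gauge_groupD(1)[OF assms]] by auto

lemma gauge_cancel:
  assumes "g \<in> HC_group n" "k \<le> n" "dim_row X = k"
  shows "g k * (cinv (g k) * X) = X" "cinv (g k) * (g k * X) = X"
  using SL_cancel[OF gauge_groupD(1)[OF assms(1,2)] assms(3)] by auto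

lemma quiver_act_quivers: "g \<in> HC_group n \<Longrightarrow> x \<in> quivers n \<Longrightarrow> quiver_act n g x \<in> quivers n"
  using gauge_dims[of g n] gauge_groupD(1)[of g SL n] unfolding quiver_act_def
  by (intro quiversI) (auto intro!: carrier_matI simp: gauge_mat_inverse quiversD)

text \<open>The restriction to \<open>{..n}\<close> keeps products extensional, as membership in
  \<open>gauge_group\<close> demands.\<close>

definition gauge_mult :: "nat \<Rightarrow> (nat \<Rightarrow> complex mat) \<Rightarrow> (nat \<Rightarrow> complex mat) \<Rightarrow> nat \<Rightarrow> complex mat" where
  "gauge_mult n g h = (\<lambda>k\<in>{..n}. g k * h k)"

definition gauge_inv :: "nat \<Rightarrow> (nat \<Rightarrow> complex mat) \<Rightarrow> nat \<Rightarrow> complex mat" where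
  "gauge_inv n g = (\<lambda>k\<in>{..n}. cinv (g k))"

lemma gauge_mult_HC: "g \<in> HC_group n \<Longrightarrow> h \<in> HC_group n \<Longrightarrow> gauge_mult n g h \<in> HC_group n"
  unfolding gauge_mult_def
proof (rule gauge_groupI)
  fix k assume "g \<in> HC_group n" "h \<in> HC_group n" "k \<le> n"
  then show "g k * h k \<in> SL k" using SL_mult gauge_groupD(1) by blast
qed (simp add: gauge_groupD(2)[of _ SL n])

lemma gauge_inv_HC: "g \<in> HC_group n \<Longrightarrow> gauge_inv n g \<in> HC_group n"
  unfolding gauge_inv_def by (rule gauge_groupI) (auto dest: gauge_groupD simp: SL_cinv cinv_one)

lemma gauge_one_H: "(\<lambda>k\<in>{..n}. 1\<^sub>m k) \<in> H_group n"
  by (rule gauge_groupI) (auto simp: SU_def SL_one)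

lemma quiver_act_one:
  assumes "x \<in> quivers n"
  shows "quiver_act n (\<lambda>k\<in>{..n}. 1\<^sub>m k) x = x"
proof (rule quivers_eqI[of _ n])
  fix i assume i: "i < n"
  then show "fst (quiver_act n (\<lambda>k\<in>{..n}. 1\<^sub>m k) x) i = fst x i"
    "snd (quiver_act n (\<lambda>k\<in>{..n}. 1\<^sub>m k) x) i = snd x i"
    using quiversD[OF assms i]
    by (simp_all add: quiver_act_sel[OF H_HC[OF gauge_one_H]] cinv_one mat_one_left mat_one_right)
qed (use assms in \<open>simp_all add: quiver_act_quivers[OF H_HC[OF gauge_one_H]]\<close>)

lemma quiver_act_act:
  assumes g: "g \<in> HC_group n" and h: "h \<in> HC_group n" and x: "x \<in> quivers n"
  shows "quiver_act n g (quiver_act n h x) = quiver_act n (gauge_mult n g h) x"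
proof (rule quivers_eqI[of _ n])
  fix i assume i: "i < n"
  then have i': "i \<le> n" "Suc i \<le> n" by auto
  have m: "gauge_mult n g h k = g k * h k" "cinv (g k * h k) = cinv (h k) * cinv (g k)" if "k \<le> n" for k
    using that gauge_groupD(1)[OF g that] gauge_groupD(1)[OF h that] by (auto simp: gauge_mult_def cinv_mult)
  note d = gauge_dims[OF g i'(1)] gauge_dims[OF g i'(2)] gauge_dims[OF h i'(1)] gauge_dims[OF h i'(2)] quiversD[OF x i]
  show "fst (quiver_act n g (quiver_act n h x)) i = fst (quiver_act n (gauge_mult n g h) x) i"
    "snd (quiver_act n g (quiver_act n h x)) i = snd (quiver_act n (gauge_mult n g h) x) i"
    unfolding quiver_act_sel[OF g i] quiver_act_sel[OF h i] quiver_act_sel[OF gauge_mult_HC[OF g h] i]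
      m[OF i'(1)] m[OF i'(2)]
    by (simp_all add: d mat_assoc)
qed (use assms in \<open>auto simp: quiver_act_quivers gauge_mult_HC\<close>)

lemma quiver_act_inv:
  assumes g: "g \<in> HC_group n" and x: "x \<in> quivers n"
  shows "quiver_act n (gauge_inv n g) (quiver_act n g x) = x"
proof (rule quivers_eqI[of _ n])
  fix i assume i: "i < n"
  then have i': "i \<le> n" "Suc i \<le> n" by auto
  have m: "gauge_inv n g k = cinv (g k)" "cinv (cinv (g k)) = g k" "cinv (g k) * g k = 1\<^sub>m k" if "k \<le> n" for k
    using that gauge_groupD(1)[OF g that] by (auto simp: gauge_inv_def cinv_cinv SL_D)
  note d = gauge_dims[OF g i'(1)] gauge_dims[OF g i'(2)] quiversD[OF x i]
  show "fst (quiver_act n (gauge_inv n g) (quiver_act n g x)) i = fst x i"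
    "snd (quiver_act n (gauge_inv n g) (quiver_act n g x)) i = snd x i"
    unfolding quiver_act_sel[OF g i] quiver_act_sel[OF gauge_inv_HC[OF g] i] m(1)[OF i'(1)] m(1)[OF i'(2)]
      m(2)[OF i'(1)] m(2)[OF i'(2)]
    by (simp_all add: d mat_assoc gauge_cancel[OF g i'(1)] gauge_cancel[OF g i'(2)]
        m(3)[OF i'(1)] m(3)[OF i'(2)] mat_one_right)
qed (use assms in \<open>auto simp: quiver_act_quivers gauge_inv_HC\<close>)

lemma gauge_mult_H: "g \<in> H_group n \<Longrightarrow> h \<in> H_group n \<Longrightarrow> gauge_mult n g h \<in> H_group n"
  unfolding gauge_mult_def
proof (rule gauge_groupI)
  fix k assume "g \<in> H_group n" "h \<in> H_group n" "k \<le> n"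
  then have "g k \<in> SU k" "h k \<in> SU k" by (auto dest: gauge_groupD)
  then show "g k * h k \<in> SU k"
    using unitary_mult[OF SU_unitary SU_unitary, of "g k" k "h k"] SL_mult[OF SU_SL SU_SL, of "g k" k "h k"]
    by (auto simp: SU_def unitary_def)
qed (simp add: gauge_groupD(2)[of _ SU n])

lemma gauge_inv_H: "g \<in> H_group n \<Longrightarrow> gauge_inv n g \<in> H_group n"
  unfolding gauge_inv_def
proof (rule gauge_groupI)
  fix k assume "g \<in> H_group n" "k \<le> n"
  then have g: "g k \<in> SU k" by (auto dest: gauge_groupD)
  then show "cinv (g k) \<in> SU k"
    using SL_cinv[OF SU_SL[OF g]] unitary_adj[OF SU_unitary[OF g]]
    by (simp add: SU_cinv) (simp add: SU_def unitary_def)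
qed (auto dest: gauge_groupD simp: cinv_one)


subsection \<open>The moment maps\<close>

lemma muC_carrier:
  assumes "x \<in> quivers n" "Suc i < n"
  shows "muC x i \<in> carrier_mat (Suc i) (Suc i)" "muR x i \<in> carrier_mat (Suc i) (Suc i)"
  using quiversD[OF assms(1), of i] quiversD[OF assms(1), of "Suc i"] assms(2)
  by (auto simp: muC_def muR_def intro!: carrier_matI)

lemma muC_act:
  assumes g: "g \<in> HC_group n" and x: "x \<in> quivers n" and i: "Suc i < n"
  shows "muC (quiver_act n g x) i = g (Suc i) * muC x i * cinv (g (Suc i))"
proof -
  have i': "i < n" "i \<le> n" "Suc i \<le> n" "Suc (Suc i) \<le> n" using i by auto
  note d = gauge_dims[OF g i'(2)] gauge_dims[OF g i'(3)] gauge_dims[OF g i'(4)]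
    quiversD[OF x i'(1)] quiversD[OF x i]
  show ?thesis
    unfolding muC_def quiver_act_sel[OF g i'(1)] quiver_act_sel[OF g i]
    by (simp add: d mat_distrib gauge_cancel[OF g i'(2)] gauge_cancel[OF g i'(3)] gauge_cancel[OF g i'(4)])
qed

text \<open>The real moment map pairs maps with their adjoints, so the inverse of a group element
  has to cancel against its adjoint; this is why the equivariance is stated for the compact
  group.\<close>

lemma muR_act:
  assumes g: "g \<in> H_group n" and x: "x \<in> quivers n" and i: "Suc i < n"
  shows "muR (quiver_act n g x) i = g (Suc i) * muR x i * cinv (g (Suc i))"
proof -
  note g' = H_HC[OF g]
  have i': "i < n" "i \<le> n" "Suc i \<le> n" "Suc (Suc i) \<le> n" using i by auto
  note d = gauge_dims[OF g' i'(2)] gauge_dims[OF g' i'(3)] gauge_dims[OF g' i'(4)]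
    quiversD[OF x i'(1)] quiversD[OF x i]
  note s = gauge_groupD(1)[OF g i'(2)] gauge_groupD(1)[OF g i'(3)] gauge_groupD(1)[OF g i'(4)]
  note c = SU_cinv[OF s(1)] SU_cinv[OF s(2)] SU_cinv[OF s(3)]
  show ?thesis
    unfolding muR_def quiver_act_sel[OF g' i'(1)] quiver_act_sel[OF g' i] c
    by (simp add: d adj_simps mat_distrib unitary_cancel(2)[OF SU_unitary[OF s(1)]]
        unitary_cancel(2)[OF SU_unitary[OF s(2)]] unitary_cancel(2)[OF SU_unitary[OF s(3)]])
qed

lemma scalar_conj:
  assumes "g \<in> HC_group n" "k \<le> n"
  shows "g k * (c \<cdot>\<^sub>m 1\<^sub>m k) * cinv (g k) = c \<cdot>\<^sub>m 1\<^sub>m k"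
  using gauge_dims[OF assms] SL_D(10)[OF gauge_groupD(1)[OF assms]] by (simp add: mat_distrib)

text \<open>The multipliers are made explicit: rotation and scaling transform them, and the
  deformation argument prescribes them.\<close>

definition is_csol :: "nat \<Rightarrow> (nat \<Rightarrow> complex) \<Rightarrow> quiver \<Rightarrow> bool" where
  "is_csol n l x \<longleftrightarrow> x \<in> quivers n \<and> (\<forall>i. Suc i < n \<longrightarrow> muC x i = l (Suc i) \<cdot>\<^sub>m 1\<^sub>m (Suc i))"

definition is_rsol :: "nat \<Rightarrow> (nat \<Rightarrow> real) \<Rightarrow> quiver \<Rightarrow> bool" where
  "is_rsol n l x \<longleftrightarrow> x \<in> quivers n \<and>
     (\<forall>i. Suc i < n \<longrightarrow> muR x i = complex_of_real (l (Suc i)) \<cdot>\<^sub>m 1\<^sub>m (Suc i))"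

lemma complex_solutions_iff: "x \<in> complex_solutions n \<longleftrightarrow> (\<exists>l. is_csol n l x)"
  by (auto simp: complex_solutions_def is_csol_def)

lemma hyperkaehler_solutions_iff:
  "x \<in> hyperkaehler_solutions n \<longleftrightarrow> (\<exists>l. is_csol n l x) \<and> (\<exists>l. is_rsol n l x)"
  by (auto simp: hyperkaehler_solutions_def complex_solutions_iff is_rsol_def is_csol_def)

lemma is_csol_act: "is_csol n l x \<Longrightarrow> g \<in> HC_group n \<Longrightarrow> is_csol n l (quiver_act n g x)"
  by (auto simp: is_csol_def quiver_act_quivers muC_act scalar_conj)

lemma is_rsol_act: "is_rsol n l x \<Longrightarrow> g \<in> H_group n \<Longrightarrow> is_rsol n l (quiver_act n g x)"
  by (auto simp: is_rsol_def quiver_act_quivers muR_act scalar_conj[OF H_HC] H_HC)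

lemma smult_one_inj: "c \<cdot>\<^sub>m 1\<^sub>m (Suc k) = d \<cdot>\<^sub>m (1\<^sub>m (Suc k) :: complex mat) \<Longrightarrow> c = d"
  by (drule arg_cong[of _ _ "\<lambda>M. M $$ (0, 0)"]) simp

lemma lambdaC_eq: "is_csol n l x \<Longrightarrow> 1 \<le> i \<Longrightarrow> i < n \<Longrightarrow> lambdaC x i = l i"
  unfolding lambdaC_def
  by (rule the_equality) (auto simp: is_csol_def Suc_le_eq gr0_conv_Suc dest: smult_one_inj)

lemma lambdaR_eq: "is_rsol n l x \<Longrightarrow> 1 \<le> i \<Longrightarrow> i < n \<Longrightarrow> lambdaR x i = l i"
  unfolding lambdaR_def
  by (rule the_equality) (auto simp: is_rsol_def Suc_le_eq gr0_conv_Suc dest: smult_one_inj)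

lemma is_csol_scale:
  assumes "is_csol n l x"
  shows "is_csol n (\<lambda>i. t\<^sup>2 * l i) (quiver_scale n t x)"
proof -
  have x: "x \<in> quivers n" using assms by (simp add: is_csol_def)
  have "muC (quiver_scale n t x) i = (t\<^sup>2 * l (Suc i)) \<cdot>\<^sub>m 1\<^sub>m (Suc i)" if i: "Suc i < n" for i
  proof -
    note d = quiversD[OF x, of i] quiversD[OF x, of "Suc i"]
    have "muC (quiver_scale n t x) i = t\<^sup>2 \<cdot>\<^sub>m muC x i"
      unfolding muC_def using i d
      by (intro eq_matI) (auto simp: mat_distrib power2_eq_square algebra_simps simp del: index_mult_mat(1))
    then show ?thesis using assms i by (simp add: is_csol_def) (auto intro!: eq_matI)
  qed
  then show ?thesis using x by (simp add: is_csol_def quiver_scale_quivers)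
qed

lemma is_rsol_scale:
  assumes "is_rsol n l x"
  shows "is_rsol n (\<lambda>i. (cmod t)\<^sup>2 * l i) (quiver_scale n t x)"
proof -
  have x: "x \<in> quivers n" using assms by (simp add: is_rsol_def)
  have "muR (quiver_scale n t x) i = complex_of_real ((cmod t)\<^sup>2 * l (Suc i)) \<cdot>\<^sub>m 1\<^sub>m (Suc i)" if i: "Suc i < n" for i
  proof -
    note d = quiversD[OF x, of i] quiversD[OF x, of "Suc i"]
    have "muR (quiver_scale n t x) i = (t * cnj t) \<cdot>\<^sub>m muR x i"
      unfolding muR_def using i d
      by (intro eq_matI) (auto simp: mat_distrib adj_smult algebra_simps simp del: index_mult_mat(1))
    then show ?thesis using assms i
      by (simp add: is_rsol_def complex_norm_square del: of_real_power) (auto intro!: eq_matI)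
  qed
  then show ?thesis using x by (simp add: is_rsol_def quiver_scale_quivers)
qed


subsection \<open>Rotation of the complex structure\<close>

lemma rotate_sel [simp]:
  "i < n \<Longrightarrow> fst (rotate_quiver n (u, v) x) i = u \<cdot>\<^sub>m fst x i + v \<cdot>\<^sub>m adj (snd x i)"
  "i < n \<Longrightarrow> snd (rotate_quiver n (u, v) x) i = (- v) \<cdot>\<^sub>m adj (fst x i) + u \<cdot>\<^sub>m snd x i"
  by (auto simp: rotate_quiver_def split: prod.splits)

lemma rotate_quivers: "x \<in> quivers n \<Longrightarrow> rotate_quiver n uv x \<in> quivers n"
  unfolding rotate_quiver_def by (cases uv; cases x) (auto intro!: quiversI carrier_matI dest: quiversD)

lemma rotate_scale:
  assumes "x \<in> quivers n"
  shows "rotate_quiver n (t * u, t * v) x = quiver_scale n t (rotate_quiver n (u, v) x)"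
proof (rule quivers_eqI[of _ n])
  fix i assume i: "i < n"
  note d = quiversD[OF assms i]
  show "fst (rotate_quiver n (t * u, t * v) x) i = fst (quiver_scale n t (rotate_quiver n (u, v) x)) i"
    "snd (rotate_quiver n (t * u, t * v) x) i = snd (quiver_scale n t (rotate_quiver n (u, v) x)) i"
    using i d by (auto simp: adj_simps complex_norm_square algebra_simps simp del: of_real_power intro!: eq_matI)
qed (use assms in \<open>simp_all add: rotate_quivers quiver_scale_quivers\<close>)

text \<open>Adjoints conjugate scalars, so only real factors pass through a rotation on the right;
  this is enough to normalise the inverse of a rotation.\<close>

lemma rotate_scale_real:
  assumes "x \<in> quivers n"
  shows "rotate_quiver n (u, v) (quiver_scale n (complex_of_real c) x) =
    quiver_scale n (complex_of_real c) (rotate_quiver n (u, v) x)"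
proof (rule quivers_eqI[of _ n])
  fix i assume i: "i < n"
  note d = quiversD[OF assms i]
  show "fst (rotate_quiver n (u, v) (quiver_scale n (complex_of_real c) x)) i = fst (quiver_scale n (complex_of_real c) (rotate_quiver n (u, v) x)) i"
    "snd (rotate_quiver n (u, v) (quiver_scale n (complex_of_real c) x)) i = snd (quiver_scale n (complex_of_real c) (rotate_quiver n (u, v) x)) i"
    using i d by (auto simp: adj_simps complex_norm_square algebra_simps simp del: of_real_power intro!: eq_matI)
qed (use assms in \<open>simp_all add: rotate_quivers quiver_scale_quivers\<close>)

text \<open>A rotation is right multiplication by a quaternion, and \<open>(cnj u, - v)\<close>
  belongs to the conjugate quaternion; together they multiply by the squared norm.\<close>

lemma rotate_rotate_inv:
  assumes "x \<in> quivers n"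
  shows "rotate_quiver n (cnj u, - v) (rotate_quiver n (u, v) x) =
    quiver_scale n (of_real ((cmod u)\<^sup>2 + (cmod v)\<^sup>2)) x"
proof (rule quivers_eqI[of _ n])
  fix i assume i: "i < n"
  note d = quiversD[OF assms i]
  show "fst (rotate_quiver n (cnj u, - v) (rotate_quiver n (u, v) x)) i = fst (quiver_scale n (of_real ((cmod u)\<^sup>2 + (cmod v)\<^sup>2)) x) i"
    "snd (rotate_quiver n (cnj u, - v) (rotate_quiver n (u, v) x)) i = snd (quiver_scale n (of_real ((cmod u)\<^sup>2 + (cmod v)\<^sup>2)) x) i"
    using i d by (auto simp: adj_simps complex_norm_square algebra_simps simp del: of_real_power intro!: eq_matI)
qed (use assms in \<open>simp_all add: rotate_quivers quiver_scale_quivers\<close>)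

lemma rotate_inj:
  assumes "x \<in> quivers n" "y \<in> quivers n" "(u, v) \<noteq> (0, 0)"
    "rotate_quiver n (u, v) x = rotate_quiver n (u, v) y"
  shows "x = y"
proof -
  define N where "N = (cmod u)\<^sup>2 + (cmod v)\<^sup>2"
  have N: "N \<noteq> 0" using assms(3) by (auto simp: N_def sum_power2_eq_zero_iff)
  have "quiver_scale n (of_real N) x = quiver_scale n (of_real N) y"
    using rotate_rotate_inv[OF assms(1)] rotate_rotate_inv[OF assms(2)] assms(4) unfolding N_def by metis
  then have "quiver_scale n (1 / of_real N) (quiver_scale n (of_real N) x) =
      quiver_scale n (1 / of_real N) (quiver_scale n (of_real N) y)"
    by simp
  then show ?thesis using N assms(1,2) by (simp add: quiver_scale_scale quiver_scale_one)
qed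

lemma rotate_surj:
  assumes "y \<in> quivers n" "(u, v) \<noteq> (0, 0)"
  defines "N \<equiv> (cmod u)\<^sup>2 + (cmod v)\<^sup>2"
  shows "rotate_quiver n (u, v) (quiver_scale n (of_real (1 / N)) (rotate_quiver n (cnj u, - v) y)) = y"
proof -
  have "N \<noteq> 0" using assms(2) by (auto simp: N_def sum_power2_eq_zero_iff)
  moreover have "rotate_quiver n (u, v) (rotate_quiver n (cnj u, - v) y) = quiver_scale n (of_real N) y"
    using rotate_rotate_inv[OF assms(1), of "cnj u" "- v"] by (simp add: N_def)
  ultimately show ?thesis
    using assms(1) unfolding rotate_scale_real[OF rotate_quivers[OF assms(1)]]
    by (simp add: quiver_scale_scale quiver_scale_one flip: of_real_mult)
qed

lemma rotate_act:
  assumes g: "g \<in> H_group n" and x: "x \<in> quivers n"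
  shows "rotate_quiver n (u, v) (quiver_act n g x) = quiver_act n g (rotate_quiver n (u, v) x)"
proof (rule quivers_eqI[of _ n])
  note g' = H_HC[OF g]
  fix i assume i: "i < n"
  then have i': "i \<le> n" "Suc i \<le> n" by auto
  note d = gauge_dims[OF g' i'(1)] gauge_dims[OF g' i'(2)] quiversD[OF x i]
  note c = SU_cinv[OF gauge_groupD(1)[OF g i'(1)]] SU_cinv[OF gauge_groupD(1)[OF g i'(2)]]
  show "fst (rotate_quiver n (u, v) (quiver_act n g x)) i = fst (quiver_act n g (rotate_quiver n (u, v) x)) i"
    "snd (rotate_quiver n (u, v) (quiver_act n g x)) i = snd (quiver_act n g (rotate_quiver n (u, v) x)) i"
    unfolding rotate_sel[OF i] quiver_act_sel[OF g' i] c
    by (simp_all add: d adj_simps mat_distrib)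
qed (use assms in \<open>auto simp: rotate_quivers quiver_act_quivers H_HC\<close>)

lemma rotated_products:
  fixes A B :: "complex mat" and u v :: complex
  assumes "A \<in> carrier_mat m k" "B \<in> carrier_mat k m"
  defines "a \<equiv> u \<cdot>\<^sub>m A + v \<cdot>\<^sub>m adj B" and "b \<equiv> (- v) \<cdot>\<^sub>m adj A + u \<cdot>\<^sub>m B"
  shows "a * b = u\<^sup>2 \<cdot>\<^sub>m (A * B) - (u * v) \<cdot>\<^sub>m (A * adj A) + (u * v) \<cdot>\<^sub>m (adj B * B) - v\<^sup>2 \<cdot>\<^sub>m (adj B * adj A)"
    "b * a = u\<^sup>2 \<cdot>\<^sub>m (B * A) - (u * v) \<cdot>\<^sub>m (adj A * A) + (u * v) \<cdot>\<^sub>m (B * adj B) - v\<^sup>2 \<cdot>\<^sub>m (adj A * adj B)"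
    "a * adj a = (u * cnj u) \<cdot>\<^sub>m (A * adj A) + (u * cnj v) \<cdot>\<^sub>m (A * B) + (cnj u * v) \<cdot>\<^sub>m (adj B * adj A) + (v * cnj v) \<cdot>\<^sub>m (adj B * B)"
    "adj b * b = (v * cnj v) \<cdot>\<^sub>m (A * adj A) - (u * cnj v) \<cdot>\<^sub>m (A * B) - (cnj u * v) \<cdot>\<^sub>m (adj B * adj A) + (u * cnj u) \<cdot>\<^sub>m (adj B * B)"
    "b * adj b = (v * cnj v) \<cdot>\<^sub>m (adj A * A) - (cnj u * v) \<cdot>\<^sub>m (adj A * adj B) - (u * cnj v) \<cdot>\<^sub>m (B * A) + (u * cnj u) \<cdot>\<^sub>m (B * adj B)"
    "adj a * a = (u * cnj u) \<cdot>\<^sub>m (adj A * A) + (cnj u * v) \<cdot>\<^sub>m (adj A * adj B) + (u * cnj v) \<cdot>\<^sub>m (B * A) + (v * cnj v) \<cdot>\<^sub>m (B * adj B)"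
  unfolding a_def b_def
  by (simp add: carrier_matD[OF assms(1)] carrier_matD[OF assms(2)] adj_simps mat_distrib mat_smult_smult,
      rule eq_matI,
      (simp_all add: carrier_matD[OF assms(1)] carrier_matD[OF assms(2)] del: index_mult_mat(1) index_adj)[3],
      (simp add: power2_eq_square algebra_simps)?)+

lemma muC_rotate:
  assumes x: "x \<in> quivers n" and i: "Suc i < n"
  shows "muC (rotate_quiver n (u, v) x) i =
    u\<^sup>2 \<cdot>\<^sub>m muC x i - (u * v) \<cdot>\<^sub>m muR x i - v\<^sup>2 \<cdot>\<^sub>m adj (muC x i)"
proof -
  note d = quiversD[OF x, of i] quiversD[OF x, of "Suc i"]
  have i': "i < n" using i by simp
  note p = rotated_products[OF d(1,2)[OF i'], where u = u and v = v] rotated_products[OF d(7,8)[OF i], where u = u and v = v]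
  show ?thesis
    unfolding muC_def muR_def rotate_sel[OF i] rotate_sel[OF i'] p
    using i i' d(1-6)[OF i'] d(7-12)[OF i]
    by (simp add: adj_simps, intro eq_matI, simp_all del: index_mult_mat(1) index_adj, simp only: algebra_simps)
qed

lemma muR_rotate_aux:
  fixes P :: "complex mat"
  assumes "P \<in> carrier_mat n n" "Q \<in> carrier_mat n n" "R \<in> carrier_mat n n" "S \<in> carrier_mat n n"
    "X \<in> carrier_mat n n" "X' \<in> carrier_mat n n" "Y \<in> carrier_mat n n" "Y' \<in> carrier_mat n n"
  shows "(a \<cdot>\<^sub>m P + b \<cdot>\<^sub>m X + c \<cdot>\<^sub>m X' + d \<cdot>\<^sub>m Q) - (d \<cdot>\<^sub>m P - b \<cdot>\<^sub>m X - c \<cdot>\<^sub>m X' + a \<cdot>\<^sub>m Q)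
      + (d \<cdot>\<^sub>m S - c \<cdot>\<^sub>m Y' - b \<cdot>\<^sub>m Y + a \<cdot>\<^sub>m R) - (a \<cdot>\<^sub>m S + c \<cdot>\<^sub>m Y' + b \<cdot>\<^sub>m Y + d \<cdot>\<^sub>m R) =
    (a - d) \<cdot>\<^sub>m (P - Q + R - S) + (2 * b) \<cdot>\<^sub>m (X - Y) + (2 * c) \<cdot>\<^sub>m (X' - Y')"
  by (rule eq_matI) (use assms in \<open>simp_all add: algebra_simps\<close>)

lemma muR_rotate:
  assumes x: "x \<in> quivers n" and i: "Suc i < n"
  shows "muR (rotate_quiver n (u, v) x) i =
    (u * cnj u - v * cnj v) \<cdot>\<^sub>m muR x i + (2 * (u * cnj v)) \<cdot>\<^sub>m muC x i + (2 * (cnj u * v)) \<cdot>\<^sub>m adj (muC x i)"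
proof -
  note d = quiversD[OF x, of i] quiversD[OF x, of "Suc i"]
  have i': "i < n" using i by simp
  note d' = d(1-6)[OF i'] d(7-12)[OF i]
  note p = rotated_products[OF d(1,2)[OF i'], where u = u and v = v] rotated_products[OF d(7,8)[OF i], where u = u and v = v]
  have a: "adj (muC x i) = adj (snd x i) * adj (fst x i) - adj (fst x (Suc i)) * adj (snd x (Suc i))"
    unfolding muC_def by (simp add: adj_simps d')
  show ?thesis
    unfolding a unfolding muC_def muR_def rotate_sel[OF i] rotate_sel[OF i'] p
    by (rule muR_rotate_aux[of _ "Suc i"]) (use d' in \<open>auto intro!: carrier_matI\<close>)
qed

text \<open>The complex multiplier of the rotated quiver is at the same time the value at
  \<open>(u, v)\<close> of the torus component of \<open>sigma\<close>, which is how that component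
  enters the proof of injectivity.\<close>

definition rotC :: "complex \<Rightarrow> complex \<Rightarrow> (nat \<Rightarrow> complex) \<Rightarrow> (nat \<Rightarrow> real) \<Rightarrow> nat \<Rightarrow> complex" where
  "rotC u v l r i = u\<^sup>2 * l i - u * v * of_real (r i) - v\<^sup>2 * cnj (l i)"

definition rotR :: "complex \<Rightarrow> complex \<Rightarrow> (nat \<Rightarrow> complex) \<Rightarrow> (nat \<Rightarrow> real) \<Rightarrow> nat \<Rightarrow> real" where
  "rotR u v l r i = ((cmod u)\<^sup>2 - (cmod v)\<^sup>2) * r i + 4 * Re (u * cnj v * l i)"

lemma is_csol_rotate:
  assumes "is_csol n l x" "is_rsol n r x"
  shows "is_csol n (rotC u v l r) (rotate_quiver n (u, v) x)"
  using assms
  by (auto simp: is_csol_def is_rsol_def rotate_quivers muC_rotate adj_simps rotC_def intro!: eq_matI)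

lemma is_rsol_rotate:
  assumes "is_csol n l x" "is_rsol n r x"
  shows "is_rsol n (rotR u v l r) (rotate_quiver n (u, v) x)"
proof -
  have eq: "(u * cnj u - v * cnj v) * of_real (r i) + 2 * (u * cnj v) * l i + 2 * (cnj u * v) * cnj (l i) =
      of_real (rotR u v l r i)" for i
  proof -
    define z where "z = u * cnj v * l i"
    have 1: "complex_of_real (4 * Re z) = 2 * (z + cnj z)" by (simp add: complex_add_cnj)
    have "complex_of_real (rotR u v l r i) =
        (of_real ((cmod u)\<^sup>2) - of_real ((cmod v)\<^sup>2)) * of_real (r i) + of_real (4 * Re z)"
      unfolding rotR_def z_def by (simp only: of_real_add of_real_diff of_real_mult)
    then show ?thesis unfolding 1 complex_norm_square by (simp add: z_def algebra_simps)
  qed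
  have "muR (rotate_quiver n (u, v) x) i = of_real (rotR u v l r (Suc i)) \<cdot>\<^sub>m 1\<^sub>m (Suc i)" if i: "Suc i < n" for i
  proof -
    have "muR (rotate_quiver n (u, v) x) i =
      (u * cnj u - v * cnj v) \<cdot>\<^sub>m (complex_of_real (r (Suc i)) \<cdot>\<^sub>m 1\<^sub>m (Suc i))
        + (2 * (u * cnj v)) \<cdot>\<^sub>m (l (Suc i) \<cdot>\<^sub>m 1\<^sub>m (Suc i)) + (2 * (cnj u * v)) \<cdot>\<^sub>m adj (l (Suc i) \<cdot>\<^sub>m 1\<^sub>m (Suc i))"
      using assms i by (simp add: is_csol_def is_rsol_def muR_rotate)
    also have "\<dots> = ((u * cnj u - v * cnj v) * of_real (r (Suc i)) + 2 * (u * cnj v) * l (Suc i)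
        + 2 * (cnj u * v) * cnj (l (Suc i))) \<cdot>\<^sub>m 1\<^sub>m (Suc i)"
      by (rule eq_matI) (simp_all add: adj_smult)
    finally show ?thesis unfolding eq .
  qed
  then show ?thesis using assms by (simp add: is_rsol_def rotate_quivers)
qed


section \<open>Regular deformations\<close>

text \<open>The hypothesis under which a perturbed product lifts to perturbed factors. It is
  demanded at every arrow because the lifting descends through all of them.\<close>

definition kernel_cond :: "nat \<Rightarrow> quiver \<Rightarrow> bool" where
  "kernel_cond n y \<longleftrightarrow> (\<forall>k<n. \<forall>v\<in>carrier_mat k 1.
     fst y k * v = 0\<^sub>m (Suc k) 1 \<longleftrightarrow> adj (snd y k) * v = 0\<^sub>m (Suc k) 1)"

definition quiver_lim :: "nat \<Rightarrow> (nat \<Rightarrow> quiver) \<Rightarrow> quiver \<Rightarrow> bool" where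
  "quiver_lim n Y y \<longleftrightarrow> y \<in> quivers n \<and> (\<forall>t. Y t \<in> quivers n) \<and>
     (\<forall>i<n. mat_lim (Suc i) i (\<lambda>t. fst (Y t) i) (fst y i) \<and> mat_lim i (Suc i) (\<lambda>t. snd (Y t) i) (snd y i))"

lemma isCont_eq_at_0:
  fixes f g :: "complex \<Rightarrow> complex"
  assumes "isCont f 0" "isCont g 0" "\<And>z. z \<noteq> 0 \<Longrightarrow> f z = g z"
  shows "f z = g z"
proof (cases "z = 0")
  case True
  have l: "f \<midarrow>0\<rightarrow> f 0" "g \<midarrow>0\<rightarrow> g 0" using assms by (auto simp: isCont_def)
  have "eventually (\<lambda>x. g x = f x) (at 0)" using assms(3) by (auto simp: eventually_at_filter)
  from LIM_unique[OF l(1) Lim_transform_eventually[OF l(2) this]] show ?thesis using True by simp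
qed (use assms in auto)

section \<open>Spectra of the products along a quiver\<close>

text \<open>The negatives of these sums, for j up to k, are the eigenvalues of the product
  \<open>fst y k * snd y k\<close> of a solution with multipliers \<open>l\<close>.\<close>

definition partial_sum :: "(nat \<Rightarrow> complex) \<Rightarrow> nat \<Rightarrow> nat \<Rightarrow> complex" where
  "partial_sum l j k = (\<Sum>i=Suc j..k. l i)"

lemma partial_sum_Suc: "j \<le> k \<Longrightarrow> partial_sum l j (Suc k) = partial_sum l j k + l (Suc k)"
  by (simp add: partial_sum_def)

lemma partial_sum_refl [simp]: "partial_sum l k k = 0"
  by (simp add: partial_sum_def)

lemma charfun_eq_prod_shift:
  assumes "B \<in> carrier_mat (Suc k) (Suc k)"
    and "\<And>x. charfun B x = (\<Prod>j<Suc k. x + partial_sum l j k)"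
  shows "charfun (B + (- l (Suc k)) \<cdot>\<^sub>m 1\<^sub>m (Suc k)) x = (\<Prod>j<Suc k. x + partial_sum l j (Suc k))"
  unfolding charfun_shift[OF assms(1)] assms(2)
  by (rule prod.cong) (auto simp: partial_sum_Suc)

lemma prod_partial_sum_Suc:
  "(\<Prod>j<Suc k. x + partial_sum l j k) = x * (\<Prod>j<k. x + partial_sum l j k)"
  by simp

lemma csol_product:
  assumes y: "is_csol n l y" and k: "Suc k < n"
  shows "snd y (Suc k) * fst y (Suc k) = fst y k * snd y k + (- l (Suc k)) \<cdot>\<^sub>m 1\<^sub>m (Suc k)"
proof -
  have q: "y \<in> quivers n" using y by (simp add: is_csol_def)
  have k': "k < n" using k by simp
  have "muC y k = l (Suc k) \<cdot>\<^sub>m 1\<^sub>m (Suc k)" using y k by (simp add: is_csol_def)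
  then have e: "fst y k * snd y k - snd y (Suc k) * fst y (Suc k) = l (Suc k) \<cdot>\<^sub>m 1\<^sub>m (Suc k)"
    by (simp add: muC_def)
  show ?thesis
  proof (rule eq_matI)
    fix i j assume "i < dim_row (fst y k * snd y k + (- l (Suc k)) \<cdot>\<^sub>m 1\<^sub>m (Suc k))"
      "j < dim_col (fst y k * snd y k + (- l (Suc k)) \<cdot>\<^sub>m 1\<^sub>m (Suc k))"
    then have ij: "i < Suc k" "j < Suc k" by auto
    have "(fst y k * snd y k) $$ (i, j) - (snd y (Suc k) * fst y (Suc k)) $$ (i, j) = l (Suc k) * 1\<^sub>m (Suc k) $$ (i, j)"
      using arg_cong[OF e, of "\<lambda>M. M $$ (i, j)"] ij quiversD[OF q k'] quiversD[OF q k]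
      by (simp del: index_mult_mat(1))
    then show "(snd y (Suc k) * fst y (Suc k)) $$ (i, j) =
        (fst y k * snd y k + (- l (Suc k)) \<cdot>\<^sub>m 1\<^sub>m (Suc k)) $$ (i, j)"
      using ij quiversD[OF q k'] quiversD[OF q k]
      by (simp add: algebra_simps del: index_mult_mat(1))
  qed (use quiversD[OF q k'] quiversD[OF q k] in auto)
qed

text \<open>Exchanging the factors adds the root 0, and the moment map equation shifts all roots by
  the next multiplier. Starting from size 0, the multipliers therefore determine the whole spectrum,
  multiplicities included.\<close>

lemma csol_charfun:
  assumes y: "is_csol n l y" and k: "k < n"
  shows "charfun (fst y k * snd y k) x = (\<Prod>j<Suc k. x + partial_sum l j k)"
    and "charfun (snd y k * fst y k) x = (\<Prod>j<k. x + partial_sum l j k)"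
proof -
  have q: "y \<in> quivers n" using y by (simp add: is_csol_def)
  have 1: "charfun (fst y k * snd y k) x = x * charfun (snd y k * fst y k) x" if "k < n" for k x
    by (rule charfun_mult_commute) (use quiversD[OF q that] in auto)
  have "(\<forall>x. charfun (snd y k * fst y k) x = (\<Prod>j<k. x + partial_sum l j k))" using k
  proof (induction k)
    case 0
    have "x \<cdot>\<^sub>m 1\<^sub>m (dim_row (snd y 0 * fst y 0)) - snd y 0 * fst y 0 \<in> carrier_mat 0 0" for x
      using quiversD[OF q 0] by (intro carrier_matI) auto
    then have "charfun (snd y 0 * fst y 0) x = 1" for x
      unfolding charfun_def by (rule det_dim_zero)
    then show ?case by simp
  next
    case (Suc k)
    have k: "k < n" using Suc.prems by simp
    have c: "fst y k * snd y k \<in> carrier_mat (Suc k) (Suc k)"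
      using quiversD[OF q k] by auto
    have "charfun (fst y k * snd y k) x = (\<Prod>j<Suc k. x + partial_sum l j k)" for x
      using Suc.IH[OF k] 1[OF k] unfolding prod_partial_sum_Suc by simp
    from charfun_eq_prod_shift[OF c this] show ?case
      unfolding csol_product[OF y Suc.prems] by blast
  qed
  then show "charfun (snd y k * fst y k) x = (\<Prod>j<k. x + partial_sum l j k)" by blast
  then show "charfun (fst y k * snd y k) x = (\<Prod>j<Suc k. x + partial_sum l j k)"
    unfolding 1[OF k] prod_partial_sum_Suc by simp
qed

lemma charfun_0: "A \<in> carrier_mat n n \<Longrightarrow> charfun A 0 = (- 1) ^ n * det A"
proof -
  assume A: "A \<in> carrier_mat n n"
  have "0 \<cdot>\<^sub>m 1\<^sub>m n - A = (- 1) \<cdot>\<^sub>m A" by (rule eq_matI) (use A in auto)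
  then show ?thesis using A by (simp add: charfun_def)
qed

text \<open>At each vertex, the prescribed product is lifted to factors \<open>A t * B t\<close>; then \<open>B t * A t\<close> and the
  moment map equation prescribe the product at the previous vertex.\<close>

lemma lift_deformation:
  assumes "is_csol (Suc m) l y" "kernel_cond (Suc m) y"
    and "mat_lim (Suc m) (Suc m) X (fst y m * snd y m)"
    and "\<And>k. 1 \<le> k \<Longrightarrow> k \<le> m \<Longrightarrow> (\<lambda>t. L t k) \<longlonglongrightarrow> l k"
    and "eventually (\<lambda>t. \<forall>x. charfun (X t) x = (\<Prod>j<Suc m. x + partial_sum (L t) j m)) sequentially"
  shows "\<exists>Y. quiver_lim (Suc m) Y y \<and>
    eventually (\<lambda>t. is_csol (Suc m) (L t) (Y t) \<and> fst (Y t) m * snd (Y t) m = X t) sequentially"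
  using assms
proof (induction m arbitrary: y X)
  case 0
  note y = 0(1)
  have q: "y \<in> quivers (Suc 0)" using y by (simp add: is_csol_def)
  note d = quiversD[OF q, of 0, simplified]
  have "quiver_lim (Suc 0) (\<lambda>_. y) y"
    using q d by (auto simp: quiver_lim_def intro!: mat_lim_const)
  moreover have "fst y 0 * snd y 0 = X t" if "\<forall>x. charfun (X t) x = (\<Prod>j<Suc 0. x + partial_sum (L t) j 0)" for t
  proof -
    have Xc: "X t \<in> carrier_mat 1 1" using mat_limD(2)[OF 0(3)] by simp
    have "charfun (X t) 0 = 0" using that by simp
    then have "det (X t) = 0" using charfun_0[OF Xc] by simp
    then have "X t $$ (0, 0) = 0" using det_single[OF Xc] by simp
    then show ?thesis
      using Xc d by (intro eq_matI) (auto simp: mult_mat_index simp del: index_mult_mat(1))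
  qed
  then have "eventually (\<lambda>t. is_csol (Suc 0) (L t) y \<and> fst y 0 * snd y 0 = X t) sequentially"
    using 0(5) q by (auto simp: is_csol_def elim!: eventually_mono)
  ultimately show ?case by (intro exI[of _ "\<lambda>_. y"] conjI)
next
  case (Suc m)
  let ?n = "Suc (Suc m)"
  have q: "y \<in> quivers ?n" using Suc.prems(1) by (simp add: is_csol_def)
  have lt: "m < ?n" "Suc m < ?n" by auto
  note d = quiversD[OF q lt(1)] quiversD[OF q lt(2)]
  define a b where "a = fst y (Suc m)" and "b = snd y (Suc m)"
  have ab: "a \<in> carrier_mat ?n (Suc m)" "b \<in> carrier_mat (Suc m) ?n" using d by (auto simp: a_def b_def)
  have Xc: "X t \<in> carrier_mat ?n ?n" for t using mat_limD(2)[OF Suc.prems(3)] .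
  \<comment> \<open>The factor with index \<open>Suc m\<close> of the prescribed product is
    \<open>x\<close> itself. Singularity is forced, since \<open>X t\<close> has to factor through a
    space of smaller dimension.\<close>
  have "det (X t) = 0" if "\<forall>x. charfun (X t) x = (\<Prod>j<?n. x + partial_sum (L t) j (Suc m))" for t
  proof -
    have "charfun (X t) 0 = 0" using that unfolding prod_partial_sum_Suc by simp
    then show ?thesis using charfun_0[OF Xc] by simp
  qed
  then have "eventually (\<lambda>t. det (X t) = 0) sequentially"
    using Suc.prems(5) by (auto elim: eventually_mono)
  then obtain A B where AB: "mat_lim ?n (Suc m) A a" "mat_lim (Suc m) ?n B b"
    "eventually (\<lambda>t. A t * B t = X t) sequentially"
    using product_perturbation[OF ab, of X] Suc.prems(2,3) unfolding a_def b_def kernel_cond_def by blast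
  note Ad = mat_limD[OF AB(1)] and Bd = mat_limD[OF AB(2)]
  \<comment> \<open>The moment map equation at this vertex, read as a prescription for the product
    one arrow below.\<close>
  define X' where "X' t = B t * A t + L t (Suc m) \<cdot>\<^sub>m 1\<^sub>m (Suc m)" for t
  have BAc: "B t * A t \<in> carrier_mat (Suc m) (Suc m)" for t using Ad Bd by auto
  define y' where "y' = (\<lambda>i\<in>{..<Suc m}. fst y i, \<lambda>i\<in>{..<Suc m}. snd y i)"
  have y's: "fst y' i = fst y i" "snd y' i = snd y i" if "i < Suc m" for i using that by (auto simp: y'_def)
  have q': "y' \<in> quivers (Suc m)"
    unfolding y'_def using quiversD(1,2)[OF q] by (intro quiversI) auto
  have y': "is_csol (Suc m) l y'"
    using Suc.prems(1) q' y's by (auto simp: is_csol_def muC_def)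
  have k': "kernel_cond (Suc m) y'"
    using Suc.prems(2) y's by (auto simp: kernel_cond_def)
  have "mat_lim (Suc m) (Suc m) X' (b * a + l (Suc m) \<cdot>\<^sub>m 1\<^sub>m (Suc m))"
    unfolding X'_def using AB Suc.prems(4)[of "Suc m"]
    by (intro mat_lim_add mat_lim_smult mat_lim_const mat_lim_mult[of _ ?n]) auto
  also have "b * a + l (Suc m) \<cdot>\<^sub>m 1\<^sub>m (Suc m) = fst y' m * snd y' m"
    unfolding a_def b_def csol_product[OF Suc.prems(1) lt(2)] using d y's[of m]
    by (intro eq_matI) (auto simp del: index_mult_mat(1))
  finally have X'l: "mat_lim (Suc m) (Suc m) X' (fst y' m * snd y' m)" .
  have "\<forall>x. charfun (X' t) x = (\<Prod>j<Suc m. x + partial_sum (L t) j m)"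
    if "\<forall>x. charfun (X t) x = (\<Prod>j<?n. x + partial_sum (L t) j (Suc m))" and "A t * B t = X t" for t
  proof
    \<comment> \<open>The root 0 introduced by the exchange of factors is cancelled; this is
      legitimate away from 0, and continuity supplies the value there.\<close>
    have "charfun (B t * A t) z = (\<Prod>j<Suc m. z + partial_sum (L t) j (Suc m))" for z
    proof (rule isCont_eq_at_0[of "charfun (B t * A t)" "\<lambda>z. \<Prod>j<Suc m. z + partial_sum (L t) j (Suc m)"])
      show "isCont (charfun (B t * A t)) 0" by (rule charfun_continuous[OF BAc])
      show "isCont (\<lambda>z. \<Prod>j<Suc m. z + partial_sum (L t) j (Suc m)) 0" by (intro continuous_intros)
      fix z :: complex assume "z \<noteq> 0"
      moreover have "z * charfun (B t * A t) z = z * (\<Prod>j<Suc m. z + partial_sum (L t) j (Suc m))"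
        using charfun_mult_commute[OF Ad(2)[of t] Bd(2)[of t], of z] that
        unfolding prod_partial_sum_Suc[of _ "L t" "Suc m"] by metis
      ultimately show "charfun (B t * A t) z = (\<Prod>j<Suc m. z + partial_sum (L t) j (Suc m))" by simp
    qed
    then show "charfun (X' t) x = (\<Prod>j<Suc m. x + partial_sum (L t) j m)" for x
      unfolding X'_def charfun_shift[OF BAc] by (auto intro!: prod.cong simp: partial_sum_Suc simp del: prod.lessThan_Suc)
  qed
  then have "eventually (\<lambda>t. \<forall>x. charfun (X' t) x = (\<Prod>j<Suc m. x + partial_sum (L t) j m)) sequentially"
    using eventually_conj[OF Suc.prems(5) AB(3)] by (auto elim: eventually_mono)
  from Suc.IH[OF y' k' X'l _ this] obtain Y where Y: "quiver_lim (Suc m) Y y'"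
    "eventually (\<lambda>t. is_csol (Suc m) (L t) (Y t) \<and> fst (Y t) m * snd (Y t) m = X' t) sequentially"
    using Suc.prems(4) by auto
  define Z where "Z t = (\<lambda>i\<in>{..<?n}. if i < Suc m then fst (Y t) i else A t,
    \<lambda>i\<in>{..<?n}. if i < Suc m then snd (Y t) i else B t)" for t
  have Yq: "Y t \<in> quivers (Suc m)" for t using Y(1) by (simp add: quiver_lim_def)
  have Zs: "fst (Z t) i = (if i < Suc m then fst (Y t) i else A t)"
    "snd (Z t) i = (if i < Suc m then snd (Y t) i else B t)" if "i < ?n" for t i
    using that by (auto simp: Z_def)
  have Zq: "Z t \<in> quivers ?n" for t
    unfolding Z_def using quiversD(1,2)[OF Yq] Ad(2) Bd(2)
    by (intro quiversI) (auto simp: less_Suc_eq)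
  have "quiver_lim ?n Z y"
    unfolding quiver_lim_def
  proof (intro conjI allI impI q Zq)
    fix i assume i: "i < ?n"
    show "mat_lim (Suc i) i (\<lambda>t. fst (Z t) i) (fst y i)" "mat_lim i (Suc i) (\<lambda>t. snd (Z t) i) (snd y i)"
      unfolding Zs[OF i]
      using Y(1) AB(1,2) i y's[of i] by (auto simp: quiver_lim_def a_def b_def less_Suc_eq)
  qed
  moreover have "is_csol ?n (L t) (Z t) \<and> fst (Z t) (Suc m) * snd (Z t) (Suc m) = X t"
    if t: "is_csol (Suc m) (L t) (Y t) \<and> fst (Y t) m * snd (Y t) m = X' t" "A t * B t = X t" for t
  proof -
    have "muC (Z t) i = L t (Suc i) \<cdot>\<^sub>m 1\<^sub>m (Suc i)" if i: "Suc i < ?n" for i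
    proof (cases "i = m")
      case True
      have "X' t - B t * A t = L t (Suc m) \<cdot>\<^sub>m 1\<^sub>m (Suc m)"
        unfolding X'_def using Ad Bd by (intro eq_matI) (auto simp del: index_mult_mat(1))
      then show ?thesis using True t by (simp add: muC_def Zs)
    next
      case False
      then show ?thesis using i t by (auto simp: muC_def Zs is_csol_def)
    qed
    then show ?thesis using Zq t by (simp add: is_csol_def Zs)
  qed
  then have "eventually (\<lambda>t. is_csol ?n (L t) (Z t) \<and> fst (Z t) (Suc m) * snd (Z t) (Suc m) = X t) sequentially"
    using eventually_conj[OF Y(2) AB(3)] by (auto elim: eventually_mono)
  ultimately show ?case by blast
qed

text \<open>Adding the same small \<open>s\<close> to every multiplier changes the sum over (j, k]
  by \<open>(k - j) * s\<close>. A sum that is nonzero stays so near the limit, and a sum that is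
  zero becomes nonzero at once, so all \<open>b_k a_k\<close> become invertible together. The top
  product must have the spectrum that the new multipliers dictate, which is arranged in a triangular
  form.\<close>

lemma regular_deformation:
  assumes y: "is_csol (Suc m) l y" and ker: "kernel_cond (Suc m) y"
  shows "\<exists>Y L. quiver_lim (Suc m) Y y \<and> eventually (\<lambda>t. is_csol (Suc m) (L t) (Y t) \<and>
    (\<forall>k<Suc m. det (snd (Y t) k * fst (Y t) k) \<noteq> 0)) sequentially"
proof -
  define s where "s t = complex_of_real (inverse (real (Suc t)))" for t
  have s0: "s t \<noteq> 0" for t unfolding s_def of_real_eq_0_iff by simp
  have sl: "s \<longlonglongrightarrow> 0"
  proof -
    have "(\<lambda>t. complex_of_real (inverse (real (Suc t)))) \<longlonglongrightarrow> complex_of_real 0"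
      by (intro tendsto_of_real LIMSEQ_inverse_real_of_nat)
    then show ?thesis unfolding s_def by simp
  qed
  define L where "L t k = l k + s t" for t k
  have Ll: "(\<lambda>t. L t k) \<longlonglongrightarrow> l k" for k
    unfolding L_def using tendsto_add[OF tendsto_const sl, of "l k"] by simp
  have q: "y \<in> quivers (Suc m)" using y by (simp add: is_csol_def)
  have m: "m < Suc m" by simp
  define X0 where "X0 = fst y m * snd y m"
  have X0: "X0 \<in> carrier_mat (Suc m) (Suc m)" using quiversD[OF q m] by (auto simp: X0_def)
  \<comment> \<open>The order of the list matters: it fixes which eigenvalue stands at which
    diagonal place of the Schur form, and hence by how much that place must move.\<close>
  define es where "es = map (\<lambda>j. - partial_sum l j m) [0..<Suc m]"
  have "poly (char_poly X0) x = poly (\<Prod>e\<leftarrow>es. [:- e, 1:]) x" for x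
  proof -
    have "poly (\<Prod>e\<leftarrow>es. [:- e, 1:]) x = (\<Prod>j\<leftarrow>[0..<Suc m]. x + partial_sum l j m)"
      by (simp add: es_def poly_prod_list o_def add.commute del: upt_Suc)
    also have "\<dots> = (\<Prod>j<Suc m. x + partial_sum l j m)"
      by (simp add: prod.distinct_set_conv_list[symmetric] atLeast0LessThan del: upt_Suc prod.lessThan_Suc)
    finally show ?thesis
      unfolding charfun_char_poly[OF X0] by (simp only: X0_def csol_charfun(1)[OF y m])
  qed
  then have cp: "char_poly X0 = (\<Prod>e\<leftarrow>es. [:- e, 1:])"
    using poly_eq_poly_eq_iff by blast
  obtain B P Q where "schur_decomposition X0 es = (B, P, Q)" by (cases "schur_decomposition X0 es") auto
  from schur_decomposition[OF X0 cp this] have BPQ: "similar_mat_wit X0 B P Q" "upper_triangular B" "diag_mat B = es"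
    by auto
  note PQ = similar_mat_witD2[OF X0 BPQ(1)]
  have Bdiag: "B $$ (j, j) = - partial_sum l j m" if "j < Suc m" for j
  proof -
    have "diag_mat B ! j = B $$ (j, j)" using that PQ by (simp add: diag_mat_def del: upt_Suc)
    then show ?thesis unfolding BPQ(3) using that by (simp add: es_def del: upt_Suc)
  qed
  \<comment> \<open>The sum over (j, m] gains one \<open>s\<close> per summand, and eigenvalues are
    the negatives of these sums.\<close>
  define D where "D = mat_diag (Suc m) (\<lambda>j. - complex_of_nat (m - j))"
  have D: "D \<in> carrier_mat (Suc m) (Suc m)" by (simp add: D_def)
  define X where "X t = P * (B + s t \<cdot>\<^sub>m D) * Q" for t
  have "mat_lim (Suc m) (Suc m) X (P * (B + 0 \<cdot>\<^sub>m D) * Q)"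
    unfolding X_def using PQ D sl
    by (intro mat_lim_mult[of _ "Suc m"] mat_lim_add mat_lim_smult mat_lim_const) auto
  also have "B + 0 \<cdot>\<^sub>m D = B" using PQ D by (intro eq_matI) auto
  finally have Xl: "mat_lim (Suc m) (Suc m) X (fst y m * snd y m)"
    using PQ by (simp add: X0_def)
  have "charfun (X t) x = (\<Prod>j<Suc m. x + partial_sum (L t) j m)" for t x
  proof -
    have ut: "upper_triangular (B + s t \<cdot>\<^sub>m D)"
      using BPQ(2) PQ D by (auto simp: upper_triangular_def D_def mat_diag_def)
    have c: "B + s t \<cdot>\<^sub>m D \<in> carrier_mat (Suc m) (Suc m)" using PQ D by auto
    have "charfun (X t) x = charfun (B + s t \<cdot>\<^sub>m D) x"
      unfolding X_def by (rule charfun_similar[OF c]) (use PQ in auto)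
    also have "\<dots> = (\<Prod>j<Suc m. x + partial_sum (L t) j m)"
      unfolding charfun_upper_triangular[OF c ut]
    proof (rule prod.cong)
      fix j assume "j \<in> {..<Suc m}"
      then have j: "j < Suc m" by simp
      have "(B + s t \<cdot>\<^sub>m D) $$ (j, j) = - partial_sum l j m - s t * of_nat (m - j)"
        using j PQ D Bdiag[OF j] by (simp add: D_def mat_diag_def algebra_simps)
      then show "x - (B + s t \<cdot>\<^sub>m D) $$ (j, j) = x + partial_sum (L t) j m"
        by (simp add: partial_sum_def L_def sum.distrib)
    qed simp
    finally show ?thesis .
  qed
  then have "eventually (\<lambda>t. \<forall>x. charfun (X t) x = (\<Prod>j<Suc m. x + partial_sum (L t) j m)) sequentially"
    by simp
  from lift_deformation[OF y ker Xl Ll this] obtain Y where Y: "quiver_lim (Suc m) Y y"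
    "eventually (\<lambda>t. is_csol (Suc m) (L t) (Y t) \<and> fst (Y t) m * snd (Y t) m = X t) sequentially" by blast
  have "eventually (\<lambda>t. partial_sum (L t) j k \<noteq> 0) sequentially" if "j < k" for j k
  proof (cases "partial_sum l j k = 0")
    case True
    have "partial_sum (L t) j k = of_nat (k - j) * s t" for t
      using True by (simp add: partial_sum_def L_def sum.distrib)
    then show ?thesis using that s0 by simp
  next
    case False
    have "(\<lambda>t. partial_sum (L t) j k) \<longlonglongrightarrow> partial_sum l j k"
      unfolding partial_sum_def by (intro tendsto_sum Ll)
    then show ?thesis using False by (rule tendsto_imp_eventually_ne)
  qed
  then have "eventually (\<lambda>t. \<forall>k\<in>{..m}. \<forall>j\<in>{..<k}. partial_sum (L t) j k \<noteq> 0) sequentially"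
    by (intro eventually_ball_finite ballI) auto
  with Y(2) have "eventually (\<lambda>t. is_csol (Suc m) (L t) (Y t) \<and>
      (\<forall>k<Suc m. det (snd (Y t) k * fst (Y t) k) \<noteq> 0)) sequentially"
  proof eventually_elim
    case (elim t)
    have "det (snd (Y t) k * fst (Y t) k) \<noteq> 0" if k: "k < Suc m" for k
    proof -
      have Yt: "is_csol (Suc m) (L t) (Y t)" using elim by simp
      then have Yq: "Y t \<in> quivers (Suc m)" by (simp add: is_csol_def)
      have "charfun (snd (Y t) k * fst (Y t) k) 0 \<noteq> 0"
        unfolding csol_charfun(2)[OF Yt k] using elim(2) k by (simp add: prod_zero_iff)
      then show ?thesis using charfun_0[of "snd (Y t) k * fst (Y t) k" k] quiversD[OF Yq k] by auto
    qed
    then show ?case using elim by blast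
  qed
  then show ?thesis using Y(1) by blast
qed


section \<open>Kernels after a generic rotation\<close>

text \<open>The orthogonal projection onto the kernel. Its rank is recorded as a trace, because
  dimensions enter the argument only through traces of scalar matrices.\<close>

definition kernel_projection :: "complex mat \<Rightarrow> complex mat \<Rightarrow> nat \<Rightarrow> bool" where
  "kernel_projection M P e \<longleftrightarrow> P \<in> carrier_mat (dim_col M) (dim_col M) \<and> adj P = P \<and> P * P = P \<and>
     mtr P = of_nat e \<and> e \<le> dim_col M \<and> M * P = 0\<^sub>m (dim_row M) (dim_col M) \<and>
     (\<forall>v. dim_row v = dim_col M \<longrightarrow> M * v = 0\<^sub>m (dim_row M) (dim_col v) \<longrightarrow> P * v = v)"

text \<open>The spectral projection of \<open>adj M * M\<close> for the eigenvalue 0; a vector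
  killed by this product is killed by \<open>M\<close>.\<close>

lemma kernel_projection_exists: "\<exists>P e. kernel_projection M P e"
proof -
  define n where "n = dim_col M"
  have [simp]: "dim_col M = n" by (simp add: n_def)
  have "adj M * M \<in> carrier_mat n n" "adj (adj M * M) = adj M * M"
    by (auto simp: adj_mult intro: carrier_matI)
  from spectral_theorem[OF this] obtain R d where R: "unitary n R"
    "adj M * M = R * mat_diag n (\<lambda>i. complex_of_real (d i)) * adj R" by blast
  note Rd = unitaryD[OF R(1)]
  note [simp] = Rd(2,3)
  define D where "D = mat_diag n (\<lambda>i. complex_of_real (d i))"
  define I where "I = {i. i < n \<and> d i = 0}"
  define Q where "Q = coord_proj n I"
  have [simp]: "dim_row D = n" "dim_col D = n" "dim_row Q = n" "dim_col Q = n"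
    by (auto simp: D_def Q_def mat_diag_def)
  have QQ: "Q * Q = Q" "adj Q = Q" by (auto simp: Q_def coord_proj_idem)
  have DQ: "D * Q = 0\<^sub>m n n"
    by (rule eq_matI) (simp_all add: Q_def mult_coord_proj_index del: index_mult_mat(1), auto simp: D_def mat_diag_def I_def)
  define P where "P = R * (Q * adj R)"
  have [simp]: "dim_row P = n" "dim_col P = n" by (auto simp: P_def)
  have "P * P = R * ((Q * Q) * adj R)"
    by (simp add: P_def mat_assoc unitary_cancel[OF R(1)])
  then have PP: "P * P = P" unfolding QQ P_def .
  have aP: "adj P = P" by (simp add: P_def adj_mult QQ mat_assoc)
  have "mtr P = mtr ((Q * adj R) * R)"
    unfolding P_def by (rule mtr_commute[of _ n n]) (auto intro: carrier_matI)
  also have "(Q * adj R) * R = Q" by (simp add: mat_assoc Rd(4) mat_one_right)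
  also have "mtr Q = of_nat (card I)"
    by (auto simp: mtr_def Q_def coord_proj_def mat_diag_def I_def sum.If_cases Int_def)
  finally have tP: "mtr P = of_nat (card I)" .
  have "card I \<le> card {..<n}" by (rule card_mono) (auto simp: I_def)
  then have cI: "card I \<le> n" by simp
  have "adj (M * P) * (M * P) = P * ((adj M * M) * P)" by (simp add: adj_mult aP mat_assoc)
  also have "(adj M * M) * P = R * ((D * Q) * adj R)"
    unfolding R(2) D_def[symmetric] P_def by (simp add: mat_assoc unitary_cancel[OF R(1)])
  finally have "adj (M * P) * (M * P) = 0\<^sub>m n n" unfolding DQ by simp
  then have MP: "M * P = 0\<^sub>m (dim_row M) n" using adj_mult_eq_0[of "M * P"] by simp
  have "P * v = v" if v: "dim_row v = n" "M * v = 0\<^sub>m (dim_row M) (dim_col v)" for v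
  proof -
    have "(adj M * M) * v = 0\<^sub>m n (dim_col v)" using v by (simp add: mat_assoc)
    then have "adj R * (R * (D * (adj R * v))) = 0\<^sub>m n (dim_col v)"
      unfolding R(2) D_def[symmetric] using v(1) by (simp add: mat_assoc)
    then have Dv: "D * (adj R * v) = 0\<^sub>m n (dim_col v)"
      using v(1) by (simp add: unitary_cancel[OF R(1)])
    have "Q * (adj R * v) = adj R * v"
    proof (rule eq_matI)
      fix i j assume "i < dim_row (adj R * v)" "j < dim_col (adj R * v)"
      then have ij: "i < n" "j < dim_col v" by auto
      have "D * (adj R * v) = mat n (dim_col v) (\<lambda>(i, j). complex_of_real (d i) * (adj R * v) $$ (i, j))"
        unfolding D_def by (rule mat_diag_mult_left) (use v(1) in \<open>auto intro: carrier_matI\<close>)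
      then have "complex_of_real (d i) * (adj R * v) $$ (i, j) = 0"
        using arg_cong[OF Dv, of "\<lambda>M. M $$ (i, j)"] ij by (simp del: index_mult_mat(1))
      then show "(Q * (adj R * v)) $$ (i, j) = (adj R * v) $$ (i, j)"
        using ij by (auto simp: Q_def coord_proj_mult_index I_def simp del: index_mult_mat(1))
    qed (use v(1) in auto)
    then show ?thesis using v(1) by (simp add: P_def mat_assoc unitary_cancel[OF R(1)])
  qed
  then show ?thesis
    unfolding kernel_projection_def using PP aP tP cI MP
    by (intro exI[of _ P] exI[of _ "card I"]) (auto intro: carrier_matI)
qed

text \<open>The recursion counts factors because their indices decrease from k; with
  \<open>Suc k - j\<close> factors the product ends in \<open>a j\<close>.\<close>

primrec chain :: "(nat \<Rightarrow> complex mat) \<Rightarrow> nat \<Rightarrow> nat \<Rightarrow> complex mat" where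
  "chain a k 0 = 1\<^sub>m (Suc k)"
| "chain a k (Suc m) = chain a k m * a (k - m)"

lemma mtr_diff_dim:
  "dim_row A = dim_row B \<Longrightarrow> dim_col B = dim_row B \<Longrightarrow> mtr (A - B) = mtr A - mtr B"
  by (simp add: mtr_def sum_subtractf)

lemma sum_atLeast1_shift: "(\<Sum>j=1..k. f j) = (\<Sum>j<k. f (Suc j))" for f :: "nat \<Rightarrow> 'a :: comm_monoid_add"
  by (rule sum.reindex_bij_witness[of _ Suc "\<lambda>j. j - 1"]) auto

text \<open>The kernels of \<open>a_k \<dots> a_j\<close> form a subrepresentation without framing; its orthogonal projections
  are \<open>P j\<close>. Traces over it show that it is orthogonal to the image of \<open>b_k\<close>.\<close>

lemma kernel_orthogonal:
  assumes yC: "is_csol n l y" and yR: "is_rsol n r y" and k: "k < n"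
    and gen: "\<And>e :: nat \<Rightarrow> nat. (\<And>j. e j \<le> j) \<Longrightarrow> (\<Sum>j=1..k. l j * of_nat (e j)) = 0 \<Longrightarrow>
      (\<Sum>j=1..k. r j * of_nat (e j)) = 0"
    and v: "v \<in> carrier_mat k 1" "fst y k * v = 0\<^sub>m (Suc k) 1"
  shows "adj (snd y k) * v = 0\<^sub>m (Suc k) 1"
proof -
  have q: "y \<in> quivers n" using yC by (simp add: is_csol_def)
  define a b where "a = fst y" and "b = snd y"
  have d: "dim_row (a j) = Suc j" "dim_col (a j) = j" "dim_row (b j) = j" "dim_col (b j) = Suc j"
    if "j \<le> k" for j
    using quiversD[OF q, of j] that k by (auto simp: a_def b_def)
  define C where "C j = chain a k (Suc k - j)" for j
  have Ck: "C (Suc k) = 1\<^sub>m (Suc k)" by (simp add: C_def)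
  have CS: "C j = C (Suc j) * a j" if "j \<le> k" for j
    using that by (simp add: C_def Suc_diff_le)
  have Cd: "dim_row (C j) = Suc k \<and> dim_col (C j) = j" if "j \<le> Suc k" for j
    using that by (induction rule: inc_induct) (simp_all add: Ck CS d)
  have "\<forall>j. \<exists>P e. kernel_projection (C j) P e" by (intro allI kernel_projection_exists)
  then obtain P e where "\<And>j. kernel_projection (C j) (P j) (e j)" by metis
  then have Pk: "P j \<in> carrier_mat j j" "adj (P j) = P j" "P j * P j = P j" "mtr (P j) = of_nat (e j)"
      "e j \<le> j" "C j * P j = 0\<^sub>m (Suc k) j"
      "dim_row w = j \<Longrightarrow> C j * w = 0\<^sub>m (Suc k) (dim_col w) \<Longrightarrow> P j * w = w"
    if "j \<le> Suc k" for j w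
    using Cd[OF that] unfolding kernel_projection_def by metis+
  have Pd: "dim_row (P j) = j" "dim_col (P j) = j" if "j \<le> Suc k" for j using Pk(1)[OF that] by auto
  \<comment> \<open>The subrepresentation is zero at the vertex above arrow k, which ends both
    telescoping sums below.\<close>
  have P1: "P (Suc k) = 0\<^sub>m (Suc k) (Suc k)"
    using Pk(6)[of "Suc k"] Pd[of "Suc k"] by (simp add: Ck mat_one_left)
  have rel: "a j * b j = b (Suc j) * a (Suc j) + l (Suc j) \<cdot>\<^sub>m 1\<^sub>m (Suc j)" if "j < k" for j
  proof -
    have j: "Suc j < n" using that k by simp
    have jk: "j \<le> k" "Suc j \<le> k" using that by auto
    show ?thesis
      unfolding a_def b_def csol_product[OF yC j]
      using d[OF jk(1)] d[OF jk(2)]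
      by (intro eq_matI) (auto simp: a_def b_def simp del: index_mult_mat(1))
  qed
  \<comment> \<open>Pulling \<open>b j\<close> through the composition by the moment map equation
    leaves a left multiple of the shorter composition. Hence \<open>b j\<close> maps the kernel at
    vertex j + 1 into the kernel at vertex j.\<close>
  have CB: "\<exists>W\<in>carrier_mat (Suc k) (Suc k). C j * b j = W * C (Suc j)" if "j \<le> k" for j
    using that
  proof (induction rule: inc_induct)
    case base
    show ?case
      by (rule bexI[of _ "a k * b k"]) (use d[of k] CS[of k] in \<open>auto simp: Ck mat_assoc mat_one_left mat_one_right intro: carrier_matI\<close>)
  next
    case (step j)
    then obtain W where W: "W \<in> carrier_mat (Suc k) (Suc k)" "C (Suc j) * b (Suc j) = W * C (Suc (Suc j))" by auto
    have jk: "j \<le> k" "Suc j \<le> k" "j < k" using step by auto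
    note dd = d[OF jk(1)] d[OF jk(2)] Cd[of "Suc j"] Cd[of "Suc (Suc j)"] jk
    have "C j * b j = C (Suc j) * (b (Suc j) * a (Suc j) + l (Suc j) \<cdot>\<^sub>m 1\<^sub>m (Suc j))"
      unfolding rel[OF jk(3), symmetric] using CS[OF jk(1)] dd by (simp add: mat_assoc)
    also have "\<dots> = (C (Suc j) * b (Suc j)) * a (Suc j) + l (Suc j) \<cdot>\<^sub>m C (Suc j)"
      using dd by (simp add: mat_distrib)
    also have "\<dots> = W * (C (Suc (Suc j)) * a (Suc j)) + l (Suc j) \<cdot>\<^sub>m C (Suc j)"
      unfolding W(2) using W(1) dd by (simp add: mat_assoc)
    also have "\<dots> = (W + l (Suc j) \<cdot>\<^sub>m 1\<^sub>m (Suc k)) * C (Suc j)"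
      unfolding CS[OF jk(2), symmetric] using W(1) dd by (simp add: mat_distrib)
    finally show ?case using W(1) by (intro bexI[of _ "W + l (Suc j) \<cdot>\<^sub>m 1\<^sub>m (Suc k)"]) auto
  qed
  have Pa: "P (Suc j) * (a j * P j) = a j * P j" if j: "j \<le> k" for j
  proof (rule Pk(7))
    have j': "j \<le> Suc k" "Suc j \<le> Suc k" using j by auto
    have "C (Suc j) * (a j * P j) = (C (Suc j) * a j) * P j"
      using d[OF j] Pd[OF j'(1)] Cd[OF j'(2)] by (simp add: mat_assoc)
    then show "C (Suc j) * (a j * P j) = 0\<^sub>m (Suc k) (dim_col (a j * P j))"
      using CS[OF j] Pk(6)[OF j'(1)] Pd[OF j'(1)] by simp
  qed (use j d[OF j] in auto)
  have Pb: "P j * (b j * P (Suc j)) = b j * P (Suc j)" if j: "j \<le> k" for j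
  proof (rule Pk(7))
    have j': "j \<le> Suc k" "Suc j \<le> Suc k" using j by auto
    obtain W where W: "W \<in> carrier_mat (Suc k) (Suc k)" "C j * b j = W * C (Suc j)" using CB[OF j] by blast
    have "C j * (b j * P (Suc j)) = (C j * b j) * P (Suc j)"
      using d[OF j] Pd[OF j'(2)] Cd[OF j'(1)] by (simp add: mat_assoc)
    also have "\<dots> = W * (C (Suc j) * P (Suc j))"
      unfolding W(2) using W(1) d[OF j] Pd[OF j'(2)] Cd[OF j'(2)] by (simp add: mat_assoc)
    also have "\<dots> = 0\<^sub>m (Suc k) (dim_col (b j * P (Suc j)))"
      unfolding Pk(6)[OF j'(2)] using W(1) Pd[OF j'(2)] by simp
    finally show "C j * (b j * P (Suc j)) = 0\<^sub>m (Suc k) (dim_col (b j * P (Suc j)))" .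
  qed (use j d[OF j] in auto)
  note cM = carrier_matI
  have tcyc: "mtr (X * Y) = mtr (Y * X)" if "dim_row X = dim_col Y" "dim_row Y = dim_col X" for X Y
    by (rule mtr_commute[of _ "dim_row X" "dim_col X"]) (use that in \<open>auto intro: carrier_matI\<close>)
  \<comment> \<open>The trace of an arrow pair over the subrepresentation. Invariance makes it
    computable at either end of the arrow, so the traces of the complex moment map
    telescope.\<close>
  define S where "S j = mtr (P j * (b j * (P (Suc j) * a j)))" for j
  have S1: "mtr (P (Suc j) * (a j * b j)) = S j" and S2: "mtr (P j * (b j * a j)) = S j" if j: "j \<le> k" for j
  proof -
    have j': "j \<le> Suc k" "Suc j \<le> Suc k" using j by auto
    note dd = d[OF j] Pd[OF j'(1)] Pd[OF j'(2)]
    have "mtr (P (Suc j) * (a j * b j)) = mtr ((P (Suc j) * P (Suc j)) * (a j * b j))"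
      unfolding Pk(3)[OF j'(2)] ..
    also have "\<dots> = mtr (P (Suc j) * (P (Suc j) * (a j * b j)))" using dd by (simp add: mat_assoc)
    also have "\<dots> = mtr ((P (Suc j) * (a j * b j)) * P (Suc j))" by (rule tcyc) (use dd in auto)
    also have "\<dots> = mtr (P (Suc j) * (a j * (b j * P (Suc j))))" using dd by (simp add: mat_assoc)
    also have "\<dots> = mtr (P (Suc j) * (a j * (P j * (b j * P (Suc j)))))" unfolding Pb[OF j] ..
    also have "\<dots> = mtr ((P (Suc j) * a j) * (P j * (b j * P (Suc j))))" using dd by (simp add: mat_assoc)
    also have "\<dots> = mtr ((P j * (b j * P (Suc j))) * (P (Suc j) * a j))" by (rule tcyc) (use dd in auto)
    also have "\<dots> = mtr (P j * (b j * ((P (Suc j) * P (Suc j)) * a j)))" using dd by (simp add: mat_assoc)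
    finally show "mtr (P (Suc j) * (a j * b j)) = S j" unfolding Pk(3)[OF j'(2)] S_def .
    have "mtr (P j * (b j * a j)) = mtr ((P j * P j) * (b j * a j))"
      unfolding Pk(3)[OF j'(1)] ..
    also have "\<dots> = mtr (P j * (P j * (b j * a j)))" using dd by (simp add: mat_assoc)
    also have "\<dots> = mtr ((P j * (b j * a j)) * P j)" by (rule tcyc) (use dd in auto)
    also have "\<dots> = mtr (P j * (b j * (a j * P j)))" using dd by (simp add: mat_assoc)
    also have "\<dots> = mtr (P j * (b j * (P (Suc j) * (a j * P j))))" unfolding Pa[OF j] ..
    also have "\<dots> = mtr ((P j * (b j * (P (Suc j) * a j))) * P j)" using dd by (simp add: mat_assoc)
    also have "\<dots> = mtr (P j * (P j * (b j * (P (Suc j) * a j))))" by (rule tcyc) (use dd in auto)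
    also have "\<dots> = mtr ((P j * P j) * (b j * (P (Suc j) * a j)))" using dd by (simp add: mat_assoc)
    finally show "mtr (P j * (b j * a j)) = S j" unfolding Pk(3)[OF j'(1)] S_def .
  qed
  have trl: "l (Suc j) * of_nat (e (Suc j)) = S j - S (Suc j)" if j: "j < k" for j
  proof -
    have jk: "j \<le> k" "Suc j \<le> k" "Suc j \<le> Suc k" using j by auto
    note dd = d[OF jk(1)] d[OF jk(2)] Pd[OF jk(3)]
    have "P (Suc j) * (a j * b j) = P (Suc j) * (b (Suc j) * a (Suc j)) + l (Suc j) \<cdot>\<^sub>m P (Suc j)"
      unfolding rel[OF j] using dd by (simp add: mat_distrib)
    then have "S j = mtr (P (Suc j) * (b (Suc j) * a (Suc j)) + l (Suc j) \<cdot>\<^sub>m P (Suc j))"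
      unfolding S1[OF jk(1), symmetric] by simp
    also have "\<dots> = S (Suc j) + l (Suc j) * of_nat (e (Suc j))"
      unfolding S2[OF jk(2), symmetric] using dd Pk(4)[OF jk(3)] Pk(1)[OF jk(3)]
      by (subst mtr_add[of _ "Suc j"]) (auto simp: mtr_smult intro: carrier_matI)
    finally show ?thesis by simp
  qed
  have S0: "S 0 = 0" using Pd[of 0] by (simp add: S_def mtr_def)
  have Sk: "S k = 0" using d[of k] Pd[of k] by (simp add: S_def P1 mtr_def)
  \<comment> \<open>The genericity hypothesis asks for a bound at every index, while the dimension
    bound is available only up to k + 1; hence the cutoff.\<close>
  define e' where "e' j = (if j \<le> k then e j else 0)" for j
  have e'le: "e' j \<le> j" for j using Pk(5)[of j] by (simp add: e'_def)
  have "(\<Sum>j=1..k. l j * of_nat (e' j)) = (\<Sum>j<k. l (Suc j) * of_nat (e (Suc j)))"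
    unfolding sum_atLeast1_shift by (rule sum.cong) (auto simp: e'_def)
  also have "\<dots> = (\<Sum>j<k. S j - S (Suc j))" using trl by simp
  also have "\<dots> = S 0 - S k" by (induction k) simp_all
  finally have "(\<Sum>j=1..k. r j * of_nat (e' j)) = 0" using S0 Sk by (intro gen e'le) simp
  then have re0: "(\<Sum>j<k. r (Suc j) * of_nat (e (Suc j))) = 0"
    unfolding sum_atLeast1_shift by (simp add: e'_def)
  \<comment> \<open>Contributions of arrow j to the trace of the real moment map over the
    subrepresentation: \<open>p j\<close> at its upper vertex and \<open>m j\<close> at its lower
    one.\<close>
  define p where "p j = sqnorm (P (Suc j) * a j) - sqnorm (b j * P (Suc j))" for j
  define m where "m j = sqnorm (P j * b j) - sqnorm (a j * P j)" for j
  have tn1: "mtr (Q * (X * adj X)) = of_real (sqnorm (Q * X))"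
    if "adj Q = Q" "Q * Q = Q" "dim_row Q = dim_row X" for Q X
  proof -
    have Qc: "dim_col Q = dim_row X" using that(1,3) by (metis dim_adj(1))
    have "mtr (Q * (X * adj X)) = mtr ((Q * Q) * (X * adj X))" unfolding that(2) ..
    also have "\<dots> = mtr (Q * (Q * (X * adj X)))" using that(3) Qc by (simp add: mat_assoc)
    also have "\<dots> = mtr ((Q * (X * adj X)) * Q)" by (rule tcyc) (use that(3) Qc in auto)
    also have "\<dots> = mtr ((Q * X) * adj (Q * X))"
      using that(1,3) Qc by (simp add: adj_mult mat_assoc)
    finally show ?thesis by (simp add: mtr_mult_adj)
  qed
  have tn2: "mtr (Q * (adj X * X)) = of_real (sqnorm (X * Q))"
    if "adj Q = Q" "Q * Q = Q" "dim_row Q = dim_col X" for Q X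
  proof -
    have "dim_col Q = dim_col X" using that(1,3) by (metis dim_adj(1))
    then have "adj (Q * adj X) = X * Q" using that by (simp add: adj_mult)
    then have "sqnorm (Q * adj X) = sqnorm (X * Q)" by (metis sqnorm_adj)
    then show ?thesis using tn1[OF that(1,2), of "adj X"] that(3) by simp
  qed
  have trr: "r (Suc j) * of_nat (e (Suc j)) = p j + m (Suc j)" if j: "j < k" for j
  proof -
    have jk: "j \<le> k" "Suc j \<le> k" "Suc j \<le> Suc k" using j by auto
    note dd = d[OF jk(1)] d[OF jk(2)] Pd[OF jk(3)]
    have jn: "Suc j < n" using j k by simp
    have mu: "muR y j = complex_of_real (r (Suc j)) \<cdot>\<^sub>m 1\<^sub>m (Suc j)" using yR jn by (simp add: is_rsol_def)
    have "of_real (r (Suc j) * of_nat (e (Suc j))) = mtr (P (Suc j) * muR y j)"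
      unfolding mu using dd Pk(4)[OF jk(3)] Pk(1)[OF jk(3)] by (simp add: mat_distrib mtr_smult)
    also have "P (Suc j) * muR y j = P (Suc j) * (a j * adj (a j)) - P (Suc j) * (adj (b j) * b j)
        + P (Suc j) * (b (Suc j) * adj (b (Suc j))) - P (Suc j) * (adj (a (Suc j)) * a (Suc j))"
      unfolding muR_def a_def[symmetric] b_def[symmetric] using dd by (simp add: mat_distrib)
    also have "mtr \<dots> = mtr (P (Suc j) * (a j * adj (a j))) - mtr (P (Suc j) * (adj (b j) * b j))
        + mtr (P (Suc j) * (b (Suc j) * adj (b (Suc j)))) - mtr (P (Suc j) * (adj (a (Suc j)) * a (Suc j)))"
      using dd by (subst mtr_diff[of _ "Suc j"] mtr_add[of _ "Suc j"]; (intro carrier_matI; simp)?)+ simp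
    also have "\<dots> = of_real (p j + m (Suc j))"
      using tn1[OF Pk(2,3)[OF jk(3)], of "a j"] tn1[OF Pk(2,3)[OF jk(3)], of "b (Suc j)"]
        tn2[OF Pk(2,3)[OF jk(3)], of "b j"] tn2[OF Pk(2,3)[OF jk(3)], of "a (Suc j)"] dd
      by (simp add: p_def m_def)
    finally show ?thesis unfolding of_real_eq_iff .
  qed
  have pyth: "sqnorm (X * Q) \<le> sqnorm X"
    if "adj Q = Q" "Q * Q = Q" "dim_row Q = dim_col X" for Q X
  proof -
    have Qc: "dim_col Q = dim_col X" using that(1,3) by (metis dim_adj(1))
    define Y where "Y = X - X * Q"
    have "adj Y * Y = adj X * X - Q * (adj X * X) - (adj X * (X * Q) - Q * (adj X * (X * Q)))"
      using that Qc by (simp add: Y_def adj_simps mat_distrib)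
    then have "mtr (adj Y * Y) = mtr (adj X * X) - mtr (Q * (adj X * X)) - (mtr (adj X * (X * Q)) - mtr (Q * (adj X * (X * Q))))"
      using that(3) Qc by (simp add: mtr_diff_dim)
    moreover have "mtr (adj X * (X * Q)) = mtr (Q * (adj X * X))"
    proof -
      have "mtr (adj X * (X * Q)) = mtr ((adj X * X) * Q)" using that(3) by (simp add: mat_assoc)
      also have "\<dots> = mtr (Q * (adj X * X))" by (rule tcyc) (use that(3) Qc in auto)
      finally show ?thesis .
    qed
    moreover have "mtr (Q * (adj X * (X * Q))) = mtr (Q * (adj X * X))"
    proof -
      have "mtr (Q * (adj X * (X * Q))) = mtr ((Q * (adj X * X)) * Q)" using that(3) Qc by (simp add: mat_assoc)
      also have "\<dots> = mtr (Q * (Q * (adj X * X)))" by (rule tcyc) (use that(3) Qc in auto)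
      also have "\<dots> = mtr ((Q * Q) * (adj X * X))" using that(3) Qc by (simp add: mat_assoc)
      finally show ?thesis unfolding that(2) .
    qed
    ultimately have "complex_of_real (sqnorm Y) = of_real (sqnorm X - sqnorm (X * Q))"
      using tn2[OF that] by (simp add: mtr_adj_mult)
    then have "sqnorm Y = sqnorm X - sqnorm (X * Q)" unfolding of_real_eq_iff .
    then show ?thesis using sqnorm_nonneg[of Y] by simp
  qed
  \<comment> \<open>Since \<open>a j\<close> and \<open>b j\<close> preserve the kernels,
    \<open>a j * P j\<close> is a compression of \<open>P (Suc j) * a j\<close>, and similarly for
    \<open>b j\<close>; so the two ends of an arrow contribute non-negatively in total.\<close>
  have pm: "p j + m j \<ge> 0" if j: "j \<le> k" for j
  proof -
    have j': "j \<le> Suc k" "Suc j \<le> Suc k" using j by auto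
    note dd = d[OF j] Pd[OF j'(1)] Pd[OF j'(2)]
    have "sqnorm (a j * P j) = sqnorm ((P (Suc j) * a j) * P j)"
      using Pa[OF j] dd by (simp add: mat_assoc)
    also have "\<dots> \<le> sqnorm (P (Suc j) * a j)"
      by (rule pyth[OF Pk(2,3)[OF j'(1)]]) (use dd in auto)
    finally have 1: "sqnorm (a j * P j) \<le> sqnorm (P (Suc j) * a j)" .
    have "sqnorm (b j * P (Suc j)) = sqnorm ((P j * b j) * P (Suc j))"
      using Pb[OF j] dd by (simp add: mat_assoc)
    also have "\<dots> \<le> sqnorm (P j * b j)"
      by (rule pyth[OF Pk(2,3)[OF j'(2)]]) (use dd in auto)
    finally show ?thesis using 1 by (simp add: p_def m_def)
  qed
  have m0: "m 0 = 0" using d[of 0] Pd[of 0] by (simp add: m_def sqnorm_def)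
  have pk: "p k = 0" using d[of k] by (simp add: p_def P1 sqnorm_def)
  have "(\<Sum>j<k. p j + m (Suc j)) = 0" using re0 trr by simp
  moreover have "(\<Sum>j<k. p j + m (Suc j)) = (\<Sum>j<k. p j + m j) + m k - m 0" for k
    by (induction k) simp_all
  ultimately have "(\<Sum>j<k. p j + m j) + m k = 0" using m0 by simp
  moreover have "(\<Sum>j<k. p j + m j) \<ge> 0" by (rule sum_nonneg) (use pm in auto)
  moreover have "m k \<ge> 0" using pm[of k] pk by simp
  \<comment> \<open>A sum of non-negative terms vanishes. At arrow k only \<open>m k\<close> is
    left; as \<open>a k * P k = 0\<close>, it equals the squared norm of \<open>P k * b k\<close>,
    the part of \<open>b k\<close> with values in the kernel of \<open>a k\<close>.\<close>
  ultimately have mk: "m k = 0" by simp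
  have "sqnorm (P (Suc k) * a k) = 0" using d[of k] by (simp add: P1 sqnorm_def)
  moreover have "sqnorm (a k * P k) \<le> sqnorm (P (Suc k) * a k)"
  proof -
    have "sqnorm (a k * P k) = sqnorm ((P (Suc k) * a k) * P k)"
      using Pa[of k] d[of k] Pd[of k] Pd[of "Suc k"] by (simp add: mat_assoc)
    also have "\<dots> \<le> sqnorm (P (Suc k) * a k)"
      by (rule pyth[OF Pk(2,3)[of k]]) (use d[of k] Pd[of k] Pd[of "Suc k"] in auto)
    finally show ?thesis .
  qed
  ultimately have "sqnorm (a k * P k) = 0" using sqnorm_nonneg[of "a k * P k"] by linarith
  then have "sqnorm (P k * b k) = 0" using mk by (simp add: m_def)
  then have Pb0: "P k * b k = 0\<^sub>m k (Suc k)" using sqnorm_eq_0[of "P k * b k"] d[of k] Pd[of k] by simp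
  have "P k * v = v"
    using v d[of k] CS[of k] by (intro Pk(7)) (auto simp: Ck a_def mat_one_left)
  then have "adj (b k) * v = adj (b k) * (P k * v)" by simp
  also have "\<dots> = adj (P k * b k) * v"
    using d[of k] Pd[of k] Pk(2)[of k] v(1) by (simp add: adj_mult mat_assoc)
  also have "\<dots> = 0\<^sub>m (Suc k) 1" unfolding Pb0 using v(1) by simp
  finally show ?thesis by (simp add: b_def)
qed

section \<open>Generic multipliers\<close>

text \<open>\<open>e\<close> ranges over all possible dimension vectors. The complex trace over a
  subrepresentation vanishes automatically; the condition transfers this to the real trace, which
  carries the norms.\<close>

definition generic_params :: "nat \<Rightarrow> (nat \<Rightarrow> complex) \<Rightarrow> (nat \<Rightarrow> real) \<Rightarrow> bool" where
  "generic_params n l r \<longleftrightarrow> (\<forall>k<n. \<forall>e :: nat \<Rightarrow> nat. (\<forall>j. e j \<le> j) \<longrightarrow>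
     (\<Sum>j=1..k. l j * of_nat (e j)) = 0 \<longrightarrow> (\<Sum>j=1..k. r j * of_nat (e j)) = 0)"

text \<open>One inclusion of kernels is \<open>kernel_orthogonal\<close>. The other is the same
  statement after rotation by \<open>(0, 1)\<close>, which exchanges \<open>a\<close> and
  \<open>adj b\<close> up to sign and replaces the multipliers by \<open>- cnj l\<close> and
  \<open>- r\<close>, so that genericity is preserved.\<close>

lemma generic_imp_kernel_cond:
  assumes yC: "is_csol n l y" and yR: "is_rsol n r y" and gen: "generic_params n l r"
  shows "kernel_cond n y"
  unfolding kernel_cond_def
proof (intro allI impI ballI iffI)
  fix k and v :: "complex mat" assume k: "k < n" and v: "v \<in> carrier_mat k (1::nat)"
  have q: "y \<in> quivers n" using yC by (simp add: is_csol_def)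
  {
    assume "fst y k * v = 0\<^sub>m (Suc k) 1"
    with gen k v show "adj (snd y k) * v = 0\<^sub>m (Suc k) 1"
      by (intro kernel_orthogonal[OF yC yR k]) (auto simp: generic_params_def)
  }
  assume av: "adj (snd y k) * v = 0\<^sub>m (Suc k) 1"
  define z where "z = rotate_quiver n (0, 1) y"
  have z: "fst z k = adj (snd y k)" "snd z k = - adj (fst y k)"
    using quiversD[OF q k] k unfolding z_def by (auto intro!: eq_matI)
  have "adj (snd z k) * v = 0\<^sub>m (Suc k) 1"
  proof (rule kernel_orthogonal[OF is_csol_rotate[OF yC yR, of 0 1] is_rsol_rotate[OF yC yR, of 0 1] k, folded z_def])
    fix e :: "nat \<Rightarrow> nat" assume e: "\<And>j. e j \<le> j"
      and s: "(\<Sum>j=1..k. rotC 0 1 l r j * of_nat (e j)) = 0"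
    have eq: "(\<Sum>j=1..k. rotC 0 1 l r j * of_nat (e j)) = - cnj (\<Sum>j=1..k. l j * of_nat (e j))"
      by (simp add: rotC_def sum_negf)
    have "(\<Sum>j=1..k. l j * of_nat (e j)) = 0"
      using s unfolding eq by (simp only: neg_equal_0_iff_equal complex_cnj_zero_iff)
    then have "(\<Sum>j=1..k. r j * of_nat (e j)) = 0" using gen k e by (auto simp: generic_params_def)
    then show "(\<Sum>j=1..k. rotR 0 1 l r j * of_nat (e j)) = 0" by (simp add: rotR_def sum_negf)
  qed (use v av z in auto)
  moreover have "adj (snd z k) = - fst y k"
    unfolding z(2) using quiversD[OF q k] by (intro eq_matI) auto
  ultimately have "- (fst y k * v) = 0\<^sub>m (Suc k) 1" using quiversD[OF q k] v by simp
  then have "- (- (fst y k * v)) = - 0\<^sub>m (Suc k) 1" by simp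
  also have "\<dots> = (0\<^sub>m (Suc k) 1 :: complex mat)" by (rule eq_matI) auto
  finally show "fst y k * v = 0\<^sub>m (Suc k) 1" by simp
qed

text \<open>For a fixed dimension vector the weighted sum of rotated complex multipliers is a
  polynomial in \<open>w\<close> with coefficients \<open>A\<close>, \<open>- B\<close> and
  \<open>- cnj A\<close>. If it is nonzero it has finitely many roots; if it is zero, then
  \<open>A = B = 0\<close> and the real sum vanishes for every \<open>w\<close>.\<close>

lemma finite_nongeneric:
  "finite {w. \<not> generic_params n (rotC 1 w l r) (rotR 1 w l r)}"
proof -
  define E where "E = (\<Pi>\<^sub>E j\<in>{..n}. {..j::nat})"
  define A where "A k e = (\<Sum>j=1..k. l j * of_nat (e j))" for k and e :: "nat \<Rightarrow> nat"
  define B where "B k e = (\<Sum>j=1..k. r j * of_nat (e j))" for k and e :: "nat \<Rightarrow> nat"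
  define p where "p k e = [:A k e, - of_real (B k e), - cnj (A k e):]" for k e
  have "finite E" unfolding E_def by (intro finite_PiE) auto
  then have "finite (\<Union>k<n. \<Union>e\<in>E. {w. p k e \<noteq> 0 \<and> poly (p k e) w = 0})"
    using poly_roots_finite by (intro finite_UN_I) (auto intro: rev_finite_subset)
  moreover have "{w. \<not> generic_params n (rotC 1 w l r) (rotR 1 w l r)} \<subseteq>
      (\<Union>k<n. \<Union>e\<in>E. {w. p k e \<noteq> 0 \<and> poly (p k e) w = 0})"
  proof
    fix w assume "w \<in> {w. \<not> generic_params n (rotC 1 w l r) (rotR 1 w l r)}"
    then obtain k e where k: "k < n" and e: "\<And>j. e j \<le> (j::nat)"
      and sC: "(\<Sum>j=1..k. rotC 1 w l r j * of_nat (e j)) = 0" and sR: "(\<Sum>j=1..k. rotR 1 w l r j * of_nat (e j)) \<noteq> 0"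
      by (auto simp: generic_params_def)
    \<comment> \<open>Values beyond n do not affect the sums; restricting leaves finitely many
      vectors.\<close>
    define e' where "e' = restrict e {..n}"
    have e'E: "e' \<in> E" using e by (auto simp: e'_def E_def)
    have AB: "A k e' = A k e" "B k e' = B k e"
      unfolding A_def B_def using k by (auto simp: e'_def intro!: sum.cong)
    have "(\<Sum>j=1..k. rotC 1 w l r j * of_nat (e j)) = A k e - w * of_real (B k e) - w\<^sup>2 * cnj (A k e)"
      by (simp add: rotC_def A_def B_def sum_distrib_left left_diff_distrib sum_subtractf mult.assoc)
    then have "poly (p k e') w = 0"
      using sC by (simp add: p_def AB power2_eq_square algebra_simps)
    moreover have "p k e' \<noteq> 0"
    proof
      assume "p k e' = 0"
      then have AB0: "A k e = 0" "B k e = 0" by (auto simp: p_def AB)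
      have "(\<Sum>j=1..k. rotR 1 w l r j * of_nat (e j)) = (1 - (cmod w)\<^sup>2) * B k e + 4 * Re (cnj w * A k e)"
        by (simp add: rotR_def A_def B_def sum_distrib_left distrib_right sum.distrib mult.assoc Re_sum)
      then show False using sR AB0 by simp
    qed
    ultimately show "w \<in> (\<Union>k<n. \<Union>e\<in>E. {w. p k e \<noteq> 0 \<and> poly (p k e) w = 0})"
      using k e'E by auto
  qed
  ultimately show ?thesis by (rule finite_subset[rotated])
qed

lemma finite_not_kernel_cond:
  assumes "is_csol n l x" "is_rsol n r x"
  shows "finite {w. \<not> kernel_cond n (rotate_quiver n (1, w) x)}"
  by (rule finite_subset[OF _ finite_nongeneric[of n l r]])
     (use generic_imp_kernel_cond[OF is_csol_rotate[OF assms] is_rsol_rotate[OF assms]] in blast)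


section \<open>Minimal vectors\<close>

definition qnorm :: "nat \<Rightarrow> quiver \<Rightarrow> real" where
  "qnorm n x = (\<Sum>i<n. sqnorm (fst x i) + sqnorm (snd x i))"

text \<open>Squaring the tangent inequality at \<open>z / 2\<close> gives
  \<open>(1 + z / 2)^2 \<le> exp z = 1 + z\<close>, hence \<open>z^2 \<le> 0\<close>. This is the
  strict convexity behind the equality case for norms.\<close>

lemma exp_gt_add_one:
  fixes z :: real
  assumes "exp z = 1 + z"
  shows "z = 0"
proof -
  have "exp z > 0" by simp
  then have "1 + z / 2 > 0" using assms by simp
  then have "(1 + z / 2) * (1 + z / 2) \<le> exp (z / 2) * exp (z / 2)"
    by (intro mult_mono) auto
  also have "\<dots> = exp z" by (simp flip: exp_add)
  finally have "z * z \<le> 0" using assms by (simp add: field_simps)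
  then show ?thesis using zero_le_square[of z] by simp
qed

lemma sqnorm_unitary_left:
  assumes "unitary k V" "dim_row X = k"
  shows "sqnorm (V * X) = sqnorm X"
proof -
  note V = unitaryD[OF assms(1)]
  have "adj (V * X) * (V * X) = adj X * X"
    using V(1-3) assms(2) by (simp add: adj_mult mat_assoc unitary_cancel[OF assms(1)])
  then have "complex_of_real (sqnorm (V * X)) = complex_of_real (sqnorm X)"
    unfolding mtr_adj_mult[symmetric] by simp
  then show ?thesis by simp
qed

lemma sqnorm_unitary_right:
  assumes "unitary k V" "dim_col X = k"
  shows "sqnorm (X * V) = sqnorm X"
proof -
  have "sqnorm (adj V * adj X) = sqnorm (adj X)"
    by (rule sqnorm_unitary_left[OF unitary_adj[OF assms(1)]]) (use assms in auto)
  moreover have "adj V * adj X = adj (X * V)" using assms unitaryD[OF assms(1)] by (simp add: adj_mult)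
  ultimately show ?thesis by simp
qed

lemma det_unitary: "unitary k U \<Longrightarrow> cmod (det U) = 1"
proof -
  assume "unitary k U"
  note U = unitaryD[OF this]
  have "det (adj U) * det U = det (adj U * U)" using U(1) by (simp add: det_mult[of _ k])
  also have "\<dots> = 1" unfolding U(4) by simp
  finally have "complex_of_real ((cmod (det U))\<^sup>2) = 1"
    unfolding det_adj[OF U(1)] complex_norm_square by (simp add: mult.commute)
  then have "(cmod (det U))\<^sup>2 = 1" unfolding of_real_eq_1_iff .
  then show ?thesis by (simp add: power2_eq_1_iff) (use norm_ge_zero[of "det U"] in linarith)
qed

section \<open>Singular values and the norm along an orbit\<close>

definition exp_diag :: "nat \<Rightarrow> (nat \<Rightarrow> real) \<Rightarrow> complex mat" where
  "exp_diag k x = mat_diag k (\<lambda>i. complex_of_real (exp (x i)))"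

lemma dim_exp_diag [simp]: "dim_row (exp_diag k x) = k" "dim_col (exp_diag k x) = k"
  by (auto simp: exp_diag_def mat_diag_def)

lemma exp_diag_mult: "exp_diag k x * exp_diag k y = exp_diag k (\<lambda>i. x i + y i)"
  by (simp add: exp_diag_def exp_add)

lemma exp_diag_0: "exp_diag k (\<lambda>_. 0) = 1\<^sub>m k"
  by (simp add: exp_diag_def)

lemma exp_diag_inverse: "exp_diag k x * exp_diag k (\<lambda>i. - x i) = 1\<^sub>m k"
  "exp_diag k (\<lambda>i. - x i) * exp_diag k x = 1\<^sub>m k"
  by (simp_all add: exp_diag_mult exp_diag_0)

lemma adj_exp_diag [simp]: "adj (exp_diag k x) = exp_diag k x"
  by (rule eq_matI) (auto simp: exp_diag_def mat_diag_def)

lemma exp_diag_mult_index: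
  assumes "dim_row A = k" "i < k" "j < dim_col A"
  shows "(exp_diag k x * A) $$ (i, j) = of_real (exp (x i)) * A $$ (i, j)"
proof -
  have "exp_diag k x * A = mat k (dim_col A) (\<lambda>(i, j). of_real (exp (x i)) * A $$ (i, j))"
    unfolding exp_diag_def by (rule mat_diag_mult_left) (use assms in \<open>auto intro: carrier_matI\<close>)
  then show ?thesis using assms by simp
qed

lemma mult_exp_diag_index:
  assumes "dim_col A = k" "i < dim_row A" "j < k"
  shows "(A * exp_diag k x) $$ (i, j) = A $$ (i, j) * of_real (exp (x j))"
proof -
  have "A * exp_diag k x = mat (dim_row A) k (\<lambda>(i, j). A $$ (i, j) * of_real (exp (x j)))"
    unfolding exp_diag_def by (rule mat_diag_mult_right) (use assms in \<open>auto intro: carrier_matI\<close>)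
  then show ?thesis using assms by simp
qed

lemma det_exp_diag: "det (exp_diag k x) = of_real (exp (\<Sum>i<k. x i))"
proof -
  have "det (exp_diag k x) = prod_list (diag_mat (exp_diag k x))"
    by (rule det_upper_triangular[of _ k]) (auto simp: upper_triangular_def exp_diag_def mat_diag_def)
  also have "\<dots> = (\<Prod>i<k. of_real (exp (x i)))"
    by (auto simp: prod_list_diag_prod atLeast0LessThan exp_diag_def mat_diag_def intro!: prod.cong)
  finally show ?thesis by (simp add: exp_sum)
qed

text \<open>Singular values are written as exponentials, so that determinant 1 becomes the vanishing
  of the sum of exponents, the form in which scalar moment map values drop out.\<close>

lemma singular_value_decomposition:
  assumes "h \<in> SL k"
  shows "\<exists>U V x. unitary k U \<and> unitary k V \<and> h = V * (exp_diag k x * adj U) \<and> (\<Sum>i<k. x i) = 0"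
proof -
  note h = SL_D[OF assms]
  have "adj h * h \<in> carrier_mat k k" "adj (adj h * h) = adj h * h"
    using h by (auto simp: adj_mult intro: carrier_matI)
  from spectral_theorem[OF this] obtain U d where U: "unitary k U"
    "adj h * h = U * mat_diag k (\<lambda>i. complex_of_real (d i)) * adj U" by blast
  note Ud = unitaryD[OF U(1)]
  have dU [simp]: "dim_row U = k" "dim_col U = k" "dim_row h = k" "dim_col h = k" using Ud h by auto
  have D: "adj (h * U) * (h * U) = mat_diag k (\<lambda>i. complex_of_real (d i))"
  proof -
    have "adj (h * U) * (h * U) = adj U * ((adj h * h) * U)" by (simp add: adj_mult mat_assoc)
    also have "\<dots> = adj U * (U * (mat_diag k (\<lambda>i. complex_of_real (d i)) * (adj U * U)))"
      unfolding U(2) by (simp add: mat_assoc mat_diag_def)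
    finally show ?thesis unfolding Ud(4)
      by (simp add: unitary_cancel[OF U(1)] mat_one_right mat_diag_def)
  qed
  have hUc: "h * U \<in> carrier_mat k k" by (auto intro: carrier_matI)
  have dpos: "d i > 0" if i: "i < k" for i
  proof -
    have "complex_of_real (d i) = (adj (h * U) * (h * U)) $$ (i, i)"
      unfolding D using i by (simp add: mat_diag_def)
    also have "\<dots> = (\<Sum>r<k. cnj ((h * U) $$ (r, i)) * (h * U) $$ (r, i))"
      by (subst mult_mat_index) (use i in \<open>auto simp del: index_mult_mat(1)\<close>)
    also have "\<dots> = of_real (\<Sum>r<k. (cmod ((h * U) $$ (r, i)))\<^sup>2)"
      by (simp add: complex_norm_square mult.commute del: of_real_power index_mult_mat(1))
    finally have "d i = (\<Sum>r<k. (cmod ((h * U) $$ (r, i)))\<^sup>2)" unfolding of_real_eq_iff .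
    then have "d i \<ge> 0" by (simp add: sum_nonneg del: index_mult_mat(1))
    moreover have "d i \<noteq> 0"
    proof
      assume "d i = 0"
      then have "(\<Prod>i<k. complex_of_real (d i)) = 0" using i by (auto simp: prod_zero_iff)
      moreover have "det (mat_diag k (\<lambda>i. complex_of_real (d i))) = prod_list (diag_mat (mat_diag k (\<lambda>i. complex_of_real (d i))))"
        by (rule det_upper_triangular[of _ k]) (auto simp: upper_triangular_def mat_diag_def)
      moreover have "prod_list (diag_mat (mat_diag k (\<lambda>i. complex_of_real (d i)))) = (\<Prod>i<k. complex_of_real (d i))"
        by (auto simp: prod_list_diag_prod atLeast0LessThan mat_diag_def intro!: prod.cong)
      ultimately have "det (adj (h * U) * (h * U)) = 0" unfolding D by simp
      moreover have "det (adj (h * U) * (h * U)) = cnj (det (h * U)) * det (h * U)"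
        using hUc by (subst det_mult[of _ k]) (auto simp: det_adj)
      moreover have "det (h * U) = det U" using det_mult[OF h(1) Ud(1)] h(2) by simp
      ultimately have "det U = 0" by simp
      then show False using det_unitary[OF U(1)] by simp
    qed
    ultimately show ?thesis by simp
  qed
  define x where "x i = ln (d i) / 2" for i
  have dx: "mat_diag k (\<lambda>i. complex_of_real (d i)) = exp_diag k (\<lambda>i. x i + x i)"
    unfolding exp_diag_def by (rule eq_matI) (auto simp: mat_diag_def x_def dpos)
  define V where "V = h * (U * exp_diag k (\<lambda>i. - x i))"
  have [simp]: "dim_row V = k" "dim_col V = k" by (auto simp: V_def)
  have "adj V * V = exp_diag k (\<lambda>i. - x i) * ((adj (h * U) * (h * U)) * exp_diag k (\<lambda>i. - x i))"
    by (simp add: V_def adj_mult mat_assoc)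
  also have "\<dots> = 1\<^sub>m k" unfolding D dx by (simp add: exp_diag_mult exp_diag_0)
  finally have VV: "adj V * V = 1\<^sub>m k" .
  have Vc: "V \<in> carrier_mat k k" by (intro carrier_matI) simp_all
  then have "V * adj V = 1\<^sub>m k" using VV by (intro mat_mult_left_right_inverse[of "adj V" k V]) auto
  then have V: "unitary k V" unfolding unitary_def using VV Vc by simp
  have "V * (exp_diag k x * adj U) = h * (U * ((exp_diag k (\<lambda>i. - x i) * exp_diag k x) * adj U))"
    by (simp add: V_def mat_assoc)
  also have "\<dots> = h" unfolding exp_diag_inverse using Ud(5) by (simp add: mat_one_left mat_one_right)
  finally have hV: "h = V * (exp_diag k x * adj U)" by simp
  have c: "exp_diag k x \<in> carrier_mat k k" "adj U \<in> carrier_mat k k" "V \<in> carrier_mat k k"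
    "exp_diag k x * adj U \<in> carrier_mat k k" by (auto intro: carrier_matI)
  have "det h = det V * (det (exp_diag k x) * det (adj U))"
    unfolding hV using c by (simp add: det_mult[of _ k])
  then have "cmod (det h) = exp (\<Sum>i<k. x i)"
    using det_unitary[OF V] det_unitary[OF unitary_adj[OF U(1)]] by (simp add: norm_mult det_exp_diag)
  then have "(\<Sum>i<k. x i) = 0" using h(2) by simp
  then show ?thesis using U(1) V hV by blast
qed

text \<open>In singular bases the norm along the orbit is \<open>\<Sum> |a|^2 exp (2 (x - x'))\<close>; the linear term of
  \<open>exp z \<ge> 1 + z\<close> is the real moment map paired with \<open>x\<close>.\<close>

lemma qnorm_act_ge:
  assumes yR: "is_rsol n r y" and h: "h \<in> HC_group n"
  shows "qnorm n y \<le> qnorm n (quiver_act n h y)"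
    and "qnorm n y = qnorm n (quiver_act n h y) \<Longrightarrow> i < n \<Longrightarrow>
      adj (h (Suc i)) * h (Suc i) * fst y i = fst y i * (adj (h i) * h i)"
proof -
  have q: "y \<in> quivers n" using yR by (simp add: is_rsol_def)
  \<comment> \<open>At n the group element is 1, and the trivial decomposition is chosen there so
    that the boundary term at the top vanishes.\<close>
  have "\<forall>k. \<exists>T. k \<le> n \<longrightarrow> (case T of (U, V, x) \<Rightarrow> unitary k U \<and> unitary k V \<and>
      h k = V * (exp_diag k x * adj U) \<and> (\<Sum>i<k. x i) = 0 \<and> (k = n \<longrightarrow> x = (\<lambda>_. 0)))"
  proof
    fix k
    show "\<exists>T. k \<le> n \<longrightarrow> (case T of (U, V, x) \<Rightarrow> unitary k U \<and> unitary k V \<and>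
      h k = V * (exp_diag k x * adj U) \<and> (\<Sum>i<k. x i) = 0 \<and> (k = n \<longrightarrow> x = (\<lambda>_. 0)))"
    proof (cases "k = n")
      case True
      have "unitary n (1\<^sub>m n)" by (simp add: unitary_def)
      then show ?thesis using gauge_groupD(2)[OF h] True
        by (intro exI[of _ "(1\<^sub>m n, 1\<^sub>m n, \<lambda>_. 0)"]) (simp add: exp_diag_0)
    next
      case False
      show ?thesis
      proof (cases "k \<le> n")
        case True
        obtain U V x where "unitary k U \<and> unitary k V \<and> h k = V * (exp_diag k x * adj U) \<and> (\<Sum>i<k. x i) = 0"
          using singular_value_decomposition[OF gauge_groupD(1)[OF h True]] by blast
        then show ?thesis using False by (intro exI[of _ "(U, V, x)"]) simp
      qed auto
    qed
  qed
  from choice[OF this] obtain T where "\<forall>k. k \<le> n \<longrightarrow> (case T k of (U, V, x) \<Rightarrow> unitary k U \<and> unitary k V \<and>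
      h k = V * (exp_diag k x * adj U) \<and> (\<Sum>i<k. x i) = 0 \<and> (k = n \<longrightarrow> x = (\<lambda>_. 0)))"
    by (rule exE)
  then have T: "case T k of (U, V, x) \<Rightarrow> unitary k U \<and> unitary k V \<and>
      h k = V * (exp_diag k x * adj U) \<and> (\<Sum>i<k. x i) = 0 \<and> (k = n \<longrightarrow> x = (\<lambda>_. 0))" if "k \<le> n" for k
    using that by (elim allE[of _ k] impE)
  define U V x where "U k = fst (T k)" and "V k = fst (snd (T k))" and "x k = snd (snd (T k))" for k
  have U: "unitary k (U k)" and V: "unitary k (V k)" and hV: "h k = V k * (exp_diag k (x k) * adj (U k))"
    and x0: "(\<Sum>i<k. x k i) = 0" and xn: "k = n \<Longrightarrow> x k = (\<lambda>_. 0)" if "k \<le> n" for k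
    using T[OF that] by (auto simp: U_def V_def x_def split: prod.splits)
  have dims: "dim_row (U k) = k" "dim_col (U k) = k" "dim_row (V k) = k" "dim_col (V k) = k" if "k \<le> n" for k
    using unitaryD(2,3)[OF U[OF that]] unitaryD(2,3)[OF V[OF that]] by auto
  have hinv: "cinv (h k) = U k * (exp_diag k (\<lambda>i. - x k i) * adj (V k))" if k: "k \<le> n" for k
  proof (rule cinv_eqI[OF gauge_groupD(1)[OF h k]])
    show "U k * (exp_diag k (\<lambda>i. - x k i) * adj (V k)) \<in> carrier_mat k k"
      using dims[OF k] by (auto intro: carrier_matI)
    have "U k * (exp_diag k (\<lambda>i. - x k i) * adj (V k)) * h k =
        U k * ((exp_diag k (\<lambda>i. - x k i) * exp_diag k (x k)) * adj (U k))"
      unfolding hV[OF k] using dims[OF k] by (simp add: mat_assoc unitary_cancel[OF V[OF k]])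
    then show "U k * (exp_diag k (\<lambda>i. - x k i) * adj (V k)) * h k = 1\<^sub>m k"
      unfolding exp_diag_inverse using dims[OF k] unitaryD(5)[OF U[OF k]] by (simp add: mat_one_left)
  qed
  \<comment> \<open>The arrows in the bases \<open>U\<close>: there the group acts by diagonal
    exponentials, and the remaining factors \<open>V\<close> do not change norms.\<close>
  define a b where "a i = adj (U (Suc i)) * (fst y i * U i)" and "b i = adj (U i) * (snd y i * U (Suc i))" for i
  have ab: "dim_row (a i) = Suc i" "dim_col (a i) = i" "dim_row (b i) = i" "dim_col (b i) = Suc i" if "i < n" for i
    using quiversD[OF q that] dims[of i] dims[of "Suc i"] that by (auto simp: a_def b_def)
  have na: "sqnorm (fst y i) = sqnorm (a i)" "sqnorm (snd y i) = sqnorm (b i)" if i: "i < n" for i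
  proof -
    have k: "i \<le> n" "Suc i \<le> n" using i by auto
    note dd = quiversD[OF q i] dims[OF k(1)] dims[OF k(2)]
    show "sqnorm (fst y i) = sqnorm (a i)" "sqnorm (snd y i) = sqnorm (b i)"
      unfolding a_def b_def using dd
      by (simp_all add: sqnorm_unitary_left[OF unitary_adj[OF U[OF k(1)]]] sqnorm_unitary_left[OF unitary_adj[OF U[OF k(2)]]]
          sqnorm_unitary_right[OF U[OF k(1)]] sqnorm_unitary_right[OF U[OF k(2)]])
  qed
  define za zb where "za i p q = 2 * (x (Suc i) p - x i q)" and "zb i q p = 2 * (x i q - x (Suc i) p)" for i p q
  have hlp: "(exp s * (c * exp (- t)))\<^sup>2 = c\<^sup>2 * exp (2 * (s - t))" for s t c :: real
  proof -
    have "exp (2 * (s - t)) = (exp (s - t))\<^sup>2" by (rule exp_double)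
    moreover have "exp (s - t) = exp s * exp (- t)" using exp_add[of s "- t"] by simp
    ultimately show ?thesis by (simp only: power_mult_distrib mult_ac)
  qed
  have nact: "sqnorm (fst (quiver_act n h y) i) = (\<Sum>p<Suc i. \<Sum>q<i. (cmod (a i $$ (p, q)))\<^sup>2 * exp (za i p q))"
    "sqnorm (snd (quiver_act n h y) i) = (\<Sum>q<i. \<Sum>p<Suc i. (cmod (b i $$ (q, p)))\<^sup>2 * exp (zb i q p))"
    if i: "i < n" for i
  proof -
    have k: "i \<le> n" "Suc i \<le> n" using i by auto
    note dd = quiversD[OF q i] dims[OF k(1)] dims[OF k(2)] ab[OF i]
    have "fst (quiver_act n h y) i = V (Suc i) * ((exp_diag (Suc i) (x (Suc i)) * (a i * exp_diag i (\<lambda>j. - x i j))) * adj (V i))"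
      unfolding quiver_act_sel[OF h i] hinv[OF k(1)] unfolding hV[OF k(2)] a_def using dd by (simp add: mat_assoc)
    then have "sqnorm (fst (quiver_act n h y) i) = sqnorm (exp_diag (Suc i) (x (Suc i)) * (a i * exp_diag i (\<lambda>j. - x i j)))"
      using dd by (simp add: sqnorm_unitary_left[OF V[OF k(2)]] sqnorm_unitary_right[OF unitary_adj[OF V[OF k(1)]]])
    also have "\<dots> = (\<Sum>p<Suc i. \<Sum>q<i. (cmod (a i $$ (p, q)))\<^sup>2 * exp (za i p q))"
      unfolding sqnorm_def using dd
      by (intro sum.cong) (simp_all add: exp_diag_mult_index mult_exp_diag_index norm_mult za_def hlp del: index_mult_mat(1))
    finally show "sqnorm (fst (quiver_act n h y) i) = (\<Sum>p<Suc i. \<Sum>q<i. (cmod (a i $$ (p, q)))\<^sup>2 * exp (za i p q))" .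
    have "snd (quiver_act n h y) i = V i * ((exp_diag i (x i) * (b i * exp_diag (Suc i) (\<lambda>j. - x (Suc i) j))) * adj (V (Suc i)))"
      unfolding quiver_act_sel[OF h i] hinv[OF k(2)] unfolding hV[OF k(1)] b_def using dd by (simp add: mat_assoc)
    then have "sqnorm (snd (quiver_act n h y) i) = sqnorm (exp_diag i (x i) * (b i * exp_diag (Suc i) (\<lambda>j. - x (Suc i) j)))"
      using dd by (simp add: sqnorm_unitary_left[OF V[OF k(1)]] sqnorm_unitary_right[OF unitary_adj[OF V[OF k(2)]]])
    also have "\<dots> = (\<Sum>q<i. \<Sum>p<Suc i. (cmod (b i $$ (q, p)))\<^sup>2 * exp (zb i q p))"
      unfolding sqnorm_def using dd
      by (intro sum.cong) (simp_all add: exp_diag_mult_index mult_exp_diag_index norm_mult zb_def hlp del: index_mult_mat(1))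
    finally show "sqnorm (snd (quiver_act n h y) i) = (\<Sum>q<i. \<Sum>p<Suc i. (cmod (b i $$ (q, p)))\<^sup>2 * exp (zb i q p))" .
  qed
  \<comment> \<open>The linear term of arrow i, split into the part paired with the exponents at its
    upper vertex (\<open>A\<close>) and at its lower vertex (\<open>B\<close>).\<close>
  define A where "A i = (\<Sum>p<Suc i. x (Suc i) p * ((\<Sum>q<i. (cmod (a i $$ (p, q)))\<^sup>2) - (\<Sum>q<i. (cmod (b i $$ (q, p)))\<^sup>2)))" for i
  define B where "B i = (\<Sum>q<i. x i q * ((\<Sum>p<Suc i. (cmod (b i $$ (q, p)))\<^sup>2) - (\<Sum>p<Suc i. (cmod (a i $$ (p, q)))\<^sup>2)))" for i
  have lin: "(\<Sum>p<Suc i. \<Sum>q<i. (cmod (a i $$ (p, q)))\<^sup>2 * za i p q) + (\<Sum>q<i. \<Sum>p<Suc i. (cmod (b i $$ (q, p)))\<^sup>2 * zb i q p)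
      = 2 * (A i + B i)" for i
  proof -
    have 1: "(\<Sum>p<Suc i. \<Sum>q<i. (cmod (a i $$ (p, q)))\<^sup>2 * za i p q) =
      2 * (\<Sum>p<Suc i. x (Suc i) p * (\<Sum>q<i. (cmod (a i $$ (p, q)))\<^sup>2)) - 2 * (\<Sum>q<i. x i q * (\<Sum>p<Suc i. (cmod (a i $$ (p, q)))\<^sup>2))"
      unfolding za_def sum_distrib_left
      by (subst (3) sum.swap) (simp add: sum_subtractf[symmetric] algebra_simps del: sum.lessThan_Suc)
    have 2: "(\<Sum>q<i. \<Sum>p<Suc i. (cmod (b i $$ (q, p)))\<^sup>2 * zb i q p) =
      2 * (\<Sum>q<i. x i q * (\<Sum>p<Suc i. (cmod (b i $$ (q, p)))\<^sup>2)) - 2 * (\<Sum>p<Suc i. x (Suc i) p * (\<Sum>q<i. (cmod (b i $$ (q, p)))\<^sup>2))"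
      unfolding zb_def sum_distrib_left
      by (subst (3) sum.swap) (simp add: sum_subtractf[symmetric] algebra_simps del: sum.lessThan_Suc)
    show ?thesis
      unfolding 1 2 A_def B_def right_diff_distrib sum_subtractf by (simp add: algebra_simps del: sum.lessThan_Suc)
  qed
  \<comment> \<open>At a vertex the two parts add up to the diagonal of the real moment map paired
    with \<open>x\<close>; the former is constant and the latter has sum 0.\<close>
  have AB: "A i + B (Suc i) = 0" if i: "Suc i < n" for i
  proof -
    have i': "i < n" "i \<le> n" "Suc i \<le> n" "Suc (Suc i) \<le> n" using i by auto
    note dd = quiversD[OF q i'(1)] quiversD[OF q i] dims[OF i'(2)] dims[OF i'(3)] dims[OF i'(4)] ab[OF i'(1)] ab[OF i]
    have "adj (U (Suc i)) * (muR y i * U (Suc i)) = a i * adj (a i) - adj (b i) * b i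
        + b (Suc i) * adj (b (Suc i)) - adj (a (Suc i)) * a (Suc i)"
      unfolding muR_def a_def b_def using dd
      by (simp add: adj_mult mat_distrib unitary_cancel[OF U[OF i'(2)]] unitary_cancel[OF U[OF i'(4)]])
    moreover have mu: "muR y i = complex_of_real (r (Suc i)) \<cdot>\<^sub>m 1\<^sub>m (Suc i)"
      using yR i by (simp add: is_rsol_def)
    have "adj (U (Suc i)) * (muR y i * U (Suc i)) = complex_of_real (r (Suc i)) \<cdot>\<^sub>m 1\<^sub>m (Suc i)"
      unfolding mu using dims[OF i'(3)] unitaryD(4)[OF U[OF i'(3)]]
      by (simp add: mat_smult_left mat_smult_right mat_one_left)
    ultimately have eq: "a i * adj (a i) - adj (b i) * b i
        + b (Suc i) * adj (b (Suc i)) - adj (a (Suc i)) * a (Suc i) = complex_of_real (r (Suc i)) \<cdot>\<^sub>m 1\<^sub>m (Suc i)" by simp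
    have "(\<Sum>q<i. (cmod (a i $$ (p, q)))\<^sup>2) - (\<Sum>q<i. (cmod (b i $$ (q, p)))\<^sup>2)
        + (\<Sum>s<Suc (Suc i). (cmod (b (Suc i) $$ (p, s)))\<^sup>2) - (\<Sum>s<Suc (Suc i). (cmod (a (Suc i) $$ (s, p)))\<^sup>2) = r (Suc i)"
      if p: "p < Suc i" for p
    proof -
      have rr: "(X * adj X) $$ (p, p) = of_real (\<Sum>q<dim_col X. (cmod (X $$ (p, q)))\<^sup>2)" if "p < dim_row X" for X
        using that by (subst mult_mat_index) (auto simp: complex_norm_square simp del: of_real_power intro!: sum.cong)
      have cc: "(adj X * X) $$ (p, p) = of_real (\<Sum>q<dim_row X. (cmod (X $$ (q, p)))\<^sup>2)" if "p < dim_col X" for X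
        using that by (subst mult_mat_index) (auto simp: complex_norm_square mult.commute simp del: of_real_power intro!: sum.cong)
      have "complex_of_real ((\<Sum>q<i. (cmod (a i $$ (p, q)))\<^sup>2) - (\<Sum>q<i. (cmod (b i $$ (q, p)))\<^sup>2)
        + (\<Sum>s<Suc (Suc i). (cmod (b (Suc i) $$ (p, s)))\<^sup>2) - (\<Sum>s<Suc (Suc i). (cmod (a (Suc i) $$ (s, p)))\<^sup>2)) = of_real (r (Suc i))"
        using arg_cong[OF eq, of "\<lambda>M. M $$ (p, p)"] p dd rr[of "a i"] cc[of "b i"] rr[of "b (Suc i)"] cc[of "a (Suc i)"]
        by (simp del: index_mult_mat(1) sum.lessThan_Suc of_real_sum of_real_power)
      then show ?thesis unfolding of_real_eq_iff .
    qed
    then have "A i + B (Suc i) = (\<Sum>p<Suc i. x (Suc i) p * r (Suc i))"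
      unfolding A_def B_def sum.distrib[symmetric]
      by (intro sum.cong refl) (simp only: distrib_left[symmetric] add_diff_eq lessThan_iff)
    also have "\<dots> = 0" using x0[OF i'(3)] by (simp add: sum_distrib_right[symmetric] del: sum.lessThan_Suc)
    finally show ?thesis .
  qed
  have sumAB: "(\<Sum>i<n. A i + B i) = 0"
  proof (cases n)
    case (Suc m)
    have e: "(\<Sum>i<Suc m. A i + B i) = B 0 + (\<Sum>i<m. A i + B (Suc i)) + A m" for m
      by (induction m) simp_all
    have "B 0 = 0" by (simp add: B_def)
    moreover have "A m = 0" using xn[of n] Suc by (simp add: A_def)
    moreover have "(\<Sum>i<m. A i + B (Suc i)) = 0" using AB Suc by (intro sum.neutral) auto
    ultimately show ?thesis unfolding Suc e by linarith
  qed simp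
  \<comment> \<open>The excess of \<open>exp z\<close> over its tangent \<open>1 + z\<close>,
    weighted by squared entries. With the linear terms gone, the growth of the norm is the sum of
    these non-negative quantities.\<close>
  define ga where "ga i p q = (cmod (a i $$ (p, q)))\<^sup>2 * (exp (za i p q) - 1 - za i p q)" for i p q
  define gb where "gb i q p = (cmod (b i $$ (q, p)))\<^sup>2 * (exp (zb i q p) - 1 - zb i q p)" for i p q
  have g0: "ga i p q \<ge> 0" "gb i q p \<ge> 0" for i p q
  proof -
    have "exp z - 1 - z \<ge> 0" for z :: real using exp_ge_add_one_self[of z] by linarith
    then show "ga i p q \<ge> 0" "gb i q p \<ge> 0"
      unfolding ga_def gb_def by (intro mult_nonneg_nonneg zero_le_power2; blast)+
  qed
  have "qnorm n (quiver_act n h y) - qnorm n y = (\<Sum>i<n. (\<Sum>p<Suc i. \<Sum>q<i. ga i p q) + (\<Sum>q<i. \<Sum>p<Suc i. gb i q p) + 2 * (A i + B i))"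
  proof -
    have "sqnorm (fst (quiver_act n h y) i) + sqnorm (snd (quiver_act n h y) i) - (sqnorm (fst y i) + sqnorm (snd y i)) =
      (\<Sum>p<Suc i. \<Sum>q<i. ga i p q) + (\<Sum>q<i. \<Sum>p<Suc i. gb i q p) + 2 * (A i + B i)" if i: "i < n" for i
      unfolding nact[OF i] na[OF i] lin[symmetric] ga_def gb_def unfolding sqnorm_def ab[OF i]
      by (simp add: right_diff_distrib sum_subtractf del: sum.lessThan_Suc)
    then show ?thesis unfolding qnorm_def sum_subtractf[symmetric] by (intro sum.cong) auto
  qed
  also have "\<dots> = (\<Sum>i<n. (\<Sum>p<Suc i. \<Sum>q<i. ga i p q) + (\<Sum>q<i. \<Sum>p<Suc i. gb i q p))"
    using sumAB by (simp add: sum.distrib sum_distrib_left[symmetric] del: sum.lessThan_Suc)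
  finally have diff: "qnorm n (quiver_act n h y) - qnorm n y = (\<Sum>i<n. (\<Sum>p<Suc i. \<Sum>q<i. ga i p q) + (\<Sum>q<i. \<Sum>p<Suc i. gb i q p))" .
  have t0: "(\<Sum>p<Suc i. \<Sum>q<i. ga i p q) \<ge> 0" "(\<Sum>q<i. \<Sum>p<Suc i. gb i q p) \<ge> 0" for i
    using g0 by (intro sum_nonneg; simp)+
  show "qnorm n y \<le> qnorm n (quiver_act n h y)"
    using diff sum_nonneg[of "{..<n}" "\<lambda>i. (\<Sum>p<Suc i. \<Sum>q<i. ga i p q) + (\<Sum>q<i. \<Sum>p<Suc i. gb i q p)"] t0
    by (smt (verit, best))
  assume eq: "qnorm n y = qnorm n (quiver_act n h y)" and i: "i < n"
  have "(\<Sum>i<n. (\<Sum>p<Suc i. \<Sum>q<i. ga i p q) + (\<Sum>q<i. \<Sum>p<Suc i. gb i q p)) = 0" using diff eq by simp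
  then have "(\<Sum>p<Suc i. \<Sum>q<i. ga i p q) + (\<Sum>q<i. \<Sum>p<Suc i. gb i q p) = 0"
    by (subst (asm) sum_nonneg_eq_0_iff) (use t0 i in \<open>auto simp del: sum.lessThan_Suc intro: add_nonneg_nonneg\<close>)
  then have "(\<Sum>p<Suc i. \<Sum>q<i. ga i p q) = 0" using t0[of i] by linarith
  then have "\<forall>p\<in>{..<Suc i}. (\<Sum>q<i. ga i p q) = 0"
    by (subst (asm) sum_nonneg_eq_0_iff) (use g0 in \<open>auto intro: sum_nonneg\<close>)
  then have ga0: "ga i p q = 0" if "p < Suc i" "q < i" for p q
    using that g0 by (auto simp: sum_nonneg_eq_0_iff)
  have k: "i \<le> n" "Suc i \<le> n" using i by auto
  note dd = quiversD[OF q i] dims[OF k(1)] dims[OF k(2)] ab[OF i]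
  \<comment> \<open>An entry is nonzero only between equal exponents, hence the diagonal
    exponentials intertwine the arrow.\<close>
  have com: "exp_diag (Suc i) (\<lambda>p. x (Suc i) p + x (Suc i) p) * a i = a i * exp_diag i (\<lambda>q. x i q + x i q)"
  proof (rule eq_matI)
    fix p q assume "p < dim_row (a i * exp_diag i (\<lambda>q. x i q + x i q))" "q < dim_col (a i * exp_diag i (\<lambda>q. x i q + x i q))"
    then have pq: "p < Suc i" "q < i" using dd by auto
    then have "a i $$ (p, q) = 0 \<or> exp (za i p q) = 1 + za i p q" using ga0[OF pq] by (auto simp: ga_def)
    then have "a i $$ (p, q) = 0 \<or> x (Suc i) p = x i q" using exp_gt_add_one[of "za i p q"] by (auto simp: za_def)
    then show "(exp_diag (Suc i) (\<lambda>p. x (Suc i) p + x (Suc i) p) * a i) $$ (p, q) = (a i * exp_diag i (\<lambda>q. x i q + x i q)) $$ (p, q)"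
      using pq dd by (auto simp: exp_diag_mult_index mult_exp_diag_index simp del: index_mult_mat(1))
  qed (use dd in auto)
  have P: "adj (h k) * h k = U k * (exp_diag k (\<lambda>i. x k i + x k i) * adj (U k))" if "k \<le> n" for k
  proof -
    have "adj (h k) * h k = U k * ((exp_diag k (x k) * exp_diag k (x k)) * adj (U k))"
      unfolding hV[OF that] using dims[OF that] by (simp add: adj_mult mat_assoc unitary_cancel[OF V[OF that]])
    then show ?thesis unfolding exp_diag_mult .
  qed
  have "adj (h (Suc i)) * h (Suc i) * fst y i = U (Suc i) * ((exp_diag (Suc i) (\<lambda>p. x (Suc i) p + x (Suc i) p) * a i) * adj (U i))"
    unfolding P[OF k(2)] a_def using dd unitaryD(5)[OF U[OF k(1)]] by (simp add: mat_assoc mat_one_right)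
  also have "\<dots> = fst y i * (adj (h i) * h i)"
    unfolding com unfolding P[OF k(1)] a_def using dd by (simp add: mat_assoc unitary_cancel[OF U[OF k(1)]] unitary_cancel[OF U[OF k(2)]])
  finally show "adj (h (Suc i)) * h (Suc i) * fst y i = fst y i * (adj (h i) * h i)" .
qed

text \<open>Both endpoints solve the real equation, so each has minimal norm in the common orbit and
  the norms agree. The equality case says that \<open>adj (h k) * h k\<close> intertwines the arrows
  \<open>a\<close>; it is 1 at n, and the left inverse of each \<open>a_k\<close> carries this
  downwards.\<close>

lemma regular_orbit_unitary:
  assumes y: "is_rsol n r y" and y': "is_rsol n r' (quiver_act n h y)" and h: "h \<in> HC_group n"
    and reg: "\<And>k. k < n \<Longrightarrow> det (snd y k * fst y k) \<noteq> 0"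
  shows "h \<in> H_group n"
proof -
  have q: "y \<in> quivers n" using y by (simp add: is_rsol_def)
  have "qnorm n (quiver_act n h y) \<le> qnorm n (quiver_act n (gauge_inv n h) (quiver_act n h y))"
    by (rule qnorm_act_ge(1)[OF y' gauge_inv_HC[OF h]])
  then have "qnorm n y = qnorm n (quiver_act n h y)"
    using qnorm_act_ge(1)[OF y h] by (simp add: quiver_act_inv[OF h q])
  note com = qnorm_act_ge(2)[OF y h this]
  have "adj (h k) * h k = 1\<^sub>m k" if "k \<le> n" for k
    using that
  proof (induction rule: inc_induct)
    case base
    then show ?case using gauge_groupD(2)[OF h] by simp
  next
    case (step k)
    have kn: "k \<le> n" using step by simp
    note dd = quiversD[OF q step(2)] gauge_dims[OF h kn]
    define P where "P = adj (h k) * h k"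
    have [simp]: "dim_row P = k" "dim_col P = k" using dd by (auto simp: P_def)
    have aP: "fst y k = fst y k * P"
      using com[OF step(2)] dd unfolding step(3) P_def by (simp add: mat_one_left)
    have c: "snd y k * fst y k \<in> carrier_mat k k" using dd by auto
    note inv = cinv[OF c]
    have "cinv (snd y k * fst y k) * (snd y k * (fst y k * P)) = (cinv (snd y k * fst y k) * (snd y k * fst y k)) * P"
      using inv(1) dd by (simp add: mat_assoc)
    also have "\<dots> = P" using inv(3)[OF reg[OF step(2)]] by (simp add: mat_one_left)
    finally have "P = 1\<^sub>m k" unfolding aP[symmetric] inv(3)[OF reg[OF step(2)]] by simp
    then show ?case by (simp add: P_def)
  qed
  then have "h k \<in> SU k" if "k \<le> n" for k
    using gauge_groupD(1)[OF h that] gauge_dims[OF h that] mat_mult_left_right_inverse[of "adj (h k)" k "h k"] that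
    by (auto simp: SU_def)
  then show ?thesis using h by (auto simp: gauge_group_def PiE_iff)
qed


section \<open>Compactness and limits of quivers\<close>

text \<open>Monotone subsequences are extracted first for the real parts and then for the imaginary
  parts.\<close>

lemma complex_bounded_subseq:
  fixes f :: "nat \<Rightarrow> complex"
  assumes "\<And>t. cmod (f t) \<le> C"
  shows "\<exists>r. strict_mono r \<and> convergent (\<lambda>t. f (r t))"
proof -
  have R: "\<exists>r. strict_mono r \<and> convergent (\<lambda>t. g (r t))" if "\<And>t. \<bar>g t\<bar> \<le> C" for g :: "nat \<Rightarrow> real"
  proof -
    obtain r where r: "strict_mono r" "monoseq (\<lambda>t. g (r t))" using seq_monosub[of g] by blast
    have "Bseq (\<lambda>t. g (r t))" by (rule BseqI'[of _ C]) (use that in simp)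
    then show ?thesis using r Bseq_monoseq_convergent by blast
  qed
  obtain r where r: "strict_mono r" "convergent (\<lambda>t. Re (f (r t)))"
    using R[of "\<lambda>t. Re (f t)"] assms abs_Re_le_cmod order_trans by meson
  obtain s where s: "strict_mono s" "convergent (\<lambda>t. Im (f (r (s t))))"
    using R[of "\<lambda>t. Im (f (r t))"] assms abs_Im_le_cmod order_trans by meson
  have rs: "convergent (\<lambda>t. Re (f (r (s t))))"
    using convergent_subseq_convergent[OF r(2) s(1)] by (simp add: o_def)
  obtain a b where "(\<lambda>t. Re (f (r (s t)))) \<longlonglongrightarrow> a" "(\<lambda>t. Im (f (r (s t)))) \<longlonglongrightarrow> b"
    using rs s(2) unfolding convergent_def by blast
  from tendsto_Complex[OF this] have "(\<lambda>t. f (r (s t))) \<longlonglongrightarrow> Complex a b" by (simp add: complex_surj)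
  then show ?thesis
    using strict_mono_o[OF r(1) s(1)] by (intro exI[of _ "r \<circ> s"]) (auto simp: convergent_def o_def)
qed

lemma finite_family_subseq:
  fixes f :: "nat \<Rightarrow> 'i \<Rightarrow> complex"
  assumes "finite I" "\<And>t j. j \<in> I \<Longrightarrow> cmod (f t j) \<le> C"
  shows "\<exists>r. strict_mono r \<and> (\<forall>j\<in>I. convergent (\<lambda>t. f (r t) j))"
  using assms
proof (induction I)
  case empty
  show ?case by (intro exI[of _ "\<lambda>t. t"]) (auto simp: strict_mono_def)
next
  case (insert k I)
  then obtain r where r: "strict_mono r" "\<forall>j\<in>I. convergent (\<lambda>t. f (r t) j)" by auto
  obtain s where s: "strict_mono s" "convergent (\<lambda>t. f (r (s t)) k)"
    using complex_bounded_subseq[of "\<lambda>t. f (r t) k" C] insert.prems by auto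
  have "convergent (\<lambda>t. f (r (s t)) j)" if "j \<in> I" for j
    using convergent_subseq_convergent[OF bspec[OF r(2) that] s(1)] by (simp add: o_def)
  then show ?case
    using strict_mono_o[OF r(1) s(1)] s(2) by (intro exI[of _ "r \<circ> s"]) (auto simp: o_def)
qed

lemma bounded_quivers_subseq:
  fixes Y :: "nat \<Rightarrow> quiver"
  assumes Y: "\<And>t. Y t \<in> quivers n" and C: "\<And>t. qnorm n (Y t) \<le> C"
  shows "\<exists>r z. strict_mono r \<and> quiver_lim n (\<lambda>t. Y (r t)) z"
proof -
  \<comment> \<open>All entries as one finite family: the boolean separates the two kinds of arrows,
    and indices outside a matrix get the value 0, so that the index set can be a product.\<close>
  define f where "f t j = (case j of (c :: bool, i, p, q) \<Rightarrow>
    if c then (if p < Suc i \<and> q < i then fst (Y t) i $$ (p, q) else 0)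
    else (if p < i \<and> q < Suc i then snd (Y t) i $$ (p, q) else 0))" for t and j :: "bool \<times> nat \<times> nat \<times> nat"
  define I where "I = (UNIV :: bool set) \<times> {..<n} \<times> {..n} \<times> {..n}"
  have "0 \<le> qnorm n (Y 0)" by (auto simp: qnorm_def intro!: sum_nonneg add_nonneg_nonneg)
  then have C0: "0 \<le> C" using C[of 0] by linarith
  have le: "sqnorm (fst (Y t) i) \<le> C" "sqnorm (snd (Y t) i) \<le> C" if "i < n" for t i
  proof -
    have "sqnorm (fst (Y t) i) + sqnorm (snd (Y t) i) \<le> qnorm n (Y t)"
      unfolding qnorm_def by (rule member_le_sum) (use that in auto)
    then show "sqnorm (fst (Y t) i) \<le> C" "sqnorm (snd (Y t) i) \<le> C"
      using C[of t] sqnorm_nonneg[of "fst (Y t) i"] sqnorm_nonneg[of "snd (Y t) i"] by linarith+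
  qed
  have "cmod (f t j) \<le> sqrt C" if j: "j \<in> I" for t j
  proof -
    obtain c i p q where jj: "j = (c, i, p, q)" by (cases j) auto
    then have i: "i < n" using j by (simp add: I_def)
    note d = quiversD[OF Y i, of t]
    have "cmod (fst (Y t) i $$ (p, q)) \<le> sqrt C" if "p < Suc i" "q < i"
      using sqnorm_entry_le[of p "fst (Y t) i" q] le(1)[OF i, of t] d that by (intro real_le_rsqrt) simp
    moreover have "cmod (snd (Y t) i $$ (p, q)) \<le> sqrt C" if "p < i" "q < Suc i"
      using sqnorm_entry_le[of p "snd (Y t) i" q] le(2)[OF i, of t] d that by (intro real_le_rsqrt) simp
    ultimately show ?thesis using C0 by (auto simp: f_def jj)
  qed
  then obtain r where r: "strict_mono r" "\<forall>j\<in>I. convergent (\<lambda>t. f (r t) j)"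
    using finite_family_subseq[of I f "sqrt C"] by (auto simp: I_def)
  define z where "z = (\<lambda>i\<in>{..<n}. mat (Suc i) i (\<lambda>(p, q). lim (\<lambda>t. f (r t) (True, i, p, q))),
    \<lambda>i\<in>{..<n}. mat i (Suc i) (\<lambda>(p, q). lim (\<lambda>t. f (r t) (False, i, p, q))))"
  have "quiver_lim n (\<lambda>t. Y (r t)) z"
    unfolding quiver_lim_def
  proof (intro conjI allI impI Y)
    show "z \<in> quivers n" unfolding z_def by (rule quiversI) auto
    fix i assume i: "i < n"
    show "mat_lim (Suc i) i (\<lambda>t. fst (Y (r t)) i) (fst z i)"
    proof (rule mat_limI)
      fix p q assume pq: "p < Suc i" "q < i"
      then have "(True, i, p, q) \<in> I" using i by (auto simp: I_def)
      then have "(\<lambda>t. f (r t) (True, i, p, q)) \<longlonglongrightarrow> lim (\<lambda>t. f (r t) (True, i, p, q))"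
        using r(2) by (auto simp: convergent_LIMSEQ_iff)
      then show "(\<lambda>t. fst (Y (r t)) i $$ (p, q)) \<longlonglongrightarrow> fst z i $$ (p, q)"
        using i pq by (simp add: f_def z_def)
    qed (use i quiversD[OF Y i] in \<open>auto simp: z_def\<close>)
    show "mat_lim i (Suc i) (\<lambda>t. snd (Y (r t)) i) (snd z i)"
    proof (rule mat_limI)
      fix p q assume pq: "p < i" "q < Suc i"
      then have "(False, i, p, q) \<in> I" using i by (auto simp: I_def)
      then have "(\<lambda>t. f (r t) (False, i, p, q)) \<longlonglongrightarrow> lim (\<lambda>t. f (r t) (False, i, p, q))"
        using r(2) by (auto simp: convergent_LIMSEQ_iff)
      then show "(\<lambda>t. snd (Y (r t)) i $$ (p, q)) \<longlonglongrightarrow> snd z i $$ (p, q)"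
        using i pq by (simp add: f_def z_def)
    qed (use i quiversD[OF Y i] in \<open>auto simp: z_def\<close>)
  qed
  then show ?thesis using r(1) by blast
qed

lemma qnorm_tendsto: "quiver_lim n Y z \<Longrightarrow> (\<lambda>t. qnorm n (Y t)) \<longlonglongrightarrow> qnorm n z"
  unfolding qnorm_def quiver_lim_def
  by (intro tendsto_sum tendsto_add; rule sqnorm_tendsto; blast)

lemma quiver_lim_act:
  assumes "quiver_lim n Y z" "g \<in> HC_group n"
  shows "quiver_lim n (\<lambda>t. quiver_act n g (Y t)) (quiver_act n g z)"
  unfolding quiver_lim_def
proof (intro conjI allI impI)
  show "quiver_act n g z \<in> quivers n" "quiver_act n g (Y t) \<in> quivers n" for t
    using assms by (auto simp: quiver_lim_def quiver_act_quivers)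
  fix i assume i: "i < n"
  then have k: "i \<le> n" "Suc i \<le> n" by auto
  have l: "mat_lim (Suc i) i (\<lambda>t. fst (Y t) i) (fst z i)" "mat_lim i (Suc i) (\<lambda>t. snd (Y t) i) (snd z i)"
    using assms(1) i by (auto simp: quiver_lim_def)
  note c = gauge_dims(1)[OF assms(2) k(1)] gauge_dims(1)[OF assms(2) k(2)]
    SL_D(7)[OF gauge_groupD(1)[OF assms(2) k(1)]] SL_D(7)[OF gauge_groupD(1)[OF assms(2) k(2)]]
  show "mat_lim (Suc i) i (\<lambda>t. fst (quiver_act n g (Y t)) i) (fst (quiver_act n g z) i)"
    unfolding quiver_act_sel[OF assms(2) i]
    by (rule mat_lim_mult[OF mat_lim_mult[OF mat_lim_const l(1)] mat_lim_const]) (rule c)+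
  show "mat_lim i (Suc i) (\<lambda>t. snd (quiver_act n g (Y t)) i) (snd (quiver_act n g z) i)"
    unfolding quiver_act_sel[OF assms(2) i]
    by (rule mat_lim_mult[OF mat_lim_mult[OF mat_lim_const l(2)] mat_lim_const]) (rule c)+
qed

lemma is_csol_lim:
  assumes "quiver_lim n Y z" "\<And>t. is_csol n l (Y t)"
  shows "is_csol n l z"
  unfolding is_csol_def
proof (intro conjI allI impI)
  show "z \<in> quivers n" using assms(1) by (simp add: quiver_lim_def)
  fix i assume i: "Suc i < n"
  then have i': "i < n" by simp
  have "mat_lim (Suc i) (Suc i) (\<lambda>t. muC (Y t) i) (muC z i)"
    unfolding muC_def using assms(1) i i'
    by (intro mat_lim_diff mat_lim_mult[of "Suc i" i _ _ "Suc i"] mat_lim_mult[of "Suc i" "Suc (Suc i)" _ _ "Suc i"])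
       (auto simp: quiver_lim_def)
  moreover have "muC (Y t) i = l (Suc i) \<cdot>\<^sub>m 1\<^sub>m (Suc i)" for t using assms(2) i by (simp add: is_csol_def)
  ultimately have "mat_lim (Suc i) (Suc i) (\<lambda>t. l (Suc i) \<cdot>\<^sub>m 1\<^sub>m (Suc i)) (muC z i)" by simp
  then show "muC z i = l (Suc i) \<cdot>\<^sub>m 1\<^sub>m (Suc i)"
    by (rule mat_lim_unique) (rule mat_lim_const, simp)
qed

section \<open>First-order conditions at a minimal vector\<close>

definition single_gauge :: "nat \<Rightarrow> nat \<Rightarrow> complex mat \<Rightarrow> nat \<Rightarrow> complex mat" where
  "single_gauge n k G = (\<lambda>j\<in>{..n}. if j = k then G else 1\<^sub>m j)"

lemma single_gauge_HC: "k < n \<Longrightarrow> G \<in> SL k \<Longrightarrow> single_gauge n k G \<in> HC_group n"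
  unfolding single_gauge_def by (rule gauge_groupI) (auto simp: SL_one)

text \<open>A change of basis at one vertex affects only the four maps that meet it, so the
  variation of the norm is local.\<close>

lemma qnorm_single_gauge:
  assumes x: "x \<in> quivers n" and j: "Suc j < n" and G: "G \<in> SL (Suc j)"
  shows "qnorm n (quiver_act n (single_gauge n (Suc j) G) x) - qnorm n x =
    (sqnorm (G * fst x j) - sqnorm (fst x j)) + (sqnorm (snd x j * cinv G) - sqnorm (snd x j)) +
    (sqnorm (fst x (Suc j) * cinv G) - sqnorm (fst x (Suc j))) + (sqnorm (G * snd x (Suc j)) - sqnorm (snd x (Suc j)))"
proof -
  let ?g = "single_gauge n (Suc j) G"
  let ?y = "quiver_act n ?g x"
  have g: "?g \<in> HC_group n" by (rule single_gauge_HC[OF j G])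
  have gs: "?g k = (if k = Suc j then G else 1\<^sub>m k)" if "k \<le> n" for k using that by (simp add: single_gauge_def)
  have j': "j < n" using j by simp
  note d = quiversD[OF x j'] quiversD[OF x j] SL_D[OF G]
  have y: "fst ?y i = (if Suc i = Suc j then G else 1\<^sub>m (Suc i)) * fst x i * cinv (if i = Suc j then G else 1\<^sub>m i)"
    "snd ?y i = (if i = Suc j then G else 1\<^sub>m i) * snd x i * cinv (if Suc i = Suc j then G else 1\<^sub>m (Suc i))"
    if "i < n" for i
    using that by (simp_all add: quiver_act_sel[OF g] gs)
  have other: "fst ?y i = fst x i" "snd ?y i = snd x i" if "i < n" "i \<noteq> j" "i \<noteq> Suc j" for i
    using that quiversD[OF x that(1)] by (simp_all add: y cinv_one mat_one_left mat_one_right)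
  have at: "fst ?y j = G * fst x j" "snd ?y j = snd x j * cinv G"
    "fst ?y (Suc j) = fst x (Suc j) * cinv G" "snd ?y (Suc j) = G * snd x (Suc j)"
    using d by (simp_all add: y[OF j] y[OF j'] cinv_one mat_one_left mat_one_right)
  define t where "t i = (sqnorm (fst ?y i) + sqnorm (snd ?y i)) - (sqnorm (fst x i) + sqnorm (snd x i))" for i
  have "qnorm n ?y - qnorm n x = (\<Sum>i<n. t i)" unfolding qnorm_def t_def by (simp add: sum_subtractf)
  also have "\<dots> = (\<Sum>i\<in>{j, Suc j}. t i)"
    by (rule sum.mono_neutral_right) (use j other in \<open>auto simp: t_def\<close>)
  also have "\<dots> = t j + t (Suc j)" by simp
  finally show ?thesis unfolding t_def at by simp
qed

lemma diag_self_adj_product: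
  "i < dim_row X \<Longrightarrow> (X * adj X) $$ (i, i) = of_real (\<Sum>q<dim_col X. (cmod (X $$ (i, q)))\<^sup>2)"
  by (subst mult_mat_index) (auto simp: complex_norm_square simp del: of_real_power intro!: sum.cong)

text \<open>For \<open>p \<noteq> q\<close> a transvection; varying its coefficient tests one
  off-diagonal entry of the real moment map.\<close>

definition elem_mat :: "nat \<Rightarrow> complex \<Rightarrow> nat \<Rightarrow> nat \<Rightarrow> complex mat" where
  "elem_mat k \<epsilon> p q = mat k k (\<lambda>(i, j). (if i = j then 1 else 0) + (if i = p \<and> j = q then \<epsilon> else 0))"

lemma elem_mat_mult_index:
  assumes "dim_row X = k" "i < k" "j < dim_col X" "p < k" "q < k"
  shows "(elem_mat k \<epsilon> p q * X) $$ (i, j) = X $$ (i, j) + (if i = p then \<epsilon> * X $$ (q, j) else 0)"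
proof -
  have "(elem_mat k \<epsilon> p q * X) $$ (i, j) = (\<Sum>l<k. (if l = i then X $$ (i, j) else 0) + (if l = q then (if i = p then \<epsilon> * X $$ (q, j) else 0) else 0))"
  proof -
    have "(elem_mat k \<epsilon> p q * X) $$ (i, j) = (\<Sum>l<k. elem_mat k \<epsilon> p q $$ (i, l) * X $$ (l, j))"
      using assms by (subst mult_mat_index) (auto simp: elem_mat_def)
    also have "\<dots> = (\<Sum>l<k. (if l = i then X $$ (i, j) else 0) + (if l = q then (if i = p then \<epsilon> * X $$ (q, j) else 0) else 0))"
      by (intro sum.cong) (use assms in \<open>auto simp: elem_mat_def distrib_right\<close>)
    finally show ?thesis .
  qed
  also have "\<dots> = X $$ (i, j) + (if i = p then \<epsilon> * X $$ (q, j) else 0)"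
    using assms by (simp add: sum.distrib)
  finally show ?thesis .
qed

lemma elem_mat_SL:
  assumes "p < k" "q < k" "p \<noteq> q"
  shows "elem_mat k \<epsilon> p q \<in> SL k" "cinv (elem_mat k \<epsilon> p q) = elem_mat k (- \<epsilon>) p q"
proof -
  have "elem_mat k \<epsilon> p q = addrow_mat k \<epsilon> p q"
    using assms by (intro eq_matI) (auto simp: elem_mat_def addrow_mat_def)
  then have "det (elem_mat k \<epsilon> p q) = 1" using det_addrow_mat[of p q k \<epsilon>] assms by simp
  then show 1: "elem_mat k \<epsilon> p q \<in> SL k" by (simp add: SL_def elem_mat_def)
  show "cinv (elem_mat k \<epsilon> p q) = elem_mat k (- \<epsilon>) p q"
  proof (rule cinv_eqI[OF 1])
    show "elem_mat k (- \<epsilon>) p q * elem_mat k \<epsilon> p q = 1\<^sub>m k"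
    proof (rule eq_matI)
      fix i j assume "i < dim_row (1\<^sub>m k :: complex mat)" "j < dim_col (1\<^sub>m k :: complex mat)"
      then show "(elem_mat k (- \<epsilon>) p q * elem_mat k \<epsilon> p q) $$ (i, j) = 1\<^sub>m k $$ (i, j)"
        using assms by (subst elem_mat_mult_index) (auto simp: elem_mat_def)
    qed (auto simp: elem_mat_def)
  qed (simp add: elem_mat_def)
qed

lemma sqnorm_elem_left:
  assumes X: "dim_row X = k" and pq: "p < k" "q < k"
  shows "sqnorm (elem_mat k \<epsilon> p q * X) - sqnorm X =
    2 * Re (\<epsilon> * (X * adj X) $$ (q, p)) + (cmod \<epsilon>)\<^sup>2 * Re ((X * adj X) $$ (q, q))"
proof -
  have d: "dim_row (elem_mat k \<epsilon> p q * X) = k" "dim_col (elem_mat k \<epsilon> p q * X) = dim_col X"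
    by (auto simp: elem_mat_def)
  have "sqnorm (elem_mat k \<epsilon> p q * X) - sqnorm X =
      (\<Sum>i<k. (\<Sum>j<dim_col X. (cmod ((elem_mat k \<epsilon> p q * X) $$ (i, j)))\<^sup>2) - (\<Sum>j<dim_col X. (cmod (X $$ (i, j)))\<^sup>2))"
    unfolding sqnorm_def d X by (simp add: sum_subtractf del: index_mult_mat(1))
  also have "\<dots> = (\<Sum>i<k. if i = p then (\<Sum>j<dim_col X. (cmod (X $$ (p, j) + \<epsilon> * X $$ (q, j)))\<^sup>2 - (cmod (X $$ (p, j)))\<^sup>2) else 0)"
    using assms by (intro sum.cong) (auto simp: elem_mat_mult_index sum_subtractf simp del: index_mult_mat(1))
  also have "\<dots> = (\<Sum>j<dim_col X. (cmod (X $$ (p, j) + \<epsilon> * X $$ (q, j)))\<^sup>2 - (cmod (X $$ (p, j)))\<^sup>2)"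
    using pq by simp
  also have "\<dots> = (\<Sum>j<dim_col X. 2 * Re (\<epsilon> * (X $$ (q, j) * cnj (X $$ (p, j)))) + (cmod \<epsilon>)\<^sup>2 * (cmod (X $$ (q, j)))\<^sup>2)"
  proof (rule sum.cong)
    fix j
    have "(cmod (a + b))\<^sup>2 - (cmod a)\<^sup>2 = 2 * Re (b * cnj a) + (cmod b)\<^sup>2" for a b
      by (simp add: cmod_power2) (simp add: power2_eq_square algebra_simps)
    from this[of "X $$ (p, j)" "\<epsilon> * X $$ (q, j)"]
    show "(cmod (X $$ (p, j) + \<epsilon> * X $$ (q, j)))\<^sup>2 - (cmod (X $$ (p, j)))\<^sup>2 =
      2 * Re (\<epsilon> * (X $$ (q, j) * cnj (X $$ (p, j)))) + (cmod \<epsilon>)\<^sup>2 * (cmod (X $$ (q, j)))\<^sup>2"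
      by (simp only: norm_mult power_mult_distrib mult.assoc)
  qed simp
  also have "\<dots> = 2 * Re (\<epsilon> * (\<Sum>j<dim_col X. X $$ (q, j) * cnj (X $$ (p, j)))) + (cmod \<epsilon>)\<^sup>2 * (\<Sum>j<dim_col X. (cmod (X $$ (q, j)))\<^sup>2)"
    by (simp only: sum.distrib sum_distrib_left Re_sum)
  also have "(\<Sum>j<dim_col X. X $$ (q, j) * cnj (X $$ (p, j))) = (X * adj X) $$ (q, p)"
    using assms by (subst mult_mat_index) auto
  also have "(\<Sum>j<dim_col X. (cmod (X $$ (q, j)))\<^sup>2) = Re ((X * adj X) $$ (q, q))"
    using assms by (subst diag_self_adj_product) auto
  finally show ?thesis .
qed

lemma sqnorm_elem_right:
  assumes X: "dim_col X = k" and pq: "p < k" "q < k"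
  shows "sqnorm (X * elem_mat k (- \<epsilon>) p q) - sqnorm X =
    - 2 * Re (\<epsilon> * (adj X * X) $$ (q, p)) + (cmod \<epsilon>)\<^sup>2 * Re ((adj X * X) $$ (p, p))"
proof -
  have "adj (X * elem_mat k (- \<epsilon>) p q) = elem_mat k (- cnj \<epsilon>) q p * adj X"
  proof -
    have "adj (elem_mat k (- \<epsilon>) p q) = elem_mat k (- cnj \<epsilon>) q p"
      by (rule eq_matI) (auto simp: elem_mat_def)
    then show ?thesis using X by (subst adj_mult) (auto simp: elem_mat_def)
  qed
  then have "sqnorm (X * elem_mat k (- \<epsilon>) p q) = sqnorm (elem_mat k (- cnj \<epsilon>) q p * adj X)"
    by (metis sqnorm_adj)
  moreover have "sqnorm (elem_mat k (- cnj \<epsilon>) q p * adj X) - sqnorm (adj X) =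
      2 * Re (- cnj \<epsilon> * (adj X * adj (adj X)) $$ (p, q)) + (cmod (- cnj \<epsilon>))\<^sup>2 * Re ((adj X * adj (adj X)) $$ (p, p))"
    by (rule sqnorm_elem_left) (use assms in auto)
  moreover have "(adj X * X) $$ (p, q) = cnj ((adj X * X) $$ (q, p))"
  proof -
    have "(adj X * X) $$ (p, q) = adj (adj X * X) $$ (p, q)" by (simp add: adj_mult)
    also have "\<dots> = cnj ((adj X * X) $$ (q, p))" by (rule index_adj) (use assms in auto)
    finally show ?thesis .
  qed
  ultimately show ?thesis by (simp del: index_mult_mat(1))
qed

text \<open>For \<open>p \<noteq> q\<close> a one-parameter subgroup of the diagonal torus of SL; it
  compares two diagonal entries of the real moment map.\<close>

definition scale_mat :: "nat \<Rightarrow> real \<Rightarrow> nat \<Rightarrow> nat \<Rightarrow> complex mat" where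
  "scale_mat k s p q = exp_diag k (\<lambda>i. (if i = p then s else 0) + (if i = q then - s else 0))"

lemma scale_mat_SL:
  assumes "p < k" "q < k"
  shows "scale_mat k s p q \<in> SL k" "cinv (scale_mat k s p q) = scale_mat k (- s) p q"
proof -
  have c: "scale_mat k s p q \<in> carrier_mat k k" for s by (auto simp: scale_mat_def intro: carrier_matI)
  have "det (scale_mat k s p q) = 1"
    using assms by (simp add: scale_mat_def det_exp_diag sum.distrib)
  then show 1: "scale_mat k s p q \<in> SL k" using c by (simp add: SL_def)
  show "cinv (scale_mat k s p q) = scale_mat k (- s) p q"
    by (rule cinv_eqI[OF 1 c]) (simp add: scale_mat_def exp_diag_mult exp_diag_0 cong: if_cong,
      auto simp: exp_diag_def mat_diag_def intro!: eq_matI)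
qed

lemma sqnorm_scale_left:
  assumes X: "dim_row X = k" and pq: "p < k" "q < k" "p \<noteq> q"
  shows "sqnorm (scale_mat k s p q * X) - sqnorm X =
    (exp (2 * s) - 1) * Re ((X * adj X) $$ (p, p)) + (exp (- 2 * s) - 1) * Re ((X * adj X) $$ (q, q))"
proof -
  define R where "R i = (\<Sum>j<dim_col X. (cmod (X $$ (i, j)))\<^sup>2)" for i
  have R: "Re ((X * adj X) $$ (i, i)) = R i" if "i < k" for i
    unfolding R_def using that X by (subst diag_self_adj_product) auto
  have e2: "(exp r)\<^sup>2 = exp (2 * r)" for r :: real by (simp add: exp_double)
  have 1: "sqnorm (scale_mat k s p q * X) = (\<Sum>i<k. exp (2 * ((if i = p then s else 0) + (if i = q then - s else 0))) * R i)"
    unfolding sqnorm_def R_def sum_distrib_left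
    by (intro sum.cong) (auto simp: scale_mat_def X exp_diag_mult_index norm_mult power_mult_distrib e2 simp del: index_mult_mat(1))
  have 2: "sqnorm X = (\<Sum>i<k. R i)" by (simp add: sqnorm_def R_def X)
  have "sqnorm (scale_mat k s p q * X) - sqnorm X =
      (\<Sum>i<k. exp (2 * ((if i = p then s else 0) + (if i = q then - s else 0))) * R i - R i)"
    unfolding 1 2 by (rule sum_subtractf[symmetric])
  also have "\<dots> = (\<Sum>i<k. (if i = p then (exp (2 * s) - 1) * R p else 0) + (if i = q then (exp (- 2 * s) - 1) * R q else 0))"
    by (rule sum.cong) (use pq in \<open>auto simp: algebra_simps\<close>)
  also have "\<dots> = (exp (2 * s) - 1) * R p + (exp (- 2 * s) - 1) * R q" using pq by (simp add: sum.distrib)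
  finally show ?thesis using R pq by simp
qed

lemma sqnorm_scale_right:
  assumes X: "dim_col X = k" and pq: "p < k" "q < k" "p \<noteq> q"
  shows "sqnorm (X * scale_mat k s p q) - sqnorm X =
    (exp (2 * s) - 1) * Re ((adj X * X) $$ (p, p)) + (exp (- 2 * s) - 1) * Re ((adj X * X) $$ (q, q))"
proof -
  have "adj (X * scale_mat k s p q) = scale_mat k s p q * adj X"
    using X by (simp add: scale_mat_def adj_mult)
  then have "sqnorm (X * scale_mat k s p q) = sqnorm (scale_mat k s p q * adj X)" by (metis sqnorm_adj)
  then show ?thesis using sqnorm_scale_left[of "adj X" k p q s] assms by simp
qed

text \<open>Minimality is tested at one vertex. Transvections force the off-diagonal entries of the
  real moment map to vanish and torus elements force equal diagonal entries. Since the directions in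
  SL are traceless, a scalar matrix is all that can be expected.\<close>

lemma minimal_imp_rsol:
  assumes x: "x \<in> quivers n" and min: "\<And>g. g \<in> HC_group n \<Longrightarrow> qnorm n x \<le> qnorm n (quiver_act n g x)"
  shows "\<exists>r. is_rsol n r x"
proof -
  have "\<exists>c. muR x j = complex_of_real c \<cdot>\<^sub>m 1\<^sub>m (Suc j)" if j: "Suc j < n" for j
  proof -
    let ?k = "Suc j"
    have j': "j < n" using j by simp
    define a b a' b' where "a = fst x j" and "b = snd x j" and "a' = fst x ?k" and "b' = snd x ?k"
    have d: "dim_row a = ?k" "dim_col b = ?k" "dim_col a' = ?k" "dim_row b' = ?k"
      using quiversD[OF x j'] quiversD[OF x j] by (auto simp: a_def b_def a'_def b'_def)
    define N1 N2 N3 N4 where "N1 = a * adj a" and "N2 = adj b * b" and "N3 = b' * adj b'" and "N4 = adj a' * a'"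
    have M: "muR x j = N1 - N2 + N3 - N4" by (simp add: muR_def N1_def N2_def N3_def N4_def a_def b_def a'_def b'_def)
    have Nd: "dim_row N1 = ?k" "dim_col N1 = ?k" "dim_row N2 = ?k" "dim_col N2 = ?k"
      "dim_row N3 = ?k" "dim_col N3 = ?k" "dim_row N4 = ?k" "dim_col N4 = ?k"
      using d by (auto simp: N1_def N2_def N3_def N4_def)
    have Mi: "muR x j $$ (p, q) = N1 $$ (p, q) - N2 $$ (p, q) + N3 $$ (p, q) - N4 $$ (p, q)" if "p < ?k" "q < ?k" for p q
      unfolding M using that Nd by simp
    have pos: "(sqnorm (G * a) - sqnorm a) + (sqnorm (b * cinv G) - sqnorm b) + (sqnorm (a' * cinv G) - sqnorm a')
        + (sqnorm (G * b') - sqnorm b') \<ge> 0" if G: "G \<in> SL ?k" for G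
      using qnorm_single_gauge[OF x j G] min[OF single_gauge_HC[OF j G]]
      by (simp add: a_def b_def a'_def b'_def)
    have off: "muR x j $$ (q, p) = 0" if pq: "p < ?k" "q < ?k" "p \<noteq> q" for p q
    proof -
      define m where "m = muR x j $$ (q, p)"
      define c where "c = Re (N1 $$ (q, q)) + Re (N2 $$ (p, p)) + Re (N4 $$ (p, p)) + Re (N3 $$ (q, q))"
      have ge: "0 \<le> 2 * Re (\<epsilon> * m) + (cmod \<epsilon>)\<^sup>2 * c" for \<epsilon>
      proof -
        have "0 \<le> (2 * Re (\<epsilon> * N1 $$ (q, p)) + (cmod \<epsilon>)\<^sup>2 * Re (N1 $$ (q, q))) +
            (- 2 * Re (\<epsilon> * N2 $$ (q, p)) + (cmod \<epsilon>)\<^sup>2 * Re (N2 $$ (p, p))) +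
            (- 2 * Re (\<epsilon> * N4 $$ (q, p)) + (cmod \<epsilon>)\<^sup>2 * Re (N4 $$ (p, p))) +
            (2 * Re (\<epsilon> * N3 $$ (q, p)) + (cmod \<epsilon>)\<^sup>2 * Re (N3 $$ (q, q)))"
          using pos[OF elem_mat_SL(1)[OF pq, of \<epsilon>]]
          unfolding elem_mat_SL(2)[OF pq] sqnorm_elem_left[OF d(1) pq(1,2)] sqnorm_elem_left[OF d(4) pq(1,2)]
            sqnorm_elem_right[OF d(2) pq(1,2)] sqnorm_elem_right[OF d(3) pq(1,2)]
          unfolding N1_def N2_def N3_def N4_def .
        also have "\<dots> = 2 * Re (\<epsilon> * m) + (cmod \<epsilon>)\<^sup>2 * c"
          unfolding m_def Mi[OF pq(2,1)] c_def by (simp add: algebra_simps)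
        finally show ?thesis .
      qed
      have "m = 0"
      proof (rule ccontr)
        assume "m \<noteq> 0"
        define M2 where "M2 = (cmod m)\<^sup>2"
        have M2: "M2 > 0" using \<open>m \<noteq> 0\<close> by (simp add: M2_def)
        \<comment> \<open>The direction \<open>- t * cnj m\<close> makes the linear term real and
          negative.\<close>
        have *: "0 \<le> - 2 * t * M2 + t\<^sup>2 * M2 * c" for t :: real
        proof -
          have e: "(- of_real t * cnj m) * m = of_real (- t * M2)"
            using complex_norm_square[of m] by (simp add: M2_def mult.commute del: of_real_power)
          have "(cmod (- of_real t * cnj m))\<^sup>2 = t\<^sup>2 * M2"
            by (simp add: norm_mult power_mult_distrib M2_def)
          then show ?thesis using ge[of "- of_real t * cnj m"] unfolding e by simp
        qed
        \<comment> \<open>Small enough for the linear term to outweigh the quadratic one, whatever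
          the sign of \<open>c\<close>.\<close>
        define t where "t = 1 / (\<bar>c\<bar> + 1)"
        have t: "t > 0" "t * c < 2" by (auto simp: t_def divide_simps)
        have "0 \<le> t * M2 * (t * c - 2)" using *[of t] by (simp add: power2_eq_square algebra_simps)
        moreover have "t * M2 * (t * c - 2) < 0" using t M2 by (intro mult_pos_neg) auto
        ultimately show False by linarith
      qed
      then show ?thesis by (simp add: m_def)
    qed
    have dg: "Re (muR x j $$ (p, p)) \<le> Re (muR x j $$ (q, q))" if pq: "p < ?k" "q < ?k" "p \<noteq> q" for p q
    proof -
      define A where "A = Re (N1 $$ (p, p)) + Re (N3 $$ (p, p)) + Re (N2 $$ (q, q)) + Re (N4 $$ (q, q))"
      define B where "B = Re (N1 $$ (q, q)) + Re (N3 $$ (q, q)) + Re (N2 $$ (p, p)) + Re (N4 $$ (p, p))"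
      have ge: "0 \<le> (exp (2 * s) - 1) * A + (exp (- 2 * s) - 1) * B" for s
      proof -
        have "0 \<le> ((exp (2 * s) - 1) * Re (N1 $$ (p, p)) + (exp (- 2 * s) - 1) * Re (N1 $$ (q, q))) +
            ((exp (2 * - s) - 1) * Re (N2 $$ (p, p)) + (exp (- 2 * - s) - 1) * Re (N2 $$ (q, q))) +
            ((exp (2 * - s) - 1) * Re (N4 $$ (p, p)) + (exp (- 2 * - s) - 1) * Re (N4 $$ (q, q))) +
            ((exp (2 * s) - 1) * Re (N3 $$ (p, p)) + (exp (- 2 * s) - 1) * Re (N3 $$ (q, q)))"
          using pos[OF scale_mat_SL(1)[OF pq(1,2), of s]]
          unfolding scale_mat_SL(2)[OF pq(1,2)] sqnorm_scale_left[OF d(1) pq] sqnorm_scale_left[OF d(4) pq]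
            sqnorm_scale_right[OF d(2) pq] sqnorm_scale_right[OF d(3) pq]
          unfolding N1_def N2_def N3_def N4_def .
        also have "\<dots> = (exp (2 * s) - 1) * A + (exp (- 2 * s) - 1) * B"
          unfolding A_def B_def by (simp add: algebra_simps)
        finally show ?thesis .
      qed
      \<comment> \<open>With \<open>\<sigma> = exp (2 s)\<close> the variation factors, and values
        below 1 give the one-sided bound that is needed.\<close>
      have "(\<sigma> - 1) * (A - B / \<sigma>) \<ge> 0" if "\<sigma> > 0" for \<sigma> :: real
      proof -
        have 1: "exp (2 * (ln \<sigma> / 2)) = \<sigma>" "exp (- 2 * (ln \<sigma> / 2)) = 1 / \<sigma>"
          using that by (simp_all add: exp_minus inverse_eq_divide)
        have "0 \<le> (\<sigma> - 1) * A + (1 / \<sigma> - 1) * B" using ge[of "ln \<sigma> / 2"] unfolding 1 .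
        also have "\<dots> = (\<sigma> - 1) * (A - B / \<sigma>)" using that by (simp add: field_simps)
        finally show ?thesis .
      qed
      then have lt: "A \<le> B / \<sigma>" if "0 < \<sigma>" "\<sigma> < 1" for \<sigma>
        using that by (smt (verit) mult_neg_pos)
      have "A \<le> B"
      proof (rule ccontr)
        assume "\<not> A \<le> B"
        have B0: "B \<ge> 0"
        proof -
          have "Re ((Z * adj Z) $$ (i, i)) \<ge> 0" if "i < dim_row Z" for Z i
            using that by (subst diag_self_adj_product) (auto intro: sum_nonneg)
          from this[of _ a] this[of _ b'] this[of _ "adj b"] this[of _ "adj a'"] show ?thesis
            using pq d unfolding B_def N1_def N2_def N3_def N4_def by (auto intro!: add_nonneg_nonneg simp del: index_mult_mat(1))
        qed
        have A0: "A > 0" using B0 \<open>\<not> A \<le> B\<close> by simp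
        \<comment> \<open>The midpoint of \<open>B / A\<close> and 1, which contradicts
          \<open>A \<le> B / \<sigma>\<close> when \<open>A > B\<close>.\<close>
        define \<sigma> where "\<sigma> = (A + B) / (2 * A)"
        have \<sigma>: "0 < \<sigma>" "\<sigma> < 1" using A0 B0 \<open>\<not> A \<le> B\<close> by (auto simp: \<sigma>_def field_simps)
        have "A * \<sigma> \<le> B" using lt[OF \<sigma>] \<sigma> by (simp add: field_simps)
        moreover have "A * \<sigma> = (A + B) / 2" using A0 by (simp add: \<sigma>_def)
        ultimately show False using \<open>\<not> A \<le> B\<close> by simp
      qed
      then show ?thesis
        unfolding Mi[OF pq(1,1)] Mi[OF pq(2,2)] A_def B_def by simp
    qed
    define c where "c = Re (muR x j $$ (0, 0))"
    have diag: "muR x j $$ (p, p) = of_real c" if p: "p < ?k" for p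
    proof -
      have "Re (muR x j $$ (p, p)) = c"
        using dg[of p 0] dg[of 0 p] p unfolding c_def by (cases "p = 0") auto
      moreover have "Im ((Z * adj Z) $$ (i, i)) = 0" if "i < dim_row Z" for Z i
        using that by (subst diag_self_adj_product) auto
      from this[of p a] this[of p b'] this[of p "adj b"] this[of p "adj a'"]
      have "Im (muR x j $$ (p, p)) = 0"
        unfolding Mi[OF p p] N1_def N2_def N3_def N4_def using d p by (simp del: index_mult_mat(1))
      ultimately show ?thesis by (simp add: complex_eq_iff)
    qed
    have "muR x j = complex_of_real c \<cdot>\<^sub>m 1\<^sub>m ?k"
    proof (rule eq_matI)
      fix p q assume "p < dim_row (complex_of_real c \<cdot>\<^sub>m 1\<^sub>m ?k)" "q < dim_col (complex_of_real c \<cdot>\<^sub>m 1\<^sub>m ?k)"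
      then show "muR x j $$ (p, q) = (complex_of_real c \<cdot>\<^sub>m 1\<^sub>m ?k) $$ (p, q)"
        using diag[of p] off[of q p] by (cases "p = q") auto
    qed (use muC_carrier(2)[OF x j] in auto)
    then show ?thesis by blast
  qed
  then obtain f where f: "\<And>j. Suc j < n \<Longrightarrow> muR x j = complex_of_real (f j) \<cdot>\<^sub>m 1\<^sub>m (Suc j)" by metis
  have "is_rsol n (\<lambda>k. f (k - 1)) x" using x f by (simp add: is_rsol_def)
  then show ?thesis by blast
qed

text \<open>The infimum of the norm need not be attained on the orbit of \<open>y\<close>, but a
  minimising sequence is bounded and has a limit \<open>z\<close> in the closure. The norm cannot
  drop below the infimum along the orbit of \<open>z\<close> either, since translates of the
  sequence stay in the original orbit; so \<open>z\<close> is minimal. The complex multipliers are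
  constant along the sequence and survive the limit.\<close>

theorem Kempf_Ness_existence:
  assumes y: "is_csol n l y"
  shows "\<exists>z r Y. is_csol n l z \<and> is_rsol n r z \<and> quiver_lim n Y z \<and> (\<forall>t. \<exists>g\<in>HC_group n. Y t = quiver_act n g y)"
proof -
  have q: "y \<in> quivers n" using y by (simp add: is_csol_def)
  define S where "S = (\<lambda>g. qnorm n (quiver_act n g y)) ` HC_group n"
  have S0: "S \<noteq> {}" using H_HC[OF gauge_one_H] by (auto simp: S_def)
  have Sb: "bdd_below S"
    by (rule bdd_belowI[of _ 0]) (auto simp: S_def qnorm_def intro!: sum_nonneg add_nonneg_nonneg)
  define m where "m = Inf S"
  have "\<exists>g\<in>HC_group n. qnorm n (quiver_act n g y) < m + 1 / real (Suc t)" for t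
  proof -
    have "\<exists>s\<in>S. s < m + 1 / real (Suc t)"
      unfolding m_def by (rule cInf_lessD[OF S0]) simp
    then show ?thesis by (auto simp: S_def)
  qed
  then obtain g where g: "\<And>t. g t \<in> HC_group n" "\<And>t. qnorm n (quiver_act n (g t) y) < m + 1 / real (Suc t)"
    by metis
  define Y where "Y t = quiver_act n (g t) y" for t
  have Yq: "Y t \<in> quivers n" for t unfolding Y_def by (rule quiver_act_quivers[OF g(1) q])
  have Yle: "qnorm n (Y t) \<le> m + 1" for t
  proof -
    have "1 / real (Suc t) \<le> 1" by simp
    then show ?thesis using g(2)[of t] unfolding Y_def by linarith
  qed
  obtain r z where r: "strict_mono r" and z: "quiver_lim n (\<lambda>t. Y (r t)) z"
    using bounded_quivers_subseq[of Y n "m + 1"] Yq Yle by blast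
  have m_le: "m \<le> qnorm n (quiver_act n h y)" if "h \<in> HC_group n" for h
    unfolding m_def by (rule cInf_lower[OF _ Sb]) (use that in \<open>auto simp: S_def\<close>)
  have "qnorm n z \<le> m"
  proof (rule LIMSEQ_le)
    show "(\<lambda>t. qnorm n (Y (r t))) \<longlonglongrightarrow> qnorm n z" by (rule qnorm_tendsto[OF z])
    have "(\<lambda>t. m + 1 / real (Suc t)) \<longlonglongrightarrow> m + 0"
      by (intro tendsto_add tendsto_const) (use LIMSEQ_inverse_real_of_nat in \<open>simp add: inverse_eq_divide\<close>)
    then show "(\<lambda>t. m + 1 / real (Suc (r t))) \<longlonglongrightarrow> m"
      using LIMSEQ_subseq_LIMSEQ[OF _ r, of "\<lambda>t. m + 1 / real (Suc t)" m] by (simp add: o_def)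
    show "\<exists>N. \<forall>t\<ge>N. qnorm n (Y (r t)) \<le> m + 1 / real (Suc (r t))"
      using g(2) unfolding Y_def by (auto intro: less_imp_le)
  qed
  moreover have "m \<le> qnorm n (quiver_act n h z)" if h: "h \<in> HC_group n" for h
  proof (rule LIMSEQ_le_const[OF qnorm_tendsto[OF quiver_lim_act[OF z h]]])
    show "\<exists>N. \<forall>t\<ge>N. m \<le> qnorm n (quiver_act n h (Y (r t)))"
      unfolding Y_def quiver_act_act[OF h g(1) q] using m_le[OF gauge_mult_HC[OF h g(1)]] by blast
  qed
  ultimately have "\<exists>r. is_rsol n r z"
    using z by (intro minimal_imp_rsol) (auto simp: quiver_lim_def intro: order_trans)
  moreover have "is_csol n l z"
    by (rule is_csol_lim[OF z]) (simp add: Y_def is_csol_act[OF y g(1)])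
  ultimately show ?thesis using z g(1) unfolding Y_def by blast
qed


section \<open>Reconstruction from maximal minors\<close>

text \<open>A repeated row makes both determinants 0; otherwise the selection is a permutation of an
  increasing one, whose determinant is a maximal minor.\<close>

lemma det_selected_rows_eq:
  fixes A A' :: "complex mat"
  assumes A: "A \<in> carrier_mat n j" and A': "A' \<in> carrier_mat n j"
    and minors: "\<And>I. I \<in> index_sets n j \<Longrightarrow> det (submatrix A I UNIV) = det (submatrix A' I UNIV)"
    and f: "\<And>p. p < j \<Longrightarrow> f p < n"
  shows "det (mat j j (\<lambda>(p, q). A $$ (f p, q))) = det (mat j j (\<lambda>(p, q). A' $$ (f p, q)))"
proof (cases "inj_on f {..<j}")
  case False
  then obtain p q where pq: "p < j" "q < j" "p \<noteq> q" "f p = f q" by (auto simp: inj_on_def)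
  have "det (mat j j (\<lambda>(p, q). B $$ (f p, q))) = 0" for B :: "complex mat"
    by (rule det_identical_rows[of _ j p q]) (use pq in \<open>auto intro!: eq_vecI\<close>)
  then show ?thesis by simp
next
  case True
  define I where "I = f ` {..<j}"
  have I: "I \<subseteq> {..<n}" "card I = j" "finite I"
    using f True by (auto simp: I_def card_image)
  then have II: "I \<in> index_sets n j" by (simp add: index_sets_def)
  have cI: "card {i. i < n \<and> i \<in> I} = j"
  proof -
    have "{i. i < n \<and> i \<in> I} = I" using I by auto
    then show ?thesis using I by simp
  qed
  \<comment> \<open>The rank of \<open>f p\<close> within the selected rows, which inverts
    \<open>pick I\<close>.\<close>
  define \<pi> where "\<pi> p = (if p < j then card {a \<in> I. a < f p} else p)" for p
  have pick: "pick I (\<pi> p) = f p" if "p < j" for p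
    using pick_card_in_set[of "f p" I] that by (simp add: \<pi>_def I_def)
  have lt: "\<pi> p < j" if "p < j" for p
  proof -
    have "{a \<in> I. a < f p} \<subset> I" using that by (auto simp: I_def)
    then have "card {a \<in> I. a < f p} < card I" by (rule psubset_card_mono[OF I(3)])
    then show ?thesis using I(2) that by (simp add: \<pi>_def)
  qed
  have inj: "inj_on \<pi> {0..<j}"
  proof (rule inj_onI)
    fix p q assume "p \<in> {0..<j}" "q \<in> {0..<j}" "\<pi> p = \<pi> q"
    then have "f p = f q" "p < j" "q < j" using pick[of p] pick[of q] by auto
    then show "p = q" using True by (auto simp: inj_on_def)
  qed
  have "\<pi> permutes {0..<j}"
  proof (rule bij_imp_permutes)
    have "\<pi> ` {0..<j} \<subseteq> {0..<j}" using lt by auto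
    then show "bij_betw \<pi> {0..<j} {0..<j}" using inj endo_inj_surj[of "{0..<j}" \<pi>] by (auto simp: bij_betw_def)
  qed (auto simp: \<pi>_def)
  then have "det (mat j j (\<lambda>(p, q). B $$ (f p, q))) = signof \<pi> * det (submatrix B I UNIV)"
    if B: "B \<in> carrier_mat n j" for B :: "complex mat"
  proof -
    have d: "submatrix B I UNIV \<in> carrier_mat j j"
      using B cI by (intro carrier_matI) (auto simp: dim_submatrix)
    have "mat j j (\<lambda>(p, q). B $$ (f p, q)) = mat j j (\<lambda>(p, q). submatrix B I UNIV $$ (\<pi> p, q))"
    proof (rule eq_matI)
      fix p q assume "p < dim_row (mat j j (\<lambda>(p, q). submatrix B I UNIV $$ (\<pi> p, q)))"
        "q < dim_col (mat j j (\<lambda>(p, q). submatrix B I UNIV $$ (\<pi> p, q)))"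
      then have pq: "p < j" "q < j" by auto
      have "submatrix B I UNIV $$ (\<pi> p, q) = B $$ (pick I (\<pi> p), pick UNIV q)"
        by (rule submatrix_index) (use B cI lt pq in auto)
      then show "mat j j (\<lambda>(p, q). B $$ (f p, q)) $$ (p, q) = mat j j (\<lambda>(p, q). submatrix B I UNIV $$ (\<pi> p, q)) $$ (p, q)"
        using pq pick by (simp add: pick_UNIV)
    qed auto
    then show ?thesis using det_permute_rows[OF d \<open>\<pi> permutes {0..<j}\<close>] by simp
  qed
  then show ?thesis using A A' minors[OF II] by simp
qed

text \<open>The Cauchy-Binet expansion, left in its multilinear form with a sum over all row
  selections: each summand depends on \<open>A\<close> only through a determinant of selected
  rows.\<close>

lemma det_mult_eq_if_minors_eq:
  fixes A A' :: "complex mat"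
  assumes A: "A \<in> carrier_mat n j" and A': "A' \<in> carrier_mat n j" and B: "B \<in> carrier_mat j n"
    and minors: "\<And>I. I \<in> index_sets n j \<Longrightarrow> det (submatrix A I UNIV) = det (submatrix A' I UNIV)"
  shows "det (B * A) = det (B * A')"
proof -
  define F where "F = {f :: nat \<Rightarrow> nat. (\<forall>i\<in>{0..<j}. f i \<in> {0..<n}) \<and> (\<forall>i. i \<notin> {0..<j} \<longrightarrow> f i = i)}"
  have exp: "det (B * M) = (\<Sum>f\<in>F. (\<Prod>i\<in>{0..<j}. B $$ (i, f i)) * det (mat j j (\<lambda>(p, q). M $$ (f p, q))))"
    if M: "M \<in> carrier_mat n j" for M
  proof -
    have "det (B * M) = det (mat\<^sub>r j j (\<lambda>i. finsum_vec TYPE(complex) j (\<lambda>k. B $$ (i, k) \<cdot>\<^sub>v row M k) {0..<n}))"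
      unfolding mat_mul_finsum_alt[OF B M] ..
    also have "\<dots> = (\<Sum>f\<in>F. det (mat\<^sub>r j j (\<lambda>i. B $$ (i, f i) \<cdot>\<^sub>v row M (f i))))"
      unfolding F_def by (rule det_linear_rows_sum) (use M in auto)
    also have "\<dots> = (\<Sum>f\<in>F. (\<Prod>i\<in>{0..<j}. B $$ (i, f i)) * det (mat j j (\<lambda>(p, q). M $$ (f p, q))))"
    proof (rule sum.cong)
      fix f assume f: "f \<in> F"
      have "det (mat\<^sub>r j j (\<lambda>i. B $$ (i, f i) \<cdot>\<^sub>v row M (f i))) =
          (\<Prod>i\<in>{0..<j}. B $$ (i, f i)) * det (mat\<^sub>r j j (\<lambda>i. row M (f i)))"
        by (rule det_rows_mul) (use M in auto)
      also have "mat\<^sub>r j j (\<lambda>i. row M (f i)) = mat j j (\<lambda>(p, q). M $$ (f p, q))"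
      proof (rule eq_rowI)
        fix i assume "i < dim_row (mat j j (\<lambda>(p, q). M $$ (f p, q)))"
        then have i: "i < j" "f i < n" using f by (auto simp: F_def)
        then have "row (mat\<^sub>r j j (\<lambda>i. row M (f i))) i = row M (f i)" using M by (intro row_mat_of_row_fun) auto
        then show "row (mat\<^sub>r j j (\<lambda>i. row M (f i))) i = row (mat j j (\<lambda>(p, q). M $$ (f p, q))) i"
          using i M by (intro eq_vecI) auto
      qed auto
      finally show "det (mat\<^sub>r j j (\<lambda>i. B $$ (i, f i) \<cdot>\<^sub>v row M (f i))) =
        (\<Prod>i\<in>{0..<j}. B $$ (i, f i)) * det (mat j j (\<lambda>(p, q). M $$ (f p, q)))" .
    qed simp
    finally show ?thesis .
  qed
  show ?thesis
    unfolding exp[OF A] exp[OF A']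
    by (intro sum.cong refl arg_cong2[of _ _ _ _ "(*)"] det_selected_rows_eq[OF A A' minors])
       (auto simp: F_def)
qed

text \<open>The determinants \<open>det (B A')\<close> with \<open>B = L + M (1 - A L)\<close> are all \<open>1\<close>, which forces
  \<open>(1 - A L) A' = 0\<close>.\<close>

lemma SL_equivalent_if_minors_eq:
  fixes A A' :: "complex mat"
  assumes A: "A \<in> carrier_mat n j" and A': "A' \<in> carrier_mat n j" and L: "L \<in> carrier_mat j n"
    and LA: "L * A = 1\<^sub>m j"
    and minors: "\<And>I. I \<in> index_sets n j \<Longrightarrow> det (submatrix A I UNIV) = det (submatrix A' I UNIV)"
  shows "\<exists>g\<in>SL j. A' = A * g"
proof -
  note d = carrier_matD[OF A] carrier_matD[OF A'] carrier_matD[OF L]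
  note dets = det_mult_eq_if_minors_eq[OF A A' _ minors]
  define g where "g = L * A'"
  have gc: "g \<in> carrier_mat j j" using A' L by (auto simp: g_def)
  have "det g = 1" using dets[OF L] LA by (simp add: g_def)
  then have g: "g \<in> SL j" using gc by (simp add: SL_def)
  note gd = SL_D[OF g]
  define C where "C = 1\<^sub>m n - A * L"
  have Cd: "dim_row C = n" "dim_col C = n" using d by (auto simp: C_def)
  have CA: "C * A = 0\<^sub>m n j"
    using d LA by (simp add: C_def mat_distrib) (rule eq_matI, auto)
  define T where "T = C * A'"
  have Td: "dim_row T = n" "dim_col T = j" using Cd d by (auto simp: T_def)
  define S where "S = T * cinv g"
  have Sd: "dim_row S = n" "dim_col S = j" using Td gd by (auto simp: S_def)
  have "S $$ (r, q) = 0" if rq: "r < n" "q < j" for r q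
  proof (rule ccontr)
    assume s: "S $$ (r, q) \<noteq> 0"
    \<comment> \<open>A single entry, scaled so that \<open>M * S\<close> sends \<open>e_q\<close>
      to \<open>- e_q\<close>; then \<open>1 + M * S\<close> is singular, while its determinant
      should be 1.\<close>
    define M where "M = mat j n (\<lambda>(i, k). if i = q \<and> k = r then - 1 / S $$ (r, q) else 0)"
    have Md: "dim_row M = j" "dim_col M = n" by (auto simp: M_def)
    define B where "B = L + M * C"
    have Bc: "B \<in> carrier_mat j n" using d Md Cd by (auto simp: B_def intro!: carrier_matI)
    have "B * A = L * A + M * (C * A)" using d Md Cd by (simp add: B_def mat_distrib)
    also have "\<dots> = 1\<^sub>m j" unfolding LA CA using Md by simp
    finally have "det (B * A') = 1" using dets[OF Bc] by simp
    moreover have "B * A' = (1\<^sub>m j + M * S) * g"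
    proof -
      have "B * A' = g + M * T" using d Md Cd by (simp add: B_def T_def g_def mat_distrib)
      also have "T = S * g" using Td gd by (simp add: S_def mat_assoc mat_one_right)
      finally show ?thesis using Md Sd gd by (simp add: mat_distrib)
    qed
    moreover have "det ((1\<^sub>m j + M * S) * g) = det (1\<^sub>m j + M * S) * det g"
      by (rule det_mult[of _ j]) (use Md Sd gc in \<open>auto intro!: carrier_matI\<close>)
    ultimately have "det (1\<^sub>m j + M * S) = 1" using gd(2) by simp
    moreover have "det (1\<^sub>m j + M * S) = 0"
    proof -
      have c: "1\<^sub>m j + M * S \<in> carrier_mat j j" using Md Sd by (auto intro!: carrier_matI)
      have "(M * S) $$ (i, q) = (if i = q then - 1 else 0)" if "i < j" for i
      proof -
        have "(M * S) $$ (i, q) = (\<Sum>k<n. M $$ (i, k) * S $$ (k, q))"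
          using that rq Md Sd by (subst mult_mat_index) auto
        also have "\<dots> = (\<Sum>k<n. if k = r then (if i = q then - 1 else 0) else 0)"
          by (rule sum.cong) (use that rq s in \<open>auto simp: M_def\<close>)
        finally show ?thesis using rq by simp
      qed
      then have "(1\<^sub>m j + M * S) *\<^sub>v unit_vec j q = 0\<^sub>v j"
        using rq Md Sd by (intro eq_vecI) (auto simp del: index_mult_mat(1))
      moreover have "unit_vec j q \<noteq> (0\<^sub>v j :: complex vec)" using rq by simp
      ultimately show ?thesis unfolding det_0_iff_vec_prod_zero_field[OF c] by (metis unit_vec_carrier)
    qed
    ultimately show False by simp
  qed
  then have "S = 0\<^sub>m n j" using Sd by (intro eq_matI) auto
  moreover have "T = S * g" using Td gd by (simp add: S_def mat_assoc mat_one_right)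
  ultimately have "T = 0\<^sub>m n j" using gd by simp
  moreover have "T = A' - A * g" using d by (simp add: T_def C_def g_def mat_distrib)
  ultimately have T0: "A' - A * g = 0\<^sub>m n j" by simp
  have "A' = A * g"
  proof (rule eq_matI)
    fix p q assume "p < dim_row (A * g)" "q < dim_col (A * g)"
    then show "A' $$ (p, q) = (A * g) $$ (p, q)"
      using arg_cong[OF T0, of "\<lambda>M. M $$ (p, q)"] d gd by (simp del: index_mult_mat(1))
  qed (use d gd in auto)
  then show ?thesis using g by blast
qed

section \<open>Compositions and equivalence of regular solutions\<close>

text \<open>The fold adds factors on the left, whereas the recursion needed later splits off the
  rightmost one; an arbitrary initial matrix \<open>B\<close> reconciles the two.\<close>

lemma fold_mult_left:
  fixes B :: "complex mat"
  assumes "\<And>i. i < n \<Longrightarrow> a i \<in> carrier_mat (Suc i) i" "j \<le> m" "m \<le> n" "dim_row B = j"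
  shows "dim_row (fold (\<lambda>i B. a i * B) [j..<m] B) = m \<and> dim_col (fold (\<lambda>i B. a i * B) [j..<m] B) = dim_col B \<and>
    fold (\<lambda>i B. a i * B) [j..<m] B = fold (\<lambda>i B. a i * B) [j..<m] (1\<^sub>m j) * B \<and>
    dim_row (fold (\<lambda>i B. a i * B) [j..<m] (1\<^sub>m j)) = m \<and> dim_col (fold (\<lambda>i B. a i * B) [j..<m] (1\<^sub>m j)) = (j :: nat)"
  using assms(2,3)
proof (induction m rule: dec_induct)
  case base
  show ?case using assms(4) mat_one_left[of B j] by simp
next
  case (step m)
  then have m: "m < n" by simp
  have IH: "dim_row (fold (\<lambda>i B. a i * B) [j..<m] B) = m" "dim_col (fold (\<lambda>i B. a i * B) [j..<m] B) = dim_col B"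
    "fold (\<lambda>i B. a i * B) [j..<m] B = fold (\<lambda>i B. a i * B) [j..<m] (1\<^sub>m j) * B"
    "dim_row (fold (\<lambda>i B. a i * B) [j..<m] (1\<^sub>m j)) = m" "dim_col (fold (\<lambda>i B. a i * B) [j..<m] (1\<^sub>m j)) = j"
    using step m by auto
  have u: "[j..<Suc m] = [j..<m] @ [m]" using step(1) by simp
  have am: "dim_row (a m) = Suc m" "dim_col (a m) = m" using assms(1)[OF m] by auto
  show ?case
    unfolding u fold_append o_def using IH(1,2,4,5) am assms(4)
    by (simp add: mat_assoc) (simp add: IH(3))
qed

lemma compose_from_dims:
  assumes "\<And>i. i < n \<Longrightarrow> a i \<in> carrier_mat (Suc i) i" "j \<le> n"
  shows "compose_from n a j \<in> carrier_mat n j" "dim_row (compose_from n a j) = n" "dim_col (compose_from n a j) = j"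
  unfolding compose_from_def using fold_mult_left[OF assms(1), of n j n "1\<^sub>m j"] assms(2)
  by (auto intro: carrier_matI)

lemma compose_from_rec:
  assumes "\<And>i. i < n \<Longrightarrow> a i \<in> carrier_mat (Suc i) i" "j < n"
  shows "compose_from n a j = compose_from n a (Suc j) * a j"
proof -
  have "[j..<n] = j # [Suc j..<n]" using assms(2) by (rule upt_conv_Cons)
  moreover have "a j * 1\<^sub>m j = a j" using assms(1)[OF assms(2)] by simp
  ultimately have "compose_from n a j = fold (\<lambda>i B. a i * B) [Suc j..<n] (a j)"
    by (simp add: compose_from_def)
  then show ?thesis
    using fold_mult_left[OF assms(1), of n "Suc j" n "a j"] assms(1)[OF assms(2)] assms(2)
    unfolding compose_from_def by auto
qed

lemma compose_from_n: "compose_from n a n = 1\<^sub>m n"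
  by (simp add: compose_from_def)

lemma compose_from_act:
  assumes x: "x \<in> quivers n" and g: "g \<in> HC_group n" and j: "j \<le> n"
  shows "compose_from n (fst (quiver_act n g x)) j = compose_from n (fst x) j * cinv (g j)"
  using j
proof (induction rule: inc_induct)
  case base
  then show ?case using gauge_groupD(2)[OF g] by (simp add: compose_from_n cinv_one)
next
  case (step j)
  then have k: "j < n" "j \<le> n" "Suc j \<le> n" by auto
  have c: "\<And>i. i < n \<Longrightarrow> fst x i \<in> carrier_mat (Suc i) i" using quiversD[OF x] by blast
  have c': "\<And>i. i < n \<Longrightarrow> fst (quiver_act n g x) i \<in> carrier_mat (Suc i) i"
    using quiversD[OF quiver_act_quivers[OF g x]] by blast
  note dd = gauge_dims[OF g k(2)] gauge_dims[OF g k(3)] quiversD[OF x k(1)] compose_from_dims[OF c k(3)]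
  have "compose_from n (fst (quiver_act n g x)) j = compose_from n (fst (quiver_act n g x)) (Suc j) * fst (quiver_act n g x) j"
    by (rule compose_from_rec[OF c' k(1)])
  also have "\<dots> = compose_from n (fst x) (Suc j) * cinv (g (Suc j)) * (g (Suc j) * fst x j * cinv (g j))"
    unfolding step(3) quiver_act_sel[OF g k(1)] ..
  also have "\<dots> = compose_from n (fst x) (Suc j) * fst x j * cinv (g j)"
    using dd by (simp add: mat_assoc gauge_cancel[OF g k(3)])
  also have "compose_from n (fst x) (Suc j) * fst x j = compose_from n (fst x) j"
    by (rule compose_from_rec[OF c k(1), symmetric])
  finally show ?case .
qed

text \<open>The multipliers determine the trace of every product, which restores what
  \<open>traceless_part\<close> removes.\<close>

lemma csol_trace_eq:
  assumes y: "is_csol n l y" and y': "is_csol n l y'" and k: "k < n"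
  shows "mtr (fst y k * snd y k) = mtr (fst y' k * snd y' k)"
proof -
  have q: "y \<in> quivers n" "y' \<in> quivers n" using y y' by (auto simp: is_csol_def)
  have c: "mtr (fst z k * snd z k) = mtr (snd z k * fst z k)" if "z \<in> quivers n" "k < n" for z k
    by (rule mtr_commute[OF quiversD(1,2)[OF that]])
  show ?thesis using k
  proof (induction k)
    case 0
    then show ?case unfolding c[OF q(1) 0] c[OF q(2) 0] using quiversD[OF q(1) 0] quiversD[OF q(2) 0]
      by (simp add: mtr_def)
  next
    case (Suc k)
    have k: "k < n" using Suc.prems by simp
    have "mtr (fst z k * snd z k + (- l (Suc k)) \<cdot>\<^sub>m 1\<^sub>m (Suc k)) = mtr (fst z k * snd z k) - l (Suc k) * of_nat (Suc k)"
      if "z \<in> quivers n" for z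
      using quiversD[OF that k] by (subst mtr_add[of _ "Suc k"]) (auto simp: mtr_smult[of _ "Suc k"])
    then show ?case
      unfolding c[OF q(1) Suc.prems] c[OF q(2) Suc.prems] csol_product[OF y Suc.prems] csol_product[OF y' Suc.prems]
      using Suc.IH[OF k] q by simp
  qed
qed

text \<open>Regularity supplies left inverses \<open>R j\<close> of the arrows and, by composition,
  \<open>L j\<close> of the compositions \<open>A j\<close>. Cancelling \<open>A (Suc j)\<close>
  turns the relation \<open>A' j = A j * g j\<close> into an intertwining relation for the arrows
  \<open>a\<close>; cancelling \<open>a_j\<close> turns an intertwining of products into one for
  \<open>b_j\<close>. The latter is propagated from the top, where \<open>g\<close> is 1.\<close>

theorem regular_csol_equivalent:
  assumes y: "is_csol n l y" and y': "is_csol n l y'" and n: "n = Suc m"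
    and reg: "\<And>k. k < n \<Longrightarrow> det (snd y k * fst y k) \<noteq> 0"
    and X: "traceless_part n (fst y m * snd y m) = traceless_part n (fst y' m * snd y' m)"
    and w: "\<And>j. j \<in> {1..<n} \<Longrightarrow> wedge_columns n j (compose_from n (fst y) j) = wedge_columns n j (compose_from n (fst y') j)"
  shows "\<exists>h\<in>HC_group n. y' = quiver_act n h y"
proof -
  have q: "y \<in> quivers n" "y' \<in> quivers n" using y y' by (auto simp: is_csol_def)
  have c: "\<And>i. i < n \<Longrightarrow> fst y i \<in> carrier_mat (Suc i) i" "\<And>i. i < n \<Longrightarrow> fst y' i \<in> carrier_mat (Suc i) i"
    using quiversD[OF q(1)] quiversD[OF q(2)] by blast+
  define A A' where "A j = compose_from n (fst y) j" and "A' j = compose_from n (fst y') j" for j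
  have Ad: "A j \<in> carrier_mat n j" "dim_row (A j) = n" "dim_col (A j) = j" if "j \<le> n" for j
    using compose_from_dims[OF c(1) that] by (auto simp: A_def)
  have A'd: "A' j \<in> carrier_mat n j" "dim_row (A' j) = n" "dim_col (A' j) = j" if "j \<le> n" for j
    using compose_from_dims[OF c(2) that] by (auto simp: A'_def)
  define R where "R j = cinv (snd y j * fst y j) * snd y j" for j
  have Rd: "dim_row (R j) = j" "dim_col (R j) = Suc j" and Ra: "R j * fst y j = 1\<^sub>m j" if j: "j < n" for j
  proof -
    have cc: "snd y j * fst y j \<in> carrier_mat j j" using quiversD[OF q(1) j] by auto
    note inv = cinv[OF cc]
    show "dim_row (R j) = j" "dim_col (R j) = Suc j" using inv(1) quiversD[OF q(1) j] by (auto simp: R_def)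
    show "R j * fst y j = 1\<^sub>m j"
      using inv(1) inv(3)[OF reg[OF j]] quiversD[OF q(1) j] by (simp add: R_def mat_assoc)
  qed
  have RaX: "R j * (fst y j * Z) = Z" if "j < n" "dim_row Z = j" for j Z
    using Rd[OF that(1)] Ra[OF that(1)] quiversD[OF q(1) that(1)] that(2) by (simp add: mat_assoc[symmetric] mat_one_left)
  have "\<exists>L. L \<in> carrier_mat j n \<and> L * A j = 1\<^sub>m j" if "j \<le> n" for j
    using that
  proof (induction rule: inc_induct)
    case base
    show ?case by (intro exI[of _ "1\<^sub>m n"]) (simp add: A_def compose_from_n)
  next
    case (step j)
    then obtain L where L: "L \<in> carrier_mat (Suc j) n" "L * A (Suc j) = 1\<^sub>m (Suc j)" by blast
    have jn: "j < n" "Suc j \<le> n" using step by auto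
    have "A j = A (Suc j) * fst y j" unfolding A_def by (rule compose_from_rec[OF c(1) jn(1)])
    then have "R j * L * A j = R j * L * (A (Suc j) * fst y j)" by simp
    also have "\<dots> = R j * ((L * A (Suc j)) * fst y j)"
      using carrier_matD[OF L(1)] Rd[OF jn(1)] quiversD[OF q(1) jn(1)] Ad[OF jn(2)] by (simp add: mat_assoc)
    also have "\<dots> = 1\<^sub>m j" unfolding L(2) using Ra[OF jn(1)] quiversD[OF q(1) jn(1)] by (simp add: mat_one_left)
    finally show ?case using L(1) Rd[OF jn(1)] by (intro exI[of _ "R j * L"]) (auto intro: carrier_matI)
  qed
  then obtain L where L: "\<And>j. j \<le> n \<Longrightarrow> L j \<in> carrier_mat j n" "\<And>j. j \<le> n \<Longrightarrow> L j * A j = 1\<^sub>m j"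
    by metis
  have "\<exists>g. j \<le> n \<longrightarrow> g \<in> SL j \<and> A' j = A j * g \<and> (j = n \<longrightarrow> g = 1\<^sub>m n)" for j
  proof (cases "1 \<le> j \<and> j < n")
    case True
    then have j: "j \<le> n" by simp
    have "\<exists>g\<in>SL j. A' j = A j * g"
    proof (rule SL_equivalent_if_minors_eq[OF Ad(1)[OF j] A'd(1)[OF j] L[OF j]])
      fix I assume "I \<in> index_sets n j"
      then show "det (submatrix (A j) I UNIV) = det (submatrix (A' j) I UNIV)"
        using fun_cong[OF w[of j], of I] True by (simp add: wedge_columns_def A_def A'_def)
    qed
    then show ?thesis using True by auto
  next
    case False
    \<comment> \<open>Minors are given for 0 < j < n only; at 0 there is nothing to compare, and at
      n both compositions are the identity.\<close>
    then consider "j = 0" | "j = n" | "j > n" by linarith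
    then show ?thesis
    proof cases
      case 1
      then show ?thesis using Ad[of 0] A'd[of 0] n
        by (intro exI[of _ "1\<^sub>m 0"]) (auto simp: SL_one intro!: eq_matI)
    next
      case 2
      then show ?thesis by (intro exI[of _ "1\<^sub>m n"]) (simp add: SL_one A_def A'_def compose_from_n)
    qed auto
  qed
  then obtain g where "\<forall>j. j \<le> n \<longrightarrow> g j \<in> SL j \<and> A' j = A j * g j \<and> (j = n \<longrightarrow> g j = 1\<^sub>m n)"
    using choice[of "\<lambda>j g. j \<le> n \<longrightarrow> g \<in> SL j \<and> A' j = A j * g \<and> (j = n \<longrightarrow> g = 1\<^sub>m n)"] by blast
  then have g: "g j \<in> SL j" "A' j = A j * g j" and gn: "g n = 1\<^sub>m n" if "j \<le> n" for j
    using that by auto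
  have gd: "dim_row (g j) = j" "dim_col (g j) = j" "dim_row (cinv (g j)) = j" "dim_col (cinv (g j)) = j" if "j \<le> n" for j
    using SL_D[OF g(1)[OF that]] by auto
  have ea: "g (Suc j) * fst y' j = fst y j * g j" if j: "j < n" for j
  proof -
    have k: "j \<le> n" "Suc j \<le> n" using j by auto
    note dd = gd[OF k(1)] gd[OF k(2)] quiversD[OF q(1) j] quiversD[OF q(2) j] Ad[OF k(2)] carrier_matD[OF L(1)[OF k(2)]]
    have "A (Suc j) * (g (Suc j) * fst y' j) = (A (Suc j) * g (Suc j)) * fst y' j"
      using dd by (simp add: mat_assoc)
    also have "\<dots> = A' j" unfolding g(2)[OF k(2), symmetric] unfolding A'_def by (rule compose_from_rec[OF c(2) j, symmetric])
    also have "\<dots> = A j * g j" using g(2)[OF k(1)] .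
    also have "A j = A (Suc j) * fst y j" unfolding A_def by (rule compose_from_rec[OF c(1) j])
    also have "A (Suc j) * fst y j * g j = A (Suc j) * (fst y j * g j)" using dd by (simp add: mat_assoc)
    finally have "L (Suc j) * (A (Suc j) * (g (Suc j) * fst y' j)) = L (Suc j) * (A (Suc j) * (fst y j * g j))" by simp
    then have "(L (Suc j) * A (Suc j)) * (g (Suc j) * fst y' j) = (L (Suc j) * A (Suc j)) * (fst y j * g j)"
      using dd by (simp add: mat_assoc)
    then show ?thesis unfolding L(2)[OF k(2)] using dd by (simp add: mat_one_left)
  qed
  have eb: "g j * snd y' j = snd y j * g (Suc j)"
    if j: "j < n" and X: "g (Suc j) * (fst y' j * snd y' j) = (fst y j * snd y j) * g (Suc j)" for j
  proof -
    have k: "j \<le> n" "Suc j \<le> n" using j by auto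
    note dd = gd[OF k(1)] gd[OF k(2)] quiversD[OF q(1) j] quiversD[OF q(2) j] Rd[OF j]
    have "fst y j * (g j * snd y' j) = (fst y j * g j) * snd y' j" using dd by (simp add: mat_assoc)
    also have "\<dots> = g (Suc j) * (fst y' j * snd y' j)" unfolding ea[OF j, symmetric] using dd by (simp add: mat_assoc)
    also have "\<dots> = fst y j * (snd y j * g (Suc j))" unfolding X using dd by (simp add: mat_assoc)
    finally have "R j * (fst y j * (g j * snd y' j)) = R j * (fst y j * (snd y j * g (Suc j)))" by simp
    then show ?thesis using dd by (simp add: RaX[OF j])
  qed
  have Xm: "fst y' m * snd y' m = fst y m * snd y m"
  proof -
    have mn: "m < n" using n by simp
    have tr: "(\<Sum>i<n. (fst y m * snd y m) $$ (i, i)) = (\<Sum>i<n. (fst y' m * snd y' m) $$ (i, i))"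
      using csol_trace_eq[OF y y' mn] quiversD[OF q(1) mn] quiversD[OF q(2) mn] n by (simp add: mtr_def del: index_mult_mat(1) sum.lessThan_Suc)
    show ?thesis
    proof (rule eq_matI)
      fix r s assume "r < dim_row (fst y m * snd y m)" "s < dim_col (fst y m * snd y m)"
      then have rs: "r < n" "s < n" using quiversD[OF q(1) mn] n by auto
      show "(fst y' m * snd y' m) $$ (r, s) = (fst y m * snd y m) $$ (r, s)"
        using arg_cong[OF X, of "\<lambda>M. M $$ (r, s)"] rs quiversD[OF q(1) mn] quiversD[OF q(2) mn] n
        unfolding traceless_part_def tr by (simp del: index_mult_mat(1) sum.lessThan_Suc)
    qed (use quiversD[OF q(1) mn] quiversD[OF q(2) mn] in auto)
  qed
  have Xj: "j < n \<longrightarrow> g (Suc j) * (fst y' j * snd y' j) = (fst y j * snd y j) * g (Suc j)" if "j \<le> m" for j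
    using that
  proof (induction rule: inc_induct)
    case base
    have d: "dim_row (fst y m * snd y m) = n" "dim_col (fst y m * snd y m) = n"
      using quiversD[OF q(1), of m] n by auto
    have "g (Suc m) = 1\<^sub>m n" using gn[OF order_refl] n by simp
    then show ?case unfolding Xm using mat_one_left[OF d(1)] mat_one_right[OF d(2)] by simp
  next
    case (step j)
    then have jn: "j < n" "Suc j < n" "Suc j \<le> n" "Suc (Suc j) \<le> n" using n by auto
    have IH: "g (Suc (Suc j)) * (fst y' (Suc j) * snd y' (Suc j)) = (fst y (Suc j) * snd y (Suc j)) * g (Suc (Suc j))"
      using step jn by simp
    note dd = gd[OF jn(3)] gd[OF jn(4)] quiversD[OF q(1) jn(1)] quiversD[OF q(2) jn(1)] quiversD[OF q(1) jn(2)] quiversD[OF q(2) jn(2)]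
    have "g (Suc j) * (snd y' (Suc j) * fst y' (Suc j)) = (g (Suc j) * snd y' (Suc j)) * fst y' (Suc j)"
      using dd by (simp add: mat_assoc)
    also have "\<dots> = snd y (Suc j) * (g (Suc (Suc j)) * fst y' (Suc j))"
      unfolding eb[OF jn(2) IH] using dd by (simp add: mat_assoc)
    also have "\<dots> = (snd y (Suc j) * fst y (Suc j)) * g (Suc j)"
      unfolding ea[OF jn(2)] using dd by (simp add: mat_assoc)
    finally have e: "g (Suc j) * (snd y' (Suc j) * fst y' (Suc j)) = (snd y (Suc j) * fst y (Suc j)) * g (Suc j)" .
    have "g (Suc j) * (fst y' j * snd y' j) + (- l (Suc j)) \<cdot>\<^sub>m g (Suc j) =
        (fst y j * snd y j) * g (Suc j) + (- l (Suc j)) \<cdot>\<^sub>m g (Suc j)"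
      using e unfolding csol_product[OF y jn(2)] csol_product[OF y' jn(2)] using dd by (simp add: mat_distrib)
    then have e2: "(g (Suc j) * (fst y' j * snd y' j) + (- l (Suc j)) \<cdot>\<^sub>m g (Suc j)) $$ (r, s) =
        ((fst y j * snd y j) * g (Suc j) + (- l (Suc j)) \<cdot>\<^sub>m g (Suc j)) $$ (r, s)" for r s by simp
    have "g (Suc j) * (fst y' j * snd y' j) = (fst y j * snd y j) * g (Suc j)"
    proof (rule eq_matI)
      fix r s assume "r < dim_row ((fst y j * snd y j) * g (Suc j))" "s < dim_col ((fst y j * snd y j) * g (Suc j))"
      then show "(g (Suc j) * (fst y' j * snd y' j)) $$ (r, s) = ((fst y j * snd y j) * g (Suc j)) $$ (r, s)"
        using e2[of r s] dd by (simp del: index_mult_mat(1))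
    qed (use dd in auto)
    then show ?case by simp
  qed
  \<comment> \<open>Inverses appear because the action multiplies compositions by
    \<open>cinv (h j)\<close> on the right.\<close>
  define h where "h = (\<lambda>k\<in>{..n}. cinv (g k))"
  have h: "h \<in> HC_group n"
    unfolding h_def using g(1) gn[OF order_refl] by (intro gauge_groupI) (auto simp: SL_cinv cinv_one)
  have hs: "h k = cinv (g k)" "cinv (h k) = g k" if "k \<le> n" for k
    using that cinv_cinv[OF g(1)[OF that]] by (auto simp: h_def)
  have "y' = quiver_act n h y"
  proof (rule quivers_eqI[OF q(2) quiver_act_quivers[OF h q(1)]])
    fix j assume j: "j < n"
    then have k: "j \<le> n" "Suc j \<le> n" by auto
    note dd = gd[OF k(1)] gd[OF k(2)] quiversD[OF q(1) j] quiversD[OF q(2) j]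
    have "fst (quiver_act n h y) j = cinv (g (Suc j)) * (fst y j * g j)"
      unfolding quiver_act_sel[OF h j] hs(2)[OF k(1)] hs(2)[OF k(2)] unfolding hs(1)[OF k(1)] hs(1)[OF k(2)] using dd by (simp add: mat_assoc)
    then show "fst y' j = fst (quiver_act n h y) j"
      unfolding ea[OF j, symmetric] using dd by (simp add: SL_cancel[OF g(1)[OF k(2)]])
    have "snd (quiver_act n h y) j = cinv (g j) * (snd y j * g (Suc j))"
      unfolding quiver_act_sel[OF h j] hs(2)[OF k(1)] hs(2)[OF k(2)] unfolding hs(1)[OF k(1)] hs(1)[OF k(2)] using dd by (simp add: mat_assoc)
    moreover have "g j * snd y' j = snd y j * g (Suc j)"
      using Xj[of j] j n by (intro eb) auto
    ultimately show "snd y' j = snd (quiver_act n h y) j"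
      using dd by (metis SL_cancel(2)[OF g(1)[OF k(1)]])
  qed
  then show ?thesis using h by blast
qed


section \<open>Polynomial functions\<close>

lemma polynomial_sum:
  "finite A \<Longrightarrow> (\<And>a. a \<in> A \<Longrightarrow> F a \<in> polynomial_functions n) \<Longrightarrow> (\<lambda>p. \<Sum>a\<in>A. F a p) \<in> polynomial_functions n"
  by (induction A rule: finite_induct) (auto intro: polynomial_functions.const polynomial_functions.add)

lemma polynomial_prod:
  "finite A \<Longrightarrow> (\<And>a. a \<in> A \<Longrightarrow> F a \<in> polynomial_functions n) \<Longrightarrow> (\<lambda>p. \<Prod>a\<in>A. F a p) \<in> polynomial_functions n"
  by (induction A rule: finite_induct) (auto intro: polynomial_functions.const polynomial_functions.mult)

lemma polynomial_tendsto:
  assumes "f \<in> polynomial_functions n" "quiver_lim n Y y"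
  shows "(\<lambda>t. f (w, Y t)) \<longlonglongrightarrow> f (w, y)"
  using assms(1)
proof induction
  case (alpha i r s)
  then have "mat_lim (Suc i) i (\<lambda>t. fst (Y t) i) (fst y i)" using assms(2) by (auto simp: quiver_lim_def)
  then show ?case using alpha by (auto simp: mat_lim_def)
next
  case (beta i r s)
  then have "mat_lim i (Suc i) (\<lambda>t. snd (Y t) i) (snd y i)" using assms(2) by (auto simp: quiver_lim_def)
  then show ?case using beta by (auto simp: mat_lim_def)
qed (auto intro: tendsto_intros)

text \<open>The base coordinate is frozen and the fibre rescaled, so the result no longer depends on
  the base; questions about points in different chart coordinates then become questions about one
  polynomial.\<close>

lemma polynomial_rescale:
  assumes "f \<in> polynomial_functions n"
  shows "\<exists>h\<in>polynomial_functions n. \<forall>w. \<forall>x\<in>quivers n. h (w, x) = f (a, quiver_scale n c x)"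
  using assms
proof induction
  case (const d)
  then show ?case by (intro bexI[OF _ polynomial_functions.const[of d]]) auto
next
  case base
  then show ?case by (intro bexI[OF _ polynomial_functions.const[of a]]) auto
next
  case (alpha i r s)
  show ?case
    by (rule bexI[OF _ polynomial_functions.mult[OF polynomial_functions.const[of c] polynomial_functions.alpha[OF alpha]]])
       (use alpha in \<open>auto simp: quiversD\<close>)
next
  case (beta i r s)
  show ?case
    by (rule bexI[OF _ polynomial_functions.mult[OF polynomial_functions.const[of c] polynomial_functions.beta[OF beta]]])
       (use beta in \<open>auto simp: quiversD\<close>)
next
  case (add f1 f2)
  then obtain h1 h2 where "h1 \<in> polynomial_functions n" "h2 \<in> polynomial_functions n"
    "\<forall>w. \<forall>x\<in>quivers n. h1 (w, x) = f1 (a, quiver_scale n c x)"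
    "\<forall>w. \<forall>x\<in>quivers n. h2 (w, x) = f2 (a, quiver_scale n c x)" by blast
  then show ?case by (intro bexI[of _ "\<lambda>p. h1 p + h2 p"]) (auto intro: polynomial_functions.add)
next
  case (mult f1 f2)
  then obtain h1 h2 where "h1 \<in> polynomial_functions n" "h2 \<in> polynomial_functions n"
    "\<forall>w. \<forall>x\<in>quivers n. h1 (w, x) = f1 (a, quiver_scale n c x)"
    "\<forall>w. \<forall>x\<in>quivers n. h2 (w, x) = f2 (a, quiver_scale n c x)" by blast
  then show ?case by (intro bexI[of _ "\<lambda>p. h1 p * h2 p"]) (auto intro: polynomial_functions.mult)
qed

text \<open>Adjoints occur only of the fixed quiver \<open>x\<close>, while \<open>u\<close> and
  \<open>v\<close> enter linearly and without conjugation. Twistor lines are therefore algebraic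
  curves, although rotation is not algebraic in \<open>x\<close>.\<close>

lemma polynomial_along_rotation:
  assumes "f \<in> polynomial_functions n" "x \<in> quivers n"
  shows "\<exists>P. \<forall>s. f (poly W s, rotate_quiver n (poly U s, poly V s) x) = poly P s"
  using assms(1)
proof induction
  case (const c)
  then show ?case by (intro exI[of _ "[:c:]"]) simp
next
  case base
  then show ?case by (intro exI[of _ W]) simp
next
  case (alpha i r s)
  then show ?case using quiversD[OF assms(2), of i]
    by (intro exI[of _ "smult (fst x i $$ (r, s)) U + smult (cnj (snd x i $$ (s, r))) V"]) (simp add: index_adj)
next
  case (beta i r s)
  then show ?case using quiversD[OF assms(2), of i]
    by (intro exI[of _ "smult (snd x i $$ (r, s)) U - smult (cnj (fst x i $$ (s, r))) V"]) (simp add: index_adj)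
next
  case (add f1 f2)
  then obtain P1 P2 where "\<forall>s. f1 (poly W s, rotate_quiver n (poly U s, poly V s) x) = poly P1 s"
    "\<forall>s. f2 (poly W s, rotate_quiver n (poly U s, poly V s) x) = poly P2 s" by blast
  then show ?case by (intro exI[of _ "P1 + P2"]) simp
next
  case (mult f1 f2)
  then obtain P1 P2 where "\<forall>s. f1 (poly W s, rotate_quiver n (poly U s, poly V s) x) = poly P1 s"
    "\<forall>s. f2 (poly W s, rotate_quiver n (poly U s, poly V s) x) = poly P2 s" by blast
  then show ?case by (intro exI[of _ "P1 * P2"]) simp
qed

lemma finite_zeros_along_rotation:
  assumes "f \<in> polynomial_functions n" "x \<in> quivers n"
    and "f (poly W s0, rotate_quiver n (poly U s0, poly V s0) x) \<noteq> 0"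
  shows "finite {s. f (poly W s, rotate_quiver n (poly U s, poly V s) x) = 0}"
proof -
  obtain P where P: "\<And>s. f (poly W s, rotate_quiver n (poly U s, poly V s) x) = poly P s"
    using polynomial_along_rotation[OF assms(1,2)] by blast
  then have "P \<noteq> 0" using assms(3) by auto
  then show ?thesis unfolding P by (rule poly_roots_finite)
qed

section \<open>The invariant that detects regularity\<close>

definition regular_quiver :: "nat \<Rightarrow> quiver \<Rightarrow> bool" where
  "regular_quiver n x \<longleftrightarrow> (\<forall>k<n. det (snd x k * fst x k) \<noteq> 0)"

text \<open>The matrix product is spelled out because polynomial functions are also evaluated at quivers
  with wrong dimensions.\<close>

definition reg_fun :: "nat \<Rightarrow> complex \<times> quiver \<Rightarrow> complex" where
  "reg_fun n p = (\<Prod>k<n. det (mat k k (\<lambda>(i, j). \<Sum>r<Suc k. snd (snd p) k $$ (i, r) * fst (snd p) k $$ (r, j))))"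

lemma reg_fun_polynomial: "reg_fun n \<in> polynomial_functions n"
proof -
  have "(\<lambda>p. det (mat k k (\<lambda>(i, j). \<Sum>r<Suc k. snd (snd p) k $$ (i, r) * fst (snd p) k $$ (r, j)))) \<in> polynomial_functions n"
    if k: "k < n" for k
  proof -
    have "(\<lambda>p :: complex \<times> quiver. det (mat k k (\<lambda>(i, j). \<Sum>r<Suc k. snd (snd p) k $$ (i, r) * fst (snd p) k $$ (r, j)))) =
      (\<lambda>p. \<Sum>\<pi>\<in>{\<pi>. \<pi> permutes {0..<k}}. signof \<pi> *
        (\<Prod>i\<in>{0..<k}. \<Sum>r<Suc k. snd (snd p) k $$ (i, r) * fst (snd p) k $$ (r, \<pi> i)))"
    proof
      fix p :: "complex \<times> quiver"
      let ?M = "mat k k (\<lambda>(i, j). \<Sum>r<Suc k. snd (snd p) k $$ (i, r) * fst (snd p) k $$ (r, j))"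
      have "?M $$ (i, \<pi> i) = (\<Sum>r<Suc k. snd (snd p) k $$ (i, r) * fst (snd p) k $$ (r, \<pi> i))"
        if "\<pi> permutes {0..<k}" "i < k" for \<pi> i
        using permutes_in_image[OF that(1), of i] that(2) by (simp del: sum.lessThan_Suc)
      then show "det ?M = (\<Sum>\<pi>\<in>{\<pi>. \<pi> permutes {0..<k}}. signof \<pi> *
        (\<Prod>i\<in>{0..<k}. \<Sum>r<Suc k. snd (snd p) k $$ (i, r) * fst (snd p) k $$ (r, \<pi> i)))"
        by (subst det_def'[of _ k]) (auto intro!: sum.cong prod.cong simp del: sum.lessThan_Suc)
    qed
    also have "\<dots> \<in> polynomial_functions n"
    proof (intro polynomial_sum polynomial_prod polynomial_functions.mult polynomial_functions.const)
      fix \<pi> i r assume a: "\<pi> \<in> {\<pi>. \<pi> permutes {0..<k}}" "i \<in> {0..<k}" "r \<in> {..<Suc k}"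
      then have "\<pi> i < k" using permutes_in_image[of \<pi> "{0..<k}" i] by auto
      then show "(\<lambda>p. fst (snd p) k $$ (r, \<pi> i)) \<in> polynomial_functions n"
        using a k by (intro polynomial_functions.alpha) auto
      show "(\<lambda>p. snd (snd p) k $$ (i, r)) \<in> polynomial_functions n"
        using a k by (intro polynomial_functions.beta) auto
    qed (auto simp: finite_permutations)
    finally show ?thesis .
  qed
  then show ?thesis unfolding reg_fun_def[abs_def] by (intro polynomial_prod) auto
qed

lemma reg_fun_eq:
  assumes "x \<in> quivers n"
  shows "reg_fun n (w, x) = (\<Prod>k<n. det (snd x k * fst x k))"
  unfolding reg_fun_def
proof (rule prod.cong)
  fix k assume "k \<in> {..<n}"
  then have "mat k k (\<lambda>(i, j). \<Sum>r<Suc k. snd x k $$ (i, r) * fst x k $$ (r, j)) = snd x k * fst x k"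
    using quiversD[OF assms, of k] by (intro eq_matI) (auto simp: mult_mat_index simp del: index_mult_mat(1) sum.lessThan_Suc)
  then show "det (mat k k (\<lambda>(i, j). \<Sum>r<Suc k. snd (snd (w, x)) k $$ (i, r) * fst (snd (w, x)) k $$ (r, j))) =
    det (snd x k * fst x k)" by simp
qed simp

lemma reg_fun_nonzero_iff: "x \<in> quivers n \<Longrightarrow> reg_fun n (w, x) \<noteq> 0 \<longleftrightarrow> regular_quiver n x"
  by (auto simp: reg_fun_eq regular_quiver_def)

text \<open>The product at vertex k is conjugated by \<open>g k\<close>, since the group element at
  vertex k + 1 cancels between the two factors.\<close>

lemma det_products_act:
  assumes x: "x \<in> quivers n" and g: "g \<in> HC_group n" and k: "k < n"
  shows "det (snd (quiver_act n g x) k * fst (quiver_act n g x) k) = det (snd x k * fst x k)"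
proof -
  have kk: "k \<le> n" "Suc k \<le> n" using k by auto
  note dd = gauge_dims[OF g kk(1)] gauge_dims[OF g kk(2)] quiversD[OF x k]
  have sl: "g k \<in> SL k" using gauge_groupD(1)[OF g kk(1)] .
  have "snd (quiver_act n g x) k * fst (quiver_act n g x) k = g k * (snd x k * fst x k) * cinv (g k)"
    unfolding quiver_act_sel[OF g k] using dd by (simp add: mat_assoc gauge_cancel[OF g kk(2)])
  also have "det \<dots> = det (g k) * det (snd x k * fst x k) * det (cinv (g k))"
  proof -
    have c: "g k \<in> carrier_mat k k" "snd x k * fst x k \<in> carrier_mat k k" "g k * (snd x k * fst x k) \<in> carrier_mat k k"
      "cinv (g k) \<in> carrier_mat k k"
      using dd by (auto intro!: carrier_matI)
    show ?thesis unfolding det_mult[OF c(3,4)] det_mult[OF c(1,2)] ..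
  qed
  finally show ?thesis using SL_D(2)[OF sl] SL_D(2)[OF SL_cinv[OF sl]] by simp
qed

lemma reg_fun_invariant: "reg_fun n \<in> invariant_functions n"
  using reg_fun_polynomial quiver_act_quivers det_products_act
  by (auto simp: invariant_functions_def complex_solutions_iff is_csol_def reg_fun_eq)

lemma regular_quiver_scale:
  assumes x: "x \<in> quivers n" and t: "t \<noteq> 0"
  shows "regular_quiver n (quiver_scale n t x) \<longleftrightarrow> regular_quiver n x"
proof -
  have "det (snd (quiver_scale n t x) k * fst (quiver_scale n t x) k) = (t * t) ^ k * det (snd x k * fst x k)" if k: "k < n" for k
  proof -
    have "snd (quiver_scale n t x) k * fst (quiver_scale n t x) k = (t * t) \<cdot>\<^sub>m (snd x k * fst x k)"
      using quiversD[OF x k] k by (simp add: mat_smult_left mat_smult_right mat_smult_smult)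
    then show ?thesis using quiversD[OF x k] by simp
  qed
  then show ?thesis using t by (simp add: regular_quiver_def)
qed


section \<open>The GIT quotient\<close>

lemma bundle_point_eqD:
  assumes "bundle_point s uv x = bundle_point s uv' x'" "s 1 x = x"
  shows "\<exists>t\<noteq>0. uv = (t * fst uv', t * snd uv') \<and> x = s t x'"
proof -
  have "(uv, x) \<in> bundle_point s uv x" unfolding bundle_point_def using assms(2) by (intro CollectI exI[of _ 1]) simp
  then show ?thesis unfolding assms(1) by (auto simp: bundle_point_def)
qed

lemma bundle_point_scale:
  assumes t: "t \<noteq> 0" and s: "\<And>a. s a (s t x) = s (a * t) x"
  shows "bundle_point s (t * u, t * v) (s t x) = bundle_point s (u, v) x"
proof (rule equalityI; rule subsetI)
  fix z assume "z \<in> bundle_point s (t * u, t * v) (s t x)"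
  then obtain a where "a \<noteq> 0" "z = ((a * (t * u), a * (t * v)), s a (s t x))" by (auto simp: bundle_point_def)
  then show "z \<in> bundle_point s (u, v) x" unfolding bundle_point_def s using t
    by (intro CollectI exI[of _ "a * t"]) (auto simp: mult.assoc)
next
  fix z assume "z \<in> bundle_point s (u, v) x"
  then obtain a where "a \<noteq> 0" "z = ((a * u, a * v), s a x)" by (auto simp: bundle_point_def)
  then show "z \<in> bundle_point s (t * u, t * v) (s t x)" unfolding bundle_point_def s using t
    by (intro CollectI exI[of _ "a / t"]) auto
qed

section \<open>Inseparable points and equality of classes\<close>

abbreviation "quiver_point n \<equiv> bundle_point (quiver_scale n)"

lemma quiver_point_scale:
  "x \<in> quivers n \<Longrightarrow> t \<noteq> 0 \<Longrightarrow> quiver_point n (t * u, t * v) (quiver_scale n t x) = quiver_point n (u, v) x"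
  by (rule bundle_point_scale) (auto simp: quiver_scale_scale)

lemma complex_solutions_quivers: "x \<in> complex_solutions n \<Longrightarrow> x \<in> quivers n"
  by (simp add: complex_solutions_def)

lemma complex_solutions_scale: "x \<in> complex_solutions n \<Longrightarrow> quiver_scale n t x \<in> complex_solutions n"
  unfolding complex_solutions_iff using is_csol_scale by blast

lemma complex_solutions_act: "x \<in> complex_solutions n \<Longrightarrow> g \<in> HC_group n \<Longrightarrow> quiver_act n g x \<in> complex_solutions n"
  unfolding complex_solutions_iff using is_csol_act by blast

lemma quiver_act_scale:
  assumes x: "x \<in> quivers n" and g: "g \<in> HC_group n"
  shows "quiver_act n g (quiver_scale n c x) = quiver_scale n c (quiver_act n g x)"
proof (rule quivers_eqI[OF quiver_act_quivers[OF g quiver_scale_quivers[OF x]] quiver_scale_quivers[OF quiver_act_quivers[OF g x]]])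
  fix k assume k: "k < n"
  then have kk: "k \<le> n" "Suc k \<le> n" by auto
  note dd = gauge_dims[OF g kk(1)] gauge_dims[OF g kk(2)] quiversD[OF x k]
  show "fst (quiver_act n g (quiver_scale n c x)) k = fst (quiver_scale n c (quiver_act n g x)) k"
    "snd (quiver_act n g (quiver_scale n c x)) k = snd (quiver_scale n c (quiver_act n g x)) k"
    using k dd by (simp_all add: quiver_act_sel[OF g k] mat_smult_left mat_smult_right)
qed

text \<open>Points of the complex solution set that are not separated by invariants. The definition is
  stable under scaling, hence does not depend on the chart.\<close>

definition inseparable :: "nat \<Rightarrow> quiver \<Rightarrow> quiver \<Rightarrow> bool" where
  "inseparable n x y \<longleftrightarrow> x \<in> complex_solutions n \<and> y \<in> complex_solutions n \<and>
     (\<forall>f\<in>invariant_functions n. \<forall>a c. f (a, quiver_scale n c x) = f (a, quiver_scale n c y))"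

lemma inseparable_sym: "inseparable n x y \<Longrightarrow> inseparable n y x"
  unfolding inseparable_def by metis

lemma inseparable_scale:
  assumes "inseparable n x y"
  shows "inseparable n (quiver_scale n t x) (quiver_scale n t y)"
  using assms complex_solutions_scale quiver_scale_scale[OF complex_solutions_quivers[of x n]]
    quiver_scale_scale[OF complex_solutions_quivers[of y n]]
  unfolding inseparable_def by simp

lemma inseparableD:
  assumes "inseparable n x y" "f \<in> invariant_functions n"
  shows "f (w, x) = f (w, y)"
proof -
  have "quiver_scale n 1 x = x" "quiver_scale n 1 y = y"
    using assms(1) by (auto simp: inseparable_def quiver_scale_one complex_solutions_quivers)
  then show ?thesis using assms unfolding inseparable_def by metis
qed

text \<open>Scaling commutes with the group and preserves the complex equations, so the rescaled
  polynomial is invariant again.\<close>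

lemma invariant_rescale:
  assumes "f \<in> invariant_functions n"
  shows "\<exists>h\<in>invariant_functions n. \<forall>w. \<forall>x\<in>quivers n. h (w, x) = f (a, quiver_scale n c x)"
proof -
  have f: "f \<in> polynomial_functions n"
    and finv: "\<And>w x g. x \<in> complex_solutions n \<Longrightarrow> g \<in> HC_group n \<Longrightarrow> f (w, quiver_act n g x) = f (w, x)"
    using assms by (auto simp: invariant_functions_def)
  obtain h where h: "h \<in> polynomial_functions n" "\<And>w x. x \<in> quivers n \<Longrightarrow> h (w, x) = f (a, quiver_scale n c x)"
    using polynomial_rescale[OF f] by blast
  have "h (w, quiver_act n g x) = h (w, x)" if x: "x \<in> complex_solutions n" and g: "g \<in> HC_group n" for w x g
    using h(2) complex_solutions_quivers[OF x] quiver_act_quivers[OF g] quiver_act_scale[OF _ g, symmetric]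
      finv[OF complex_solutions_scale[OF x] g] by simp
  then have "h \<in> invariant_functions n" using h(1) by (auto simp: invariant_functions_def)
  then show ?thesis using h(2) by blast
qed

text \<open>Comparison at one base coordinate \<open>w\<close> suffices: any invariant at any base
  point and scale agrees on quivers with an invariant that is independent of the base.\<close>

lemma inseparableI:
  assumes x: "x \<in> complex_solutions n" and y: "y \<in> complex_solutions n"
    and eq: "\<And>f. f \<in> invariant_functions n \<Longrightarrow> f (w, x) = f (w, y)"
  shows "inseparable n x y"
  unfolding inseparable_def
proof (intro conjI ballI allI x y)
  fix f a c assume "f \<in> invariant_functions n"
  then obtain h where h: "h \<in> invariant_functions n" "\<And>w x. x \<in> quivers n \<Longrightarrow> h (w, x) = f (a, quiver_scale n c x)"
    using invariant_rescale by blast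
  show "f (a, quiver_scale n c x) = f (a, quiver_scale n c y)"
    using eq[OF h(1)] h(2) complex_solutions_quivers[OF x] complex_solutions_quivers[OF y] by simp
qed

text \<open>Invariants are continuous and constant on orbits, hence constant on orbit closures
  within the solution set.\<close>

lemma inseparable_orbit_closure:
  assumes x: "x \<in> complex_solutions n" and z: "z \<in> complex_solutions n"
    and lim: "quiver_lim n Y z" and orb: "\<And>t. \<exists>g\<in>HC_group n. Y t = quiver_act n g x"
  shows "inseparable n x z"
proof (rule inseparableI[OF x z, of 0])
  fix f assume f: "f \<in> invariant_functions n"
  have "f (0, Y t) = f (0, x)" for t using f x orb[of t] by (auto simp: invariant_functions_def)
  moreover have "(\<lambda>t. f (0, Y t)) \<longlonglongrightarrow> f (0, z)"
    by (rule polynomial_tendsto[OF _ lim]) (use f in \<open>auto simp: invariant_functions_def\<close>)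
  ultimately show "f (0, x) = f (0, z)" by (simp add: LIMSEQ_const_iff)
qed

lemma inseparable_act: "x \<in> complex_solutions n \<Longrightarrow> g \<in> HC_group n \<Longrightarrow> inseparable n x (quiver_act n g x)"
  by (rule inseparableI[of _ _ _ 0]) (auto simp: invariant_functions_def complex_solutions_act)

text \<open>A chart is given by a map \<open>\<iota>\<close> into homogeneous coordinates, which
  allows both to be treated at once.\<close>

lemma chart_form: "\<phi> \<in> charts n \<Longrightarrow> \<exists>\<iota>. \<phi> = (\<lambda>(w, x). quiver_point n (\<iota> w) x)"
  unfolding charts_def by (elim insertE) (rule exI, assumption, rule exI, assumption, simp)

lemma chart_surj:
  assumes "uv \<noteq> (0, 0)" "y \<in> quivers n"
  shows "\<exists>\<phi>\<in>charts n. \<exists>w t. quiver_point n uv y = \<phi> (w, quiver_scale n t y)"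
proof (cases "fst uv = 0")
  case False
  then have "quiver_point n (1, snd uv / fst uv) (quiver_scale n (1 / fst uv) y) = quiver_point n uv y"
    using quiver_point_scale[OF assms(2), of "1 / fst uv" "fst uv" "snd uv"] by simp
  then have "quiver_point n uv y = (\<lambda>(w, x). quiver_point n (1, w) x) (snd uv / fst uv, quiver_scale n (1 / fst uv) y)"
    by simp
  moreover have "(\<lambda>(w, x). quiver_point n (1, w) x) \<in> charts n" by (simp add: charts_def)
  ultimately show ?thesis by blast
next
  case True
  then have "snd uv \<noteq> 0" using assms(1) by (cases uv) auto
  then have "quiver_point n (fst uv / snd uv, 1) (quiver_scale n (1 / snd uv) y) = quiver_point n uv y"
    using quiver_point_scale[OF assms(2), of "1 / snd uv" "fst uv" "snd uv"] by simp
  then have "quiver_point n uv y = (\<lambda>(w, x). quiver_point n (w, 1) x) (fst uv / snd uv, quiver_scale n (1 / snd uv) y)"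
    by simp
  moreover have "(\<lambda>(w, x). quiver_point n (w, 1) x) \<in> charts n" by (simp add: charts_def)
  ultimately show ?thesis by blast
qed

text \<open>A chart coordinate of the point of \<open>y\<close> becomes one of the point of
  \<open>y'\<close> with the same factor \<open>t\<close>, and inseparability is stable under
  scaling.\<close>

lemma git_class_mono:
  assumes ins: "inseparable n y y'"
  shows "git_class n (quiver_point n uv y) \<subseteq> git_class n (quiver_point n uv y')"
proof
  have y: "y \<in> complex_solutions n" "y' \<in> complex_solutions n" using ins by (auto simp: inseparable_def)
  fix z assume "z \<in> git_class n (quiver_point n uv y)"
  then obtain \<phi> w x p' where z: "z = \<phi> p'" "\<phi> \<in> charts n" "x \<in> complex_solutions n"
    "p' \<in> UNIV \<times> complex_solutions n" "quiver_point n uv y = \<phi> (w, x)" "\<forall>f\<in>invariant_functions n. f (w, x) = f p'"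
    by (auto simp: git_class_def)
  from chart_form[OF z(2)] obtain \<iota> where \<iota>: "\<phi> = (\<lambda>(w, x). quiver_point n (\<iota> w) x)" ..
  have "quiver_point n (\<iota> w) x = quiver_point n uv y" using z(5) \<iota> by simp
  then obtain t where t: "t \<noteq> 0" "\<iota> w = (t * fst uv, t * snd uv)" "x = quiver_scale n t y"
    using bundle_point_eqD quiver_scale_one[OF complex_solutions_quivers[OF z(3)]] by metis
  have "quiver_point n uv y' = \<phi> (w, quiver_scale n t y')"
    unfolding \<iota> using quiver_point_scale[OF complex_solutions_quivers[OF y(2)] t(1), of "fst uv" "snd uv"] t(2) by simp
  moreover have "\<forall>f\<in>invariant_functions n. f (w, quiver_scale n t y') = f p'"
    using z(6) inseparableD[OF inseparable_scale[OF ins, of t]] unfolding t(3) by metis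
  ultimately show "z \<in> git_class n (quiver_point n uv y')"
    unfolding git_class_def using z(1,2,4) complex_solutions_scale[OF y(2)]
    by - (rule CollectI, rule exI[of _ \<phi>], rule exI[of _ "(w, quiver_scale n t y')"], rule exI[of _ p'], simp)
qed

lemma git_class_eqI: "inseparable n y y' \<Longrightarrow> git_class n (quiver_point n uv y) = git_class n (quiver_point n uv y')"
  using git_class_mono inseparable_sym by blast

text \<open>Class equality forces equal base points and leaves one common scalar \<open>t\<close>:
  the fibre coordinates are compared only after the homogeneous coordinates have been
  matched.\<close>

lemma git_class_eqD:
  assumes y: "y \<in> complex_solutions n" and y': "y' \<in> complex_solutions n" and uv': "uv' \<noteq> (0, 0)"
    and eq: "git_class n (quiver_point n uv y) = git_class n (quiver_point n uv' y')"
  shows "\<exists>t\<noteq>0. uv' = (t * fst uv, t * snd uv) \<and> inseparable n (quiver_scale n t y) y'"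
proof -
  note yq = complex_solutions_quivers[OF y] and yq' = complex_solutions_quivers[OF y']
  obtain \<phi>' w' t' where "\<phi>' \<in> charts n" "quiver_point n uv' y' = \<phi>' (w', quiver_scale n t' y')"
    using chart_surj[OF uv' yq'] by blast
  then have "quiver_point n uv' y' \<in> git_class n (quiver_point n uv' y')"
    unfolding git_class_def using complex_solutions_scale[OF y'] by blast
  then obtain \<phi> w x w2 x2 where z: "\<phi> \<in> charts n" "x \<in> complex_solutions n" "x2 \<in> complex_solutions n"
    "quiver_point n uv' y' = \<phi> (w2, x2)" "quiver_point n uv y = \<phi> (w, x)" "\<forall>f\<in>invariant_functions n. f (w, x) = f (w2, x2)"
    unfolding eq[symmetric] by (auto simp: git_class_def)
  \<comment> \<open>The base coordinate of the chart is itself an invariant function, so the two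
    points lie over the same point of the line.\<close>
  have "fst \<in> invariant_functions n" by (auto simp: invariant_functions_def polynomial_functions.base)
  then have w: "w2 = w" using z(6) by force
  have ins: "inseparable n x x2" using inseparableI[OF z(2,3), of w] z(6) w by blast
  from chart_form[OF z(1)] obtain \<iota> where \<iota>: "\<phi> = (\<lambda>(w, x). quiver_point n (\<iota> w) x)" ..
  have e: "quiver_point n (\<iota> w) x = quiver_point n uv y" "quiver_point n uv' y' = quiver_point n (\<iota> w) x2"
    using z(4,5) \<iota> w by auto
  obtain s where s: "s \<noteq> 0" "\<iota> w = (s * fst uv, s * snd uv)" "x = quiver_scale n s y"
    using bundle_point_eqD[OF e(1)] quiver_scale_one[OF complex_solutions_quivers[OF z(2)]] by metis
  obtain r where r: "r \<noteq> 0" "uv' = (r * fst (\<iota> w), r * snd (\<iota> w))" "y' = quiver_scale n r x2"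
    using bundle_point_eqD[OF e(2)] quiver_scale_one[OF yq'] by metis
  show ?thesis
    using r s inseparable_scale[OF ins, of r] quiver_scale_scale[OF yq, of r s]
    by (intro exI[of _ "r * s"]) (auto simp: mult.assoc)
qed

section \<open>Basic open sets of the quotient\<close>

definition chart_open :: "nat \<Rightarrow> (complex \<Rightarrow> complex \<times> complex) \<Rightarrow> (complex \<times> quiver \<Rightarrow> complex) \<Rightarrow> twistor_point set set" where
  "chart_open n \<iota> f = {git_class n (quiver_point n (\<iota> w) x) |w x. x \<in> complex_solutions n \<and> f (w, x) \<noteq> 0}"

lemma Collect_two_cases: "{F \<phi> f |\<phi> f. \<phi> \<in> {a, b} \<and> f \<in> I} = {F a f |f. f \<in> I} \<union> {F b f |f. f \<in> I}"
  by blast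

lemma git_subbasis:
  "{git_class n ` \<phi> ` {p \<in> UNIV \<times> complex_solutions n. f p \<noteq> 0} |\<phi> f. \<phi> \<in> charts n \<and> f \<in> invariant_functions n} =
   {chart_open n \<iota> f |\<iota> f. \<iota> \<in> {\<lambda>w. (1, w), \<lambda>w. (w, 1)} \<and> f \<in> invariant_functions n}"
proof -
  have "git_class n ` (\<lambda>(w, x). quiver_point n (\<iota> w) x) ` {p \<in> UNIV \<times> complex_solutions n. f p \<noteq> 0} = chart_open n \<iota> f" for \<iota> f
    by (force simp: chart_open_def image_image)
  note e = this[of "\<lambda>w. (1, w)"] this[of "\<lambda>w. (w, 1)"]
  show ?thesis unfolding charts_def Collect_two_cases by (simp add: e)
qed

text \<open>Nonvanishing of an invariant can be tested on any representative of a class, after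
  rescaling it into the chart; this removes classes from all later membership questions.\<close>

lemma mem_chart_open_iff:
  assumes y: "y \<in> complex_solutions n" and f: "f \<in> invariant_functions n" and \<iota>: "\<iota> \<in> {\<lambda>w. (1, w), \<lambda>w. (w, 1)}"
  shows "git_class n (quiver_point n uv y) \<in> chart_open n \<iota> f \<longleftrightarrow>
    (\<exists>w t. t \<noteq> 0 \<and> \<iota> w = (t * fst uv, t * snd uv) \<and> f (w, quiver_scale n t y) \<noteq> 0)"
proof
  assume "git_class n (quiver_point n uv y) \<in> chart_open n \<iota> f"
  then obtain w x where wx: "git_class n (quiver_point n uv y) = git_class n (quiver_point n (\<iota> w) x)"
    "x \<in> complex_solutions n" "f (w, x) \<noteq> 0" by (auto simp: chart_open_def)
  have "\<iota> w \<noteq> (0, 0)" using \<iota> by auto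
  from git_class_eqD[OF y wx(2) this wx(1)] obtain t where
    t: "t \<noteq> 0" "\<iota> w = (t * fst uv, t * snd uv)" "inseparable n (quiver_scale n t y) x" by blast
  then show "\<exists>w t. t \<noteq> 0 \<and> \<iota> w = (t * fst uv, t * snd uv) \<and> f (w, quiver_scale n t y) \<noteq> 0"
    using inseparableD[OF t(3) f, of w] wx(3) by metis
next
  assume "\<exists>w t. t \<noteq> 0 \<and> \<iota> w = (t * fst uv, t * snd uv) \<and> f (w, quiver_scale n t y) \<noteq> 0"
  then obtain w t where t: "t \<noteq> 0" "\<iota> w = (t * fst uv, t * snd uv)" "f (w, quiver_scale n t y) \<noteq> 0" by blast
  have "git_class n (quiver_point n (\<iota> w) (quiver_scale n t y)) \<in> chart_open n \<iota> f"
    unfolding chart_open_def using t(3) complex_solutions_scale[OF y] by blast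
  moreover have "quiver_point n uv y = quiver_point n (\<iota> w) (quiver_scale n t y)"
    using quiver_point_scale[OF complex_solutions_quivers[OF y] t(1), of "fst uv" "snd uv"] t(2) by simp
  ultimately show "git_class n (quiver_point n uv y) \<in> chart_open n \<iota> f" by simp
qed

text \<open>The properties used below pass to finite intersections and to unions, so only the basic
  sets of the two charts need an argument.\<close>

lemma openin_git_quotient_induct [consumes 1, case_names empty inter union basis]:
  assumes "openin (git_quotient n) V" "P {}" "\<And>S T. P S \<Longrightarrow> P T \<Longrightarrow> P (S \<inter> T)"
    "\<And>K. (\<And>S. S \<in> K \<Longrightarrow> P S) \<Longrightarrow> P (\<Union>K)"
    "\<And>\<iota> f. \<iota> \<in> {\<lambda>w. (1, w), \<lambda>w. (w, 1)} \<Longrightarrow> f \<in> invariant_functions n \<Longrightarrow> P (chart_open n \<iota> f)"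
  shows "P V"
proof -
  have "generate_topology_on {chart_open n \<iota> f |\<iota> f. \<iota> \<in> {\<lambda>w. (1, w), \<lambda>w. (w, 1)} \<and> f \<in> invariant_functions n} V"
    using assms(1) unfolding git_quotient_def git_subbasis openin_topology_generated_by_iff .
  then show ?thesis by induction (use assms(2-) in blast)+
qed

lemma openin_chart_open:
  "\<iota> \<in> {\<lambda>w. (1, w), \<lambda>w. (w, 1)} \<Longrightarrow> f \<in> invariant_functions n \<Longrightarrow> openin (git_quotient n) (chart_open n \<iota> f)"
  unfolding git_quotient_def git_subbasis by (rule topology_generated_by_Basis) blast

lemma mem_chart_open_cases:
  assumes y: "y \<in> complex_solutions n" and f: "f \<in> invariant_functions n" and uv: "uv \<noteq> (0, 0)"
    and nz: "\<And>w t. t \<noteq> 0 \<Longrightarrow> f (w, quiver_scale n t y) \<noteq> 0"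
  shows "git_class n (quiver_point n uv y) \<in> chart_open n (\<lambda>w. (1, w)) f \<union> chart_open n (\<lambda>w. (w, 1)) f"
proof (cases "fst uv = 0")
  case False
  have "git_class n (quiver_point n uv y) \<in> chart_open n (\<lambda>w. (1, w)) f"
    by (subst mem_chart_open_iff[OF y f]) (use False nz in \<open>auto intro!: exI[of _ "1 / fst uv"]\<close>)
  then show ?thesis by blast
next
  case True
  then have "snd uv \<noteq> 0" using uv by (cases uv) auto
  then have "git_class n (quiver_point n uv y) \<in> chart_open n (\<lambda>w. (w, 1)) f"
    by (subst mem_chart_open_iff[OF y f]) (use nz in \<open>auto intro!: exI[of _ "1 / snd uv"]\<close>)
  then show ?thesis by blast
qed

text \<open>Zariski-open sets are open for classical limits: a nonzero value of a polynomial stays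
  nonzero along a convergent sequence.\<close>

lemma eventually_mem_open:
  assumes V: "openin (git_quotient n) V" and y: "y \<in> complex_solutions n"
    and mem: "git_class n (quiver_point n uv y) \<in> V"
    and lim: "quiver_lim n Y y" and Y: "eventually (\<lambda>t. Y t \<in> complex_solutions n) sequentially"
  shows "eventually (\<lambda>t. git_class n (quiver_point n uv (Y t)) \<in> V) sequentially"
  using V mem
proof (induction rule: openin_git_quotient_induct)
  case (inter S T)
  then show ?case by (simp add: eventually_conj_iff)
next
  case (union K)
  then obtain S where S: "S \<in> K" "git_class n (quiver_point n uv y) \<in> S" by blast
  show ?case by (rule eventually_mono[OF union.IH[OF S]]) (use S in blast)
next
  case (basis \<iota> f)
  obtain w t where t: "t \<noteq> 0" "\<iota> w = (t * fst uv, t * snd uv)" "f (w, quiver_scale n t y) \<noteq> 0"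
    using basis(3) mem_chart_open_iff[OF y basis(2,1)] by blast
  obtain h where h: "h \<in> invariant_functions n" "\<And>v x. x \<in> quivers n \<Longrightarrow> h (v, x) = f (w, quiver_scale n t x)"
    using invariant_rescale[OF basis(2)] by blast
  have "(\<lambda>k. h (w, Y k)) \<longlonglongrightarrow> h (w, y)"
    by (rule polynomial_tendsto[OF _ lim]) (use h(1) in \<open>auto simp: invariant_functions_def\<close>)
  moreover have "h (w, y) \<noteq> 0" using h(2) t(3) complex_solutions_quivers[OF y] by simp
  ultimately have "eventually (\<lambda>k. h (w, Y k) \<noteq> 0) sequentially" by (rule tendsto_imp_eventually_ne)
  with Y show ?case
  proof eventually_elim
    case (elim k)
    then have "f (w, quiver_scale n t (Y k)) \<noteq> 0" using h(2) complex_solutions_quivers by metis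
    then show ?case using mem_chart_open_iff[OF elim(1) basis(2,1)] t by blast
  qed
qed simp

lemma hyperkaehler_rotate:
  assumes "x \<in> hyperkaehler_solutions n"
  shows "rotate_quiver n uv x \<in> complex_solutions n"
  using assms is_csol_rotate[of n _ x _ "fst uv" "snd uv"] unfolding hyperkaehler_solutions_iff complex_solutions_iff
  by (metis prod.collapse)

text \<open>A twistor line meets a basic open set in the nonvanishing locus of a polynomial in one
  variable. One point of the line in the set makes this polynomial nonzero, so only finitely many
  parameters are lost.\<close>

lemma finite_not_mem_open:
  assumes V: "openin (git_quotient n) V" and x: "x \<in> hyperkaehler_solutions n"
    and mem: "git_class n (quiver_point n uv (rotate_quiver n uv x)) \<in> V"
  shows "finite {w. git_class n (quiver_point n (1, w) (rotate_quiver n (1, w) x)) \<notin> V}"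
  using V mem
proof (induction rule: openin_git_quotient_induct)
  case (inter S T)
  have "{w. git_class n (quiver_point n (1, w) (rotate_quiver n (1, w) x)) \<notin> S \<inter> T} =
    {w. git_class n (quiver_point n (1, w) (rotate_quiver n (1, w) x)) \<notin> S} \<union>
    {w. git_class n (quiver_point n (1, w) (rotate_quiver n (1, w) x)) \<notin> T}" by blast
  then show ?case using inter by simp
next
  case (union K)
  then obtain S where S: "S \<in> K" "git_class n (quiver_point n uv (rotate_quiver n uv x)) \<in> S" by blast
  show ?case by (rule finite_subset[OF _ union.IH[OF S]]) (use S in blast)
next
  case (basis \<iota> f)
  have xq: "x \<in> quivers n" using x by (auto simp: hyperkaehler_solutions_iff is_csol_def)
  note y = hyperkaehler_rotate[OF x]
  have f: "f \<in> polynomial_functions n" using basis(2) by (simp add: invariant_functions_def)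
  obtain w0 t0 where t0: "t0 \<noteq> 0" "\<iota> w0 = (t0 * fst uv, t0 * snd uv)" "f (w0, quiver_scale n t0 (rotate_quiver n uv x)) \<noteq> 0"
    using basis(3) mem_chart_open_iff[OF y basis(2,1)] by blast
  have nz: "f (w0, rotate_quiver n (\<iota> w0) x) \<noteq> 0"
    using t0 rotate_scale[OF xq, of t0 "fst uv" "snd uv"] by simp
  have mem: "git_class n (quiver_point n uv' (rotate_quiver n uv' x)) \<in> chart_open n \<iota> f"
    if "t \<noteq> 0" "\<iota> w = (t * fst uv', t * snd uv')" "f (w, rotate_quiver n (\<iota> w) x) \<noteq> 0" for uv' w t
    using mem_chart_open_iff[OF y basis(2,1)] that rotate_scale[OF xq, of t "fst uv'" "snd uv'"] by auto
  from basis(1) consider "\<iota> = (\<lambda>w. (1, w))" | "\<iota> = (\<lambda>w. (w, 1))" by blast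
  then show ?case
  proof cases
    case 1
    have "finite {w. f (w, rotate_quiver n (1, w) x) = 0}"
      using finite_zeros_along_rotation[OF f xq, of "[:0, 1:]" w0 "[:1:]" "[:0, 1:]"] nz 1 by simp
    moreover have "{w. git_class n (quiver_point n (1, w) (rotate_quiver n (1, w) x)) \<notin> chart_open n \<iota> f} \<subseteq>
      {w. f (w, rotate_quiver n (1, w) x) = 0}"
      using mem[of 1] 1 by auto
    ultimately show ?thesis by (rule rev_finite_subset)
  next
    case 2
    have "finite {w. f (w, rotate_quiver n (w, 1) x) = 0}"
      using finite_zeros_along_rotation[OF f xq, of "[:0, 1:]" w0 "[:0, 1:]" "[:1:]"] nz 2 by simp
    \<comment> \<open>In the other chart the parameter is \<open>1 / w\<close>; the point
      \<open>w = 0\<close> lies outside that chart and is counted as exceptional.\<close>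
    then have "finite (insert 0 ((\<lambda>w. 1 / w) ` {w. f (w, rotate_quiver n (w, 1) x) = 0}))" by simp
    moreover have "{w. git_class n (quiver_point n (1, w) (rotate_quiver n (1, w) x)) \<notin> chart_open n \<iota> f} \<subseteq>
      insert 0 ((\<lambda>w. 1 / w) ` {w. f (w, rotate_quiver n (w, 1) x) = 0})"
    proof
      fix w assume w: "w \<in> {w. git_class n (quiver_point n (1, w) (rotate_quiver n (1, w) x)) \<notin> chart_open n \<iota> f}"
      show "w \<in> insert 0 ((\<lambda>w. 1 / w) ` {w. f (w, rotate_quiver n (w, 1) x) = 0})"
      proof (cases "w = 0")
        case False
        then have "f (1 / w, rotate_quiver n (1 / w, 1) x) = 0" using mem[of "1 / w" "1 / w" "(1, w)"] w 2 by auto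
        then show ?thesis using False by (intro insertI2 image_eqI[of _ _ "1 / w"]) auto
      qed simp
    qed
    ultimately show ?thesis by (rule rev_finite_subset)
  qed
qed simp

lemma regular_if_mem_chart_open:
  assumes y: "y \<in> complex_solutions n" and \<iota>: "\<iota> \<in> {\<lambda>w. (1, w), \<lambda>w. (w, 1)}"
    and mem: "git_class n (quiver_point n uv y) \<in> chart_open n \<iota> (reg_fun n)"
  shows "regular_quiver n y"
proof -
  note yq = complex_solutions_quivers[OF y]
  obtain w t where "t \<noteq> 0" "reg_fun n (w, quiver_scale n t y) \<noteq> 0"
    using mem mem_chart_open_iff[OF y reg_fun_invariant \<iota>] by blast
  then show ?thesis using reg_fun_nonzero_iff[OF quiver_scale_quivers[OF yq]] regular_quiver_scale[OF yq] by blast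
qed

text \<open>Regularity is unaffected by scaling, so the nonvanishing sets in the two charts glue;
  one chart alone would miss a fibre.\<close>

definition regular_classes :: "nat \<Rightarrow> twistor_point set set" where
  "regular_classes n = chart_open n (\<lambda>w. (1, w)) (reg_fun n) \<union> chart_open n (\<lambda>w. (w, 1)) (reg_fun n)"

lemma openin_regular_classes: "openin (git_quotient n) (regular_classes n)"
  unfolding regular_classes_def by (intro openin_Un openin_chart_open reg_fun_invariant) auto

lemma mem_regular_classes_iff:
  assumes y: "y \<in> complex_solutions n" and uv: "uv \<noteq> (0, 0)"
  shows "git_class n (quiver_point n uv y) \<in> regular_classes n \<longleftrightarrow> regular_quiver n y"
proof
  assume "git_class n (quiver_point n uv y) \<in> regular_classes n"
  then show "regular_quiver n y" unfolding regular_classes_def using regular_if_mem_chart_open[OF y] by blast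
next
  assume "regular_quiver n y"
  then show "git_class n (quiver_point n uv y) \<in> regular_classes n"
    unfolding regular_classes_def
    using complex_solutions_quivers[OF y] reg_fun_nonzero_iff[OF quiver_scale_quivers] regular_quiver_scale
    by (intro mem_chart_open_cases[OF y reg_fun_invariant uv]) auto
qed

section \<open>The sections of a quiver\<close>

lemma submatrix_rows_eq_mat:
  assumes "A \<in> carrier_mat n j" "I \<in> index_sets n j"
  shows "submatrix A I UNIV = mat j j (\<lambda>(p, q). A $$ (pick I p, q))"
    and "p < j \<Longrightarrow> pick I p < n"
proof -
  have I: "I \<subseteq> {..<n}" "card I = j" using assms(2) by (auto simp: index_sets_def)
  have "{i. i < n \<and> i \<in> I} = I" using I by auto
  then have c: "card {i. i < dim_row A \<and> i \<in> I} = j" "card {i. i < dim_col A \<and> i \<in> UNIV} = j" using assms(1) I by auto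
  show "submatrix A I UNIV = mat j j (\<lambda>(p, q). A $$ (pick I p, q))"
  proof (rule eq_matI)
    fix p q assume "p < dim_row (mat j j (\<lambda>(p, q). A $$ (pick I p, q)))" "q < dim_col (mat j j (\<lambda>(p, q). A $$ (pick I p, q)))"
    then show "submatrix A I UNIV $$ (p, q) = mat j j (\<lambda>(p, q). A $$ (pick I p, q)) $$ (p, q)"
      using submatrix_index[of p A I q UNIV] c by (simp add: pick_UNIV)
  qed (use c in \<open>auto simp: dim_submatrix\<close>)
  show "p < j \<Longrightarrow> pick I p < n" using pick_in_set_le[of p I] I by auto
qed

text \<open>Selecting rows commutes with multiplication on the right, so every maximal minor is
  multiplied by the determinant of \<open>h\<close>, which is 1.\<close>

lemma wedge_columns_SL:
  assumes A: "A \<in> carrier_mat n j" and h: "h \<in> SL j"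
  shows "wedge_columns n j (A * h) = wedge_columns n j A"
  unfolding wedge_columns_def
proof (rule restrict_ext)
  fix I assume I: "I \<in> index_sets n j"
  note hd = SL_D[OF h]
  have Ah: "A * h \<in> carrier_mat n j" using A hd(1) by auto
  note s = submatrix_rows_eq_mat[OF A I] submatrix_rows_eq_mat[OF Ah I]
  have "mat j j (\<lambda>(p, q). (A * h) $$ (pick I p, q)) = mat j j (\<lambda>(p, q). A $$ (pick I p, q)) * h"
    using A hd(1) s(2) by (intro eq_matI) (auto simp: mult_mat_index simp del: index_mult_mat(1))
  then show "det (submatrix (A * h) I UNIV) = det (submatrix A I UNIV)"
    unfolding s(1) s(3) using det_mult[of "mat j j (\<lambda>(p, q). A $$ (pick I p, q))" j h] hd(1,2) by simp
qed

lemma wedge_columns_smult: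
  assumes A: "A \<in> carrier_mat n j" and I: "I \<in> index_sets n j"
  shows "wedge_columns n j (c \<cdot>\<^sub>m A) I = c ^ j * wedge_columns n j A I"
proof -
  have cA: "c \<cdot>\<^sub>m A \<in> carrier_mat n j" using A by auto
  note s = submatrix_rows_eq_mat[OF A I] submatrix_rows_eq_mat[OF cA I]
  have "mat j j (\<lambda>(p, q). (c \<cdot>\<^sub>m A) $$ (pick I p, q)) = c \<cdot>\<^sub>m mat j j (\<lambda>(p, q). A $$ (pick I p, q))"
    using A s(2) by (intro eq_matI) auto
  then show ?thesis using I by (simp add: wedge_columns_def s(1) s(3))
qed

lemma compose_from_scale:
  assumes x: "x \<in> quivers n" and j: "j \<le> n"
  shows "compose_from n (fst (quiver_scale n t x)) j = t ^ (n - j) \<cdot>\<^sub>m compose_from n (fst x) j"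
  using j
proof (induction rule: inc_induct)
  case base
  then show ?case by (simp add: compose_from_n mat_one_smult)
next
  case (step j)
  then have k: "j < n" "Suc j \<le> n" by auto
  have c: "\<And>i. i < n \<Longrightarrow> fst x i \<in> carrier_mat (Suc i) i" using quiversD[OF x] by blast
  have c': "\<And>i. i < n \<Longrightarrow> fst (quiver_scale n t x) i \<in> carrier_mat (Suc i) i"
    using quiversD[OF quiver_scale_quivers[OF x]] by blast
  note dd = quiversD[OF x k(1)] compose_from_dims[OF c k(2)]
  have "compose_from n (fst (quiver_scale n t x)) j = compose_from n (fst (quiver_scale n t x)) (Suc j) * fst (quiver_scale n t x) j"
    by (rule compose_from_rec[OF c' k(1)])
  also have "\<dots> = (t ^ (n - Suc j) \<cdot>\<^sub>m compose_from n (fst x) (Suc j)) * (t \<cdot>\<^sub>m fst x j)"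
    using k step.IH by simp
  also have "\<dots> = (t ^ (n - Suc j) * t) \<cdot>\<^sub>m (compose_from n (fst x) (Suc j) * fst x j)"
    using dd by (simp add: mat_smult_left mat_smult_right mat_smult_smult mult.commute)
  also have "t ^ (n - Suc j) * t = t ^ (n - j)" using k by (metis Suc_diff_Suc power_Suc2)
  also have "compose_from n (fst x) (Suc j) * fst x j = compose_from n (fst x) j"
    by (rule compose_from_rec[OF c k(1), symmetric])
  finally show ?case .
qed

lemma traceless_part_smult:
  assumes "Y \<in> carrier_mat n n"
  shows "traceless_part n (c \<cdot>\<^sub>m Y) = c \<cdot>\<^sub>m traceless_part n Y"
proof -
  have "(\<Sum>i<n. (c \<cdot>\<^sub>m Y) $$ (i, i)) = c * (\<Sum>i<n. Y $$ (i, i))" using assms by (simp add: sum_distrib_left)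
  then show ?thesis using assms unfolding traceless_part_def by (intro eq_matI) (auto simp: algebra_simps)
qed

lemma sections_of_quiver_eq:
  assumes "is_csol (Suc m) l x" "is_rsol (Suc m) r x"
  shows "sections_of_quiver (Suc m) x (u, v) =
    (traceless_part (Suc m) (fst (rotate_quiver (Suc m) (u, v) x) m * snd (rotate_quiver (Suc m) (u, v) x) m),
     \<lambda>i\<in>{1..<Suc m}. rotC u v l r i,
     \<lambda>j\<in>{1..<Suc m}. wedge_columns (Suc m) j (compose_from (Suc m) (fst (rotate_quiver (Suc m) (u, v) x)) j))"
  unfolding sections_of_quiver_def
  by (auto simp: Let_def case_prod_beta rotC_def lambdaC_eq[OF assms(1)] lambdaR_eq[OF assms(2)] intro!: restrict_ext)

lemma hyperkaehler_quivers: "x \<in> hyperkaehler_solutions n \<Longrightarrow> x \<in> quivers n"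
  by (auto simp: hyperkaehler_solutions_iff is_csol_def)

text \<open>The group is trivial at the top, which fixes the last product; the compositions change
  by SL on the right, which the minors do not see; and the multipliers are invariant.\<close>

lemma sections_of_quiver_act:
  assumes x: "x \<in> hyperkaehler_solutions (Suc m)" and g: "g \<in> H_group (Suc m)"
  shows "sections_of_quiver (Suc m) (quiver_act (Suc m) g x) = sections_of_quiver (Suc m) x"
proof (rule ext, safe)
  fix u v
  note xq = hyperkaehler_quivers[OF x] and g' = H_HC[OF g]
  obtain l r where lr: "is_csol (Suc m) l x" "is_rsol (Suc m) r x" using x by (auto simp: hyperkaehler_solutions_iff)
  note lr' = is_csol_act[OF lr(1) g'] is_rsol_act[OF lr(2) g]
  define y where "y = rotate_quiver (Suc m) (u, v) x"
  have yq: "y \<in> quivers (Suc m)" using rotate_quivers[OF xq] by (simp add: y_def)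
  have c: "\<And>i. i < Suc m \<Longrightarrow> fst y i \<in> carrier_mat (Suc i) i" using quiversD[OF yq] by blast
  have e: "rotate_quiver (Suc m) (u, v) (quiver_act (Suc m) g x) = quiver_act (Suc m) g y"
    unfolding y_def by (rule rotate_act[OF g xq])
  have m: "m \<le> Suc m" "Suc m \<le> Suc m" "m < Suc m" by auto
  note dd = gauge_dims[OF g' m(1)] gauge_dims[OF g' m(2)] quiversD[OF yq m(3)]
  have "fst (quiver_act (Suc m) g y) m * snd (quiver_act (Suc m) g y) m = fst y m * snd y m"
    unfolding quiver_act_sel[OF g' m(3)] gauge_groupD(2)[OF g'] cinv_one
    using dd gauge_cancel[OF g' m(1)] by (simp add: mat_assoc mat_one_left mat_one_right)
  moreover have "wedge_columns (Suc m) j (compose_from (Suc m) (fst (quiver_act (Suc m) g y)) j) =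
      wedge_columns (Suc m) j (compose_from (Suc m) (fst y) j)" if "j \<in> {1..<Suc m}" for j
  proof -
    have j: "j \<le> Suc m" using that by simp
    show ?thesis unfolding compose_from_act[OF yq g' j]
      by (rule wedge_columns_SL[OF compose_from_dims(1)[OF c j] SL_cinv[OF gauge_groupD(1)[OF g' j]]])
  qed
  ultimately show "sections_of_quiver (Suc m) (quiver_act (Suc m) g x) (u, v) = sections_of_quiver (Suc m) x (u, v)"
    unfolding sections_of_quiver_eq[OF lr] sections_of_quiver_eq[OF lr'] e y_def[symmetric]
    by (auto intro!: restrict_ext)
qed

text \<open>The wedge component has degree \<open>j * (n - j)\<close> because the composition has n
  - j factors and its j-th exterior power is taken.\<close>

lemma sections_of_quiver_homogeneous:
  assumes x: "x \<in> hyperkaehler_solutions (Suc m)"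
  shows "sections_of_quiver (Suc m) x (t * u, t * v) = fibre_scale (Suc m) t (sections_of_quiver (Suc m) x (u, v))"
proof -
  note xq = hyperkaehler_quivers[OF x]
  obtain l r where lr: "is_csol (Suc m) l x" "is_rsol (Suc m) r x" using x by (auto simp: hyperkaehler_solutions_iff)
  define y where "y = rotate_quiver (Suc m) (u, v) x"
  have yq: "y \<in> quivers (Suc m)" using rotate_quivers[OF xq] by (simp add: y_def)
  have c: "\<And>i. i < Suc m \<Longrightarrow> fst y i \<in> carrier_mat (Suc i) i" using quiversD[OF yq] by blast
  have e: "rotate_quiver (Suc m) (t * u, t * v) x = quiver_scale (Suc m) t y"
    unfolding y_def by (rule rotate_scale[OF xq])
  note dd = quiversD[OF yq lessI]
  have "fst (quiver_scale (Suc m) t y) m * snd (quiver_scale (Suc m) t y) m = t\<^sup>2 \<cdot>\<^sub>m (fst y m * snd y m)"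
    using dd by (simp add: mat_smult_left mat_smult_right mat_smult_smult power2_eq_square)
  moreover have "fst y m * snd y m \<in> carrier_mat (Suc m) (Suc m)" using dd by auto
  moreover have "rotC (t * u) (t * v) l r i = t\<^sup>2 * rotC u v l r i" for i
    by (simp add: rotC_def power2_eq_square algebra_simps)
  moreover have "wedge_columns (Suc m) j (compose_from (Suc m) (fst (quiver_scale (Suc m) t y)) j) =
     (\<lambda>I\<in>index_sets (Suc m) j. t ^ (j * (Suc m - j)) * wedge_columns (Suc m) j (compose_from (Suc m) (fst y) j) I)"
    if "j \<in> {1..<Suc m}" for j
  proof -
    have j: "j \<le> Suc m" using that by simp
    show ?thesis
      unfolding compose_from_scale[OF yq j]
    proof
      fix I
      show "wedge_columns (Suc m) j (t ^ (Suc m - j) \<cdot>\<^sub>m compose_from (Suc m) (fst y) j) I =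
        (\<lambda>I\<in>index_sets (Suc m) j. t ^ (j * (Suc m - j)) * wedge_columns (Suc m) j (compose_from (Suc m) (fst y) j) I) I"
      proof (cases "I \<in> index_sets (Suc m) j")
        case True
        have "(t ^ (Suc m - j)) ^ j = t ^ (j * (Suc m - j))" unfolding power_mult[symmetric] by (simp only: mult.commute)
        moreover have "compose_from (Suc m) (fst y) j \<in> carrier_mat (Suc m) j"
          by (rule compose_from_dims(1)[OF c j])
        from wedge_columns_smult[OF this True, of "t ^ (Suc m - j)"]
        have "wedge_columns (Suc m) j (t ^ (Suc m - j) \<cdot>\<^sub>m compose_from (Suc m) (fst y) j) I =
          (t ^ (Suc m - j)) ^ j * wedge_columns (Suc m) j (compose_from (Suc m) (fst y) j) I" .
        ultimately show ?thesis unfolding restrict_apply'[OF True] by (simp only:)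
      qed (simp add: wedge_columns_def)
    qed
  qed
  ultimately show ?thesis
    unfolding sections_of_quiver_eq[OF lr] e y_def[symmetric] fibre_scale_def case_prod_conv prod.inject
    by (intro conjI restrict_ext) (simp_all add: traceless_part_smult)
qed

lemma sections_of_quiver_in_fibres:
  assumes x: "x \<in> hyperkaehler_solutions (Suc m)"
  shows "sections_of_quiver (Suc m) x (u, v) \<in> fibres (Suc m)"
proof -
  note xq = hyperkaehler_quivers[OF x]
  obtain l r where lr: "is_csol (Suc m) l x" "is_rsol (Suc m) r x" using x by (auto simp: hyperkaehler_solutions_iff)
  have yq: "rotate_quiver (Suc m) (u, v) x \<in> quivers (Suc m)" using rotate_quivers[OF xq] .
  have tr: "traceless_part n Y \<in> carrier_mat n n" "(\<Sum>i<n. traceless_part n Y $$ (i, i)) = 0"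
    if "Y \<in> carrier_mat n n" "0 < n" for n and Y :: "complex mat"
    using that by (auto simp: traceless_part_def sum_subtractf intro!: carrier_matI)
  note tr' = tr[of "fst (rotate_quiver (Suc m) (u, v) x) m * snd (rotate_quiver (Suc m) (u, v) x) m" "Suc m"]
  show ?thesis
    unfolding sections_of_quiver_eq[OF lr] fibres_def
    using tr' quiversD[OF yq lessI] by (auto simp: wedge_columns_def simp del: sum.lessThan_Suc)
qed

text \<open>\<open>fibre_scale\<close> restricts its functions, so this rests on the elements of
  \<open>fibres\<close> being extensional.\<close>

lemma fibre_scale_one: "w \<in> fibres n \<Longrightarrow> fibre_scale n 1 w = w"
proof -
  assume "w \<in> fibres n"
  then obtain X \<tau> b where w: "w = (X, \<tau>, b)" "\<tau> \<in> (\<Pi>\<^sub>E i\<in>{1..<n}. UNIV)"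
    "b \<in> (\<Pi>\<^sub>E j\<in>{1..<n}. \<Pi>\<^sub>E I\<in>index_sets n j. UNIV)" by (auto simp: fibres_def)
  have "(\<lambda>i\<in>{1..<n}. \<tau> i) = \<tau>" using w(2) by (rule PiE_restrict)
  moreover have "(\<lambda>j\<in>{1..<n}. \<lambda>I\<in>index_sets n j. b j I) = (\<lambda>j\<in>{1..<n}. b j)"
    by (rule restrict_ext) (use PiE_restrict[OF PiE_mem[OF w(3)]] in simp)
  moreover have "(\<lambda>j\<in>{1..<n}. b j) = b" using w(3) by (rule PiE_restrict)
  ultimately show ?thesis by (simp add: w(1) fibre_scale_def mat_one_smult)
qed

lemma fibre_scale_scale: "fibre_scale n s (fibre_scale n t w) = fibre_scale n (s * t) w"
proof (cases w)
  case (fields X \<tau> b)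
  show ?thesis unfolding fields fibre_scale_def case_prod_conv prod.inject
    by (intro conjI restrict_ext) (simp_all add: mat_smult_smult power_mult_distrib mult.assoc)
qed


section \<open>Orbits\<close>

definition orbit :: "nat \<Rightarrow> quiver \<Rightarrow> quiver set" where
  "orbit n x = {quiver_act n g x |g. g \<in> H_group n}"

lemma orbit_self: "x \<in> quivers n \<Longrightarrow> x \<in> orbit n x"
  unfolding orbit_def using gauge_one_H quiver_act_one by (intro CollectI exI[of _ "\<lambda>k\<in>{..n}. 1\<^sub>m k"]) auto

lemma orbit_act:
  assumes x: "x \<in> quivers n" and g: "g \<in> H_group n"
  shows "orbit n (quiver_act n g x) = orbit n x"
proof (rule equalityI; rule subsetI)
  fix y assume "y \<in> orbit n (quiver_act n g x)"
  then obtain h where "h \<in> H_group n" "y = quiver_act n h (quiver_act n g x)" by (auto simp: orbit_def)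
  then show "y \<in> orbit n x"
    unfolding orbit_def using quiver_act_act[OF H_HC H_HC[OF g] x] gauge_mult_H[OF _ g] by blast
next
  fix y assume "y \<in> orbit n x"
  then obtain h where h: "h \<in> H_group n" "y = quiver_act n h x" by (auto simp: orbit_def)
  have "y = quiver_act n h (quiver_act n (gauge_inv n g) (quiver_act n g x))"
    using h(2) quiver_act_inv[OF H_HC[OF g] x] by simp
  also have "\<dots> = quiver_act n (gauge_mult n h (gauge_inv n g)) (quiver_act n g x)"
    by (rule quiver_act_act[OF H_HC[OF h(1)] gauge_inv_HC[OF H_HC[OF g]] quiver_act_quivers[OF H_HC[OF g] x]])
  finally show "y \<in> orbit n (quiver_act n g x)"
    unfolding orbit_def using gauge_mult_H[OF h(1) gauge_inv_H[OF g]] by blast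
qed

lemma implosion_eq: "implosion n = orbit n ` hyperkaehler_solutions n"
  unfolding implosion_def quotient_def orbit_def by (auto simp: Image_def)

section \<open>The twistor class and the map on representatives\<close>

lemma proj_point_scale:
  assumes "t \<noteq> 0"
  shows "proj_point (t * u, t * v) = proj_point (u, v)"
proof (rule equalityI; rule subsetI)
  fix z assume "z \<in> proj_point (t * u, t * v)"
  then obtain s where "s \<noteq> 0" "z = (s * (t * u), s * (t * v))" by (auto simp: proj_point_def)
  then show "z \<in> proj_point (u, v)" unfolding proj_point_def using assms by (intro CollectI exI[of _ "s * t"]) auto
next
  fix z assume "z \<in> proj_point (u, v)"
  then obtain s where "s \<noteq> 0" "z = (s * u, s * v)" by (auto simp: proj_point_def)
  then show "z \<in> proj_point (t * u, t * v)" unfolding proj_point_def using assms by (intro CollectI exI[of _ "s / t"]) auto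
qed

lemma proj_line_implosionE:
  assumes "a \<in> proj_line \<times> implosion n"
  obtains u v x where "a = (proj_point (u, v), orbit n x)" "(u, v) \<noteq> (0, 0)" "x \<in> hyperkaehler_solutions n"
  using assms unfolding proj_line_def implosion_eq by auto

text \<open>Independence of representatives: a scalar on the line is absorbed by the homogeneity of
  the rotation, and a compact group element commutes with the rotation and does not change the
  class.\<close>

lemma twistor_class_eq:
  assumes x: "x \<in> hyperkaehler_solutions n"
  shows "twistor_class n (proj_point (u, v), orbit n x) = git_class n (quiver_point n (u, v) (rotate_quiver n (u, v) x))"
  unfolding twistor_class_def case_prod_conv
proof (rule the_elem_image_unique)
  note xq = hyperkaehler_quivers[OF x]
  have "(1 * u, 1 * v) \<in> proj_point (u, v)" unfolding proj_point_def by (intro CollectI exI[of _ 1]) auto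
  then show "proj_point (u, v) \<times> orbit n x \<noteq> {}" using orbit_self[OF xq] by blast
  fix a assume "a \<in> proj_point (u, v) \<times> orbit n x"
  then obtain t g where a: "t \<noteq> 0" "g \<in> H_group n" "a = ((t * u, t * v), quiver_act n g x)"
    by (auto simp: proj_point_def orbit_def)
  have gx: "quiver_act n g x \<in> quivers n" by (rule quiver_act_quivers[OF H_HC[OF a(2)] xq])
  have "quiver_point n (t * u, t * v) (rotate_quiver n (t * u, t * v) (quiver_act n g x)) =
      quiver_point n (u, v) (quiver_act n g (rotate_quiver n (u, v) x))"
    unfolding rotate_scale[OF gx] quiver_point_scale[OF rotate_quivers[OF gx] a(1)] unfolding rotate_act[OF a(2) xq] ..
  then show "(case a of (uv, x) \<Rightarrow> git_class n (quiver_point n uv (rotate_quiver n uv x))) =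
      git_class n (quiver_point n (u, v) (rotate_quiver n (u, v) x))"
    using a(3) git_class_eqI[OF inseparable_act[OF hyperkaehler_rotate[OF x] H_HC[OF a(2)]]] by simp
qed

text \<open>Both uses of \<open>the_elem\<close> are resolved: the sections are constant on an
  orbit, and by homogeneity the point of the total space does not depend on the chosen coordinates
  of the base point.\<close>

lemma sigma_tilde_eq:
  assumes x: "x \<in> hyperkaehler_solutions (Suc m)"
  shows "sigma_tilde (Suc m) (proj_point (u, v), orbit (Suc m) x) =
    bundle_point (fibre_scale (Suc m)) (u, v) (sections_of_quiver (Suc m) x (u, v))"
proof -
  have sigma: "sigma (Suc m) (orbit (Suc m) x) = sections_of_quiver (Suc m) x"
    unfolding sigma_def
  proof (rule the_elem_image_unique)
    show "orbit (Suc m) x \<noteq> {}" using orbit_self[OF hyperkaehler_quivers[OF x]] by blast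
    show "sections_of_quiver (Suc m) y = sections_of_quiver (Suc m) x" if "y \<in> orbit (Suc m) x" for y
      using that sections_of_quiver_act[OF x] by (auto simp: orbit_def)
  qed
  have "the_elem ((\<lambda>uv. bundle_point (fibre_scale (Suc m)) uv (sections_of_quiver (Suc m) x uv)) ` proj_point (u, v)) =
    bundle_point (fibre_scale (Suc m)) (u, v) (sections_of_quiver (Suc m) x (u, v))"
  proof (rule the_elem_image_unique)
    have "(1 * u, 1 * v) \<in> proj_point (u, v)" unfolding proj_point_def by (intro CollectI exI[of _ 1]) auto
    then show "proj_point (u, v) \<noteq> {}" by blast
    fix uv assume "uv \<in> proj_point (u, v)"
    then obtain t where t: "t \<noteq> 0" "uv = (t * u, t * v)" by (auto simp: proj_point_def)
    show "bundle_point (fibre_scale (Suc m)) uv (sections_of_quiver (Suc m) x uv) =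
        bundle_point (fibre_scale (Suc m)) (u, v) (sections_of_quiver (Suc m) x (u, v))"
      unfolding t(2) sections_of_quiver_homogeneous[OF x] by (rule bundle_point_scale[OF t(1)]) (rule fibre_scale_scale)
  qed
  then show ?thesis unfolding sigma_tilde_def evaluation_def comp_def map_prod_simp id_apply sigma case_prod_conv .
qed

text \<open>The sections at a single point of the projective line determine a regular complex solution up to
  the complexified group, and the real moment map equation reduces this group to the compact one.\<close>

lemma orbit_eq_if_sections_eq:
  assumes x: "x \<in> hyperkaehler_solutions (Suc m)" and x': "x' \<in> hyperkaehler_solutions (Suc m)"
    and uv: "(u, v) \<noteq> (0, 0)" and reg: "regular_quiver (Suc m) (rotate_quiver (Suc m) (u, v) x)"
    and eq: "sections_of_quiver (Suc m) x (u, v) = sections_of_quiver (Suc m) x' (u, v)"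
  shows "orbit (Suc m) x = orbit (Suc m) x'"
proof -
  note xq = hyperkaehler_quivers[OF x] and xq' = hyperkaehler_quivers[OF x']
  obtain l r where lr: "is_csol (Suc m) l x" "is_rsol (Suc m) r x" using x by (auto simp: hyperkaehler_solutions_iff)
  obtain l' r' where lr': "is_csol (Suc m) l' x'" "is_rsol (Suc m) r' x'" using x' by (auto simp: hyperkaehler_solutions_iff)
  define y y' where "y = rotate_quiver (Suc m) (u, v) x" and "y' = rotate_quiver (Suc m) (u, v) x'"
  note eqs = eq[unfolded sections_of_quiver_eq[OF lr] sections_of_quiver_eq[OF lr'] prod.inject, folded y_def y'_def]
  have y: "is_csol (Suc m) (rotC u v l r) y" "is_rsol (Suc m) (rotR u v l r) y"
    unfolding y_def using is_csol_rotate[OF lr] is_rsol_rotate[OF lr] by auto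
  have y': "is_csol (Suc m) (rotC u v l' r') y'" "is_rsol (Suc m) (rotR u v l' r') y'"
    unfolding y'_def using is_csol_rotate[OF lr'] is_rsol_rotate[OF lr'] by auto
  have "rotC u v l' r' i = rotC u v l r i" if "i \<in> {1..<Suc m}" for i
    using fun_cong[OF eqs[THEN conjunct2, THEN conjunct1], of i] that by simp
  then have y'c: "is_csol (Suc m) (rotC u v l r) y'" using y'(1) by (auto simp: is_csol_def)
  have reg': "\<And>k. k < Suc m \<Longrightarrow> det (snd y k * fst y k) \<noteq> 0" using reg by (simp add: regular_quiver_def y_def)
  have "\<exists>h\<in>HC_group (Suc m). y' = quiver_act (Suc m) h y"
  proof (rule regular_csol_equivalent[OF y(1) y'c refl reg'])
    fix j assume "j \<in> {1..<Suc m}"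
    then show "wedge_columns (Suc m) j (compose_from (Suc m) (fst y) j) = wedge_columns (Suc m) j (compose_from (Suc m) (fst y') j)"
      using fun_cong[OF eqs[THEN conjunct2, THEN conjunct2], of j] by simp
  qed (use eqs in auto)
  then obtain h where h: "h \<in> HC_group (Suc m)" "y' = quiver_act (Suc m) h y" by blast
  have hH: "h \<in> H_group (Suc m)"
    by (rule regular_orbit_unitary[OF y(2) y'(2)[unfolded h(2)] h(1) reg'])
  \<comment> \<open>Unitarity is also what allows \<open>h\<close> to pass through the rotation, so
    that the equivalence descends to the original quivers.\<close>
  have "rotate_quiver (Suc m) (u, v) (quiver_act (Suc m) h x) = rotate_quiver (Suc m) (u, v) x'"
    using h(2) unfolding rotate_act[OF hH xq] y_def y'_def by simp
  then have "quiver_act (Suc m) h x = x'"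
    by (rule rotate_inj[OF quiver_act_quivers[OF h(1) xq] xq' uv])
  then show ?thesis using orbit_act[OF xq hH] by simp
qed

text \<open>A class that is regular and lies in a given open set is found by first moving along the twistor line,
  which makes the regular deformation possible, and then deforming.\<close>

lemma regular_twistor_class_dense:
  assumes V: "openin (git_quotient (Suc m)) V" and x: "x \<in> hyperkaehler_solutions (Suc m)"
    and mem: "git_class (Suc m) (quiver_point (Suc m) uv (rotate_quiver (Suc m) uv x)) \<in> V"
  shows "\<exists>w. \<exists>x'\<in>hyperkaehler_solutions (Suc m). twistor_class (Suc m) (proj_point (1, w), orbit (Suc m) x') \<in> V \<inter> regular_classes (Suc m)"
proof -
  obtain l r where lr: "is_csol (Suc m) l x" "is_rsol (Suc m) r x" using x by (auto simp: hyperkaehler_solutions_iff)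
  have "finite ({w. git_class (Suc m) (quiver_point (Suc m) (1, w) (rotate_quiver (Suc m) (1, w) x)) \<notin> V} \<union>
      {w. \<not> kernel_cond (Suc m) (rotate_quiver (Suc m) (1, w) x)})"
    using finite_not_mem_open[OF V x mem] finite_not_kernel_cond[OF lr] by simp
  \<comment> \<open>Both requirements exclude finitely many parameters only, so one parameter
    satisfies them simultaneously.\<close>
  from ex_new_if_finite[OF infinite_UNIV_char_0 this] obtain w where
    w: "git_class (Suc m) (quiver_point (Suc m) (1, w) (rotate_quiver (Suc m) (1, w) x)) \<in> V"
    "kernel_cond (Suc m) (rotate_quiver (Suc m) (1, w) x)" by blast
  have nz: "(1 :: complex, w) \<noteq> (0, 0)" by simp
  obtain Y L where Y: "quiver_lim (Suc m) Y (rotate_quiver (Suc m) (1, w) x)"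
    "eventually (\<lambda>t. is_csol (Suc m) (L t) (Y t) \<and> (\<forall>k<Suc m. det (snd (Y t) k * fst (Y t) k) \<noteq> 0)) sequentially"
    using regular_deformation[OF is_csol_rotate[OF lr] w(2)] by blast
  have "eventually (\<lambda>t. Y t \<in> complex_solutions (Suc m)) sequentially"
    using Y(2) by eventually_elim (auto simp: complex_solutions_iff)
  from eventually_mem_open[OF V hyperkaehler_rotate[OF x] w(1) Y(1) this] Y(2)
  have "eventually (\<lambda>t. is_csol (Suc m) (L t) (Y t) \<and> regular_quiver (Suc m) (Y t) \<and>
      git_class (Suc m) (quiver_point (Suc m) (1, w) (Y t)) \<in> V) sequentially"
    by eventually_elim (auto simp: regular_quiver_def)
  then obtain t where t: "is_csol (Suc m) (L t) (Y t)" "regular_quiver (Suc m) (Y t)"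
    "git_class (Suc m) (quiver_point (Suc m) (1, w) (Y t)) \<in> V"
    using eventually_happens'[OF sequentially_bot] by blast
  obtain z s Z where z: "is_csol (Suc m) (L t) z" "is_rsol (Suc m) s z" "quiver_lim (Suc m) Z z"
    "\<And>k. \<exists>g\<in>HC_group (Suc m). Z k = quiver_act (Suc m) g (Y t)"
    using Kempf_Ness_existence[OF t(1)] by blast
  have Yc: "Y t \<in> complex_solutions (Suc m)" and zc: "z \<in> complex_solutions (Suc m)"
    using t(1) z(1) by (auto simp: complex_solutions_iff)
  have ins: "inseparable (Suc m) (Y t) z" by (rule inseparable_orbit_closure[OF Yc zc z(3,4)])
  \<comment> \<open>\<open>z\<close> solves the hyperkaehler equations as seen over
    \<open>(1, w)\<close>; the inverse rotation, normalised by the squared norm, gives the quiver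
    whose rotation is \<open>z\<close>.\<close>
  define x' where "x' = quiver_scale (Suc m) (of_real (1 / ((cmod 1)\<^sup>2 + (cmod w)\<^sup>2))) (rotate_quiver (Suc m) (cnj 1, - w) z)"
  have rot: "rotate_quiver (Suc m) (1, w) x' = z"
    unfolding x'_def by (rule rotate_surj[OF complex_solutions_quivers[OF zc] nz])
  have x': "x' \<in> hyperkaehler_solutions (Suc m)"
    unfolding x'_def hyperkaehler_solutions_iff
    using is_csol_scale[OF is_csol_rotate[OF z(1,2)]] is_rsol_scale[OF is_rsol_rotate[OF z(1,2)]] by blast
  have "twistor_class (Suc m) (proj_point (1, w), orbit (Suc m) x') = git_class (Suc m) (quiver_point (Suc m) (1, w) (Y t))"
    unfolding twistor_class_eq[OF x'] rot by (rule git_class_eqI[OF ins, symmetric])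
  then have "twistor_class (Suc m) (proj_point (1, w), orbit (Suc m) x') \<in> V \<inter> regular_classes (Suc m)"
    using t(3) mem_regular_classes_iff[OF Yc nz] t(2) by simp
  then show ?thesis using x' by blast
qed

theorem theorem4p13:
  fixes n :: nat
  assumes "n \<ge> 2"
  shows "sigma_tilde n \<in> topspace (twistor_space n) \<rightarrow> total_space n \<and>
         (\<exists>U. openin (twistor_space n) U \<and> twistor_space n closure_of U = topspace (twistor_space n) \<and>
              inj_on (sigma_tilde n) U)"
proof -
  obtain m where n: "n = Suc m" using assms by (cases n) auto
  define A where "A = proj_line \<times> implosion n"
  define U where "U = twistor_class n -` regular_classes n \<inter> A"
  have top: "topspace (twistor_space n) = twistor_class n -` topspace (git_quotient n) \<inter> A"
    by (simp add: twistor_space_def topspace_pullback_topology A_def)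
  have opn: "openin (twistor_space n) S \<longleftrightarrow> (\<exists>V. openin (git_quotient n) V \<and> S = twistor_class n -` V \<inter> A)" for S
    by (simp add: twistor_space_def openin_pullback_topology A_def)
  have "sigma_tilde n a \<in> total_space n" if a: "a \<in> topspace (twistor_space n)" for a
  proof -
    obtain u v x where a: "a = (proj_point (u, v), orbit n x)" "(u, v) \<noteq> (0, 0)" "x \<in> hyperkaehler_solutions n"
      using a unfolding top A_def by (elim IntE proj_line_implosionE)
    show ?thesis
      unfolding a(1) total_space_def using a(2,3) sigma_tilde_eq sections_of_quiver_in_fibres unfolding n by blast
  qed
  moreover have "openin (twistor_space n) U"
    unfolding opn U_def using openin_regular_classes by blast
  moreover have "twistor_space n closure_of U = topspace (twistor_space n)"
  proof (rule equalityI[OF closure_of_subset_topspace], rule subsetI, unfold in_closure_of, intro conjI allI impI)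
    fix a T assume a: "a \<in> topspace (twistor_space n)" and T: "a \<in> T \<and> openin (twistor_space n) T"
    obtain V where V: "openin (git_quotient n) V" "T = twistor_class n -` V \<inter> A" using T opn by blast
    obtain u v x where ax: "a = (proj_point (u, v), orbit n x)" "(u, v) \<noteq> (0, 0)" "x \<in> hyperkaehler_solutions n"
      using a unfolding top A_def by (elim IntE proj_line_implosionE)
    have "git_class n (quiver_point n (u, v) (rotate_quiver n (u, v) x)) \<in> V"
      using T V(2) ax(1) twistor_class_eq[OF ax(3)] by simp
    then obtain w x' where w: "x' \<in> hyperkaehler_solutions n"
      "twistor_class n (proj_point (1, w), orbit n x') \<in> V \<inter> regular_classes n"
      using regular_twistor_class_dense V(1) ax(3) unfolding n by blast
    have "(proj_point (1, w), orbit n x') \<in> A" using w(1) by (auto simp: A_def proj_line_def implosion_eq)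
    then show "\<exists>y. y \<in> U \<and> y \<in> T" using w(2) V(2) by (intro exI[of _ "(proj_point (1, w), orbit n x')"]) (simp add: U_def)
  qed
  moreover have "inj_on (sigma_tilde n) U"
  proof (rule inj_onI)
    fix a b assume ab: "a \<in> U" "b \<in> U" and eq: "sigma_tilde n a = sigma_tilde n b"
    obtain u v x where a: "a = (proj_point (u, v), orbit n x)" "(u, v) \<noteq> (0, 0)" "x \<in> hyperkaehler_solutions n"
      using ab(1) unfolding U_def A_def by (elim IntE proj_line_implosionE)
    obtain u' v' x' where b: "b = (proj_point (u', v'), orbit n x')" "(u', v') \<noteq> (0, 0)" "x' \<in> hyperkaehler_solutions n"
      using ab(2) unfolding U_def A_def by (elim IntE proj_line_implosionE)
    note hk = a(3)[unfolded n] b(3)[unfolded n]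
    have "bundle_point (fibre_scale n) (u, v) (sections_of_quiver n x (u, v)) =
        bundle_point (fibre_scale n) (u', v') (sections_of_quiver n x' (u', v'))"
      using eq unfolding a(1) b(1) n sigma_tilde_eq[OF hk(1)] sigma_tilde_eq[OF hk(2)] .
    from bundle_point_eqD[OF this] obtain t where t: "t \<noteq> 0" "u = t * u'" "v = t * v'"
      "sections_of_quiver n x (u, v) = fibre_scale n t (sections_of_quiver n x' (u', v'))"
      using fibre_scale_one[OF sections_of_quiver_in_fibres[OF hk(1)]] unfolding n by auto
    \<comment> \<open>Equal points of the total space have proportional homogeneous coordinates;
      homogeneity moves the value for \<open>x'\<close> to the coordinates \<open>(u, v)\<close>
      used for \<open>x\<close>, so that a single fibre is compared.\<close>
    have seq: "sections_of_quiver n x (u, v) = sections_of_quiver n x' (u, v)"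
      using t(4) sections_of_quiver_homogeneous[OF hk(2), of t u' v'] t(2,3) unfolding n by simp
    have "twistor_class n a \<in> regular_classes n" using ab(1) by (simp add: U_def)
    then have "regular_quiver n (rotate_quiver n (u, v) x)"
      unfolding a(1) twistor_class_eq[OF a(3)] mem_regular_classes_iff[OF hyperkaehler_rotate[OF a(3)] a(2)] .
    then have "orbit n x = orbit n x'"
      using orbit_eq_if_sections_eq[OF hk a(2)] seq unfolding n by blast
    moreover have "proj_point (u, v) = proj_point (u', v')" unfolding t(2,3) by (rule proj_point_scale[OF t(1)])
    ultimately show "a = b" unfolding a(1) b(1) by simp
  qed
  ultimately show ?thesis by blast
qed

end
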